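(* Let $(a_{nk})_{n,k\ge0}$ be complex scalars with $\sum_k|a_{nk}|<\infty$ for each $n$. Then the following are equivalent: (i) $\sum_{k\ge0}a_{nk}\hat g(k)z^k\to g$ weakly in $H^1$, for all $g\in H^1$; (ii) $\sum_{k\ge0}a_{nk}\hat g(k)z^k\to g$ in $H^1$-norm, for all $g\in H^1$; (iii) $\sum_{k\ge0}a_{nk}\hat h(k)z^k\to h$ weak* in $\mathrm{BMOA}$, for all $h\in\mathrm{BMOA}$; (iv) $\sum_{k\ge0}a_{nk}\hat f(k)z^k\to f$ weakly in $\mathrm{VMOA}$, for all $f\in\mathrm{VMOA}$; (v) $\sum_{k\ge0}a_{nk}\hat f(k)z^k\to f$ in $\mathrm{BMOA}$-norm, for all $f\in\mathrm{VMOA}$.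
   Context: $\mathbb D$ is the unit disk, $\hat g(k)$ denote Taylor coefficients. $H^1$ is the Hardy space of holomorphic $f$ on $\mathbb D$ with $\|f\|_{H^1}=\sup_{r<1}\frac1{2\pi}\int_0^{2\pi}|f(re^{i\theta})|d\theta<\infty$. $\mathrm{BMOA}$ is the space of $f\in H^2$ with $\|f\|_{\mathrm{BMOA}}:=|f(0)|+\sup_{\mathbb D}(P|f|^2-|f|^2)^{1/2}<\infty$, where $P|f|^2$ is the Poisson integral of the boundary values of $|f|^2$; $\mathrm{VMOA}$ is the closed subspace of $f\in\mathrm{BMOA}$ with $(P|f|^2-|f|^2)(z)\to0$ as $|z|\to1$. Up to isomorphism $\mathrm{VMOA}^*\cong H^1$ and $(H^1)^*\cong\mathrm{BMOA}$ via the pairing $\langle g,h\rangle=\lim_{r\to1^-}\frac1{2\pi}\int_0^{2\pi}g(re^{i\theta})h(re^{-i\theta})d\theta$; weak* in $\mathrm{BMOA}$ refers to this duality with $H^1$. *)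

theory Defs
  imports "HOL-Analysis.Analysis"
begin

text \<open>Functions on the unit disk are modelled as total functions complex \<Rightarrow> complex;
  only their values on the open unit disk (ball 0 1) matter.\<close>

definition taylor_coeff :: "(complex \<Rightarrow> complex) \<Rightarrow> nat \<Rightarrow> complex" where
  "taylor_coeff g k = (deriv ^^ k) g 0 / of_nat (fact k)"

definition H1_mean :: "(complex \<Rightarrow> complex) \<Rightarrow> real \<Rightarrow> real" where
  "H1_mean f r = (1 / (2*pi)) * integral {0..2*pi} (\<lambda>t. cmod (f (of_real r * cis t)))"

definition H2_mean :: "(complex \<Rightarrow> complex) \<Rightarrow> real \<Rightarrow> real" where
  "H2_mean f r = (1 / (2*pi)) * integral {0..2*pi} (\<lambda>t. (cmod (f (of_real r * cis t)))\<^sup>2)"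

definition H1 :: "(complex \<Rightarrow> complex) set" where
  "H1 = {f. f holomorphic_on ball 0 1 \<and> bdd_above (H1_mean f ` {0..<1})}"

definition H1_norm :: "(complex \<Rightarrow> complex) \<Rightarrow> real" where
  "H1_norm f = (SUP r\<in>{0..<1}. H1_mean f r)"

definition H2 :: "(complex \<Rightarrow> complex) set" where
  "H2 = {f. f holomorphic_on ball 0 1 \<and> bdd_above (H2_mean f ` {0..<1})}"

text \<open>Boundary values (radial limits; they exist a.e. for H^2 functions).\<close>
definition boundary_val :: "(complex \<Rightarrow> complex) \<Rightarrow> real \<Rightarrow> complex" where
  "boundary_val f t = Lim (at_left 1) (\<lambda>r::real. f (of_real r * cis t))"

definition poisson_sq :: "(complex \<Rightarrow> complex) \<Rightarrow> complex \<Rightarrow> real" where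
  "poisson_sq f z = (1 / (2*pi)) * integral {0..2*pi}
     (\<lambda>t. (1 - (cmod z)\<^sup>2) / (cmod (cis t - z))\<^sup>2 * (cmod (boundary_val f t))\<^sup>2)"

definition garsia :: "(complex \<Rightarrow> complex) \<Rightarrow> complex \<Rightarrow> real" where
  "garsia f z = poisson_sq f z - (cmod (f z))\<^sup>2"

definition BMOA :: "(complex \<Rightarrow> complex) set" where
  "BMOA = {f. f \<in> H2 \<and> bdd_above ((\<lambda>z. sqrt (garsia f z)) ` ball 0 1)}"

definition BMOA_norm :: "(complex \<Rightarrow> complex) \<Rightarrow> real" where
  "BMOA_norm f = cmod (f 0) + (SUP z\<in>ball 0 1. sqrt (garsia f z))"

definition VMOA :: "(complex \<Rightarrow> complex) set" where
  "VMOA = {f. f \<in> BMOA \<and>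
     (\<forall>e>0. \<exists>r<1. \<forall>z. r < cmod z \<and> cmod z < 1 \<longrightarrow> \<bar>garsia f z\<bar> < e)}"

definition bounded_lin_functional ::
  "(complex \<Rightarrow> complex) set \<Rightarrow> ((complex \<Rightarrow> complex) \<Rightarrow> real) \<Rightarrow>
   ((complex \<Rightarrow> complex) \<Rightarrow> complex) \<Rightarrow> bool" where
  "bounded_lin_functional X N \<phi> \<longleftrightarrow>
     (\<forall>f\<in>X. \<forall>g\<in>X. \<forall>c d. \<phi> (\<lambda>z. c * f z + d * g z) = c * \<phi> f + d * \<phi> g) \<and>
     (\<exists>C. \<forall>f\<in>X. cmod (\<phi> f) \<le> C * N f)"

definition weak_conv ::
  "(complex \<Rightarrow> complex) set \<Rightarrow> ((complex \<Rightarrow> complex) \<Rightarrow> real) \<Rightarrow>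
   (nat \<Rightarrow> complex \<Rightarrow> complex) \<Rightarrow> (complex \<Rightarrow> complex) \<Rightarrow> bool" where
  "weak_conv X N xs x \<longleftrightarrow>
     (\<forall>\<phi>. bounded_lin_functional X N \<phi> \<longrightarrow> (\<lambda>n. \<phi> (xs n)) \<longlonglongrightarrow> \<phi> x)"

definition pairing :: "(complex \<Rightarrow> complex) \<Rightarrow> (complex \<Rightarrow> complex) \<Rightarrow> complex" where
  "pairing g h = Lim (at_left 1) (\<lambda>r::real. complex_of_real (1 / (2*pi)) *
     integral {0..2*pi} (\<lambda>t. g (of_real r * cis t) * h (of_real r * cis (-t))))"

definition weak_star_BMOA :: "(nat \<Rightarrow> complex \<Rightarrow> complex) \<Rightarrow> (complex \<Rightarrow> complex) \<Rightarrow> bool" where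
  "weak_star_BMOA hs h \<longleftrightarrow> (\<forall>g\<in>H1. (\<lambda>n. pairing g (hs n)) \<longlonglongrightarrow> pairing g h)"

definition approx :: "(nat \<Rightarrow> nat \<Rightarrow> complex) \<Rightarrow> nat \<Rightarrow> (complex \<Rightarrow> complex) \<Rightarrow> complex \<Rightarrow> complex" where
  "approx a n g = (\<lambda>z. \<Sum>k. a n k * taylor_coeff g k * z ^ k)"

end

theory Submission
  imports Defs "HOL-Complex_Analysis.Complex_Analysis"
begin

text \<open>
  All five statements are equivalent to: \<open>a\<^sub>n\<^sub>k \<rightarrow> 1\<close> for every \<open>k\<close>, and the bilinear forms
  \<open>B\<^sub>n(g, h) = \<Sum>\<^sub>k a\<^sub>n\<^sub>k g\<^sub>k h\<^sub>k\<close> are bounded on \<open>H\<^sup>1 \<times> VMOA\<close> uniformly in \<open>n\<close>. The weak statements give this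
  by uniform boundedness, since pairing with a \<open>BMOA\<close> function is a bounded functional on \<open>H\<^sup>1\<close> and
  conversely. The uniform bound gives back both norm statements, because the norms of \<open>H\<^sup>1\<close> and
  \<open>BMOA\<close> are recovered, up to constants, from the pairing and because dilations are dense in \<open>H\<^sup>1\<close> and
  in \<open>VMOA\<close>.

  The Garsia functional \<open>P|f|\<^sup>2 - |f|\<^sup>2\<close> at \<open>z\<close> is \<open>1 - |z|\<^sup>2\<close> times the squared \<open>\<ell>\<^sup>2\<close> norm of the Taylor
  coefficients of \<open>(f - f(z)) / (\<zeta> - z)\<close>; once Fatou's theorem on radial limits has identified the two,
  \<open>BMOA\<close> and \<open>VMOA\<close> can be handled on coefficients. The bound of the pairing by the two norms
  (Fefferman) follows from the subharmonicity of a single explicit function, in the spirit of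
  Uchiyama. The density of dilations in \<open>H\<^sup>1\<close> comes from the uniform PL-convexity of \<open>L\<^sup>1\<close>, without
  factorization or boundary values.
\<close>

section \<open>Means over the circle\<close>

text \<open>Two definitions are limits that might fail to exist: \<open>pairing\<close> is a
  \<open>Lim\<close> as the radius tends to 1, and \<open>poisson_sq\<close> integrates radial
  limits. Much of the analysis shows that they do exist. For \<open>poisson_sq\<close> this takes a
  weak-type maximal estimate. For \<open>pairing\<close> it takes Fefferman's bound, uniform in the
  radius, and the density of dilations in \<open>H1\<close>: for a dilated function the coefficient
  series converges absolutely. The form \<open>\<Sum>k. a n k * tc g k * tc h k\<close> is symmetric
  in the two functions, so a multiplier may be moved from one side of the pairing to the other.
  Hence a single uniform bound on \<open>H1\<close> times \<open>VMOA\<close> governs both spaces.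
  The second factor is \<open>VMOA\<close> because a \<open>BMOA\<close> function is the norm limit
  of its dilations only if it lies in \<open>VMOA\<close>; this is also why (iii) remains a weak*
  statement. Summability of each row puts every approximant among the absolutely convergent series,
  which lie in all the spaces. For a single \<open>n\<close> the form is therefore a bounded plain
  sum, and only uniformity in \<open>n\<close> is at stake.\<close>

definition cmean :: "(real \<Rightarrow> 'a::banach) \<Rightarrow> 'a" where
  "cmean \<phi> = (1 / (2*pi)) *\<^sub>R integral {0..2*pi} \<phi>"

lemma H1_mean_cmean: "H1_mean f r = cmean (\<lambda>t. cmod (f (of_real r * cis t)))"
  by (simp add: H1_mean_def cmean_def)

lemma H2_mean_cmean: "H2_mean f r = cmean (\<lambda>t. (cmod (f (of_real r * cis t)))\<^sup>2)"
  by (simp add: H2_mean_def cmean_def)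

lemma continuous_integrable: "continuous_on UNIV (\<phi>::real \<Rightarrow> 'a::banach) \<Longrightarrow> \<phi> integrable_on {a..b}"
  by (meson continuous_on_subset integrable_continuous_interval subset_UNIV)

lemma cmean_add:
  fixes \<phi> \<psi> :: "real \<Rightarrow> 'a::banach"
  assumes "continuous_on UNIV \<phi>" "continuous_on UNIV \<psi>"
  shows "cmean (\<lambda>t. \<phi> t + \<psi> t) = cmean \<phi> + cmean \<psi>"
  unfolding cmean_def using assms
  by (simp add: integral_add continuous_integrable scaleR_add_right)

lemma cmean_diff:
  fixes \<phi> \<psi> :: "real \<Rightarrow> 'a::banach"
  assumes "continuous_on UNIV \<phi>" "continuous_on UNIV \<psi>"
  shows "cmean (\<lambda>t. \<phi> t - \<psi> t) = cmean \<phi> - cmean \<psi>"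
  unfolding cmean_def using assms
  by (simp add: integral_diff continuous_integrable scaleR_diff_right)

lemma cmean_cmul:
  fixes \<phi> :: "real \<Rightarrow> 'a::{banach,real_normed_field}"
  shows "cmean (\<lambda>t. c * \<phi> t) = c * cmean \<phi>"
  unfolding cmean_def by (metis integral_mult_right mult_scaleR_right)

lemma cmean_sum:
  fixes \<phi> :: "'i \<Rightarrow> real \<Rightarrow> 'a::banach"
  assumes "finite I" "\<And>i. i \<in> I \<Longrightarrow> continuous_on UNIV (\<phi> i)"
  shows "cmean (\<lambda>t. \<Sum>i\<in>I. \<phi> i t) = (\<Sum>i\<in>I. cmean (\<phi> i))"
  unfolding cmean_def using assms
  by (simp add: integral_sum continuous_integrable scaleR_sum_right)

lemma cmean_const [simp]: "cmean (\<lambda>t. c :: 'a::{banach}) = c"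
  by (simp add: cmean_def)

lemma cmean_mono:
  fixes \<phi> \<psi> :: "real \<Rightarrow> real"
  assumes "continuous_on UNIV \<phi>" "continuous_on UNIV \<psi>" "\<And>t. \<phi> t \<le> \<psi> t"
  shows "cmean \<phi> \<le> cmean \<psi>"
  unfolding cmean_def using assms
  by (auto intro!: divide_right_mono integral_le continuous_integrable)

lemma cmean_nonneg:
  fixes \<phi> :: "real \<Rightarrow> real"
  assumes "continuous_on UNIV \<phi>" "\<And>t. 0 \<le> \<phi> t"
  shows "0 \<le> cmean \<phi>"
  using cmean_mono[of "\<lambda>_. 0" \<phi>] assms by simp

lemma norm_cmean_le:
  fixes \<phi> :: "real \<Rightarrow> 'a::banach"
  assumes "continuous_on UNIV \<phi>"
  shows "norm (cmean \<phi>) \<le> cmean (\<lambda>t. norm (\<phi> t))"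
proof -
  have "norm (integral {0..2*pi} \<phi>) \<le> integral {0..2*pi} (\<lambda>t. norm (\<phi> t))"
    using assms by (intro integral_norm_bound_integral continuous_integrable continuous_intros) auto
  then show ?thesis by (simp add: cmean_def divide_right_mono)
qed

lemma cmean_bounded_linear:
  assumes "bounded_linear T" "continuous_on UNIV \<phi>"
  shows "cmean (\<lambda>t. T (\<phi> t)) = T (cmean \<phi>)"
proof -
  interpret bounded_linear T by fact
  have "integral {0..2*pi} (T \<circ> \<phi>) = T (integral {0..2*pi} \<phi>)"
    using assms by (intro integral_linear continuous_integrable)
  then show ?thesis by (simp add: cmean_def scaleR o_def)
qed

lemma cmean_Re: "continuous_on UNIV \<phi> \<Longrightarrow> cmean (\<lambda>t. Re (\<phi> t)) = Re (cmean \<phi>)"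
  by (rule cmean_bounded_linear[OF bounded_linear_Re])

lemma cmean_cnj: "continuous_on UNIV \<phi> \<Longrightarrow> cmean (\<lambda>t. cnj (\<phi> t)) = cnj (cmean \<phi>)"
  by (rule cmean_bounded_linear[OF bounded_linear_cnj])

lemma cmean_of_real: "continuous_on UNIV \<phi> \<Longrightarrow> cmean (\<lambda>t. complex_of_real (\<phi> t)) = of_real (cmean \<phi>)"
  by (rule cmean_bounded_linear[OF bounded_linear_of_real])

text \<open>Weighted AM-GM, \<open>2 * \<phi> * \<psi> \<le> s * \<phi>^2 + \<psi>^2 / s\<close>, is
  integrated and then optimised over \<open>s\<close>. The bounds \<open>A\<close> and
  \<open>B\<close> are first raised by some \<open>d > 0\<close>, so that the optimal weight exists
  even if one of them is zero; \<open>e\<close> pays for this.\<close>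

lemma cmean_Cauchy_Schwarz:
  fixes \<phi> \<psi> :: "real \<Rightarrow> real"
  assumes c: "continuous_on UNIV \<phi>" "continuous_on UNIV \<psi>"
    and A: "cmean (\<lambda>t. (\<phi> t)\<^sup>2) \<le> A" and B: "cmean (\<lambda>t. (\<psi> t)\<^sup>2) \<le> B"
  shows "cmean (\<lambda>t. \<phi> t * \<psi> t) \<le> sqrt A * sqrt B"
proof -
  have A0: "A \<ge> 0" and B0: "B \<ge> 0"
    using A B cmean_nonneg[of "\<lambda>t. (\<phi> t)\<^sup>2"] cmean_nonneg[of "\<lambda>t. (\<psi> t)\<^sup>2"] c
    by (force intro: continuous_intros)+
  have *: "2 * cmean (\<lambda>t. \<phi> t * \<psi> t) \<le> s * A + B / s" if s: "s > 0" for s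
  proof -
    have "2 * cmean (\<lambda>t. \<phi> t * \<psi> t) = cmean (\<lambda>t. 2 * (\<phi> t * \<psi> t))"
      by (simp add: cmean_cmul)
    also have "\<dots> \<le> cmean (\<lambda>t. s * (\<phi> t)\<^sup>2 + (1/s) * (\<psi> t)\<^sup>2)"
    proof (rule cmean_mono)
      fix t
      have "0 \<le> (sqrt s * \<phi> t - \<psi> t / sqrt s)\<^sup>2" by simp
      also have "\<dots> = s * (\<phi> t)\<^sup>2 + (1/s) * (\<psi> t)\<^sup>2 - 2 * (\<phi> t * \<psi> t)"
        using s by (simp add: power2_diff power_mult_distrib power_divide field_simps)
      finally show "2 * (\<phi> t * \<psi> t) \<le> s * (\<phi> t)\<^sup>2 + (1/s) * (\<psi> t)\<^sup>2" by simp
    qed (use c s in \<open>auto intro!: continuous_intros\<close>)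
    also have "\<dots> = s * cmean (\<lambda>t. (\<phi> t)\<^sup>2) + (1/s) * cmean (\<lambda>t. (\<psi> t)\<^sup>2)"
    proof -
      have "continuous_on UNIV (\<lambda>t. s * (\<phi> t)\<^sup>2)" "continuous_on UNIV (\<lambda>t. (1/s) * (\<psi> t)\<^sup>2)"
        using c s by (auto intro!: continuous_intros)
      from cmean_add[OF this] show ?thesis by (simp only: cmean_cmul)
    qed
    also have "\<dots> \<le> s * A + (1/s) * B"
      using A B s by (intro add_mono mult_left_mono) auto
    finally show ?thesis by simp
  qed
  show ?thesis
  proof (rule field_le_epsilon)
    fix e :: real assume e: "e > 0"
    define d where "d = min 1 (e\<^sup>2 / (A + B + 1))"
    have lim: "((\<lambda>d. sqrt (A + d) * sqrt (B + d)) \<longlongrightarrow> sqrt (A + 0) * sqrt (B + 0)) (at_right 0)"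
      by (intro tendsto_intros)
    have "eventually (\<lambda>d. sqrt (A + d) * sqrt (B + d) < sqrt A * sqrt B + e) (at_right 0)"
      using order_tendstoD(2)[OF lim, of "sqrt A * sqrt B + e"] e by simp
    moreover have "eventually (\<lambda>d::real. d > 0) (at_right 0)"
      by (simp add: eventually_at_right_less)
    ultimately have "eventually (\<lambda>d. sqrt (A + d) * sqrt (B + d) < sqrt A * sqrt B + e \<and> d > 0) (at_right 0)"
      by (rule eventually_conj)
    then obtain d where d: "sqrt (A + d) * sqrt (B + d) < sqrt A * sqrt B + e" "d > 0"
      using eventually_happens trivial_limit_at_right_real by blast
    define s where "s = sqrt (B + d) / sqrt (A + d)"
    have s: "s > 0" using d A0 B0 by (auto simp: s_def intro!: divide_pos_pos)
    have "s * A \<le> sqrt (A + d) * sqrt (B + d)"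
    proof -
      have "s * A \<le> s * (A + d)" using s d by simp
      also have "\<dots> = sqrt (A + d) * sqrt (B + d)"
        unfolding s_def times_divide_eq_left times_divide_eq_right[symmetric] using d A0
        by (metis add_nonneg_nonneg less_imp_le mult.commute real_div_sqrt)
      finally show ?thesis .
    qed
    moreover have "B / s \<le> sqrt (A + d) * sqrt (B + d)"
    proof -
      have "B / s \<le> (B + d) / s" using s d by (simp add: divide_right_mono)
      also have "\<dots> = sqrt (A + d) * sqrt (B + d)"
        unfolding s_def using d B0
        by (metis (no_types, lifting) add_nonneg_nonneg less_imp_le mult.commute real_div_sqrt divide_divide_eq_right times_divide_eq_left)
      finally show ?thesis .
    qed
    ultimately show "cmean (\<lambda>t. \<phi> t * \<psi> t) \<le> sqrt A * sqrt B + e"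
      using *[OF s] d by linarith
  qed
qed

lemma cmean_shift_nonneg:
  fixes \<phi> :: "real \<Rightarrow> 'a::banach"
  assumes c: "continuous_on UNIV \<phi>" and per: "\<And>t. \<phi> (t + 2*pi) = \<phi> t" and a: "0 \<le> a" "a \<le> 2*pi"
  shows "cmean (\<lambda>t. \<phi> (t + a)) = cmean \<phi>"
proof -
  have "integral {0..2*pi} (\<lambda>t. \<phi> (t + a)) = integral {a..2*pi + a} \<phi>"
    using integral_shift_Icc_real[of 0 "2*pi" \<phi> a] by (simp add: add.commute o_def)
  also have "\<dots> = integral {a..2*pi} \<phi> + integral {2*pi..2*pi + a} \<phi>"
    using a by (intro Henstock_Kurzweil_Integration.integral_combine[symmetric] continuous_integrable c) auto
  also have "integral {2*pi..2*pi + a} \<phi> = integral {0..a} \<phi>"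
    using integral_shift_Icc_real[of 0 a \<phi> "2*pi"] per by (simp add: add.commute o_def)
  also have "integral {a..2*pi} \<phi> + integral {0..a} \<phi> = integral {0..2*pi} \<phi>"
    using a Henstock_Kurzweil_Integration.integral_combine[of 0 a "2*pi" \<phi>] continuous_integrable[OF c]
    by (simp add: add.commute)
  finally show ?thesis by (simp add: cmean_def)
qed

lemma cmean_reflect:
  fixes \<phi> :: "real \<Rightarrow> 'a::banach"
  assumes c: "continuous_on UNIV \<phi>" and per: "\<And>t. \<phi> (t + 2*pi) = \<phi> t"
  shows "cmean (\<lambda>t. \<phi> (- t)) = cmean \<phi>"
proof -
  have "integral {0..2*pi} (\<lambda>t. \<phi> (- t)) = integral {-2*pi..0} \<phi>"
    using Henstock_Kurzweil_Integration.integral_reflect_real[of 0 "-2*pi" \<phi>] by simp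
  also have "\<dots> = integral {-2*pi..0} (\<lambda>t. \<phi> (t + 2*pi))" by (simp add: per)
  also have "\<dots> = integral {0..2*pi} \<phi>"
    using integral_shift_Icc_real[of "-2*pi" 0 \<phi> "2*pi"] by (simp add: add.commute o_def)
  finally show ?thesis by (simp add: cmean_def)
qed

lemma cmean_rotate:
  fixes u :: "complex \<Rightarrow> 'a::banach"
  assumes c: "continuous_on UNIV (\<lambda>t. u (cis t))" and b: "cmod b = 1"
  shows "cmean (\<lambda>t. u (cis t * b)) = cmean (\<lambda>t. u (cis t))"
proof -
  define a where "a = Arg2pi b"
  have a: "0 \<le> a" "a \<le> 2*pi" "b = cis a"
    using Arg2pi[of b] b by (auto simp: a_def cis_conv_exp is_Arg_def)
  have "u (cis (t + 2*pi)) = u (cis t)" for t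
    by (simp flip: cis_mult)
  from cmean_shift_nonneg[OF c this a(1,2)] show ?thesis
    by (simp add: a(3) cis_mult)
qed

lemma cmean_swap:
  fixes \<phi> :: "real \<Rightarrow> real \<Rightarrow> 'a::banach"
  assumes "continuous_on UNIV (\<lambda>(s, t). \<phi> s t)"
  shows "cmean (\<lambda>s. cmean (\<phi> s)) = cmean (\<lambda>t. cmean (\<lambda>s. \<phi> s t))"
proof -
  have "integral {0..2*pi} (\<lambda>s. integral {0..2*pi} (\<phi> s)) = integral {0..2*pi} (\<lambda>t. integral {0..2*pi} (\<lambda>s. \<phi> s t))"
    using integral_swap_continuous[of 0 0 "2*pi" "2*pi" \<phi>] continuous_on_subset[OF assms subset_UNIV] by simp
  then show ?thesis by (simp add: cmean_def)
qed

lemma continuous_on_cmean: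
  fixes \<phi> :: "real \<Rightarrow> real \<Rightarrow> 'a::banach"
  assumes "continuous_on UNIV (\<lambda>(s, t). \<phi> s t)"
  shows "continuous_on UNIV (\<lambda>s. cmean (\<phi> s))"
proof -
  have "continuous_on UNIV (\<lambda>s. integral (cbox 0 (2*pi)) (\<phi> s))"
    by (rule integral_continuous_on_param) (rule continuous_on_subset[OF assms subset_UNIV])
  then show ?thesis unfolding cmean_def by (auto intro!: continuous_intros)
qed

lemma tendsto_cmean:
  fixes \<phi> :: "'i \<Rightarrow> real \<Rightarrow> 'a::banach"
  assumes u: "uniform_limit {0..2*pi} \<phi> \<psi> F" and c: "\<And>n. continuous_on UNIV (\<phi> n)"
  shows "((\<lambda>n. cmean (\<phi> n)) \<longlongrightarrow> cmean \<psi>) F"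
proof (cases "F = bot")
  case False
  obtain I J where IJ: "\<And>n. (\<phi> n has_integral I n) {0..2*pi}" "(\<psi> has_integral J) {0..2*pi}" "(I \<longlongrightarrow> J) F"
    using uniform_limit_integral[OF u continuous_on_subset[OF c subset_UNIV] False] by metis
  have "integral {0..2*pi} (\<phi> n) = I n" "integral {0..2*pi} \<psi> = J" for n
    using IJ(1)[of n] IJ(2) by (auto intro: integral_unique)
  then show ?thesis using IJ(3) unfolding cmean_def by (auto intro!: tendsto_intros)
qed auto

lemma cmean_suminf:
  fixes \<phi> :: "nat \<Rightarrow> real \<Rightarrow> 'a::banach"
  assumes c: "\<And>n. continuous_on UNIV (\<phi> n)" and b: "\<And>n t. norm (\<phi> n t) \<le> M n" and M: "summable M"
  shows "(\<lambda>n. cmean (\<phi> n)) sums cmean (\<lambda>t. \<Sum>n. \<phi> n t)"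
proof -
  have u: "uniform_limit {0..2*pi} (\<lambda>n t. \<Sum>i<n. \<phi> i t) (\<lambda>t. \<Sum>i. \<phi> i t) sequentially"
    using b M by (intro Weierstrass_m_test) auto
  have "(\<lambda>n. cmean (\<lambda>t. \<Sum>i<n. \<phi> i t)) \<longlonglongrightarrow> cmean (\<lambda>t. \<Sum>i. \<phi> i t)"
    by (rule tendsto_cmean[OF u]) (auto intro!: continuous_intros c)
  then show ?thesis using c by (simp add: sums_def cmean_sum)
qed

lemma cmean_cis_int: "cmean (\<lambda>t. cis (of_int n * t)) = (if n = 0 then 1 else 0)"
proof (cases "n = 0")
  case False
  have aux: "- (\<i> * (x * (\<i> * c))) = x * c" for x c :: complex
  proof -
    have "\<i> * (x * (\<i> * c)) = (\<i> * \<i>) * (x * c)" by (simp only: mult_ac)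
    then show ?thesis by simp
  qed
  have "((\<lambda>t. cis (of_int n * t)) has_integral
      (cis (of_int n * (2*pi)) / (\<i> * of_int n) - cis (of_int n * 0) / (\<i> * of_int n))) {0..2*pi}"
    using False
    by (intro fundamental_theorem_of_calculus)
       (auto intro!: derivative_eq_intros simp: has_vector_derivative_def scaleR_conv_of_real fun_eq_iff aux)
  moreover have "cis (of_int n * (2*pi)) = 1"
    using cis_multiple_2pi[of "of_int n"] by (simp add: mult.commute mult.left_commute)
  ultimately have "integral {0..2*pi} (\<lambda>t. cis (of_int n * t)) = 0"
    by (auto dest: integral_unique)
  then show ?thesis using False by (simp add: cmean_def)
qed simp

section \<open>Power series with summable coefficients\<close>

definition pser :: "(nat \<Rightarrow> complex) \<Rightarrow> complex \<Rightarrow> complex" where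
  "pser c z = (\<Sum>k. c k * z ^ k)"

lemma norm_power_le_one: "cmod z \<le> 1 \<Longrightarrow> cmod (z ^ k) \<le> 1"
  by (simp add: norm_power power_le_one)

lemma norm_pser_term_le: "cmod z \<le> 1 \<Longrightarrow> cmod (c k * z ^ k) \<le> cmod (c k)"
  using norm_power_le_one[of z k] by (simp add: norm_mult mult_left_le)

lemma summable_pser:
  assumes "summable (\<lambda>k. cmod (c k))" "cmod z \<le> 1"
  shows "summable (\<lambda>k. c k * z ^ k)"
  by (rule summable_comparison_test'[OF assms(1), of 0]) (use norm_pser_term_le assms in auto)

lemma pser_sums:
  assumes "summable (\<lambda>k. cmod (c k))" "cmod z \<le> 1"
  shows "(\<lambda>k. c k * z ^ k) sums pser c z"
  using summable_pser[OF assms] unfolding pser_def by (rule summable_sums)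

lemma norm_pser_le:
  assumes "summable (\<lambda>k. cmod (c k))" "cmod z \<le> 1"
  shows "cmod (pser c z) \<le> (\<Sum>k. cmod (c k))"
  unfolding pser_def using assms norm_pser_term_le by (intro norm_suminf_le) auto

lemma continuous_on_pser:
  assumes "summable (\<lambda>k. cmod (c k))"
  shows "continuous_on (cball 0 1) (pser c)"
proof -
  have u: "uniform_limit (cball 0 1) (\<lambda>n z. \<Sum>k<n. c k * z ^ k) (\<lambda>z. \<Sum>k. c k * z ^ k) sequentially"
    using assms norm_pser_term_le by (intro Weierstrass_m_test) auto
  have "continuous_on (cball 0 1) (\<lambda>z. \<Sum>k. c k * z ^ k)"
    by (rule uniform_limit_theorem[OF _ u]) (auto intro!: continuous_intros always_eventually)
  then show ?thesis by (simp add: pser_def[abs_def])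
qed

lemma continuous_on_pser_cis:
  assumes "summable (\<lambda>k. cmod (c k))" "continuous_on UNIV f"
  shows "continuous_on UNIV (\<lambda>t. pser c (cis (f t)))"
  by (rule continuous_on_compose2[OF continuous_on_pser[OF assms(1)]])
     (use assms in \<open>auto intro!: continuous_intros\<close>)

text \<open>The exchange of sum and integral behind the Fourier computations. A character for
  \<open>\<phi>\<close> gives coefficients, a conjugate series gives Parseval, and an arbitrary
  bounded continuous \<open>\<phi>\<close> gives the Riesz projection used in
  \<open>H1_norm_le_dual\<close>.\<close>

lemma cmean_mult_pser:
  assumes b: "summable (\<lambda>k. cmod (b k))" and c: "continuous_on UNIV \<phi>" and M: "\<And>t. cmod (\<phi> t) \<le> M"
  shows "(\<lambda>k. b k * cmean (\<lambda>t. \<phi> t * cis (real k * t))) sums cmean (\<lambda>t. \<phi> t * pser b (cis t))"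
proof -
  have "(\<lambda>k. cmean (\<lambda>t. b k * (\<phi> t * cis (real k * t)))) sums cmean (\<lambda>t. \<Sum>k. b k * (\<phi> t * cis (real k * t)))"
  proof (rule cmean_suminf)
    show "norm (b k * (\<phi> t * cis (real k * t))) \<le> M * cmod (b k)" for k t
      using M[of t] by (simp add: norm_mult mult.commute mult_right_mono)
    show "summable (\<lambda>k. M * cmod (b k))" using b by simp
  qed (use c in \<open>auto intro!: continuous_intros\<close>)
  also have "(\<lambda>t. \<Sum>k. b k * (\<phi> t * cis (real k * t))) = (\<lambda>t. \<phi> t * pser b (cis t))"
  proof
    fix t
    have "(\<lambda>k. \<phi> t * (b k * cis t ^ k)) sums (\<phi> t * pser b (cis t))"
      by (intro sums_mult pser_sums b) auto
    then show "(\<Sum>k. b k * (\<phi> t * cis (real k * t))) = \<phi> t * pser b (cis t)"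
      by (simp add: sums_iff Complex.DeMoivre mult_ac)
  qed
  finally show ?thesis by (simp add: cmean_cmul)
qed

lemma cmean_pser_cis:
  assumes b: "summable (\<lambda>k. cmod (b k))"
  shows "cmean (\<lambda>t. pser b (cis t) * cis (- (real j * t))) = b j"
proof -
  have "(\<lambda>k. b k * cmean (\<lambda>t. cis (- (real j * t)) * cis (real k * t))) sums
      cmean (\<lambda>t. cis (- (real j * t)) * pser b (cis t))"
    by (rule cmean_mult_pser[OF b, of _ 1]) (auto intro!: continuous_intros)
  moreover have "cmean (\<lambda>t. cis (- (real j * t)) * cis (real k * t)) = (if k = j then 1 else 0)" for k
    using cmean_cis_int[of "int k - int j"] by (auto simp: cis_mult algebra_simps)
  moreover have "(\<lambda>k. b k * (if k = j then 1 else 0)) sums b j"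
    using sums_single[of j b] by (simp add: if_distrib cong: if_cong)
  ultimately show ?thesis
    by (simp add: mult.commute sums_unique2)
qed

lemma Parseval_pser:
  assumes b: "summable (\<lambda>k. cmod (b k))" and d: "summable (\<lambda>k. cmod (d k))"
  shows "(\<lambda>k. b k * cnj (d k)) sums cmean (\<lambda>t. pser b (cis t) * cnj (pser d (cis t)))"
proof -
  have "(\<lambda>k. b k * cmean (\<lambda>t. cnj (pser d (cis t)) * cis (real k * t))) sums
      cmean (\<lambda>t. cnj (pser d (cis t)) * pser b (cis t))"
    by (rule cmean_mult_pser[OF b, of _ "\<Sum>k. cmod (d k)"])
       (auto intro!: continuous_intros continuous_on_pser_cis d norm_pser_le)
  moreover have "cmean (\<lambda>t. cnj (pser d (cis t)) * cis (real k * t)) = cnj (d k)" for k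
    using cmean_cnj[of "\<lambda>t. pser d (cis t) * cis (- (real k * t))"]
    by (simp add: cmean_pser_cis[OF d] cis_cnj continuous_intros continuous_on_pser_cis d)
  ultimately show ?thesis by (simp add: mult.commute)
qed

lemma Parseval_pser_bilinear:
  assumes b: "summable (\<lambda>k. cmod (b k))" and d: "summable (\<lambda>k. cmod (d k))"
  shows "(\<lambda>k. b k * d k) sums cmean (\<lambda>t. pser b (cis t) * pser d (cis (-t)))"
proof -
  have "cnj (pser (\<lambda>k. cnj (d k)) (cis t)) = pser d (cis (-t))" for t
  proof -
    have "(\<lambda>k. cnj (cnj (d k) * cis t ^ k)) sums cnj (pser (\<lambda>k. cnj (d k)) (cis t))"
      using d by (subst sums_cnj) (intro pser_sums, auto)
    then show ?thesis by (simp add: sums_iff pser_def cis_cnj)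
  qed
  with Parseval_pser[OF b, of "\<lambda>k. cnj (d k)"] d show ?thesis by simp
qed

lemma Parseval_pser_norm:
  assumes b: "summable (\<lambda>k. cmod (b k))"
  shows "(\<lambda>k. (cmod (b k))\<^sup>2) sums cmean (\<lambda>t. (cmod (pser b (cis t)))\<^sup>2)"
proof -
  have "(\<lambda>k. complex_of_real ((cmod (b k))\<^sup>2)) sums cmean (\<lambda>t. complex_of_real ((cmod (pser b (cis t)))\<^sup>2))"
    using Parseval_pser[OF b b] by (simp add: complex_norm_square del: of_real_power)
  then have "(\<lambda>k. complex_of_real ((cmod (b k))\<^sup>2)) sums complex_of_real (cmean (\<lambda>t. (cmod (pser b (cis t)))\<^sup>2))"
    by (subst (asm) cmean_of_real) (auto intro!: continuous_intros continuous_on_pser_cis b)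
  then show ?thesis by (simp only: sums_of_real_iff)
qed

lemma cmean_pser:
  assumes b: "summable (\<lambda>k. cmod (b k))"
  shows "cmean (\<lambda>t. pser b (cis t)) = b 0"
  using cmean_pser_cis[OF b, of 0] by simp

section \<open>Taylor coefficients\<close>

text \<open>Together with \<open>taylor_sums\<close> this trades iterated derivatives at 0 for
  coefficient sequences.\<close>

lemma taylor_coeff_eqI:
  assumes "\<And>z. z \<in> ball 0 1 \<Longrightarrow> (\<lambda>k. c k * z ^ k) sums f z"
  shows "taylor_coeff f = c"
proof -
  have "f has_fps_expansion Abs_fps c"
    unfolding has_fps_expansion_def
  proof
    have "summable (\<lambda>k. fps_nth (Abs_fps c) k * (1/2) ^ k)"
      using assms[of "1/2"] by (auto simp: sums_iff)
    then have "fps_conv_radius (Abs_fps c) \<ge> norm (1/2 :: complex)"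
      unfolding fps_conv_radius_def by (intro conv_radius_geI) auto
    then show "0 < fps_conv_radius (Abs_fps c)"
      by (rule less_le_trans[rotated]) (auto simp: zero_ereal_def)
    have "eventually (\<lambda>z. z \<in> ball 0 1) (nhds (0::complex))"
      by (rule eventually_nhds_in_open) auto
    then show "eventually (\<lambda>z. eval_fps (Abs_fps c) z = f z) (nhds 0)"
      by eventually_elim (use assms in \<open>auto simp: eval_fps_def sums_iff\<close>)
  qed
  then have "fps_nth (Abs_fps c) k = (deriv ^^ k) f 0 / fact k" for k
    by (rule fps_nth_fps_expansion)
  then show ?thesis by (auto simp: taylor_coeff_def fun_eq_iff of_nat_fact)
qed

lemma taylor_sums:
  assumes "f holomorphic_on ball 0 1" "cmod z < 1"
  shows "(\<lambda>k. taylor_coeff f k * z ^ k) sums f z"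
  using holomorphic_power_series[OF assms(1), of z] assms(2)
  by (simp add: taylor_coeff_def of_nat_fact dist_norm)

lemma summable_power_bounded:
  assumes "\<And>k. cmod (c k) \<le> M" "cmod z < 1"
  shows "summable (\<lambda>k. cmod (c k * z ^ k))"
proof (rule summable_comparison_test'[of "\<lambda>k. M * cmod z ^ k" 0])
  show "summable (\<lambda>k. M * cmod z ^ k)" using assms(2) by (intro summable_mult summable_geometric) auto
  show "norm (cmod (c k * z ^ k)) \<le> M * cmod z ^ k" for k
    using assms(1)[of k] by (simp add: norm_mult norm_power mult_right_mono)
qed

lemma summable_dilated_taylor:
  assumes "f holomorphic_on ball 0 1" "0 \<le> r" "r < 1"
  shows "summable (\<lambda>k. cmod (taylor_coeff f k * of_real r ^ k))"
proof -
  obtain s where s: "r < s" "s < 1" using assms dense by blast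
  have "summable (\<lambda>k. taylor_coeff f k * of_real s ^ k)"
    using taylor_sums[OF assms(1), of "of_real s"] s assms by (auto simp: sums_iff)
  then show ?thesis
    by (rule powser_insidea) (use s assms in auto)
qed

lemma pser_dilate: "pser (\<lambda>k. c k * r ^ k) z = pser c (r * z)"
  by (simp add: pser_def power_mult_distrib mult_ac)

lemma holomorphic_eq_pser:
  assumes "f holomorphic_on ball 0 1" "cmod z < 1"
  shows "f z = pser (taylor_coeff f) z"
  using taylor_sums[OF assms] by (simp add: pser_def sums_iff)

lemma holomorphic_dilated_eq_pser:
  assumes "f holomorphic_on ball 0 1" "0 \<le> r" "r < 1" "cmod z \<le> 1"
  shows "f (of_real r * z) = pser (\<lambda>k. taylor_coeff f k * of_real r ^ k) z"
proof -
  have "cmod (of_real r * z) < 1"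
    using assms mult_left_le[of "cmod z" r] by (simp add: norm_mult)
  then show ?thesis using assms by (simp add: pser_dilate holomorphic_eq_pser)
qed

lemma holomorphic_pser:
  assumes "\<And>k. cmod (c k) \<le> M"
  shows "pser c holomorphic_on ball 0 1"
proof -
  have "(\<lambda>k. c k * (z - 0) ^ k) sums pser c z" if "z \<in> ball 0 1" for z
    using summable_norm_cancel[OF summable_power_bounded[OF assms]] that
    by (simp add: pser_def summable_sums)
  then show ?thesis by (rule power_series_holomorphic)
qed

lemma pser_bounded_sums:
  assumes "\<And>k. cmod (c k) \<le> M" "cmod z < 1"
  shows "(\<lambda>k. c k * z ^ k) sums pser c z"
  using summable_norm_cancel[OF summable_power_bounded[OF assms]]
  by (simp add: pser_def summable_sums)

lemma taylor_coeff_pser: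
  assumes "\<And>k. cmod (c k) \<le> M"
  shows "taylor_coeff (pser c) = c"
  by (rule taylor_coeff_eqI) (use pser_bounded_sums[OF assms] in auto)

lemma taylor_coeff_cong_ball:
  assumes "f holomorphic_on ball 0 1" "\<And>z. cmod z < 1 \<Longrightarrow> f z = g z"
  shows "taylor_coeff g = taylor_coeff f"
  by (rule taylor_coeff_eqI) (use taylor_sums[OF assms(1)] assms(2) in auto)

lemma taylor_coeff_linear:
  assumes "f holomorphic_on ball 0 1" "g holomorphic_on ball 0 1"
  shows "taylor_coeff (\<lambda>z. a * f z + b * g z) = (\<lambda>k. a * taylor_coeff f k + b * taylor_coeff g k)"
proof (rule taylor_coeff_eqI)
  fix z :: complex assume "z \<in> ball 0 1"
  then have "(\<lambda>k. a * (taylor_coeff f k * z ^ k) + b * (taylor_coeff g k * z ^ k)) sums (a * f z + b * g z)"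
    using assms by (intro sums_add sums_mult taylor_sums) auto
  then show "(\<lambda>k. (a * taylor_coeff f k + b * taylor_coeff g k) * z ^ k) sums (a * f z + b * g z)"
    by (simp add: algebra_simps)
qed

lemma taylor_coeff_diff:
  assumes "f holomorphic_on ball 0 1" "g holomorphic_on ball 0 1"
  shows "taylor_coeff (\<lambda>z. f z - g z) = (\<lambda>k. taylor_coeff f k - taylor_coeff g k)"
  using taylor_coeff_linear[OF assms, of 1 "-1"] by simp

lemma taylor_coeff_0: "taylor_coeff f 0 = f 0"
  by (simp add: taylor_coeff_def)

lemma continuous_on_circle:
  assumes "f holomorphic_on ball 0 1" "0 \<le> r" "r < 1" "continuous_on UNIV \<tau>"
  shows "continuous_on UNIV (\<lambda>t. f (of_real r * cis (\<tau> t)))"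
  by (rule continuous_on_compose2[OF holomorphic_on_imp_continuous_on[OF assms(1)]])
     (use assms in \<open>auto intro!: continuous_intros simp: norm_mult\<close>)

section \<open>Square-summable sequences\<close>

definition l2 :: "(nat \<Rightarrow> complex) \<Rightarrow> bool" where
  "l2 c \<longleftrightarrow> summable (\<lambda>k. (cmod (c k))\<^sup>2)"

text \<open>Meaningful under \<open>l2\<close> only, since \<open>suminf\<close> of a divergent
  series is unspecified; membership is therefore carried as a separate hypothesis.\<close>

definition n2 :: "(nat \<Rightarrow> complex) \<Rightarrow> real" where
  "n2 c = sqrt (\<Sum>k. (cmod (c k))\<^sup>2)"

lemma n2_nonneg': "l2 c \<Longrightarrow> 0 \<le> n2 c"
  unfolding n2_def l2_def by (intro real_sqrt_ge_zero suminf_nonneg) auto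

lemma n2_sq: "l2 c \<Longrightarrow> (n2 c)\<^sup>2 = (\<Sum>k. (cmod (c k))\<^sup>2)"
  unfolding n2_def l2_def by (intro real_sqrt_pow2 suminf_nonneg) auto

lemma L2_set_le_n2:
  assumes "l2 c" "finite A"
  shows "L2_set (\<lambda>k. cmod (c k)) A \<le> n2 c"
  unfolding n2_def L2_set_def using assms
  by (auto simp: l2_def intro!: real_sqrt_le_mono sum_le_suminf)

text \<open>Finite sections give membership and the norm bound at once. Minkowski's inequality,
  shifts and coefficientwise limits are all carried over from \<open>L2_set\<close> in this
  way.\<close>

lemma n2_leI:
  assumes "\<And>K. L2_set (\<lambda>k. cmod (c k)) {..<K} \<le> B"
  shows "l2 c" "n2 c \<le> B"
proof -
  have B: "0 \<le> B" using assms[of 0] by simp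
  have *: "(\<Sum>k<K. (cmod (c k))\<^sup>2) \<le> B\<^sup>2" for K
    using assms[of K] B unfolding L2_set_def by (simp add: real_sqrt_le_iff' sqrt_le_D)
  show "l2 c" unfolding l2_def
    by (rule summableI_nonneg_bounded[of _ "B\<^sup>2"]) (use * in auto)
  then have "(\<Sum>k. (cmod (c k))\<^sup>2) \<le> B\<^sup>2"
    using * by (intro suminf_le_const) (auto simp: l2_def)
  then show "n2 c \<le> B" unfolding n2_def using B by (simp add: real_le_lsqrt)
qed

lemma l2_bounded: "l2 c \<Longrightarrow> cmod (c k) \<le> n2 c"
  using L2_set_le_n2[of c "{k}"] by (simp add: L2_set_def)

lemma n2_triangle:
  assumes "l2 b" "l2 c"
  shows "l2 (\<lambda>k. b k + c k)" "n2 (\<lambda>k. b k + c k) \<le> n2 b + n2 c"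
proof -
  have "L2_set (\<lambda>k. cmod (b k + c k)) {..<K} \<le> n2 b + n2 c" for K
  proof -
    have "L2_set (\<lambda>k. cmod (b k + c k)) {..<K} \<le> L2_set (\<lambda>k. cmod (b k) + cmod (c k)) {..<K}"
      by (rule L2_set_mono) (auto intro: norm_triangle_ineq)
    also have "\<dots> \<le> L2_set (\<lambda>k. cmod (b k)) {..<K} + L2_set (\<lambda>k. cmod (c k)) {..<K}"
      by (rule L2_set_triangle_ineq)
    also have "\<dots> \<le> n2 b + n2 c"
      using assms by (intro add_mono L2_set_le_n2) auto
    finally show ?thesis .
  qed
  from n2_leI[OF this] show "l2 (\<lambda>k. b k + c k)" "n2 (\<lambda>k. b k + c k) \<le> n2 b + n2 c" by auto
qed

lemma n2_mono:
  assumes "l2 b" "\<And>k. cmod (c k) \<le> cmod (b k)"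
  shows "l2 c" "n2 c \<le> n2 b"
proof -
  have "L2_set (\<lambda>k. cmod (c k)) {..<K} \<le> n2 b" for K
    using L2_set_mono[of "{..<K}" "\<lambda>k. cmod (c k)" "\<lambda>k. cmod (b k)"] L2_set_le_n2[OF assms(1), of "{..<K}"] assms(2)
    by auto
  from n2_leI[OF this] show "l2 c" "n2 c \<le> n2 b" by auto
qed

lemma n2_cmul:
  assumes "l2 c"
  shows "l2 (\<lambda>k. a * c k)" "n2 (\<lambda>k. a * c k) = cmod a * n2 c"
  using assms unfolding l2_def n2_def
  by (auto simp: norm_mult power_mult_distrib suminf_mult real_sqrt_mult)

lemma n2_diff:
  assumes "l2 b" "l2 c"
  shows "l2 (\<lambda>k. b k - c k)" "n2 (\<lambda>k. b k - c k) \<le> n2 b + n2 c"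
  using n2_triangle[OF assms(1) n2_cmul(1)[OF assms(2), of "-1"]] n2_cmul(2)[OF assms(2), of "-1"] by auto

lemma l2_Suc: "l2 (\<lambda>k. c (Suc k)) \<longleftrightarrow> l2 c"
  unfolding l2_def by (subst summable_Suc_iff) simp

lemma n2_Suc_sq: "l2 c \<Longrightarrow> (n2 c)\<^sup>2 = (cmod (c 0))\<^sup>2 + (n2 (\<lambda>k. c (Suc k)))\<^sup>2"
  using suminf_split_head[of "\<lambda>k. (cmod (c k))\<^sup>2"] by (simp add: n2_sq l2_Suc l2_def)

lemma n2_le_Suc:
  assumes "l2 c"
  shows "n2 c \<le> cmod (c 0) + n2 (\<lambda>k. c (Suc k))"
proof (rule power2_le_imp_le)
  show "(n2 c)\<^sup>2 \<le> (cmod (c 0) + n2 (\<lambda>k. c (Suc k)))\<^sup>2"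
    unfolding n2_Suc_sq[OF assms] using assms by (simp add: power2_sum l2_Suc n2_nonneg')
qed (use assms in \<open>simp add: l2_Suc n2_nonneg'\<close>)

lemma summable_imp_l2:
  assumes "summable (\<lambda>k. cmod (c k))"
  shows "l2 c"
proof -
  have "cmod (c k) \<le> (\<Sum>k. cmod (c k))" for k
    using sum_le_suminf[OF assms, of "{k}"] by auto
  then show ?thesis unfolding l2_def
    by (intro summable_comparison_test'[OF summable_mult[OF assms], of 0 _ "\<Sum>k. cmod (c k)"])
       (auto simp: power2_eq_square intro!: mult_right_mono)
qed

section \<open>Difference quotients and the Garsia seminorm\<close>

text \<open>The value at \<open>z\<close> of the \<open>k\<close>-fold backward shift of the series
  with coefficients \<open>c\<close>. The Horner-type recursion \<open>tser_rec\<close> linking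
  consecutive values drives all later estimates.\<close>

definition tser :: "(nat \<Rightarrow> complex) \<Rightarrow> complex \<Rightarrow> nat \<Rightarrow> complex" where
  "tser c z k = (\<Sum>j. c (k + j) * z ^ j)"

text \<open>The Taylor coefficients of \<open>\<zeta> \<mapsto> (f \<zeta> - f z) / (\<zeta> - z)\<close> when \<open>c\<close> are those of \<open>f\<close>.\<close>

definition dq :: "(nat \<Rightarrow> complex) \<Rightarrow> complex \<Rightarrow> nat \<Rightarrow> complex" where
  "dq c z k = tser c z (Suc k)"

definition gars :: "(nat \<Rightarrow> complex) \<Rightarrow> complex \<Rightarrow> real" where
  "gars c z = sqrt (1 - (cmod z)\<^sup>2) * n2 (dq c z)"

lemma norm_sq_less_1: "cmod z < 1 \<Longrightarrow> (cmod z)\<^sup>2 < 1"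
  by (simp add: power_less_one_iff)

lemma tser_summable:
  assumes "\<And>k. cmod (c k) \<le> M" "cmod z < 1"
  shows "summable (\<lambda>j. c (k + j) * z ^ j)"
  using summable_norm_cancel[OF summable_power_bounded[of "\<lambda>j. c (k + j)" M z]] assms by auto

lemma tser_0: "tser c z 0 = pser c z"
  by (simp add: tser_def pser_def)

lemma tser_rec:
  assumes "\<And>k. cmod (c k) \<le> M" "cmod z < 1"
  shows "tser c z k = c k + z * tser c z (Suc k)"
proof -
  have "tser c z k = c k + (\<Sum>j. c (k + Suc j) * z ^ Suc j)"
    unfolding tser_def using suminf_split_head[OF tser_summable[of c M, OF assms, of k]] by simp
  also have "(\<Sum>j. c (k + Suc j) * z ^ Suc j) = z * (\<Sum>j. c (Suc k + j) * z ^ j)"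
    by (subst suminf_mult[OF tser_summable[of c M, OF assms], symmetric]) (simp add: mult_ac)
  finally show ?thesis by (simp add: tser_def)
qed

lemma norm_tser_le:
  assumes "\<And>k. cmod (c k) \<le> M" "cmod z < 1"
  shows "cmod (tser c z k) \<le> M / (1 - cmod z)"
proof -
  have M: "0 \<le> M" using assms(1)[of 0] norm_ge_zero[of "c 0"] by linarith
  have "cmod (tser c z k) \<le> (\<Sum>j. M * cmod z ^ j)"
    unfolding tser_def
    by (intro norm_suminf_le summable_mult summable_geometric)
       (use assms in \<open>auto simp: norm_mult norm_power mult_right_mono\<close>)
  also have "\<dots> = M / (1 - cmod z)"
    using assms(2) by (simp add: suminf_mult summable_geometric suminf_geometric)
  finally show ?thesis .
qed

lemma tser_linear:
  assumes "\<And>k. cmod (b k) \<le> L" "\<And>k. cmod (c k) \<le> M" "cmod z < 1"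
  shows "tser (\<lambda>k. \<alpha> * b k + \<beta> * c k) z k = \<alpha> * tser b z k + \<beta> * tser c z k"
proof -
  have "(\<lambda>j. \<alpha> * (b (k + j) * z ^ j) + \<beta> * (c (k + j) * z ^ j)) sums (\<alpha> * tser b z k + \<beta> * tser c z k)"
    unfolding tser_def
    by (intro sums_add sums_mult summable_sums tser_summable[OF assms(1,3)] tser_summable[OF assms(2,3)])
  then show ?thesis unfolding tser_def by (simp add: sums_iff algebra_simps)
qed

lemma dq_linear:
  assumes "l2 b" "l2 c" "cmod z < 1"
  shows "dq (\<lambda>k. \<alpha> * b k + \<beta> * c k) z = (\<lambda>k. \<alpha> * dq b z k + \<beta> * dq c z k)"
  using tser_linear[OF l2_bounded[OF assms(1)] l2_bounded[OF assms(2)] assms(3)] by (auto simp: dq_def)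

text \<open>Apply Minkowski to the recursion \<open>tser_rec\<close> on a finite section. The
  shifted section exceeds the original one by at most one boundary term, bounded by
  \<open>n2 c / (1 - cmod z)\<close>. Because sections are finite, the term with factor
  \<open>cmod z < 1\<close> can be absorbed on the left.\<close>

lemma tser_l2:
  assumes "l2 c" "cmod z < 1"
  shows "l2 (tser c z)" "n2 (tser c z) \<le> 2 * n2 c / (1 - cmod z)\<^sup>2"
proof -
  let ?s = "\<lambda>K. L2_set (\<lambda>k. cmod (tser c z k)) {..<K}"
  note bd = l2_bounded[OF assms(1)]
  have n0: "0 \<le> n2 c" using n2_nonneg'[OF assms(1)] .
  have "?s K \<le> 2 * n2 c / (1 - cmod z)\<^sup>2" for K
  proof -
    have "?s K \<le> L2_set (\<lambda>k. cmod (c k) + cmod z * cmod (tser c z (Suc k))) {..<K}"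
    proof (rule L2_set_mono)
      show "cmod (tser c z k) \<le> cmod (c k) + cmod z * cmod (tser c z (Suc k))" for k
        by (subst tser_rec[OF bd assms(2)]) (metis norm_mult norm_triangle_ineq)
    qed simp
    also have "\<dots> \<le> L2_set (\<lambda>k. cmod (c k)) {..<K} + L2_set (\<lambda>k. cmod z * cmod (tser c z (Suc k))) {..<K}"
      by (rule L2_set_triangle_ineq)
    also have "L2_set (\<lambda>k. cmod (c k)) {..<K} \<le> n2 c" by (rule L2_set_le_n2[OF assms(1)]) auto
    also have "L2_set (\<lambda>k. cmod z * cmod (tser c z (Suc k))) {..<K} = cmod z * L2_set (\<lambda>k. cmod (tser c z (Suc k))) {..<K}"
      by (simp add: L2_set_right_distrib)
    also have "L2_set (\<lambda>k. cmod (tser c z (Suc k))) {..<K} \<le> ?s K + n2 c / (1 - cmod z)"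
    proof -
      have "L2_set (\<lambda>k. cmod (tser c z (Suc k))) {..<K} = L2_set (\<lambda>k. cmod (tser c z k)) {Suc 0..<Suc K}"
        unfolding L2_set_def by (simp add: sum.shift_bounds_Suc_ivl lessThan_atLeast0 del: sum.op_ivl_Suc)
      also have "\<dots> \<le> L2_set (\<lambda>k. cmod (tser c z k)) {..<Suc K}"
        unfolding L2_set_def by (intro real_sqrt_le_mono sum_mono2) auto
      also have "\<dots> = L2_set (\<lambda>k. cmod (tser c z k)) (insert K {..<K})" by (simp add: lessThan_Suc)
      also have "\<dots> \<le> cmod (tser c z K) + ?s K"
      proof -
        have "sqrt (a + b) \<le> sqrt a + sqrt b" if "a \<ge> 0" "b \<ge> 0" for a b :: real
          using that by (simp add: sqrt_add_le_add_sqrt)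
        from this[of "(cmod (tser c z K))\<^sup>2" "\<Sum>k<K. (cmod (tser c z k))\<^sup>2"] show ?thesis
          by (simp add: L2_set_def sum_nonneg)
      qed
      also have "cmod (tser c z K) \<le> n2 c / (1 - cmod z)" by (rule norm_tser_le[OF bd assms(2)])
      finally show ?thesis by simp
    qed
    finally have "?s K \<le> n2 c + cmod z * (?s K + n2 c / (1 - cmod z))"
      by (simp add: mult_left_mono)
    also have "\<dots> \<le> n2 c / (1 - cmod z) + cmod z * ?s K + n2 c / (1 - cmod z)"
    proof -
      have "cmod z * (n2 c / (1 - cmod z)) \<le> 1 * (n2 c / (1 - cmod z))"
        using assms n0 by (intro mult_right_mono divide_nonneg_pos) auto
      moreover have "n2 c \<le> n2 c / (1 - cmod z)"
        using assms n0 by (simp add: field_simps mult_left_le)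
      ultimately show ?thesis unfolding distrib_left by linarith
    qed
    finally have "(1 - cmod z) * ?s K \<le> 2 * n2 c / (1 - cmod z)" by (simp add: algebra_simps)
    then have "?s K \<le> 2 * n2 c / (1 - cmod z) / (1 - cmod z)"
      using assms by (simp add: pos_le_divide_eq mult.commute)
    then show ?thesis by (simp add: power2_eq_square)
  qed
  from n2_leI[OF this] show "l2 (tser c z)" "n2 (tser c z) \<le> 2 * n2 c / (1 - cmod z)\<^sup>2" by auto
qed

lemma dq_l2:
  assumes "l2 c" "cmod z < 1"
  shows "l2 (dq c z)" "n2 (dq c z) \<le> 2 * n2 c / (1 - cmod z)\<^sup>2"
proof -
  have [simp]: "dq c z = (\<lambda>k. tser c z (Suc k))" by (auto simp: dq_def)
  show 1: "l2 (dq c z)" using tser_l2(1)[OF assms] by (simp add: l2_Suc)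
  have "n2 (dq c z) \<le> n2 (tser c z)"
  proof (rule power2_le_imp_le)
    show "(n2 (dq c z))\<^sup>2 \<le> (n2 (tser c z))\<^sup>2"
      using n2_Suc_sq[OF tser_l2(1)[OF assms]] by simp
  qed (use n2_nonneg'[OF tser_l2(1)[OF assms]] in auto)
  with tser_l2(2)[OF assms] show "n2 (dq c z) \<le> 2 * n2 c / (1 - cmod z)\<^sup>2" by linarith
qed

lemma gars_nonneg: "l2 c \<Longrightarrow> cmod z < 1 \<Longrightarrow> 0 \<le> gars c z"
  unfolding gars_def using n2_nonneg'[OF dq_l2(1)] norm_sq_less_1[of z] by simp

lemma gars_le:
  assumes "l2 c" "cmod z < 1"
  shows "gars c z \<le> 2 * n2 c / (1 - cmod z)\<^sup>2"
proof -
  have "gars c z \<le> 1 * n2 (dq c z)"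
    unfolding gars_def using n2_nonneg'[OF dq_l2(1)[OF assms]] norm_sq_less_1[OF assms(2)]
    by (intro mult_right_mono) auto
  with dq_l2(2)[OF assms] show ?thesis by simp
qed

lemma gars_linear:
  assumes "l2 b" "l2 c" "cmod z < 1"
  shows "gars (\<lambda>k. \<alpha> * b k + \<beta> * c k) z \<le> cmod \<alpha> * gars b z + cmod \<beta> * gars c z"
proof -
  note d = dq_l2(1)[OF assms(1,3)] dq_l2(1)[OF assms(2,3)]
  have "n2 (dq (\<lambda>k. \<alpha> * b k + \<beta> * c k) z) \<le> cmod \<alpha> * n2 (dq b z) + cmod \<beta> * n2 (dq c z)"
    using n2_triangle(2)[OF n2_cmul(1)[OF d(1), of \<alpha>] n2_cmul(1)[OF d(2), of \<beta>]]
    by (simp add: dq_linear[OF assms] n2_cmul(2) d)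
  from mult_left_mono[OF this, of "sqrt (1 - (cmod z)\<^sup>2)"] show ?thesis
    using norm_sq_less_1[OF assms(3)] by (simp add: gars_def algebra_simps)
qed

lemma gars_cmul:
  assumes "l2 c" "cmod z < 1"
  shows "gars (\<lambda>k. \<alpha> * c k) z = cmod \<alpha> * gars c z"
  using dq_linear[OF assms(1,1,2), of \<alpha> 0] n2_cmul(2)[OF dq_l2(1)[OF assms], of \<alpha>]
  by (simp add: gars_def)

lemma gars_add: "l2 b \<Longrightarrow> l2 c \<Longrightarrow> cmod z < 1 \<Longrightarrow> gars (\<lambda>k. b k + c k) z \<le> gars b z + gars c z"
  using gars_linear[of b c z 1 1] by simp

lemma gars_diff: "l2 b \<Longrightarrow> l2 c \<Longrightarrow> cmod z < 1 \<Longrightarrow> gars (\<lambda>k. b k - c k) z \<le> gars b z + gars c z"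
  using gars_linear[of b c z 1 "-1"] by simp

lemma gars_0: "gars c 0 = n2 (\<lambda>k. c (Suc k))"
  by (simp add: gars_def dq_def[abs_def] tser_def powser_zero[of "\<lambda>j. c (_ + j)"])

lemma n2_le_gars: "l2 c \<Longrightarrow> n2 c \<le> cmod (c 0) + gars c 0"
  by (simp add: gars_0 n2_le_Suc)

text \<open>The difference quotient of a dilation \<open>f\<^sub>r\<close> at \<open>z\<close> is \<open>r\<close> times
  the dilation of the difference quotient of \<open>f\<close> at \<open>r z\<close>.\<close>

lemma gars_dilate:
  assumes c: "l2 c" and r: "0 \<le> r" "r \<le> 1" and z: "cmod z < 1"
  shows "gars (\<lambda>k. c k * of_real r ^ k) z \<le> gars c (of_real r * z)"
proof -
  have rz: "cmod (of_real r * z) < 1"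
    using mult_left_le_one_le[of "cmod z" r] r z by (simp add: norm_mult)
  have dq: "dq (\<lambda>k. c k * of_real r ^ k) z k = of_real r * of_real r ^ k * dq c (of_real r * z) k" for k
  proof -
    have "of_real r * of_real r ^ k * dq c (of_real r * z) k
        = (\<Sum>j. (of_real r * of_real r ^ k) * (c (Suc k + j) * (of_real r * z) ^ j))"
      unfolding dq_def tser_def
      by (rule suminf_mult[symmetric]) (rule tser_summable[OF l2_bounded[OF c] rz])
    also have "\<dots> = (\<Sum>j. c (Suc k + j) * of_real r ^ (Suc k + j) * z ^ j)"
      by (intro suminf_cong) (simp add: power_add power_mult_distrib)
    finally show ?thesis by (simp add: dq_def tser_def)
  qed
  note l = dq_l2(1)[OF c rz]
  have "n2 (dq (\<lambda>k. c k * of_real r ^ k) z) \<le> r * n2 (dq c (of_real r * z))"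
  proof -
    have "n2 (dq (\<lambda>k. c k * of_real r ^ k) z) \<le> n2 (\<lambda>k. of_real r * dq c (of_real r * z) k)"
    proof (rule n2_mono(2)[OF n2_cmul(1)[OF l]])
      show "cmod (dq (\<lambda>k. c k * of_real r ^ k) z k) \<le> cmod (of_real r * dq c (of_real r * z) k)" for k
        using r mult_left_le_one_le[of "cmod (dq c (of_real r * z) k)" "r ^ k"]
        by (simp add: dq norm_mult norm_power power_le_one mult.assoc mult_left_mono)
    qed
    also have "\<dots> = r * n2 (dq c (of_real r * z))" using r by (simp add: n2_cmul(2)[OF l])
    finally show ?thesis .
  qed
  then have "gars (\<lambda>k. c k * of_real r ^ k) z \<le> sqrt (1 - (cmod z)\<^sup>2) * (r * n2 (dq c (of_real r * z)))"
    unfolding gars_def using norm_sq_less_1[OF z] by (intro mult_left_mono) auto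
  also have "\<dots> = (sqrt (1 - (cmod z)\<^sup>2) * r) * n2 (dq c (of_real r * z))" by simp
  also have "\<dots> \<le> sqrt (1 - (cmod (of_real r * z))\<^sup>2) * n2 (dq c (of_real r * z))"
  proof (rule mult_right_mono)
    have "sqrt (1 - (cmod z)\<^sup>2) * r = sqrt ((1 - (cmod z)\<^sup>2) * r\<^sup>2)"
      using r by (simp add: real_sqrt_mult)
    also have "\<dots> \<le> sqrt (1 - (cmod (of_real r * z))\<^sup>2)"
      using r by (intro real_sqrt_le_mono) (simp add: norm_mult power_mult_distrib algebra_simps power_le_one)
    finally show "sqrt (1 - (cmod z)\<^sup>2) * r \<le> sqrt (1 - (cmod (of_real r * z))\<^sup>2)" .
  qed (use n2_nonneg'[OF l] in simp)
  finally show ?thesis by (simp add: gars_def)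
qed

text \<open>Dominated convergence for series: the factor \<open>1 - r^k\<close> lies between 0 and 1
  and tends to 0 for each \<open>k\<close>.\<close>

lemma n2_diff_dilate_tendsto:
  assumes "l2 c"
  shows "((\<lambda>r. n2 (\<lambda>k. c k - c k * of_real r ^ k)) \<longlongrightarrow> 0) (at_left 1)"
proof -
  have "((\<lambda>r. \<Sum>k. (cmod (c k - c k * of_real r ^ k))\<^sup>2) \<longlongrightarrow> (\<Sum>k. 0::real)) (at_left (1::real))"
  proof (rule conjunct2[OF conjunct2[OF tannerys_theorem]])
    show "((\<lambda>r. (cmod (c k - c k * of_real r ^ k))\<^sup>2) \<longlongrightarrow> 0) (at_left (1::real))" for k
    proof -
      have "((\<lambda>r. (cmod (c k - c k * of_real r ^ k))\<^sup>2) \<longlongrightarrow> (cmod (c k - c k * of_real 1 ^ k))\<^sup>2) (at_left (1::real))"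
        by (intro tendsto_intros)
      then show ?thesis by simp
    qed
    show "summable (\<lambda>k. (cmod (c k))\<^sup>2)" using assms by (simp add: l2_def)
    have "eventually (\<lambda>r::real. r \<in> {0<..<1}) (at_left 1)"
      by (rule eventually_at_left_real) auto
    then have "eventually (\<lambda>(k,r::real). r \<in> {0<..<1}) (at_top \<times>\<^sub>F at_left 1)"
      unfolding eventually_prod_filter
      by (intro exI[of _ "\<lambda>_. True"] exI[of _ "\<lambda>r. r \<in> {0<..<1}"]) auto
    then show "eventually (\<lambda>(k,r). norm ((cmod (c k - c k * of_real r ^ k))\<^sup>2) \<le> (cmod (c k))\<^sup>2) (at_top \<times>\<^sub>F at_left (1::real))"
    proof eventually_elim
      case (elim x)
      obtain k r where x: "x = (k, r)" by force
      have "cmod (c k - c k * of_real r ^ k) = cmod (c k) * \<bar>1 - r ^ k\<bar>"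
        by (metis (no_types, lifting) norm_mult norm_of_real of_real_1 of_real_diff of_real_power mult.right_neutral right_diff_distrib)
      also have "\<dots> \<le> cmod (c k)"
        using elim x by (intro mult_left_le) (auto simp: power_le_one)
      finally show ?case using x by (simp add: power_mono)
    qed
  qed simp
  then have "((\<lambda>r. sqrt (\<Sum>k. (cmod (c k - c k * of_real r ^ k))\<^sup>2)) \<longlongrightarrow> sqrt 0) (at_left (1::real))"
    by (intro tendsto_intros) simp
  then show ?thesis by (simp add: n2_def)
qed


section \<open>The Poisson kernel\<close>

definition pk :: "complex \<Rightarrow> real \<Rightarrow> real" where
  "pk z t = (1 - (cmod z)\<^sup>2) / (cmod (cis t - z))\<^sup>2"

lemma cis_diff_nonzero: "cmod z < 1 \<Longrightarrow> cis t - z \<noteq> 0"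
  by (metis eq_iff_diff_eq_0 less_irrefl norm_cis)

lemma continuous_on_pk: "cmod z < 1 \<Longrightarrow> continuous_on UNIV (pk z)"
  unfolding pk_def[abs_def] using cis_diff_nonzero by (intro continuous_intros) auto

lemma pk_nonneg: "cmod z < 1 \<Longrightarrow> 0 \<le> pk z t"
  using norm_sq_less_1[of z] by (simp add: pk_def)

text \<open>The absorption argument of \<open>tser_l2\<close>, carried out for absolute
  sums.\<close>

lemma tser_summable_norm:
  assumes c: "summable (\<lambda>k. cmod (c k))" and z: "cmod z < 1"
  shows "summable (\<lambda>k. cmod (tser c z k))"
proof -
  define S where "S = (\<Sum>k. cmod (c k))"
  have bd: "cmod (c k) \<le> S" for k
    unfolding S_def using sum_le_suminf[OF c, of "{k}"] by simp
  define B where "B = S / (1 - cmod z)"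
  note tb = norm_tser_le[of c S, OF bd z, folded B_def]
  have S0: "0 \<le> S" using bd[of 0] norm_ge_zero[of "c 0"] by linarith
  have "(\<Sum>k<K. cmod (tser c z k)) \<le> (S + B) / (1 - cmod z)" for K
  proof -
    let ?T = "\<Sum>k<K. cmod (tser c z k)"
    have "?T \<le> (\<Sum>k<K. cmod (c k) + cmod z * cmod (tser c z (Suc k)))"
    proof (rule sum_mono)
      show "cmod (tser c z k) \<le> cmod (c k) + cmod z * cmod (tser c z (Suc k))" for k
        by (subst tser_rec[of c S, OF bd z]) (metis norm_mult norm_triangle_ineq)
    qed
    also have "\<dots> = (\<Sum>k<K. cmod (c k)) + cmod z * (\<Sum>k<K. cmod (tser c z (Suc k)))"
      by (simp add: sum.distrib sum_distrib_left)
    also have "(\<Sum>k<K. cmod (c k)) \<le> S" unfolding S_def by (rule sum_le_suminf[OF c]) auto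
    also have "(\<Sum>k<K. cmod (tser c z (Suc k))) \<le> ?T + B"
    proof -
      have "(\<Sum>k<K. cmod (tser c z (Suc k))) \<le> (\<Sum>k<Suc K. cmod (tser c z k))"
        unfolding sum.lessThan_Suc_shift by simp
      also have "\<dots> = ?T + cmod (tser c z K)" by simp
      finally show ?thesis using tb[of K] by linarith
    qed
    finally have "?T \<le> S + cmod z * (?T + B)" by (simp add: mult_left_mono)
    moreover have "cmod z * B \<le> B"
      using z S0 by (intro mult_left_le_one_le) (auto simp: B_def)
    ultimately have "(1 - cmod z) * ?T \<le> S + B" by (simp add: algebra_simps)
    then show ?thesis using z by (simp add: pos_le_divide_eq mult.commute)
  qed
  then show ?thesis by (intro summableI_nonneg_bounded[of _ "(S + B) / (1 - cmod z)"]) auto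
qed

lemma dq_summable_norm:
  assumes c: "summable (\<lambda>k. cmod (c k))" and z: "cmod z < 1"
  shows "summable (\<lambda>k. cmod (dq c z k))"
  using tser_summable_norm[OF assms] unfolding dq_def by (subst summable_Suc_iff)

text \<open>The series with coefficients \<open>tser c z\<close> is evaluated at \<open>w\<close>
  twice, with \<open>q\<close> standing for the series of \<open>dq c z\<close>. Splitting off the
  head gives \<open>w * q w + f z\<close>; the recursion gives \<open>z * q w + f w\<close>.\<close>

lemma pser_diff_eq:
  assumes c: "summable (\<lambda>k. cmod (c k))" and z: "cmod z < 1" and w: "cmod w \<le> 1"
  shows "pser c w - pser c z = (w - z) * pser (dq c z) w"
proof -
  have bd: "cmod (c k) \<le> (\<Sum>k. cmod (c k))" for k
    using sum_le_suminf[OF c, of "{k}"] by simp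
  have T: "(\<lambda>k. tser c z k * w ^ k) sums pser (tser c z) w"
    by (rule pser_sums[OF tser_summable_norm[OF c z] w])
  have D: "(\<lambda>k. dq c z k * w ^ k) sums pser (dq c z) w"
    by (rule pser_sums[OF dq_summable_norm[OF c z] w])
  have "(\<lambda>k. tser c z (Suc k) * w ^ Suc k) sums (w * pser (dq c z) w)"
    using sums_mult[OF D, of w] by (simp add: dq_def mult_ac)
  then have "(\<lambda>k. tser c z k * w ^ k) sums (w * pser (dq c z) w + pser c z)"
    by (subst (asm) sums_Suc_iff) (simp add: tser_0)
  with T have 1: "pser (tser c z) w = w * pser (dq c z) w + pser c z"
    by (rule sums_unique2)
  have "(\<lambda>k. z * (dq c z k * w ^ k)) sums (z * pser (dq c z) w)"
    by (rule sums_mult[OF D])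
  moreover have "z * (dq c z k * w ^ k) = tser c z k * w ^ k - c k * w ^ k" for k
    by (subst tser_rec[of c _ z k, OF bd z]) (simp add: dq_def algebra_simps)
  ultimately have "(\<lambda>k. tser c z k * w ^ k - c k * w ^ k) sums (z * pser (dq c z) w)" by simp
  with sums_diff[OF T pser_sums[OF c w]] have 2: "z * pser (dq c z) w = pser (tser c z) w - pser c w"
    by (blast dest: sums_unique2)
  from 1 2 show ?thesis by (simp add: algebra_simps)
qed

lemma cmean_pser_cis_pos:
  assumes b: "summable (\<lambda>k. cmod (b k))" and j: "j > 0"
  shows "cmean (\<lambda>t. pser b (cis t) * cis (real j * t)) = 0"
proof -
  have "(\<lambda>k. b k * cmean (\<lambda>t. cis (real j * t) * cis (real k * t))) sums
      cmean (\<lambda>t. cis (real j * t) * pser b (cis t))"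
    by (rule cmean_mult_pser[OF b, of _ 1]) (auto intro!: continuous_intros)
  moreover have "cmean (\<lambda>t. cis (real j * t) * cis (real k * t)) = 0" for k
    using cmean_cis_int[of "int k + int j"] j by (simp add: cis_mult algebra_simps)
  ultimately show ?thesis by (simp add: mult.commute sums_iff)
qed

text \<open>Coefficients of \<open>w / (1 - cnj z * w)\<close>. On the circle its conjugate is
  \<open>1 / (cis t - z)\<close>, so the negative frequencies of a quotient by
  \<open>cis t - z\<close> are stored in a power series vanishing at 0, and the Poisson kernel is a
  multiple of its squared modulus.\<close>

definition conj_kernel :: "complex \<Rightarrow> nat \<Rightarrow> complex" where
  "conj_kernel z k = (case k of 0 \<Rightarrow> 0 | Suc j \<Rightarrow> cnj z ^ j)"

lemma conj_kernel_simps [simp]: "conj_kernel z 0 = 0" "conj_kernel z (Suc j) = cnj z ^ j"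
  by (simp_all add: conj_kernel_def)

lemma summable_conj_kernel: "cmod z < 1 \<Longrightarrow> summable (\<lambda>k. cmod (conj_kernel z k))"
  using summable_geometric[of "cmod z"]
  by (subst summable_Suc_iff[symmetric]) (simp add: norm_power)

lemma pser_conj_kernel:
  assumes z: "cmod z < 1" and w: "cmod w \<le> 1"
  shows "pser (conj_kernel z) w = w / (1 - cnj z * w)"
proof -
  have zw: "cmod (cnj z * w) < 1"
    using z w mult_left_le[of "cmod w" "cmod z"] by (simp add: norm_mult)
  have "(\<lambda>k. w * (cnj z * w) ^ k) sums (w * (1 / (1 - cnj z * w)))"
    by (intro sums_mult geometric_sums zw)
  then have "(\<lambda>k. conj_kernel z (Suc k) * w ^ Suc k) sums (w / (1 - cnj z * w))"
    by (simp add: power_mult_distrib mult_ac)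
  then have "(\<lambda>k. conj_kernel z k * w ^ k) sums (w / (1 - cnj z * w))"
    by (subst (asm) sums_Suc_iff) simp
  then show ?thesis by (simp add: pser_def sums_iff)
qed

lemma cnj_pser_conj_kernel:
  assumes z: "cmod z < 1"
  shows "cnj (pser (conj_kernel z) (cis t)) = 1 / (cis t - z)"
proof -
  have "cnj (cis t / (1 - cnj z * cis t)) = (1 / cis t) / (1 - z * (1 / cis t))"
    by (simp add: cis_cnj divide_simps flip: cis_inverse)
  also have "\<dots> = 1 / (cis t - z)"
    using cis_diff_nonzero[OF z, of t] by (simp add: divide_simps)
  finally show ?thesis using z by (simp add: pser_conj_kernel)
qed

lemma pk_conj_kernel:
  assumes z: "cmod z < 1"
  shows "pk z t = (1 - (cmod z)\<^sup>2) * (cmod (pser (conj_kernel z) (cis t)))\<^sup>2"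
proof -
  have "cmod (pser (conj_kernel z) (cis t)) = cmod (1 / (cis t - z))"
    by (metis cnj_pser_conj_kernel[OF z] complex_mod_cnj)
  then show ?thesis by (simp add: pk_def norm_divide power_divide)
qed

lemma cmean_conj_kernel_sq:
  assumes z: "cmod z < 1"
  shows "cmean (\<lambda>t. (cmod (pser (conj_kernel z) (cis t)))\<^sup>2) = 1 / (1 - (cmod z)\<^sup>2)"
proof -
  have "(\<lambda>k. ((cmod z)\<^sup>2) ^ k) sums (1 / (1 - (cmod z)\<^sup>2))"
    using norm_sq_less_1[OF z] by (intro geometric_sums) auto
  then have "(\<lambda>k. (cmod (conj_kernel z (Suc k)))\<^sup>2) sums (1 / (1 - (cmod z)\<^sup>2))"
    by (simp add: norm_power flip: power_mult) (simp add: mult.commute)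
  then have "(\<lambda>k. (cmod (conj_kernel z k))\<^sup>2) sums (1 / (1 - (cmod z)\<^sup>2))"
    by (subst (asm) sums_Suc_iff) simp
  with Parseval_pser_norm[OF summable_conj_kernel[OF z]] show ?thesis
    by (blast dest: sums_unique2)
qed

lemma cmean_pk: "cmod z < 1 \<Longrightarrow> cmean (pk z) = 1"
  using norm_sq_less_1[of z] pk_conj_kernel[of z]
  by (simp add: cmean_cmul cmean_conj_kernel_sq fun_eq_iff[of "pk z" "\<lambda>t. (1 - (cmod z)\<^sup>2) * (cmod (pser (conj_kernel z) (cis t)))\<^sup>2", THEN iffD2])

text \<open>On the circle \<open>|f|\<^sup>2 P\<^sub>z = (1 - |z|\<^sup>2) |f(z) / (\<zeta> - z) + (f - f(z)) / (\<zeta> - z)|\<^sup>2\<close>, and the two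
  summands are orthogonal: the first one only has negative frequencies.\<close>

lemma Poisson_square:
  assumes c: "summable (\<lambda>k. cmod (c k))" and z: "cmod z < 1"
  shows "cmean (\<lambda>t. pk z t * (cmod (pser c (cis t)))\<^sup>2) = (cmod (pser c z))\<^sup>2 + (gars c z)\<^sup>2"
proof -
  let ?E = "\<lambda>t. pser (conj_kernel z) (cis t)" and ?D = "\<lambda>t. pser (dq c z) (cis t)" and ?a = "pser c z"
  note sE = summable_conj_kernel[OF z] and sD = dq_summable_norm[OF c z]
  have ct: "continuous_on UNIV ?E" "continuous_on UNIV ?D"
    by (auto intro!: continuous_on_pser_cis sE sD continuous_intros)
  have pw: "pk z t * (cmod (pser c (cis t)))\<^sup>2 = (1 - (cmod z)\<^sup>2) *
      (((cmod ?a)\<^sup>2 * (cmod (?E t))\<^sup>2 + (cmod (?D t))\<^sup>2) + 2 * Re (cnj ?a * (?E t * ?D t)))" for t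
  proof -
    have nz: "cis t - z \<noteq> 0" by (rule cis_diff_nonzero[OF z])
    have "pser c (cis t) = ?a + (cis t - z) * ?D t"
      using pser_diff_eq[OF c z, of "cis t"] by (simp add: algebra_simps)
    then have "pser c (cis t) / (cis t - z) = ?a * (1 / (cis t - z)) + ?D t"
      using nz by (simp add: field_simps)
    then have *: "pser c (cis t) / (cis t - z) = ?a * cnj (?E t) + ?D t"
      by (simp add: cnj_pser_conj_kernel[OF z])
    have "pk z t * (cmod (pser c (cis t)))\<^sup>2 = (1 - (cmod z)\<^sup>2) * (cmod (pser c (cis t) / (cis t - z)))\<^sup>2"
      by (simp add: pk_def norm_divide power_divide)
    also have "(cmod (pser c (cis t) / (cis t - z)))\<^sup>2 = (cmod (?a * cnj (?E t)))\<^sup>2 + (cmod (?D t))\<^sup>2 + 2 * Re (cnj ?a * (?E t * ?D t))"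
      unfolding * cmod_power2 by (simp add: power2_eq_square algebra_simps)
    finally show ?thesis by (simp add: norm_mult power_mult_distrib)
  qed
  have 0: "cmean (\<lambda>t. ?E t * ?D t) = 0"
  proof -
    have "(\<lambda>k. conj_kernel z k * cmean (\<lambda>t. ?D t * cis (real k * t))) sums cmean (\<lambda>t. ?D t * ?E t)"
      by (rule cmean_mult_pser[OF sE ct(2), of "\<Sum>k. cmod (dq c z k)"]) (auto intro!: norm_pser_le sD)
    moreover have "conj_kernel z k * cmean (\<lambda>t. ?D t * cis (real k * t)) = 0" for k
      using cmean_pser_cis_pos[OF sD, of k] by (cases k) auto
    ultimately have "(\<lambda>k. 0) sums cmean (\<lambda>t. ?D t * ?E t)" by (simp only:)
    then have "cmean (\<lambda>t. ?D t * ?E t) = 0" using sums_unique2 sums_zero by blast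
    then show ?thesis by (simp only: mult.commute)
  qed
  have R: "cmean (\<lambda>t. Re (cnj ?a * (?E t * ?D t))) = 0"
    using 0 by (subst cmean_Re) (auto intro!: continuous_intros ct simp: cmean_cmul)
  have D2: "cmean (\<lambda>t. (cmod (?D t))\<^sup>2) = (n2 (dq c z))\<^sup>2"
    using Parseval_pser_norm[OF sD] n2_sq[OF summable_imp_l2[OF sD]] by (simp add: sums_iff)
  have "cmean (\<lambda>t. pk z t * (cmod (pser c (cis t)))\<^sup>2) =
     (1 - (cmod z)\<^sup>2) * (((cmod ?a)\<^sup>2 * cmean (\<lambda>t. (cmod (?E t))\<^sup>2) + cmean (\<lambda>t. (cmod (?D t))\<^sup>2)) + 2 * cmean (\<lambda>t. Re (cnj ?a * (?E t * ?D t))))"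
    unfolding pw cmean_cmul
    by (subst cmean_add cmean_cmul; (intro continuous_intros ct)?)+ simp
  also have "\<dots> = (cmod ?a)\<^sup>2 + (1 - (cmod z)\<^sup>2) * (n2 (dq c z))\<^sup>2"
    unfolding R D2 cmean_conj_kernel_sq[OF z] using norm_sq_less_1[OF z] by (simp add: distrib_left)
  also have "(1 - (cmod z)\<^sup>2) * (n2 (dq c z))\<^sup>2 = (gars c z)\<^sup>2"
    using norm_sq_less_1[OF z] by (simp add: gars_def power_mult_distrib)
  finally show ?thesis .
qed

text \<open>\<open>Poisson_square\<close> bounds \<open>gars\<close> squared by the Poisson mean of
  \<open>|f|^2\<close>, hence by the square of any bound for \<open>|f|\<close> on the
  circle.\<close>

lemma gars_le_summable:
  assumes c: "summable (\<lambda>k. cmod (c k))" and z: "cmod z < 1"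
  shows "gars c z \<le> (\<Sum>k. cmod (c k))"
proof (rule power2_le_imp_le)
  let ?S = "\<Sum>k. cmod (c k)"
  show S: "0 \<le> ?S" by (intro suminf_nonneg c) auto
  have "(gars c z)\<^sup>2 \<le> cmean (\<lambda>t. pk z t * (cmod (pser c (cis t)))\<^sup>2)"
    by (simp add: Poisson_square[OF c z])
  also have "\<dots> \<le> cmean (\<lambda>t. ?S\<^sup>2 * pk z t)"
  proof (rule cmean_mono)
    show "pk z t * (cmod (pser c (cis t)))\<^sup>2 \<le> ?S\<^sup>2 * pk z t" for t
      using pk_nonneg[OF z, of t] norm_pser_le[OF c, of "cis t"]
      by (subst mult.commute) (intro mult_right_mono power_mono, auto)
  qed (auto intro!: continuous_intros continuous_on_pk z continuous_on_pser_cis c)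
  also have "\<dots> = ?S\<^sup>2" by (simp add: cmean_cmul cmean_pk[OF z])
  finally show "(gars c z)\<^sup>2 \<le> ?S\<^sup>2" .
qed

text \<open>Cut the series at \<open>K\<close>. The tail is small for all \<open>z\<close>
  simultaneously by \<open>gars_le_summable\<close>. The head is a polynomial: its difference
  quotients have at most \<open>K\<close> nonzero coefficients, each bounded by \<open>S\<close>, so
  the factor \<open>sqrt (1 - |z|^2)\<close> sends its seminorm to 0 at the circle.\<close>

lemma gars_summable_small:
  assumes c: "summable (\<lambda>k. cmod (c k))" and e: "e > 0"
  shows "\<exists>r<1. \<forall>z. r < cmod z \<and> cmod z < 1 \<longrightarrow> gars c z < e"
proof -
  define S where "S = (\<Sum>k. cmod (c k))"
  have S0: "0 \<le> S" unfolding S_def by (intro suminf_nonneg c) auto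
  obtain K where K: "norm (\<Sum>k. cmod (c (k + K))) < e / 2"
    using suminf_exist_split[OF _ c, of "e/2"] e by auto
  define h where "h k = (if k < K then c k else 0)" for k
  define l where "l k = (if k < K then 0 else c k)" for k
  have sh: "summable (\<lambda>k. cmod (h k))" and sl: "summable (\<lambda>k. cmod (l k))"
    by (rule summable_comparison_test'[OF c, of 0]; simp add: h_def l_def)+
  have "(\<Sum>k. cmod (l k)) = (\<Sum>k. cmod (l (k + K))) + (\<Sum>k<K. cmod (l k))"
    by (rule suminf_split_initial_segment[OF sl])
  also have "\<dots> = (\<Sum>k. cmod (c (k + K)))" by (simp add: l_def)
  finally have l: "gars l z < e / 2" if "cmod z < 1" for z
    using gars_le_summable[OF sl that] K by simp
  have hd: "gars h z \<le> sqrt (1 - (cmod z)\<^sup>2) * (real K * S)" if z: "cmod z < 1" for z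
  proof -
    have d: "cmod (dq h z k) \<le> (if k < K then S else 0)" for k
    proof -
      have "cmod (dq h z k) \<le> (\<Sum>j. cmod (h (Suc k + j)))"
        unfolding dq_def tser_def
      proof (rule norm_suminf_le)
        show "norm (h (Suc k + j) * z ^ j) \<le> cmod (h (Suc k + j))" for j
          using norm_power_le_one[of z j] z by (simp add: norm_mult mult_left_le)
        show "summable (\<lambda>j. cmod (h (Suc k + j)))"
          using summable_ignore_initial_segment[OF sh, of "Suc k"] by (simp add: add.commute)
      qed
      also have "\<dots> \<le> (if k < K then S else 0)"
      proof (cases "k < K")
        case True
        have "(\<Sum>j. cmod (h (Suc k + j))) \<le> (\<Sum>j. cmod (c (j + Suc k)))"
          by (rule suminf_le)
             (use summable_ignore_initial_segment[OF sh, of "Suc k"] summable_ignore_initial_segment[OF c, of "Suc k"] in \<open>auto simp: h_def add.commute\<close>)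
        also have "\<dots> \<le> S" unfolding S_def
          using suminf_split_initial_segment[OF c, of "Suc k"] sum_nonneg[of "{..<Suc k}" "\<lambda>k. cmod (c k)"] by simp
        finally show ?thesis using True by simp
      qed (simp add: h_def)
      finally show ?thesis .
    qed
    have "L2_set (\<lambda>k. cmod (dq h z k)) {..<N} \<le> real K * S" for N
    proof -
      have "L2_set (\<lambda>k. cmod (dq h z k)) {..<N} \<le> (\<Sum>k<N. cmod (dq h z k))"
        by (rule L2_set_le_sum) auto
      also have "\<dots> \<le> (\<Sum>k<N. if k < K then S else 0)" by (rule sum_mono) (rule d)
      also have "\<dots> = (\<Sum>k\<in>{..<N} \<inter> {..<K}. S)" by (simp add: sum.If_cases Int_def lessThan_def)
      also have "\<dots> \<le> real K * S"
      proof -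
        have "card ({..<N} \<inter> {..<K}) \<le> K" using card_mono[of "{..<K}" "{..<N} \<inter> {..<K}"] by simp
        then show ?thesis using S0 by (simp add: mult_right_mono)
      qed
      finally show ?thesis .
    qed
    from n2_leI(2)[OF this] show ?thesis
      unfolding gars_def using norm_sq_less_1[OF z] by (intro mult_left_mono) auto
  qed
  define X where "X = real K * S + 1"
  have X: "X > 0" using S0 by (simp add: X_def add_nonneg_pos)
  have "((\<lambda>x. sqrt (1 - x\<^sup>2) * X) \<longlongrightarrow> sqrt (1 - 1\<^sup>2) * X) (at_left (1::real))"
    by (intro tendsto_intros)
  then have "eventually (\<lambda>x. sqrt (1 - x\<^sup>2) * X < e / 2) (at_left (1::real))"
    using e by (intro order_tendstoD(2)) auto
  then obtain r where r: "r < 1" "\<And>x. r < x \<Longrightarrow> x < 1 \<Longrightarrow> sqrt (1 - x\<^sup>2) * X < e / 2"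
    unfolding eventually_at_left_field by blast
  show ?thesis
  proof (intro exI[of _ r] conjI allI impI)
    fix z assume z: "r < cmod z \<and> cmod z < 1"
    have "gars c z = gars (\<lambda>k. h k + l k) z" by (intro arg_cong2[of _ _ _ _ gars]) (auto simp: h_def l_def)
    also have "\<dots> \<le> gars h z + gars l z"
      using z by (intro gars_add summable_imp_l2 sh sl) auto
    also have "gars h z \<le> sqrt (1 - (cmod z)\<^sup>2) * X"
      using hd[of z] z norm_sq_less_1[of z] by (auto simp: X_def intro: order_trans mult_left_mono)
    also have "\<dots> < e / 2" using r(2) z by auto
    finally show "gars c z < e" using l[of z] z by simp
  qed (rule r(1))
qed

section \<open>The harmonic majorant\<close>

text \<open>The Fourier coefficients of \<open>|f|^2\<close> on the circle, doubled at positive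
  frequencies. The real part of this series is thus the Poisson integral of \<open>|f|^2\<close>,
  the harmonic majorant of \<open>|f|^2\<close>, expressed through coefficients alone.\<close>

definition majc :: "(nat \<Rightarrow> complex) \<Rightarrow> nat \<Rightarrow> complex" where
  "majc c m = (case m of 0 \<Rightarrow> (\<Sum>k. of_real ((cmod (c k))\<^sup>2)) | Suc j \<Rightarrow> 2 * (\<Sum>k. cnj (c k) * c (Suc k + j)))"

lemma l2_shift: "l2 c \<Longrightarrow> l2 (\<lambda>k. c (Suc k + j))" 
  unfolding l2_def using summable_ignore_initial_segment[of "\<lambda>k. (cmod (c k))\<^sup>2" "Suc j"]
  by (simp add: add.commute)

lemma n2_shift:
  assumes "l2 c" shows "n2 (\<lambda>k. c (Suc k + j)) \<le> n2 c"
proof (rule n2_leI(2))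
  fix K
  have "L2_set (\<lambda>k. cmod (c (Suc k + j))) {..<K} = L2_set (\<lambda>k. cmod (c k)) ((\<lambda>k. Suc k + j) ` {..<K})"
    unfolding L2_set_def by (subst sum.reindex) (auto simp: inj_on_def)
  also have "\<dots> \<le> n2 c" by (rule L2_set_le_n2[OF assms]) auto
  finally show "L2_set (\<lambda>k. cmod (c (Suc k + j))) {..<K} \<le> n2 c" .
qed

lemma l2_mult_sum_le:
  assumes "l2 b" "l2 c"
  shows "(\<Sum>k<K. cmod (b k * c k)) \<le> n2 b * n2 c"
proof -
  have "(\<Sum>k<K. cmod (b k * c k)) = (\<Sum>k<K. \<bar>cmod (b k)\<bar> * \<bar>cmod (c k)\<bar>)"
    by (simp add: norm_mult)
  also have "\<dots> \<le> L2_set (\<lambda>k. cmod (b k)) {..<K} * L2_set (\<lambda>k. cmod (c k)) {..<K}"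
    by (rule L2_set_mult_ineq)
  also have "\<dots> \<le> n2 b * n2 c"
    using assms by (intro mult_mono L2_set_le_n2) (auto simp: n2_nonneg')
  finally show ?thesis .
qed

lemma l2_mult_summable:
  assumes "l2 b" "l2 c"
  shows "summable (\<lambda>k. cmod (b k * c k))"
  by (rule summableI_nonneg_bounded[of _ "n2 b * n2 c"]) (use l2_mult_sum_le[OF assms] in auto)

lemma l2_cnj: "l2 (\<lambda>k. cnj (c k)) \<longleftrightarrow> l2 c" "n2 (\<lambda>k. cnj (c k)) = n2 c"
  by (simp_all add: l2_def n2_def)

lemma majc_partial_le:
  assumes "l2 c"
  shows "cmod (\<Sum>k<K. cnj (c k) * c (Suc k + j)) \<le> (n2 c)\<^sup>2"
proof -
  have "cmod (\<Sum>k<K. cnj (c k) * c (Suc k + j)) \<le> (\<Sum>k<K. cmod (cnj (c k) * c (Suc k + j)))"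
    by (rule norm_sum)
  also have "\<dots> \<le> n2 (\<lambda>k. cnj (c k)) * n2 (\<lambda>k. c (Suc k + j))"
    by (rule l2_mult_sum_le) (use assms l2_shift in \<open>auto simp: l2_cnj\<close>)
  also have "\<dots> \<le> n2 c * n2 c"
    using assms n2_shift[OF assms] by (auto simp: l2_cnj n2_nonneg' intro!: mult_left_mono)
  finally show ?thesis by (simp add: power2_eq_square)
qed

lemma majc_sums: "l2 c \<Longrightarrow> (\<lambda>k. cnj (c k) * c (Suc k + j)) sums (\<Sum>k. cnj (c k) * c (Suc k + j))"
  by (intro summable_sums summable_norm_cancel[OF l2_mult_summable] l2_shift) (simp_all add: l2_cnj)

lemma majc_bounded:
  assumes "l2 c"
  shows "cmod (majc c m) \<le> 2 * (n2 c)\<^sup>2"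
proof (cases m)
  case 0
  have "(\<lambda>k. complex_of_real ((cmod (c k))\<^sup>2)) sums of_real ((n2 c)\<^sup>2)"
    unfolding n2_sq[OF assms] using assms by (intro sums_of_real summable_sums) (simp add: l2_def)
  then have "majc c m = of_real ((n2 c)\<^sup>2)" using 0 by (simp add: majc_def sums_iff)
  then show ?thesis by (simp del: of_real_power)
next
  case (Suc j)
  have "cmod (\<Sum>k. cnj (c k) * c (Suc k + j)) \<le> (n2 c)\<^sup>2"
    using majc_partial_le[OF assms, where j=j]
    by (intro LIMSEQ_le_const2[OF tendsto_norm[OF majc_sums[OF assms, of j, unfolded sums_def]]] exI[of _ 0]) auto
  then show ?thesis using Suc by (simp add: majc_def norm_mult)
qed

text \<open>Sum the identity \<open>|s\<^sub>k|\<^sup>2 - |z|\<^sup>2 |s\<^sub>k\<^sub>+\<^sub>1|\<^sup>2 = |c\<^sub>k|\<^sup>2 + 2 Re (cnj c\<^sub>k z s\<^sub>k\<^sub>+\<^sub>1)\<close> for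
  \<open>s\<^sub>k = c\<^sub>k + z s\<^sub>k\<^sub>+\<^sub>1\<close>.\<close>

lemma Re_majc:
  assumes c: "l2 c" and z: "cmod z < 1"
  shows "Re (pser (majc c) z) = (cmod (pser c z))\<^sup>2 + (gars c z)\<^sup>2"
proof -
  let ?s = "tser c z"
  note s2 = tser_l2(1)[OF c z]
  have sS: "l2 (\<lambda>k. ?s (Suc k))" using s2 by (simp add: l2_Suc)
  note bd = l2_bounded[OF c]
  define T where "T = (\<Sum>k. cnj (c k) * (z * ?s (Suc k)))"
  have T: "(\<lambda>k. cnj (c k) * (z * ?s (Suc k))) sums T"
    unfolding T_def using c n2_cmul(1)[OF sS]
    by (intro summable_sums summable_norm_cancel[OF l2_mult_summable]) (simp_all add: l2_cnj)
  \<comment> \<open>Interchange of the sums over \<open>k\<close> and \<open>m\<close>: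
    Cauchy-Schwarz bounds the partial sums in \<open>k\<close> independently of \<open>K\<close> and
    \<open>m\<close>, and \<open>|z|^(m+1)\<close> makes the domination summable.\<close>
  have "(\<lambda>K. \<Sum>m. \<Sum>k<K. cnj (c k) * c (Suc k + m) * z ^ Suc m) \<longlonglongrightarrow> (\<Sum>m. (\<Sum>k. cnj (c k) * c (Suc k + m)) * z ^ Suc m)"
  proof (rule conjunct2[OF conjunct2[OF tannerys_theorem]])
    show "(\<lambda>K. \<Sum>k<K. cnj (c k) * c (Suc k + m) * z ^ Suc m) \<longlonglongrightarrow> (\<Sum>k. cnj (c k) * c (Suc k + m)) * z ^ Suc m" for m
      using tendsto_mult_right[OF majc_sums[OF c, unfolded sums_def]] by (simp only: sum_distrib_right)
    show "summable (\<lambda>m. (n2 c)\<^sup>2 * cmod z ^ Suc m)"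
      using z by (intro summable_mult) (simp add: summable_geometric summable_mult)
    show "\<forall>\<^sub>F (m, K) in at_top \<times>\<^sub>F sequentially.
       norm (\<Sum>k<K. cnj (c k) * c (Suc k + m) * z ^ Suc m) \<le> (n2 c)\<^sup>2 * cmod z ^ Suc m"
    proof (rule always_eventually, clarify)
      fix m K
      have "norm (\<Sum>k<K. cnj (c k) * c (Suc k + m) * z ^ Suc m) = norm (\<Sum>k<K. cnj (c k) * c (Suc k + m)) * cmod z ^ Suc m"
        by (simp only: sum_distrib_right[symmetric] norm_mult norm_power)
      also have "\<dots> \<le> (n2 c)\<^sup>2 * cmod z ^ Suc m"
        by (intro mult_right_mono majc_partial_le c) auto
      finally show "norm (\<Sum>k<K. cnj (c k) * c (Suc k + m) * z ^ Suc m) \<le> (n2 c)\<^sup>2 * cmod z ^ Suc m" .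
    qed
  qed simp
  also have "(\<lambda>K. \<Sum>m. \<Sum>k<K. cnj (c k) * c (Suc k + m) * z ^ Suc m) = (\<lambda>K. \<Sum>k<K. cnj (c k) * (z * ?s (Suc k)))"
  proof
    fix K
    have sm: "(\<lambda>m. cnj (c k) * c (Suc k + m) * z ^ Suc m) sums (cnj (c k) * (z * ?s (Suc k)))" for k
      using sums_mult[OF summable_sums[OF tser_summable[of c "n2 c" z "Suc k", OF bd z]], of "cnj (c k) * z"]
      by (simp add: tser_def mult_ac)
    show "(\<Sum>m. \<Sum>k<K. cnj (c k) * c (Suc k + m) * z ^ Suc m) = (\<Sum>k<K. cnj (c k) * (z * ?s (Suc k)))"
      using sums_sum[of "{..<K}", OF sm] by (simp add: sums_iff)
  qed
  finally have T2: "T = (\<Sum>m. (\<Sum>k. cnj (c k) * c (Suc k + m)) * z ^ Suc m)"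
    using T unfolding sums_def by (blast dest: LIMSEQ_unique)
  have maj: "pser (majc c) z = of_real ((n2 c)\<^sup>2) + 2 * T"
  proof -
    have sm: "summable (\<lambda>m. majc c m * z ^ m)"
      using pser_bounded_sums[OF majc_bounded[OF c] z] by (simp add: sums_iff)
    have "pser (majc c) z = majc c 0 + (\<Sum>m. majc c (Suc m) * z ^ Suc m)"
      unfolding pser_def using suminf_split_head[OF sm] by simp
    also have "(\<Sum>m. majc c (Suc m) * z ^ Suc m) = (\<Sum>m. 2 * ((\<Sum>k. cnj (c k) * c (Suc k + m)) * z ^ Suc m))"
      by (simp add: majc_def mult_ac)
    also have "\<dots> = 2 * T" unfolding T2
    proof (rule suminf_mult)
      have "summable (\<lambda>m. majc c (Suc m) * z ^ Suc m)" using sm by (subst summable_Suc_iff)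
      then have "summable (\<lambda>m. (1/2) * (majc c (Suc m) * z ^ Suc m))" by (rule summable_mult)
      then show "summable (\<lambda>m. (\<Sum>k. cnj (c k) * c (Suc k + m)) * z ^ Suc m)" by (simp add: majc_def)
    qed
    also have "majc c 0 = of_real ((n2 c)\<^sup>2)"
    proof -
      have "(\<lambda>k. complex_of_real ((cmod (c k))\<^sup>2)) sums of_real ((n2 c)\<^sup>2)"
        unfolding n2_sq[OF c] using c by (intro sums_of_real summable_sums) (simp add: l2_def)
      then show ?thesis by (simp add: majc_def sums_iff)
    qed
    finally show ?thesis .
  qed
  have "(\<lambda>k. (cmod (?s k))\<^sup>2) sums (n2 ?s)\<^sup>2" "(\<lambda>k. (cmod (c k))\<^sup>2) sums (n2 c)\<^sup>2"
    "(\<lambda>k. (cmod (?s (Suc k)))\<^sup>2) sums (n2 (\<lambda>k. ?s (Suc k)))\<^sup>2"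
    using s2 c sS by (simp_all add: n2_sq l2_def summable_sums)
  note sq = this
  have pt: "(cmod (?s k))\<^sup>2 - (cmod z)\<^sup>2 * (cmod (?s (Suc k)))\<^sup>2 = (cmod (c k))\<^sup>2 + 2 * Re (cnj (c k) * (z * ?s (Suc k)))" for k
  proof -
    have "?s k = c k + z * ?s (Suc k)" by (rule tser_rec[of c "n2 c", OF bd z])
    moreover have "(cmod (a + b))\<^sup>2 - (cmod b)\<^sup>2 = (cmod a)\<^sup>2 + 2 * Re (cnj a * b)" for a b
      unfolding cmod_power2 by (simp add: power2_eq_square algebra_simps)
    ultimately show ?thesis by (metis norm_mult power_mult_distrib)
  qed
  have "(\<lambda>k. (cmod (?s k))\<^sup>2 - (cmod z)\<^sup>2 * (cmod (?s (Suc k)))\<^sup>2) sums ((n2 ?s)\<^sup>2 - (cmod z)\<^sup>2 * (n2 (\<lambda>k. ?s (Suc k)))\<^sup>2)"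
    by (intro sums_diff sums_mult sq)
  moreover have "(\<lambda>k. (cmod (c k))\<^sup>2 + 2 * Re (cnj (c k) * (z * ?s (Suc k)))) sums ((n2 c)\<^sup>2 + 2 * Re T)"
    by (intro sums_add sums_mult sq sums_Re T)
  ultimately have "(n2 ?s)\<^sup>2 - (cmod z)\<^sup>2 * (n2 (\<lambda>k. ?s (Suc k)))\<^sup>2 = (n2 c)\<^sup>2 + 2 * Re T"
    unfolding pt by (rule sums_unique2)
  moreover have "(n2 ?s)\<^sup>2 = (cmod (pser c z))\<^sup>2 + (n2 (\<lambda>k. ?s (Suc k)))\<^sup>2"
    using n2_Suc_sq[OF s2] by (simp add: tser_0)
  moreover have "(gars c z)\<^sup>2 = (1 - (cmod z)\<^sup>2) * (n2 (\<lambda>k. ?s (Suc k)))\<^sup>2"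
    using norm_sq_less_1[OF z] by (simp add: gars_def power_mult_distrib dq_def[abs_def])
  ultimately show ?thesis by (simp add: maj algebra_simps)
qed

section \<open>Subharmonic functions in logarithmic coordinates\<close>

definition dird :: "complex set \<Rightarrow> complex \<Rightarrow> (complex \<Rightarrow> real) \<Rightarrow> (complex \<Rightarrow> real) \<Rightarrow> bool" where
  "dird S d \<psi> a \<longleftrightarrow> (\<forall>w\<in>S. ((\<lambda>s. \<psi> (w + of_real s * d)) has_real_derivative a w) (at 0))"

text \<open>Here \<open>a\<close>, \<open>p\<close> are the first and second derivatives along the
  real axis and \<open>b\<close>, \<open>q\<close> those along the imaginary axis, so
  \<open>p + q\<close> is the Laplacian. Carrying explicit derivatives lets the closure rules
  compute the Laplacian of a composite expression.\<close>

definition C2_on :: "complex set \<Rightarrow> (complex \<Rightarrow> real) \<Rightarrow> (complex \<Rightarrow> real) \<Rightarrow> (complex \<Rightarrow> real) \<Rightarrow>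
    (complex \<Rightarrow> real) \<Rightarrow> (complex \<Rightarrow> real) \<Rightarrow> bool" where
  "C2_on S \<psi> a b p q \<longleftrightarrow> dird S 1 \<psi> a \<and> dird S 1 a p \<and> dird S \<i> \<psi> b \<and> dird S \<i> b q \<and>
     continuous_on S \<psi> \<and> continuous_on S a \<and> continuous_on S b \<and> continuous_on S p \<and> continuous_on S q"

lemma C2_onD:
  assumes "C2_on S \<psi> a b p q"
  shows "dird S 1 \<psi> a" "dird S 1 a p" "dird S \<i> \<psi> b" "dird S \<i> b q"
    "continuous_on S \<psi>" "continuous_on S a" "continuous_on S b" "continuous_on S p" "continuous_on S q"
  using assms by (auto simp: C2_on_def)

lemma dird_add: "dird S d f f' \<Longrightarrow> dird S d g g' \<Longrightarrow> dird S d (\<lambda>w. f w + g w) (\<lambda>w. f' w + g' w)"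
  unfolding dird_def by (auto intro!: derivative_eq_intros)

lemma dird_mult: "dird S d f f' \<Longrightarrow> dird S d g g' \<Longrightarrow> dird S d (\<lambda>w. f w * g w) (\<lambda>w. f' w * g w + f w * g' w)"
  unfolding dird_def by (auto intro!: derivative_eq_intros)

lemma dird_const: "dird S d (\<lambda>w. c) (\<lambda>w. 0)"
  unfolding dird_def by (auto intro!: derivative_eq_intros)

lemma dird_exp: "dird S d f f' \<Longrightarrow> dird S d (\<lambda>w. exp (f w)) (\<lambda>w. exp (f w) * f' w)"
  unfolding dird_def by (auto intro!: derivative_eq_intros)

lemma dird_ln: "dird S d f f' \<Longrightarrow> (\<And>w. w \<in> S \<Longrightarrow> f w > 0) \<Longrightarrow> dird S d (\<lambda>w. ln (f w)) (\<lambda>w. f' w / f w)"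
  unfolding dird_def by (auto intro!: derivative_eq_intros)

lemma dird_divide:
  "dird S d f f' \<Longrightarrow> dird S d g g' \<Longrightarrow> (\<And>w. w \<in> S \<Longrightarrow> g w > 0) \<Longrightarrow>
    dird S d (\<lambda>w. f w / g w) (\<lambda>w. f' w / g w - f w * g' w / (g w)\<^sup>2)"
  unfolding dird_def
proof (intro ballI)
  fix w
  assume f: "\<forall>w\<in>S. ((\<lambda>s. f (w + of_real s * d)) has_real_derivative f' w) (at 0)"
    and g: "\<forall>w\<in>S. ((\<lambda>s. g (w + of_real s * d)) has_real_derivative g' w) (at 0)"
    and pos: "\<And>w. w \<in> S \<Longrightarrow> g w > 0" and w: "w \<in> S"
  have nz: "g w \<noteq> 0" using pos[OF w] by simp
  show "((\<lambda>s. f (w + of_real s * d) / g (w + of_real s * d)) has_real_derivative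
      f' w / g w - f w * g' w / (g w)\<^sup>2) (at 0)"
    using DERIV_divide[OF f[rule_format, OF w] g[rule_format, OF w]] nz
    by (simp add: diff_divide_distrib power2_eq_square)
qed

lemma dird_cong: "dird S d f f' \<Longrightarrow> (\<And>w. w \<in> S \<Longrightarrow> f' w = g' w) \<Longrightarrow> dird S d f g'"
  by (auto simp: dird_def)

lemma C2_add:
  assumes "C2_on S f a b p q" "C2_on S g a' b' p' q'"
  shows "C2_on S (\<lambda>w. f w + g w) (\<lambda>w. a w + a' w) (\<lambda>w. b w + b' w) (\<lambda>w. p w + p' w) (\<lambda>w. q w + q' w)"
  using assms unfolding C2_on_def by (auto intro!: dird_add continuous_on_add)

lemma C2_const: "C2_on S (\<lambda>w. c) (\<lambda>w. 0) (\<lambda>w. 0) (\<lambda>w. 0) (\<lambda>w. 0)"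
  unfolding C2_on_def by (auto intro!: dird_const)

lemma C2_cmul:
  assumes "C2_on S f a b p q"
  shows "C2_on S (\<lambda>w. k * f w) (\<lambda>w. k * a w) (\<lambda>w. k * b w) (\<lambda>w. k * p w) (\<lambda>w. k * q w)"
  using assms unfolding C2_on_def
  by (auto intro!: continuous_intros dird_cong[OF dird_mult[OF dird_const]])

lemma C2_exp:
  assumes "C2_on S f a b p q"
  shows "C2_on S (\<lambda>w. exp (f w)) (\<lambda>w. exp (f w) * a w) (\<lambda>w. exp (f w) * b w)
    (\<lambda>w. exp (f w) * ((a w)\<^sup>2 + p w)) (\<lambda>w. exp (f w) * ((b w)\<^sup>2 + q w))"
proof -
  note D = C2_onD[OF assms]
  show ?thesis unfolding C2_on_def
    by (intro conjI continuous_intros dird_exp D dird_cong[OF dird_mult[OF dird_exp[OF D(1)] D(2)]]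
          dird_cong[OF dird_mult[OF dird_exp[OF D(3)] D(4)]])
       (simp_all add: power2_eq_square algebra_simps)
qed

lemma C2_ln:
  assumes "C2_on S f a b p q" and pos: "\<And>w. w \<in> S \<Longrightarrow> f w > 0"
  shows "C2_on S (\<lambda>w. ln (f w)) (\<lambda>w. a w / f w) (\<lambda>w. b w / f w)
    (\<lambda>w. p w / f w - (a w / f w)\<^sup>2) (\<lambda>w. q w / f w - (b w / f w)\<^sup>2)"
proof -
  have nz: "\<forall>w\<in>S. f w \<noteq> 0" using pos by force
  note D = C2_onD[OF assms(1)]
  show ?thesis unfolding C2_on_def
    using D nz pos
    by (auto intro!: continuous_intros dird_ln dird_cong[OF dird_divide[OF D(2) D(1)]] dird_cong[OF dird_divide[OF D(4) D(3)]]
        simp: power2_eq_square)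
qed

lemma dird_Re_prod:
  assumes "open S" "F holomorphic_on S" "H holomorphic_on S"
  shows "dird S d (\<lambda>w. Re (F w * cnj (H w))) (\<lambda>w. Re (d * deriv F w * cnj (H w) + F w * cnj (d * deriv H w)))"
  unfolding dird_def
proof
  fix w assume w: "w \<in> S"
  have *: "((\<lambda>s. G (w + of_real s * d)) has_vector_derivative d * deriv G w) (at 0)" if "G holomorphic_on S" for G
  proof -
    have "(G has_field_derivative deriv G w) (at (w + of_real 0 * d))"
      using holomorphic_derivI[OF that assms(1) w] by simp
    moreover have "((\<lambda>s. w + of_real s * d) has_vector_derivative d) (at 0)"
      by (auto intro!: derivative_eq_intros simp: has_vector_derivative_def scaleR_conv_of_real)
    ultimately show ?thesis
      using field_vector_diff_chain_at[of "\<lambda>s. w + of_real s * d" d 0 G "deriv G w"]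
      by (simp add: o_def)
  qed
  have "((\<lambda>s. F (w + of_real s * d) * cnj (H (w + of_real s * d))) has_vector_derivative
      (F (w + of_real 0 * d) * cnj (d * deriv H w) + d * deriv F w * cnj (H (w + of_real 0 * d)))) (at 0)"
    by (intro has_vector_derivative_mult has_vector_derivative_cnj * assms)
  then have "((\<lambda>s. Re (F (w + of_real s * d) * cnj (H (w + of_real s * d)))) has_vector_derivative
      Re (F w * cnj (d * deriv H w) + d * deriv F w * cnj (H w))) (at 0)"
    using bounded_linear.has_vector_derivative[OF bounded_linear_Re] by force
  then show "((\<lambda>s. Re (F (w + of_real s * d) * cnj (H (w + of_real s * d)))) has_real_derivative
      Re (d * deriv F w * cnj (H w) + F w * cnj (d * deriv H w))) (at 0)"
    by (simp add: has_real_derivative_iff_has_vector_derivative add.commute)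
qed

text \<open>The terms with second derivatives of \<open>F\<close> and \<open>H\<close> enter with
  opposite signs in the two directions and cancel in the Laplacian, which is
  \<open>4 * Re (F' * cnj H')\<close>. Taking \<open>H = F\<close>, \<open>H = 1\<close> or an
  independent \<open>H\<close> covers \<open>|F|^2\<close>, harmonic functions and the mixed term of
  the Uchiyama function.\<close>

lemma C2_Re_prod:
  assumes S: "open S" and F: "F holomorphic_on S" and H: "H holomorphic_on S"
  defines "Fd \<equiv> deriv F" and "Fdd \<equiv> deriv (deriv F)" and "Hd \<equiv> deriv H" and "Hdd \<equiv> deriv (deriv H)"
  shows "C2_on S (\<lambda>w. Re (F w * cnj (H w)))
    (\<lambda>w. Re (Fd w * cnj (H w) + F w * cnj (Hd w)))
    (\<lambda>w. Re (\<i> * Fd w * cnj (H w) + F w * cnj (\<i> * Hd w)))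
    (\<lambda>w. Re (Fdd w * cnj (H w) + F w * cnj (Hdd w) + 2 * Fd w * cnj (Hd w)))
    (\<lambda>w. Re (2 * Fd w * cnj (Hd w) - Fdd w * cnj (H w) - F w * cnj (Hdd w)))"
proof -
  have h: "Fd holomorphic_on S" "Hd holomorphic_on S" "Fdd holomorphic_on S" "Hdd holomorphic_on S"
    unfolding Fd_def Fdd_def Hd_def Hdd_def by (intro holomorphic_deriv F H S)+
  note c = h[THEN holomorphic_on_imp_continuous_on] F[THEN holomorphic_on_imp_continuous_on] H[THEN holomorphic_on_imp_continuous_on]
  have iF: "(\<lambda>w. \<i> * Fd w) holomorphic_on S" "(\<lambda>w. \<i> * Hd w) holomorphic_on S"
    by (intro holomorphic_intros h)+
  have di: "deriv (\<lambda>w. \<i> * Fd w) w = \<i> * Fdd w" "deriv (\<lambda>w. \<i> * Hd w) w = \<i> * Hdd w" if "w \<in> S" for w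
    using h(1,2) S that unfolding Fd_def Fdd_def Hd_def Hdd_def
    by (auto intro!: deriv_cmult holomorphic_on_imp_differentiable_at)
  have d1: "dird S 1 (\<lambda>w. Re (Fd w * cnj (H w) + F w * cnj (Hd w)))
     (\<lambda>w. Re (Fdd w * cnj (H w) + F w * cnj (Hdd w) + 2 * Fd w * cnj (Hd w)))"
    using dird_add[OF dird_Re_prod[OF S h(1) H, of 1] dird_Re_prod[OF S F h(2), of 1]]
    by (auto simp: Fd_def Fdd_def Hd_def Hdd_def algebra_simps elim!: dird_cong)
  have d2: "dird S \<i> (\<lambda>w. Re (\<i> * Fd w * cnj (H w) + F w * cnj (\<i> * Hd w)))
     (\<lambda>w. Re (2 * Fd w * cnj (Hd w) - Fdd w * cnj (H w) - F w * cnj (Hdd w)))"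
  proof -
    have "dird S \<i> (\<lambda>w. Re ((\<i> * Fd w) * cnj (H w)) + Re (F w * cnj (\<i> * Hd w)))
     (\<lambda>w. Re (2 * Fd w * cnj (Hd w) - Fdd w * cnj (H w) - F w * cnj (Hdd w)))"
      by (rule dird_cong[OF dird_add[OF dird_Re_prod[OF S iF(1) H, of \<i>] dird_Re_prod[OF S F iF(2), of \<i>]]])
         (simp add: di, simp add: Fd_def Hd_def algebra_simps)
    then show ?thesis by (simp only: plus_complex.sel)
  qed
  show ?thesis
    unfolding C2_on_def Fd_def[symmetric]
    by (intro conjI d1 d2 continuous_intros c dird_cong[OF dird_Re_prod[OF S F H, of 1]]
          dird_cong[OF dird_Re_prod[OF S F H, of \<i>]])
       (simp_all add: Fd_def Hd_def)
qed

text \<open>In the coordinate \<open>w = ln z\<close> circles become vertical segments of length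
  \<open>2 * pi\<close>. The mean as a function of \<open>x\<close> is convex: its second derivative
  is the mean of \<open>p\<close>, and adding the mean of \<open>q\<close>, which vanishes by
  periodicity, turns this into the mean of the Laplacian. A convex function that stays bounded as
  \<open>x\<close> tends to minus infinity is nondecreasing.\<close>

lemma circle_mean_mono:
  fixes \<psi> :: "complex \<Rightarrow> real"
  assumes C2: "C2_on S \<psi> a b p q" and S: "S = {w. Re w < \<delta>}" and \<delta>: "\<delta> > 0"
    and lap: "\<And>w. w \<in> S \<Longrightarrow> 0 \<le> p w + q w"
    and per: "\<And>w. w \<in> S \<Longrightarrow> \<psi> (w + 2 * of_real pi * \<i>) = \<psi> w"
    and bd: "\<And>w. Re w \<le> 0 \<Longrightarrow> \<bar>\<psi> w\<bar> \<le> M" and x: "x \<le> 0"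
  shows "cmean (\<lambda>t. \<psi> (of_real x + \<i> * of_real t)) \<le> cmean (\<lambda>t. \<psi> (\<i> * of_real t))"
proof -
  define mm where "mm f x = cmean (\<lambda>t. f (of_real x + \<i> * of_real t) :: real)" for f x
  note D = C2_onD[OF C2]
  have cont: "continuous_on UNIV (\<lambda>t. f (of_real x + \<i> * of_real t) :: real)" if "continuous_on S f" "x < \<delta>" for f x
    by (rule continuous_on_compose2[OF that(1)]) (use that S in \<open>auto intro!: continuous_intros\<close>)
  have der: "(mm f has_real_derivative mm g y) (at y)" if "dird S 1 f g" "continuous_on S f" "continuous_on S g" "y < \<delta>" for f g y
  proof -
    have "((\<lambda>x. integral (cbox 0 (2*pi)) (\<lambda>t. f (of_real x + \<i> * of_real t))) has_field_derivative
       integral (cbox 0 (2*pi)) (\<lambda>t. g (of_real y + \<i> * of_real t))) (at y within {..<\<delta>})"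
    proof (rule leibniz_rule_field_derivative)
      fix x t :: real assume "x \<in> {..<\<delta>}"
      then have "of_real x + \<i> * of_real t \<in> S" using S by simp
      with that(1) have "((\<lambda>s. f (of_real x + \<i> * of_real t + of_real s * 1)) has_real_derivative g (of_real x + \<i> * of_real t)) (at 0)"
        unfolding dird_def by blast
      then have "((\<lambda>s. f (of_real (s + x) + \<i> * of_real t)) has_real_derivative g (of_real x + \<i> * of_real t)) (at 0)"
        by (simp add: algebra_simps)
      then have "((\<lambda>x. f (of_real x + \<i> * of_real t)) has_real_derivative g (of_real x + \<i> * of_real t)) (at (0 + x))"
        by (subst DERIV_shift)
      then show "((\<lambda>x. f (of_real x + \<i> * of_real t)) has_real_derivative g (of_real x + \<i> * of_real t)) (at x within {..<\<delta>})"
        by (auto intro: has_field_derivative_at_within)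
    next
      show "(\<lambda>t. f (of_real x + \<i> * of_real t)) integrable_on cbox 0 (2*pi)" if "x \<in> {..<\<delta>}" for x
        using continuous_integrable[OF cont[OF \<open>continuous_on S f\<close>]] that by simp
      show "continuous_on ({..<\<delta>} \<times> cbox 0 (2*pi)) (\<lambda>(x, t). g (of_real x + \<i> * of_real t))"
        unfolding case_prod_unfold
        by (rule continuous_on_compose2[OF that(3)]) (use S in \<open>auto intro!: continuous_intros\<close>)
    qed (use that in auto)
    moreover have "at y within {..<\<delta>} = at y" using that by (intro at_within_open) auto
    ultimately have "((\<lambda>x. integral {0..2*pi} (\<lambda>t. f (of_real x + \<i> * of_real t)) / (2*pi)) has_field_derivative
       integral {0..2*pi} (\<lambda>t. g (of_real y + \<i> * of_real t)) / (2*pi)) (at y)"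
      by (intro DERIV_cdivide) simp
    then show ?thesis by (simp add: mm_def[abs_def] cmean_def)
  qed
  have q0: "mm q y = 0" if y: "y < \<delta>" for y
  proof -
    have der_i: "((\<lambda>t. f (of_real y + \<i> * of_real t)) has_real_derivative g (of_real y + \<i> * of_real t)) (at t)"
      if "dird S \<i> f g" for f g t
    proof -
      have "of_real y + \<i> * of_real t \<in> S" using S y by simp
      with that have "((\<lambda>s. f (of_real y + \<i> * of_real t + of_real s * \<i>)) has_real_derivative g (of_real y + \<i> * of_real t)) (at 0)"
        unfolding dird_def by blast
      then have "((\<lambda>s. f (of_real y + \<i> * of_real (s + t))) has_real_derivative g (of_real y + \<i> * of_real t)) (at 0)"
        by (simp add: algebra_simps)
      then have "((\<lambda>t. f (of_real y + \<i> * of_real t)) has_real_derivative g (of_real y + \<i> * of_real t)) (at (0 + t))"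
        by (subst DERIV_shift)
      then show ?thesis by simp
    qed
    \<comment> \<open>Periodicity is assumed for \<open>\<psi>\<close> only; its vertical derivative
      inherits it by uniqueness of derivatives.\<close>
    have "b (of_real y + \<i> * of_real (2*pi)) = b (of_real y + \<i> * of_real 0)"
    proof (rule DERIV_unique)
      have "((\<lambda>t. \<psi> (of_real y + \<i> * of_real t)) has_real_derivative b (of_real y + \<i> * of_real (2*pi))) (at (0 + 2*pi))"
        using der_i[OF D(3), of "2*pi"] by simp
      then have "((\<lambda>t. \<psi> (of_real y + \<i> * of_real (t + 2*pi))) has_real_derivative b (of_real y + \<i> * of_real (2*pi))) (at 0)"
        by (subst (asm) DERIV_shift)
      moreover have "\<psi> (of_real y + \<i> * of_real (t + 2*pi)) = \<psi> (of_real y + \<i> * of_real t)" for t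
        using per[of "of_real y + \<i> * of_real t"] S y by (simp add: algebra_simps)
      ultimately show "((\<lambda>t. \<psi> (of_real y + \<i> * of_real t)) has_real_derivative b (of_real y + \<i> * of_real (2*pi))) (at 0)"
        by simp
      show "((\<lambda>t. \<psi> (of_real y + \<i> * of_real t)) has_real_derivative b (of_real y + \<i> * of_real 0)) (at 0)"
        by (rule der_i[OF D(3)])
    qed
    moreover have "((\<lambda>t. q (of_real y + \<i> * of_real t)) has_integral
       (b (of_real y + \<i> * of_real (2*pi)) - b (of_real y + \<i> * of_real 0))) {0..2*pi}"
      by (rule fundamental_theorem_of_calculus)
         (auto intro!: has_field_derivative_at_within der_i[OF D(4)] simp flip: has_real_derivative_iff_has_vector_derivative)
    ultimately have "integral {0..2*pi} (\<lambda>t. q (of_real y + \<i> * of_real t)) = 0"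
      by (auto dest: integral_unique)
    then show ?thesis by (simp add: mm_def cmean_def)
  qed
  have p0: "0 \<le> mm p y" if y: "y < \<delta>" for y
  proof -
    have "0 \<le> cmean (\<lambda>t. p (of_real y + \<i> * of_real t) + q (of_real y + \<i> * of_real t))"
      using lap S y by (intro cmean_nonneg continuous_on_add cont D y) auto
    also have "\<dots> = mm p y + mm q y"
      unfolding mm_def by (intro cmean_add cont D y)
    finally show ?thesis using q0[OF y] by simp
  qed
  have mono_a: "mm a y \<le> mm a z" if "y \<le> z" "z < \<delta>" for y z
    by (rule DERIV_nonneg_imp_nondecreasing[OF that(1)])
       (use that der[OF D(2,6,8)] p0 in \<open>meson le_less_trans\<close>)
  have bdm: "\<bar>mm \<psi> y\<bar> \<le> M" if "y \<le> 0" for y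
  proof -
    have "\<bar>mm \<psi> y\<bar> \<le> cmean (\<lambda>t. norm (\<psi> (of_real y + \<i> * of_real t)))"
      unfolding mm_def real_norm_def[symmetric] using that \<delta> by (intro norm_cmean_le cont D) auto
    also have "\<dots> \<le> cmean (\<lambda>t. M)"
      using bd that \<delta> by (intro cmean_mono continuous_on_norm cont D) auto
    finally show ?thesis by simp
  qed
  have a0: "0 \<le> mm a y" if y: "y \<le> 0" for y
  proof (rule ccontr)
    assume neg: "\<not> 0 \<le> mm a y"
    \<comment> \<open>By convexity the slope left of \<open>y\<close> is at most the negative slope
      at \<open>y\<close>. Moving left by \<open>2 * M + 1\<close> over its absolute value changes
      the mean by more than \<open>2 * M\<close>, against the bound \<open>M\<close>.\<close>
    define z where "z = y + (2 * M + 1) / mm a y"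
    have M0: "0 \<le> M" using bdm[OF y] by simp
    have zy: "z < y" using neg M0 by (simp add: z_def divide_pos_neg)
    obtain u where u: "z < u" "u < y" "mm \<psi> y - mm \<psi> z = (y - z) * mm a u"
      using MVT2[OF zy, of "mm \<psi>" "mm a"] der[OF D(1,5,6)] y \<delta> by force
    have "(y - z) * mm a u \<le> (y - z) * mm a y"
      using mono_a[of u y] u y \<delta> zy by (intro mult_left_mono) auto
    also have "\<dots> = - (2 * M + 1)" using neg by (simp add: z_def)
    finally show False using u(3) bdm[OF y] bdm[of z] zy y by linarith
  qed
  have "mm \<psi> x \<le> mm \<psi> 0"
    by (rule DERIV_nonneg_imp_nondecreasing[OF x])
       (use der[OF D(1,5,6)] a0 \<delta> in \<open>meson le_less_trans\<close>)
  then show ?thesis by (simp add: mm_def)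
qed

text \<open>The origin corresponds to \<open>Re w\<close> tending to minus infinity and is missing
  from logarithmic coordinates; continuity recovers it from a sufficiently small circle.\<close>

lemma sub_mean_value:
  fixes \<Psi> :: "complex \<Rightarrow> real"
  assumes C2: "C2_on {w. Re w < \<delta>} (\<lambda>w. \<Psi> (exp w)) a b p q" and \<delta>: "\<delta> > 0"
    and lap: "\<And>w. Re w < \<delta> \<Longrightarrow> 0 \<le> p w + q w"
    and bd: "\<And>z. cmod z \<le> 1 \<Longrightarrow> \<bar>\<Psi> z\<bar> \<le> M" and c: "isCont \<Psi> 0"
  shows "\<Psi> 0 \<le> cmean (\<lambda>t. \<Psi> (cis t))"
proof (rule field_le_epsilon)
  fix e :: real assume "e > 0"
  then obtain d where d: "d > 0" "\<And>z. cmod z < d \<Longrightarrow> \<bar>\<Psi> z - \<Psi> 0\<bar> < e"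
    using c unfolding continuous_at_eps_delta by (auto simp: dist_norm)
  define x where "x = min 0 (ln (d/2))"
  have "exp x \<le> exp (ln (d/2))" unfolding x_def by simp
  also have "\<dots> < d" using d(1) by simp
  finally have x: "x \<le> 0" "exp x < d" by (auto simp: x_def)
  have "cmean (\<lambda>t. \<Psi> 0 - e) \<le> cmean (\<lambda>t. \<Psi> (exp (of_real x + \<i> * of_real t)))"
  proof (rule cmean_mono)
    show "continuous_on UNIV (\<lambda>t. \<Psi> (exp (of_real x + \<i> * of_real t)))"
      by (rule continuous_on_compose2[OF C2_onD(5)[OF C2]]) (use x \<delta> in \<open>auto intro!: continuous_intros\<close>)
    show "\<Psi> 0 - e \<le> \<Psi> (exp (of_real x + \<i> * of_real t))" for t
      using d(2)[of "exp (of_real x + \<i> * of_real t)"] x(2) by simp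
  qed auto
  also have "\<dots> \<le> cmean (\<lambda>t. \<Psi> (exp (\<i> * of_real t)))"
  proof (rule circle_mean_mono[OF C2 refl \<delta> _ _ _ x(1)])
    show "\<bar>\<Psi> (exp w)\<bar> \<le> M" if "Re w \<le> 0" for w using that by (intro bd) simp
    show "\<Psi> (exp (w + 2 * of_real pi * \<i>)) = \<Psi> (exp w)" for w
      by (simp add: exp_add exp_two_pi_i mult.commute mult.left_commute)
  qed (use lap in auto)
  finally show "\<Psi> 0 \<le> cmean (\<lambda>t. \<Psi> (cis t)) + e" by (simp add: cis_conv_exp)
qed


section \<open>Smoothed logarithms and the subharmonicity of \<open>sqrt |F|\<close>\<close>

lemma exp_half_plane: "R > 0 \<Longrightarrow> Re w < ln R \<Longrightarrow> exp w \<in> ball 0 R"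
  by (metis exp_less_cancel_iff exp_ln mem_ball_0 norm_exp_eq_Re)

lemma holomorphic_exp_comp:
  assumes "F holomorphic_on ball 0 R" "R > 0"
  shows "(\<lambda>w. F (exp w)) holomorphic_on {w. Re w < ln R}"
proof -
  have "exp ` {w. Re w < ln R} \<subseteq> ball 0 R"
    by (rule image_subsetI, rule exp_half_plane[OF assms(2)]) (simp only: mem_Collect_eq)
  from holomorphic_on_compose_gen[OF holomorphic_on_exp assms(1) this] show ?thesis
    by (simp only: o_def)
qed

lemma open_half_plane: "open {w. Re w < (c::real)}"
  by (simp add: open_halfspace_Re_lt)

text \<open>\<open>ln (|F|\<^sup>2 + \<epsilon>\<^sup>2) / 2\<close> is a smooth substitute for the subharmonic function \<open>ln |F|\<close>.\<close>

lemma C2_ln_smooth: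
  assumes S: "open S" and F: "F holomorphic_on S" and e: "e > 0"
  defines "N \<equiv> \<lambda>w. (cmod (F w))\<^sup>2 + e"
  obtains a b p q where
    "C2_on S (\<lambda>w. ln (N w)) a b p q"
    "\<And>w. w \<in> S \<Longrightarrow> (a w)\<^sup>2 + (b w)\<^sup>2 = 4 * (cmod (deriv F w))\<^sup>2 * (cmod (F w))\<^sup>2 / (N w)\<^sup>2"
    "\<And>w. w \<in> S \<Longrightarrow> p w + q w = 4 * (cmod (deriv F w))\<^sup>2 / N w - 4 * (cmod (deriv F w))\<^sup>2 * (cmod (F w))\<^sup>2 / (N w)\<^sup>2"
proof -
  let ?D = "deriv F" and ?DD = "deriv (deriv F)"
  let ?a = "\<lambda>w. Re (?D w * cnj (F w) + F w * cnj (?D w))"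
  let ?b = "\<lambda>w. Re (\<i> * ?D w * cnj (F w) + F w * cnj (\<i> * ?D w))"
  let ?p = "\<lambda>w. Re (?DD w * cnj (F w) + F w * cnj (?DD w) + 2 * ?D w * cnj (?D w))"
  let ?q = "\<lambda>w. Re (2 * ?D w * cnj (?D w) - ?DD w * cnj (F w) - F w * cnj (?DD w))"
  have N: "N w > 0" for w using e by (simp add: N_def add_nonneg_pos)
  have Neq: "(\<lambda>w. Re (F w * cnj (F w)) + e) = N"
    unfolding N_def cmod_power2 by (simp add: power2_eq_square)
  have "C2_on S N (\<lambda>w. ?a w + 0) (\<lambda>w. ?b w + 0) (\<lambda>w. ?p w + 0) (\<lambda>w. ?q w + 0)"
    using C2_add[OF C2_Re_prod[OF S F F] C2_const[of S e]] unfolding Neq .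
  then have "C2_on S N ?a ?b ?p ?q" by (simp only: add_0_right)
  from C2_ln[OF this N] have 1: "C2_on S (\<lambda>w. ln (N w)) (\<lambda>w. ?a w / N w) (\<lambda>w. ?b w / N w)
     (\<lambda>w. ?p w / N w - (?a w / N w)\<^sup>2) (\<lambda>w. ?q w / N w - (?b w / N w)\<^sup>2)" .
  have sq: "(?a w)\<^sup>2 + (?b w)\<^sup>2 = 4 * (cmod (?D w))\<^sup>2 * (cmod (F w))\<^sup>2" for w
    unfolding cmod_power2 by (simp add: power2_eq_square algebra_simps)
  have pq: "?p w + ?q w = 4 * (cmod (?D w))\<^sup>2" for w
    unfolding cmod_power2 by (simp add: power2_eq_square algebra_simps)
  have sq': "(?a w / N w)\<^sup>2 + (?b w / N w)\<^sup>2 = 4 * (cmod (?D w))\<^sup>2 * (cmod (F w))\<^sup>2 / (N w)\<^sup>2" for w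
    unfolding power_divide add_divide_distrib[symmetric] sq ..
  have pqN: "?p w / N w + ?q w / N w = 4 * (cmod (?D w))\<^sup>2 / N w" for w
    unfolding add_divide_distrib[symmetric] pq ..
  have aux: "(x - u) + (y - v) = x + y - (u + v)" for x y u v :: real by simp
  show ?thesis
  proof (rule that[OF 1])
    show "(?a w / N w)\<^sup>2 + (?b w / N w)\<^sup>2 = 4 * (cmod (?D w))\<^sup>2 * (cmod (F w))\<^sup>2 / (N w)\<^sup>2" for w by (rule sq')
    show "(?p w / N w - (?a w / N w)\<^sup>2) + (?q w / N w - (?b w / N w)\<^sup>2) =
      4 * (cmod (deriv F w))\<^sup>2 / N w - 4 * (cmod (deriv F w))\<^sup>2 * (cmod (F w))\<^sup>2 / (N w)\<^sup>2" for w
      unfolding sq'[symmetric] pqN[symmetric] by (rule aux)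
  qed
qed

lemma continuous_on_circle_R:
  assumes "F holomorphic_on ball 0 R" "R > 1"
  shows "continuous_on UNIV (\<lambda>t. F (cis t))"
  by (rule continuous_on_compose2[OF holomorphic_on_imp_continuous_on[OF assms(1)]])
     (use assms in \<open>auto intro!: continuous_intros\<close>)

lemma holomorphic_bounded_cball:
  assumes "F holomorphic_on ball 0 R" "R > 1"
  obtains M where "M \<ge> 0" "\<And>z. cmod z \<le> 1 \<Longrightarrow> cmod (F z) \<le> M"
proof -
  have "continuous_on (cball 0 1) F"
    by (rule continuous_on_subset[OF holomorphic_on_imp_continuous_on[OF assms(1)]]) (use assms in auto)
  then have "compact (F ` cball 0 1)" by (rule compact_continuous_image) simp
  then obtain M where "\<forall>x\<in>F ` cball 0 1. norm x \<le> M"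
    using compact_imp_bounded[of "F ` cball 0 1"] unfolding bounded_iff by blast
  then have M: "\<And>z. cmod z \<le> 1 \<Longrightarrow> cmod (F z) \<le> M" by simp
  have "0 \<le> M" using order_trans[OF norm_ge_zero M[of 0]] by simp
  with M that show ?thesis by auto
qed

text \<open>The fourth root of \<open>|F|^2 + e^4\<close> is smooth, and subharmonic as the
  exponential of a quarter of a subharmonic logarithm. The regularisation is \<open>e^4\<close>
  because the fourth root is subadditive: the root then lies between \<open>sqrt |F|\<close> and
  \<open>sqrt |F| + e\<close>.\<close>

lemma sqrt_norm_sub_mean:
  assumes F: "F holomorphic_on ball 0 R" and R: "R > 1"
  shows "sqrt (cmod (F 0)) \<le> cmean (\<lambda>t. sqrt (cmod (F (cis t))))"
proof (rule field_le_epsilon)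
  fix e :: real assume e: "e > 0"
  define N where "N z = (cmod (F z))\<^sup>2 + e^4" for z
  have e4: "e^4 > 0" using e by simp
  have N0: "N z > 0" for z using e4 by (simp add: N_def add_nonneg_pos)
  have N1: "(cmod (F z))\<^sup>2 + e^4 \<noteq> 0" for z using N0[of z] by (simp only: N_def)
  define S where "S = {w. Re w < ln R}"
  have S: "open S" unfolding S_def by (rule open_half_plane)
  have FS: "(\<lambda>w. F (exp w)) holomorphic_on S" unfolding S_def using F R by (intro holomorphic_exp_comp) auto
  obtain a b p q where C: "C2_on S (\<lambda>w. ln (N (exp w))) a b p q"
    "\<And>w. w \<in> S \<Longrightarrow> (a w)\<^sup>2 + (b w)\<^sup>2 = 4 * (cmod (deriv (\<lambda>w. F (exp w)) w))\<^sup>2 * (cmod (F (exp w)))\<^sup>2 / (N (exp w))\<^sup>2"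
    "\<And>w. w \<in> S \<Longrightarrow> p w + q w = 4 * (cmod (deriv (\<lambda>w. F (exp w)) w))\<^sup>2 / N (exp w) - 4 * (cmod (deriv (\<lambda>w. F (exp w)) w))\<^sup>2 * (cmod (F (exp w)))\<^sup>2 / (N (exp w))\<^sup>2"
    using C2_ln_smooth[OF S FS e4, folded N_def] by blast
  have pq: "0 \<le> p w + q w" if "w \<in> S" for w
  proof -
    have "4 * (cmod (deriv (\<lambda>w. F (exp w)) w))\<^sup>2 * (cmod (F (exp w)))\<^sup>2 / (N (exp w))\<^sup>2
        \<le> 4 * (cmod (deriv (\<lambda>w. F (exp w)) w))\<^sup>2 * N (exp w) / (N (exp w))\<^sup>2"
      using e by (intro divide_right_mono mult_left_mono) (auto simp: N_def)
    also have "\<dots> = 4 * (cmod (deriv (\<lambda>w. F (exp w)) w))\<^sup>2 / N (exp w)"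
      using N0[of "exp w"] by (simp add: power2_eq_square)
    finally show ?thesis using C(3)[OF that] by simp
  qed
  define \<Psi> where "\<Psi> z = exp (1/4 * ln (N z))" for z
  have C2: "C2_on S (\<lambda>w. \<Psi> (exp w)) (\<lambda>w. \<Psi> (exp w) * (1/4 * a w)) (\<lambda>w. \<Psi> (exp w) * (1/4 * b w))
     (\<lambda>w. \<Psi> (exp w) * ((1/4 * a w)\<^sup>2 + 1/4 * p w)) (\<lambda>w. \<Psi> (exp w) * ((1/4 * b w)\<^sup>2 + 1/4 * q w))"
    unfolding \<Psi>_def by (rule C2_exp[OF C2_cmul[OF C(1)]])
  have bounds: "sqrt (cmod (F z)) \<le> \<Psi> z" "\<Psi> z \<le> sqrt (cmod (F z)) + e" for z
  proof -
    have "(\<Psi> z)^4 = exp (of_nat 4 * (1/4 * ln (N z)))" unfolding \<Psi>_def by (rule exp_of_nat_mult[symmetric])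
    then have P4: "(\<Psi> z)^4 = N z" using N0[of z] by simp
    have P0: "\<Psi> z \<ge> 0" by (simp add: \<Psi>_def)
    have s4: "(sqrt (cmod (F z)))^4 = (cmod (F z))\<^sup>2"
      using power_mult[of "sqrt (cmod (F z))" 2 2] by simp
    show "sqrt (cmod (F z)) \<le> \<Psi> z"
      using power_mono_iff[of "sqrt (cmod (F z))" "\<Psi> z" 4] P0 e4 by (simp add: P4 s4 N_def)
    have "x^4 + e^4 \<le> (x + e)^4" if "x \<ge> 0" for x
    proof -
      have "(x + e)^4 = x^4 + e^4 + (4*x^3*e + 6*x\<^sup>2*e\<^sup>2 + 4*x*e^3)"
        by (simp add: algebra_simps power4_eq_xxxx power3_eq_cube power2_eq_square)
      moreover have "0 \<le> 4*x^3*e + 6*x\<^sup>2*e\<^sup>2 + 4*x*e^3" using that e by simp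
      ultimately show ?thesis by linarith
    qed
    from this[of "sqrt (cmod (F z))"] have "(\<Psi> z)^4 \<le> (sqrt (cmod (F z)) + e)^4"
      by (simp add: P4 N_def s4)
    then show "\<Psi> z \<le> sqrt (cmod (F z)) + e"
      using power_mono_iff[of "\<Psi> z" "sqrt (cmod (F z)) + e" 4] P0 e by simp
  qed
  obtain M where M: "M \<ge> 0" "\<And>z. cmod z \<le> 1 \<Longrightarrow> cmod (F z) \<le> M"
    using holomorphic_bounded_cball[OF F R] by blast
  have Fc: "isCont F 0"
    using F R by (intro continuous_on_interior[OF holomorphic_on_imp_continuous_on[OF F]]) auto
  have "\<Psi> 0 \<le> cmean (\<lambda>t. \<Psi> (cis t))"
  proof (rule sub_mean_value[OF C2[unfolded S_def]])
    show "0 < ln R" using R by simp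
    show "\<bar>\<Psi> z\<bar> \<le> sqrt M + e" if "cmod z \<le> 1" for z
    proof -
      have "\<bar>\<Psi> z\<bar> = \<Psi> z" by (simp add: \<Psi>_def)
      then show ?thesis using bounds(2)[of z] real_sqrt_le_mono[OF M(2)[OF that]] by linarith
    qed
    show "isCont \<Psi> 0" unfolding \<Psi>_def N_def
      by (intro continuous_intros Fc) (simp add: N1)
    show "0 \<le> \<Psi> (exp w) * ((1/4 * a w)\<^sup>2 + 1/4 * p w) + \<Psi> (exp w) * ((1/4 * b w)\<^sup>2 + 1/4 * q w)" if "Re w < ln R" for w
    proof -
      have "\<Psi> (exp w) * ((1/4 * a w)\<^sup>2 + 1/4 * p w) + \<Psi> (exp w) * ((1/4 * b w)\<^sup>2 + 1/4 * q w)
        = \<Psi> (exp w) * ((1/4 * a w)\<^sup>2 + (1/4 * b w)\<^sup>2 + 1/4 * (p w + q w))"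
        by (simp add: algebra_simps)
      also have "\<dots> \<ge> 0"
      proof (rule mult_nonneg_nonneg)
        have "0 \<le> p w + q w" using pq[of w] that by (simp add: S_def)
        then show "0 \<le> (1/4 * a w)\<^sup>2 + (1/4 * b w)\<^sup>2 + 1/4 * (p w + q w)"
          by (meson add_nonneg_nonneg mult_nonneg_nonneg zero_le_power2 zero_le_divide_1_iff zero_le_numeral)
      qed (simp add: \<Psi>_def)
      finally show ?thesis .
    qed
  qed
  also have "\<dots> \<le> cmean (\<lambda>t. sqrt (cmod (F (cis t))) + e)"
  proof (rule cmean_mono)
    show "continuous_on UNIV (\<lambda>t. \<Psi> (cis t))" unfolding \<Psi>_def N_def
      by (intro continuous_intros continuous_on_circle_R[OF F R]) (simp add: N1)
    show "continuous_on UNIV (\<lambda>t. sqrt (cmod (F (cis t))) + e)"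
      by (intro continuous_intros continuous_on_circle_R[OF F R])
  qed (rule bounds(2))
  also have "\<dots> = cmean (\<lambda>t. sqrt (cmod (F (cis t)))) + e"
    by (subst cmean_add) (auto intro!: continuous_intros continuous_on_circle_R[OF F R])
  finally show "sqrt (cmod (F 0)) \<le> cmean (\<lambda>t. sqrt (cmod (F (cis t)))) + e"
    using bounds(1)[of 0] by linarith
qed


lemma C2_Re_prod_obtain:
  assumes "open S" "F holomorphic_on S" "H holomorphic_on S"
  obtains a b p q where "C2_on S (\<lambda>w. Re (F w * cnj (H w))) a b p q"
    "\<And>w. p w + q w = 4 * Re (deriv F w * cnj (deriv H w))"
  by (rule that[OF C2_Re_prod[OF assms]]) (simp add: algebra_simps)

section \<open>The hard half of Fefferman's duality\<close>

text \<open>With \<open>N = |f|\<^sup>2 + \<epsilon>\<^sup>2\<close> and \<open>v = |h|\<^sup>2 - Re K \<in> [-B, 0]\<close> the function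
  \<open>exp (B/2) (1 + exp v) \<surd>N + Re (f cnj h)\<close> is subharmonic: the Laplacians of \<open>\<surd>N\<close> and of
  \<open>exp v \<surd>N\<close> dominate \<open>|f'|\<^sup>2 / \<surd>N\<close> and \<open>4 exp v |h'|\<^sup>2 \<surd>N\<close>, and the product of these two
  controls \<open>|f'| |h'|\<close>.\<close>

lemma Uchiyama_one_sided:
  assumes F: "F holomorphic_on ball 0 R" and h: "h holomorphic_on ball 0 R" and K: "K holomorphic_on ball 0 R"
    and R: "R > 1" and v: "\<And>z. cmod z < R \<Longrightarrow> (cmod (h z))\<^sup>2 \<le> Re (K z) \<and> Re (K z) \<le> (cmod (h z))\<^sup>2 + B"
  shows "- Re (cmean (\<lambda>t. F (cis t) * cnj (h (cis t)))) \<le> 2 * exp (B/2) * cmean (\<lambda>t. cmod (F (cis t))) + cmod (F 0 * h 0)"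
proof (rule field_le_epsilon)
  fix e0 :: real assume e0: "e0 > 0"
  define A where "A = exp (B/2)"
  have A: "A > 0" by (simp add: A_def)
  \<comment> \<open>Regularising \<open>|F|\<close> by \<open>e\<close> costs
    \<open>2 * A * e\<close> in the upper bound for \<open>\<Psi>\<close>, which is exactly
    \<open>e0\<close>.\<close>
  define e where "e = e0 / (2 * A)"
  have e: "e > 0" using e0 A by (simp add: e_def)
  define N where "N z = (cmod (F z))\<^sup>2 + e\<^sup>2" for z
  have e2: "e\<^sup>2 > 0" using e by simp
  have N0: "N z > 0" for z using e2 by (simp add: N_def add_nonneg_pos)
  have N1: "(cmod (F z))\<^sup>2 + e\<^sup>2 \<noteq> 0" for z using N0[of z] by (simp only: N_def)
  define S where "S = {w. Re w < ln R}"
  have S: "open S" unfolding S_def by (rule open_half_plane)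
  have R0: "R > 0" using R by simp
  have inS: "cmod (exp w) < R" if "w \<in> S" for w
    using exp_half_plane[OF R0, of w] that by (simp only: S_def mem_Collect_eq mem_ball_0)
  define F' where "F' w = F (exp w)" for w
  define h' where "h' w = h (exp w)" for w
  define K' where "K' w = K (exp w)" for w
  have FS: "F' holomorphic_on S" unfolding S_def F'_def using F R0 by (rule holomorphic_exp_comp)
  have hS: "h' holomorphic_on S" unfolding S_def h'_def using h R0 by (rule holomorphic_exp_comp)
  have KS: "K' holomorphic_on S" unfolding S_def K'_def using K R0 by (rule holomorphic_exp_comp)
  have N': "N (exp w) = (cmod (F' w))\<^sup>2 + e\<^sup>2" for w by (simp only: N_def F'_def)
  define X where "X w = cmod (deriv F' w)" for w
  define Y where "Y w = cmod (deriv h' w)" for w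
  obtain a b p q where C: "C2_on S (\<lambda>w. ln (N (exp w))) a b p q"
    "\<And>w. w \<in> S \<Longrightarrow> (a w)\<^sup>2 + (b w)\<^sup>2 = 4 * (X w)\<^sup>2 * (cmod (F' w))\<^sup>2 / (N (exp w))\<^sup>2"
    "\<And>w. w \<in> S \<Longrightarrow> p w + q w = 4 * (X w)\<^sup>2 / N (exp w) - 4 * (X w)\<^sup>2 * (cmod (F' w))\<^sup>2 / (N (exp w))\<^sup>2"
    using C2_ln_smooth[OF S FS e2, folded N' X_def] by blast
  obtain ah bh ph qh where Ch: "C2_on S (\<lambda>w. Re (h' w * cnj (h' w))) ah bh ph qh"
    "\<And>w. ph w + qh w = 4 * Re (deriv h' w * cnj (deriv h' w))"
    using C2_Re_prod_obtain[OF S hS hS] by blast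
  \<comment> \<open>The harmonic function \<open>Re K\<close> is written as a product with the
    constant 1, so that the same rule applies; its Laplacian is then 0.\<close>
  obtain ak bk pk qk where Ck: "C2_on S (\<lambda>w. Re (K' w * cnj 1)) ak bk pk qk"
    "\<And>w. pk w + qk w = 4 * Re (deriv K' w * cnj (deriv (\<lambda>_. 1) w))"
    using C2_Re_prod_obtain[OF S KS holomorphic_on_const[of 1]] by blast
  obtain af bf pf qf where Cf: "C2_on S (\<lambda>w. Re (F' w * cnj (h' w))) af bf pf qf"
    "\<And>w. pf w + qf w = 4 * Re (deriv F' w * cnj (deriv h' w))"
    using C2_Re_prod_obtain[OF S FS hS] by blast
  define V where "V z = Re (h z * cnj (h z)) + (-1) * Re (K z * cnj 1)" for z
  define \<Psi> where "\<Psi> z = A * (exp (1/2 * ln (N z)) + exp (1/2 * ln (N z) + V z)) + Re (F z * cnj (h z))" for z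
  note Cl = C2_cmul[OF C(1), of "1/2"]
  note Cv = C2_add[OF Ch(1) C2_cmul[OF Ck(1), of "-1"]]
  note Cw = C2_add[OF Cl Cv]
  note C\<Psi> = C2_add[OF C2_cmul[OF C2_add[OF C2_exp[OF Cl] C2_exp[OF Cw]], of A] Cf(1)]
  have \<Psi>_exp: "(\<lambda>w. \<Psi> (exp w)) = (\<lambda>w. A * (exp (1/2 * ln (N (exp w))) + exp (1/2 * ln (N (exp w)) + (Re (h' w * cnj (h' w)) + (-1) * Re (K' w * cnj 1)))) + Re (F' w * cnj (h' w)))"
    by (simp only: \<Psi>_def V_def F'_def h'_def K'_def)
  have V: "V z \<le> 0" "- B \<le> V z" if "cmod z < R" for z
  proof -
    have "V z = (cmod (h z))\<^sup>2 - Re (K z)"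
      unfolding V_def cmod_power2 by (simp add: power2_eq_square)
    then show "V z \<le> 0" "- B \<le> V z" using v[OF that] by linarith+
  qed
  have sN: "exp (1/2 * ln (N z)) = sqrt (N z)" for z
    using N0[of z] by (simp add: ln_sqrt[symmetric])
  have sN_le: "sqrt (N z) \<le> cmod (F z) + e" for z
    unfolding N_def using sqrt_add_le_add_sqrt[of "(cmod (F z))\<^sup>2" "e\<^sup>2"] e by simp
  have cont: "continuous_on UNIV (\<lambda>t. F (cis t))" "continuous_on UNIV (\<lambda>t. h (cis t))" "continuous_on UNIV (\<lambda>t. K (cis t))"
    using F h K R by (auto intro: continuous_on_circle_R)
  have isC: "isCont F 0" "isCont h 0" "isCont K 0"
    using F h K R by (auto intro!: continuous_on_interior[OF holomorphic_on_imp_continuous_on])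
  obtain MF where MF: "MF \<ge> 0" "\<And>z. cmod z \<le> 1 \<Longrightarrow> cmod (F z) \<le> MF"
    using holomorphic_bounded_cball[OF F R] by blast
  obtain Mh where Mh: "Mh \<ge> 0" "\<And>z. cmod z \<le> 1 \<Longrightarrow> cmod (h z) \<le> Mh"
    using holomorphic_bounded_cball[OF h R] by blast
  have upper: "\<Psi> z \<le> 2 * A * (cmod (F z) + e) + Re (F z * cnj (h z))" and lower: "Re (F z * cnj (h z)) \<le> \<Psi> z"
    if z: "cmod z < R" for z
  proof -
    have "exp (1/2 * ln (N z) + V z) \<le> exp (1/2 * ln (N z))" using V(1)[OF z] by simp
    moreover have "exp (1/2 * ln (N z)) \<le> cmod (F z) + e" unfolding sN by (rule sN_le)
    ultimately have "exp (1/2 * ln (N z)) + exp (1/2 * ln (N z) + V z) \<le> 2 * (cmod (F z) + e)"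
      unfolding mult_2 by (intro add_mono) (assumption, erule (1) order_trans)
    from mult_left_mono[OF this, of A] A show "\<Psi> z \<le> 2 * A * (cmod (F z) + e) + Re (F z * cnj (h z))"
      unfolding \<Psi>_def by simp
    show "Re (F z * cnj (h z)) \<le> \<Psi> z" unfolding \<Psi>_def using A by (simp add: add_nonneg_nonneg del: times_complex.sel)
  qed
  have sub: "\<Psi> 0 \<le> cmean (\<lambda>t. \<Psi> (cis t))"
  proof (rule sub_mean_value[OF C\<Psi>[folded \<Psi>_exp, unfolded S_def]])
    show "0 < ln R" using R by simp
    show "\<bar>\<Psi> z\<bar> \<le> 2 * A * (MF + e) + MF * Mh" if z: "cmod z \<le> 1" for z
    proof -
      have zR: "cmod z < R" using z R by simp
      have "\<bar>Re (F z * cnj (h z))\<bar> \<le> cmod (F z * cnj (h z))" by (rule abs_Re_le_cmod)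
      also have "\<dots> \<le> MF * Mh" using MF Mh z by (simp add: norm_mult mult_mono)
      finally have 1: "\<bar>Re (F z * cnj (h z))\<bar> \<le> MF * Mh" .
      have 2: "2 * A * (cmod (F z) + e) \<le> 2 * A * (MF + e)" using MF(2)[OF z] A by simp
      have "0 \<le> 2 * A * (MF + e)" using A e MF by simp
      then show ?thesis using upper[OF zR] lower[OF zR] 1 2 by linarith
    qed
    show "isCont \<Psi> 0" unfolding \<Psi>_def N_def V_def
      using e by (intro continuous_intros isCont_Re isCont_cnj isC) (simp_all add: N1)
  next
    fix w :: complex assume "Re w < ln R"
    then have w: "w \<in> S" by (simp add: S_def)
    let ?s = "sqrt (N (exp w))"
    have s: "?s > 0" "?s * ?s = N (exp w)" using N0[of "exp w"] by (simp_all)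
    let ?f = "cmod (F' w)"
    have fN: "?f\<^sup>2 \<le> N (exp w)" unfolding N' by simp
    let ?V = "Re (h' w * cnj (h' w)) + (-1) * Re (K' w * cnj 1)"
    have Vw: "?V = V (exp w)" by (simp only: V_def h'_def K'_def)
    define aw where "aw = 1/2 * a w + (ah w + (-1) * ak w)"
    define bw where "bw = 1/2 * b w + (bh w + (-1) * bk w)"
    have XfN: "(X w)\<^sup>2 * ?f\<^sup>2 / (N (exp w))\<^sup>2 \<le> (X w)\<^sup>2 / N (exp w)"
    proof -
      have "(X w)\<^sup>2 * ?f\<^sup>2 / (N (exp w))\<^sup>2 \<le> (X w)\<^sup>2 * N (exp w) / (N (exp w))\<^sup>2"
        using fN by (intro divide_right_mono mult_left_mono) auto
      also have "\<dots> = (X w)\<^sup>2 / N (exp w)" using N0[of "exp w"] by (simp add: power2_eq_square)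
      finally show ?thesis .
    qed
    have t1: "(X w)\<^sup>2 / N (exp w) \<le> ((1/2 * a w)\<^sup>2 + 1/2 * p w) + ((1/2 * b w)\<^sup>2 + 1/2 * q w)"
    proof -
      have "((1/2 * a w)\<^sup>2 + 1/2 * p w) + ((1/2 * b w)\<^sup>2 + 1/2 * q w) = 1/4 * ((a w)\<^sup>2 + (b w)\<^sup>2) + 1/2 * (p w + q w)"
        by (simp add: power2_eq_square algebra_simps)
      also have "\<dots> = 2 * ((X w)\<^sup>2 / N (exp w)) - (X w)\<^sup>2 * ?f\<^sup>2 / (N (exp w))\<^sup>2"
        unfolding C(2)[OF w] C(3)[OF w] by (simp add: diff_divide_distrib mult.assoc)
      finally show ?thesis using XfN by linarith
    qed
    \<comment> \<open>The part \<open>Re K\<close> is harmonic, so the Laplacian of \<open>v\<close>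
      is \<open>4 * |h'|^2\<close>. The squares of the gradient and the Laplacian of
      \<open>ln N\<close> are nonnegative and are dropped.\<close>
    have t2: "4 * (Y w)\<^sup>2 \<le> (aw\<^sup>2 + (1/2 * p w + (ph w + (-1) * pk w))) + (bw\<^sup>2 + (1/2 * q w + (qh w + (-1) * qk w)))"
    proof -
      have "ph w + qh w = 4 * (Y w)\<^sup>2"
        unfolding Ch(2) Y_def cmod_power2 by (simp add: power2_eq_square)
      moreover have "pk w + qk w = 0" unfolding Ck(2) by simp
      moreover have "0 \<le> p w + q w" unfolding C(3)[OF w] using XfN by simp
      moreover have "0 \<le> aw\<^sup>2" "0 \<le> bw\<^sup>2" by simp_all
      ultimately show ?thesis by linarith
    qed
    have t3: "- 4 * (X w * Y w) \<le> pf w + qf w"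
    proof -
      have "\<bar>Re (deriv F' w * cnj (deriv h' w))\<bar> \<le> X w * Y w"
        using abs_Re_le_cmod[of "deriv F' w * cnj (deriv h' w)"] unfolding X_def Y_def norm_mult complex_mod_cnj .
      then show ?thesis unfolding Cf(2) by linarith
    qed
    have E1: "A * (exp (1/2 * ln (N (exp w))) * ((X w)\<^sup>2 / N (exp w))) = (A / ?s) * (X w)\<^sup>2"
    proof -
      have "A * (c * (x / (c * c))) = A / c * x" if "c > 0" for c x :: real
        using that by (simp add: field_simps)
      from this[OF s(1), unfolded s(2)] show ?thesis unfolding sN .
    qed
    \<comment> \<open>The choice \<open>A = exp (B/2)\<close> is made for this step:
      \<open>A * exp (-B) * A = 1\<close> and \<open>v \<ge> -B\<close>. The coefficients of
      \<open>|f'|^2\<close> and \<open>|h'|^2\<close> therefore have product at least 4, as needed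
      to absorb a mixed term of size \<open>4 * |f'| * |h'|\<close>.\<close>
    have E2: "4 * (Y w)\<^sup>2 / (A / ?s) \<le> A * (exp (1/2 * ln (N (exp w)) + ?V) * (4 * (Y w)\<^sup>2))"
    proof -
      have "A * exp (- B) * A = exp (B/2 + - B + B/2)" unfolding A_def by (simp only: exp_add)
      also have "B/2 + - B + B/2 = 0" by simp
      finally have "A * exp (- B) * A = 1" by (simp only: exp_zero)
      then have "1 / A = A * exp (- B)" using A by (metis less_irrefl nonzero_eq_divide_eq)
      also have "\<dots> \<le> A * exp ?V" unfolding Vw using V(2)[OF inS[OF w]] A by simp
      finally have "1 / A * (?s * (4 * (Y w)\<^sup>2)) \<le> A * exp ?V * (?s * (4 * (Y w)\<^sup>2))"
        using s by (intro mult_right_mono) auto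
      moreover have "y / (A / c) = 1 / A * (c * y)" "A * (c * x * y) = A * x * (c * y)" for c x y :: real
        by (simp_all add: divide_divide_eq_right mult_ac)
      ultimately show ?thesis unfolding exp_add sN by (simp only:)
    qed
    \<comment> \<open>With \<open>k = A / sqrt N\<close> the left-hand side is the complete square
      \<open>(k * X - 2 * Y)^2 / k\<close>.\<close>
    have E3: "(A / ?s) * (X w)\<^sup>2 + 4 * (Y w)\<^sup>2 / (A / ?s) - 4 * (X w * Y w) \<ge> 0"
    proof -
      define k where "k = A / ?s"
      have k: "k > 0" unfolding k_def using A s by simp
      have "k * (X w)\<^sup>2 + 4 * (Y w)\<^sup>2 / k - 4 * (X w * Y w) = (k * X w - 2 * Y w)\<^sup>2 / k"
        using k by (simp add: field_simps power2_eq_square)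
      also have "\<dots> \<ge> 0" using k by simp
      finally show ?thesis unfolding k_def .
    qed
    let ?e1 = "exp (1/2 * ln (N (exp w)))" and ?e2 = "exp (1/2 * ln (N (exp w)) + ?V)"
    have m1: "A * (?e1 * ((X w)\<^sup>2 / N (exp w))) \<le> A * (?e1 * (((1/2 * a w)\<^sup>2 + 1/2 * p w) + ((1/2 * b w)\<^sup>2 + 1/2 * q w)))"
      using t1 A by (intro mult_left_mono) auto
    have m2: "A * (?e2 * (4 * (Y w)\<^sup>2)) \<le> A * (?e2 * ((aw\<^sup>2 + (1/2 * p w + (ph w + (-1) * pk w))) + (bw\<^sup>2 + (1/2 * q w + (qh w + (-1) * qk w)))))"
      using t2 A by (intro mult_left_mono) auto
    have aux: "(A * (x * u + y * v) + f) + (A * (x * u' + y * v') + f') = A * (x * (u + u')) + A * (y * (v + v')) + (f + f')"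
      for x y u v f u' v' f' :: real by (simp add: algebra_simps)
    show "0 \<le> (A * (?e1 * ((1/2 * a w)\<^sup>2 + 1/2 * p w) + ?e2 * ((1/2 * a w + (ah w + (-1) * ak w))\<^sup>2 + (1/2 * p w + (ph w + (-1) * pk w)))) + pf w) +
        (A * (?e1 * ((1/2 * b w)\<^sup>2 + 1/2 * q w) + ?e2 * ((1/2 * b w + (bh w + (-1) * bk w))\<^sup>2 + (1/2 * q w + (qh w + (-1) * qk w)))) + qf w)"
    proof -
      have "0 \<le> A * (?e1 * (((1/2 * a w)\<^sup>2 + 1/2 * p w) + ((1/2 * b w)\<^sup>2 + 1/2 * q w))) +
          A * (?e2 * ((aw\<^sup>2 + (1/2 * p w + (ph w + (-1) * pk w))) + (bw\<^sup>2 + (1/2 * q w + (qh w + (-1) * qk w))))) + (pf w + qf w)"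
        using m1 m2 t3 E1 E2 E3 by linarith
      then show ?thesis by (simp only: aux aw_def bw_def)
    qed
  qed
  have c\<Psi>: "continuous_on UNIV (\<lambda>t. \<Psi> (cis t))" unfolding \<Psi>_def N_def V_def
    using e by (intro continuous_intros cont) (simp_all add: N1)
  have "- cmod (F 0 * h 0) \<le> \<Psi> 0"
    using lower[of 0] abs_Re_le_cmod[of "F 0 * cnj (h 0)"] R0 by (simp add: norm_mult del: times_complex.sel)
  also note sub
  also have "cmean (\<lambda>t. \<Psi> (cis t)) \<le> cmean (\<lambda>t. 2 * A * (cmod (F (cis t)) + e) + Re (F (cis t) * cnj (h (cis t))))"
    using upper R by (intro cmean_mono c\<Psi> continuous_intros cont) auto
  also have "\<dots> = 2 * A * (cmean (\<lambda>t. cmod (F (cis t))) + e) + Re (cmean (\<lambda>t. F (cis t) * cnj (h (cis t))))"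
  proof -
    have c1: "continuous_on UNIV (\<lambda>t. cmod (F (cis t)) + e)" "continuous_on UNIV (\<lambda>t. F (cis t) * cnj (h (cis t)))"
      "continuous_on UNIV (\<lambda>t. cmod (F (cis t)))" "continuous_on UNIV (\<lambda>t::real. e)"
      by (intro continuous_intros cont)+
    have c2: "continuous_on UNIV (\<lambda>t. 2 * A * (cmod (F (cis t)) + e))" "continuous_on UNIV (\<lambda>t. Re (F (cis t) * cnj (h (cis t))))"
      by (intro continuous_intros cont)+
    show ?thesis
      unfolding cmean_add[OF c2] cmean_Re[OF c1(2)] cmean_cmul cmean_add[OF c1(3,4)] cmean_const ..
  qed
  finally have "- Re (cmean (\<lambda>t. F (cis t) * cnj (h (cis t)))) \<le> 2 * A * (cmean (\<lambda>t. cmod (F (cis t))) + e) + cmod (F 0 * h 0)"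
    by linarith
  also have "2 * A * (cmean (\<lambda>t. cmod (F (cis t))) + e) = 2 * A * cmean (\<lambda>t. cmod (F (cis t))) + e0"
    using A by (simp add: e_def distrib_left)
  finally show "- Re (cmean (\<lambda>t. F (cis t) * cnj (h (cis t)))) \<le> 2 * exp (B/2) * cmean (\<lambda>t. cmod (F (cis t))) + cmod (F 0 * h 0) + e0"
    unfolding A_def by linarith
qed

text \<open>The one-sided bound is applied to \<open>u * F\<close>, where the unimodular
  \<open>u\<close> rotates the integral onto the negative real axis; every other term depends on
  moduli only.\<close>

lemma Uchiyama:
  assumes F: "F holomorphic_on ball 0 R" and h: "h holomorphic_on ball 0 R" and K: "K holomorphic_on ball 0 R"
    and R: "R > 1" and v: "\<And>z. cmod z < R \<Longrightarrow> (cmod (h z))\<^sup>2 \<le> Re (K z) \<and> Re (K z) \<le> (cmod (h z))\<^sup>2 + B"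
  shows "cmod (cmean (\<lambda>t. F (cis t) * cnj (h (cis t)))) \<le> 2 * exp (B/2) * cmean (\<lambda>t. cmod (F (cis t))) + cmod (F 0 * h 0)"
proof -
  define I where "I = cmean (\<lambda>t. F (cis t) * cnj (h (cis t)))"
  define u where "u = (if I = 0 then 1 else - cnj I / of_real (cmod I))"
  have u: "cmod u = 1" by (simp add: u_def norm_divide)
  have uI: "- Re (u * I) = cmod I"
  proof (cases "I = 0")
    case False
    have "cnj I * I = of_real ((cmod I)\<^sup>2)" by (simp only: complex_norm_square mult.commute)
    then have "u * I = - of_real (cmod I)"
      using False by (simp add: u_def power2_eq_square)
    then show ?thesis by simp
  qed simp
  have uF: "(\<lambda>z. u * F z) holomorphic_on ball 0 R" using F by (intro holomorphic_intros)
  have "cmean (\<lambda>t. u * F (cis t) * cnj (h (cis t))) = u * I"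
    unfolding I_def by (subst cmean_cmul[symmetric]) (simp only: mult.assoc)
  with Uchiyama_one_sided[OF uF h K R v] show ?thesis
    by (simp add: uI norm_mult u I_def[symmetric] del: times_complex.sel)
qed

section \<open>The space \<open>H\<^sup>1\<close>\<close>

text \<open>Rescaling by \<open>R > 1\<close> makes the unit circle an interior circle, where the
  coefficient formulas apply. The reversed orientation serves for averages along the conjugated
  curve of \<open>cnj_mob\<close>.\<close>

lemma mean_value_circle:
  assumes F: "F holomorphic_on ball 0 R" and R: "R > 1"
  shows "cmean (\<lambda>t. F (cis t)) = F 0" "cmean (\<lambda>t. F (cis (- t))) = F 0"
proof -
  define f where "f z = F (of_real R * z)" for z
  have f: "f holomorphic_on ball 0 1"
    unfolding f_def
    by (rule holomorphic_on_compose_gen[OF _ F, unfolded o_def])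
       (use R in \<open>auto intro!: holomorphic_intros simp: norm_mult\<close>)
  define r where "r = 1 / R"
  have r: "0 \<le> r" "r < 1" using R by (auto simp: r_def)
  have "F (cis t) = f (of_real r * cis t)" for t using R by (simp add: f_def r_def)
  also have "f (of_real r * cis t) = pser (\<lambda>k. taylor_coeff f k * of_real r ^ k) (cis t)" for t
    by (rule holomorphic_dilated_eq_pser[OF f r]) simp
  finally have "cmean (\<lambda>t. F (cis t)) = taylor_coeff f 0"
    using cmean_pser[OF summable_dilated_taylor[OF f r]] by simp
  then show 1: "cmean (\<lambda>t. F (cis t)) = F 0" by (simp add: taylor_coeff_0 f_def)
  have per: "F (cis (t + 2 * pi)) = F (cis t)" for t by (simp flip: cis_mult)
  show "cmean (\<lambda>t. F (cis (- t))) = F 0"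
    using cmean_reflect[OF continuous_on_circle_R[OF F R] per] 1 by simp
qed

text \<open>A quantitative form of the uniform PL-convexity of \<open>L\<^sup>1\<close>: the expression subtracted from
  \<open>|w|\<close> is subharmonic in \<open>w\<close> and agrees with \<open>|w|\<close> at \<open>w = a\<close>.\<close>

lemma norm_diff_le_subharmonic_defect:
  fixes a w :: complex
  assumes a: "a \<noteq> 0" and \<eta>: "0 < \<eta>" "\<eta> \<le> 1"
  defines "X \<equiv> cmod w - 1/2 * (Re (w * cnj a) / cmod a + 2 * sqrt (cmod a) * sqrt (cmod w) - cmod a)"
  shows "cmod (w - a) \<le> \<eta> * cmod a + 8 / \<eta> * X"
proof -
  define A where "A = cmod a"
  define W where "W = cmod w"
  define c where "c = Re (w * cnj a)"
  define y where "y = W - c / A"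
  define z where "z = sqrt W - sqrt A"
  have A: "A > 0" and W: "W \<ge> 0" using a by (auto simp: A_def W_def)
  have c: "c \<le> W * A"
    unfolding c_def W_def A_def using complex_Re_le_cmod[of "w * cnj a"] by (simp add: norm_mult)
  have y: "y \<ge> 0" using c A by (simp add: y_def divide_le_eq)
  \<comment> \<open>The defect splits into an angular part \<open>y\<close>, comparing
    \<open>|w|\<close> with the component of \<open>w\<close> along \<open>a\<close>, and a radial
    part \<open>z\<close> measuring the change of \<open>sqrt |w|\<close>. Both terms are
    nonnegative, so each is bounded by \<open>X\<close>.\<close>
  have X: "X = (y + z\<^sup>2) / 2"
  proof -
    have "X = W - 1/2 * (c / A + 2 * sqrt A * sqrt W - A)" by (simp only: X_def A_def W_def c_def)
    then show ?thesis unfolding y_def z_def power2_diff using A W by (simp add: field_simps)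
  qed
  have X0: "X \<ge> 0" using y by (simp add: X)
  have "(cmod (w - a))\<^sup>2 = W\<^sup>2 + A\<^sup>2 - 2 * c"
    unfolding W_def A_def c_def cmod_power2 by (simp add: power2_eq_square algebra_simps)
  also have "\<dots> = (W - A)\<^sup>2 + 2 * A * y"
    using A by (simp add: y_def power2_eq_square field_simps)
  also have "(W - A)\<^sup>2 = z\<^sup>2 * (2 * sqrt A + z)\<^sup>2"
  proof -
    have "W - A = z * (2 * sqrt A + z)"
      using A W by (simp add: z_def algebra_simps)
    then show ?thesis by (simp add: power_mult_distrib)
  qed
  also have "\<dots> \<le> z\<^sup>2 * (8 * A + 2 * z\<^sup>2)"
  proof (rule mult_left_mono)
    have "(2 * sqrt A + z)\<^sup>2 + (2 * sqrt A - z)\<^sup>2 = 8 * A + 2 * z\<^sup>2"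
      using A by (simp add: power2_sum power2_diff power_mult_distrib)
    then show "(2 * sqrt A + z)\<^sup>2 \<le> 8 * A + 2 * z\<^sup>2" using zero_le_power2[of "2 * sqrt A - z"] by linarith
  qed simp
  finally have "(cmod (w - a))\<^sup>2 \<le> z\<^sup>2 * (8 * A + 2 * z\<^sup>2) + 2 * A * y" by simp
  also have "\<dots> \<le> 8 * X\<^sup>2 + 16 * A * X"
  proof -
    have "z\<^sup>2 * z\<^sup>2 \<le> (2 * X) * (2 * X)" by (rule mult_mono) (use y X X0 in auto)
    moreover have "0 \<le> A * y" using A y by simp
    moreover have "16 * A * X = 8 * A * y + 8 * A * z\<^sup>2" by (simp add: X algebra_simps)
    ultimately show ?thesis by (simp add: power2_eq_square algebra_simps)
  qed
  \<comment> \<open>The constants fit because the cross term of the square is exactly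
    \<open>16 * A * X\<close>, while \<open>\<eta> \<le> 1\<close> gives
    \<open>64 / \<eta>^2 \<ge> 8\<close>.\<close>
  also have "\<dots> \<le> (\<eta> * A + 8 / \<eta> * X)\<^sup>2"
  proof -
    have "(\<eta> * A + 8 / \<eta> * X)\<^sup>2 = (\<eta> * A)\<^sup>2 + 16 * A * X + 64 / \<eta>\<^sup>2 * X\<^sup>2"
      using \<eta> by (simp add: power2_sum power_mult_distrib power_divide)
    moreover have "8 * X\<^sup>2 \<le> 64 / \<eta>\<^sup>2 * X\<^sup>2"
    proof (rule mult_right_mono)
      have "\<eta>\<^sup>2 \<le> 1" using \<eta> by (simp add: power_le_one)
      then show "8 \<le> 64 / \<eta>\<^sup>2" using \<eta> by (simp add: le_divide_eq)
    qed simp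
    ultimately show ?thesis using zero_le_power2[of "\<eta> * A"] by linarith
  qed
  finally show ?thesis unfolding A_def[symmetric]
    by (rule power2_le_imp_le) (use \<eta> X0 A in auto)
qed

text \<open>Integrate the pointwise inequality with \<open>a = F 0\<close>. The linear term averages
  to \<open>|F 0|\<close> by the mean value property, and the square root term averages to at least
  its central value by \<open>sqrt_norm_sub_mean\<close>. The mean defect is thus at most the excess
  of the mean of \<open>|F|\<close> over \<open>|F 0|\<close>.\<close>

lemma mean_oscillation_le:
  assumes F: "F holomorphic_on ball 0 R" and R: "R > 1" and \<eta>: "0 < \<eta>" "\<eta> \<le> 1"
  shows "cmod (F 0) \<le> cmean (\<lambda>t. cmod (F (cis t)))"
    and "cmean (\<lambda>t. cmod (F (cis t) - F 0)) \<le> \<eta> * cmod (F 0) + 8 / \<eta> * (cmean (\<lambda>t. cmod (F (cis t))) - cmod (F 0))"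
proof -
  note cF = continuous_on_circle_R[OF F R]
  show 1: "cmod (F 0) \<le> cmean (\<lambda>t. cmod (F (cis t)))"
    using norm_cmean_le[OF cF] by (simp add: mean_value_circle[OF F R])
  show "cmean (\<lambda>t. cmod (F (cis t) - F 0)) \<le> \<eta> * cmod (F 0) + 8 / \<eta> * (cmean (\<lambda>t. cmod (F (cis t))) - cmod (F 0))"
  proof (cases "F 0 = 0")
    case True
    have "1 * cmean (\<lambda>t. cmod (F (cis t))) \<le> 8 / \<eta> * cmean (\<lambda>t. cmod (F (cis t)))"
      using \<eta> 1 True by (intro mult_right_mono) (auto simp: le_divide_eq)
    then show ?thesis using True by simp
  next
    case False
    define A where "A = cmod (F 0)"
    have A: "A > 0" using False by (simp add: A_def)
    define X where "X t = cmod (F (cis t)) - 1/2 * (Re (F (cis t) * cnj (F 0)) / A + 2 * sqrt A * sqrt (cmod (F (cis t))) - A)" for t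
    have cX: "continuous_on UNIV X" unfolding X_def[abs_def] using A by (intro continuous_intros cF) auto
    have "cmean (\<lambda>t. cmod (F (cis t) - F 0)) \<le> cmean (\<lambda>t. \<eta> * A + 8 / \<eta> * X t)"
      using norm_diff_le_subharmonic_defect[OF False \<eta>]
      by (intro cmean_mono continuous_intros cF cX) (auto simp: X_def A_def)
    also have "\<dots> = \<eta> * A + 8 / \<eta> * cmean X"
      by (subst cmean_add) (auto intro!: continuous_intros cX simp: cmean_cmul simp del: times_divide_eq_left)
    also have "cmean X \<le> cmean (\<lambda>t. cmod (F (cis t))) - A"
    proof -
      have R1: "cmean (\<lambda>t. Re (F (cis t) * cnj (F 0)) / A) = A"
      proof -
        have "cmean (\<lambda>t. Re (F (cis t) * cnj (F 0)) / A) = cmean (\<lambda>t. Re ((cnj (F 0) / of_real A) * F (cis t)))"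
        proof -
          have "Re (F (cis t) * cnj (F 0)) / A = Re ((cnj (F 0) / of_real A) * F (cis t))" for t
            by (simp add: mult.commute flip: Re_divide_of_real)
          then show ?thesis by (simp only:)
        qed
        also have "\<dots> = Re ((cnj (F 0) / of_real A) * F 0)"
        proof -
          have c: "continuous_on UNIV (\<lambda>t. (cnj (F 0) / of_real A) * F (cis t))" by (intro continuous_on_mult continuous_on_const cF)
          show ?thesis unfolding cmean_Re[OF c] cmean_cmul mean_value_circle(1)[OF F R] ..
        qed
        also have "(cnj (F 0) / of_real A) * F 0 = of_real A"
        proof -
          have "cnj (F 0) * F 0 = of_real (A * A)"
            by (simp only: A_def complex_norm_square[symmetric] power2_eq_square[symmetric] mult.commute[of "cnj (F 0)"])
          then show ?thesis using A by simp
        qed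
        finally show ?thesis by simp
      qed
      have s: "sqrt A \<le> cmean (\<lambda>t. sqrt (cmod (F (cis t))))"
        unfolding A_def by (rule sqrt_norm_sub_mean[OF F R])
      have cs: "continuous_on UNIV (\<lambda>t. Re (F (cis t) * cnj (F 0)) / A)" "continuous_on UNIV (\<lambda>t. 2 * sqrt A * sqrt (cmod (F (cis t))))"
        "continuous_on UNIV (\<lambda>t. cmod (F (cis t)))"
        "continuous_on UNIV (\<lambda>t. Re (F (cis t) * cnj (F 0)) / A + 2 * sqrt A * sqrt (cmod (F (cis t))))"
        "continuous_on UNIV (\<lambda>t. Re (F (cis t) * cnj (F 0)) / A + 2 * sqrt A * sqrt (cmod (F (cis t))) - A)"
        "continuous_on UNIV (\<lambda>t. 1/2 * (Re (F (cis t) * cnj (F 0)) / A + 2 * sqrt A * sqrt (cmod (F (cis t))) - A))"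
        "continuous_on UNIV (\<lambda>t::real. A)"
        using A by (intro continuous_intros cF; simp)+
      have "cmean X = cmean (\<lambda>t. cmod (F (cis t))) - 1/2 * (A + 2 * sqrt A * cmean (\<lambda>t. sqrt (cmod (F (cis t)))) - A)"
        unfolding X_def[abs_def] cmean_diff[OF cs(3,6)] cmean_cmul cmean_diff[OF cs(4,7)] cmean_add[OF cs(1,2)] R1 cmean_const ..
      also have "\<dots> = cmean (\<lambda>t. cmod (F (cis t))) - sqrt A * cmean (\<lambda>t. sqrt (cmod (F (cis t))))" by simp
      also have "\<dots> \<le> cmean (\<lambda>t. cmod (F (cis t))) - sqrt A * sqrt A"
        using s A by (intro diff_left_mono mult_left_mono) auto
      finally show ?thesis using A by simp
    qed
    finally show ?thesis using \<eta> by (simp add: A_def mult_left_mono divide_right_mono)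
  qed
qed

text \<open>The disc automorphism that sends 0 to \<open>r\<close> and preserves the circle.
  Composed inside \<open>g (R * cis \<theta> * _)\<close> it has central value
  \<open>g (r * R * cis \<theta>)\<close>, while after averaging over \<open>\<theta>\<close> its
  boundary values see only the circle of radius \<open>R\<close>.\<close>

definition mob :: "real \<Rightarrow> complex \<Rightarrow> complex" where
  "mob r z = (z + of_real r) / (1 + of_real r * z)"

lemma mob_0 [simp]: "mob r 0 = of_real r" by (simp add: mob_def)

lemma mob_den: "0 \<le> r \<Longrightarrow> r * cmod z < 1 \<Longrightarrow> 1 - r * cmod z \<le> cmod (1 + of_real r * z)"
  using norm_diff_ineq[of 1 "of_real r * z"] by (simp add: norm_mult)

lemma mob_den_nonzero: "0 \<le> r \<Longrightarrow> r * cmod z < 1 \<Longrightarrow> 1 + of_real r * z \<noteq> 0"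
  using mob_den[of r z] by auto

lemma mob_norm_identity:
  "(cmod (z + of_real r))\<^sup>2 = (cmod (1 + of_real r * z))\<^sup>2 + (1 - r\<^sup>2) * ((cmod z)\<^sup>2 - 1)"
  unfolding cmod_power2 by (simp add: power2_eq_square algebra_simps)

lemma norm_mob_circle: "0 \<le> r \<Longrightarrow> r < 1 \<Longrightarrow> cmod (mob r (cis t)) = 1"
  using mob_norm_identity[of "cis t" r] mob_den_nonzero[of r "cis t"]
  by (simp add: mob_def norm_divide power2_eq_iff_nonneg)

lemma cnj_mob: "cnj (mob r (cis t)) = mob r (cis (- t))"
  by (simp add: mob_def cis_cnj)

text \<open>The mean value lemmas require a disc of radius larger than 1. Just outside the circle
  \<open>mob r\<close> exceeds modulus 1 only slightly, by \<open>mob_norm_identity\<close>, and the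
  slack \<open>|u| < 1\<close> absorbs the excess. The inequality that selects \<open>R\<close>
  holds strictly at 1 and hence somewhat beyond.\<close>

lemma holomorphic_mob_comp:
  assumes g: "g holomorphic_on ball 0 1" and u: "cmod u < 1" and r: "0 \<le> r" "r < 1"
  obtains R where "R > 1" "(\<lambda>z. g (u * mob r z)) holomorphic_on ball 0 R"
proof -
  let ?u = "cmod u"
  have u2: "?u\<^sup>2 < 1" using u by (simp add: norm_sq_less_1)
  have r1: "(1 - r)\<^sup>2 > 0" using r by simp
  have "((\<lambda>x. ?u\<^sup>2 * ((1 - r\<^sup>2) * (x\<^sup>2 - 1)) - (1 - ?u\<^sup>2) * (1 - r * x)\<^sup>2) \<longlongrightarrow>
     ?u\<^sup>2 * ((1 - r\<^sup>2) * (1\<^sup>2 - 1)) - (1 - ?u\<^sup>2) * (1 - r * 1)\<^sup>2) (at_right 1)"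
    by (intro tendsto_intros)
  moreover have "?u\<^sup>2 * ((1 - r\<^sup>2) * (1\<^sup>2 - 1)) - (1 - ?u\<^sup>2) * (1 - r * 1)\<^sup>2 < 0" using u2 r1 by simp
  ultimately have "eventually (\<lambda>x. ?u\<^sup>2 * ((1 - r\<^sup>2) * (x\<^sup>2 - 1)) - (1 - ?u\<^sup>2) * (1 - r * x)\<^sup>2 < 0) (at_right 1)"
    by (rule order_tendstoD(2))
  moreover have "((\<lambda>x. r * x) \<longlongrightarrow> r * 1) (at_right 1)" by (intro tendsto_intros)
  then have "eventually (\<lambda>x. r * x < 1) (at_right 1)" using r by (intro order_tendstoD(2)) auto
  moreover have "eventually (\<lambda>x::real. x > 1) (at_right 1)" by (simp add: eventually_at_right_less)
  ultimately have "eventually (\<lambda>x. (?u\<^sup>2 * ((1 - r\<^sup>2) * (x\<^sup>2 - 1)) - (1 - ?u\<^sup>2) * (1 - r * x)\<^sup>2 < 0 \<and> r * x < 1) \<and> x > 1) (at_right 1)"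
    by (intro eventually_conj)
  then obtain R where R: "?u\<^sup>2 * ((1 - r\<^sup>2) * (R\<^sup>2 - 1)) < (1 - ?u\<^sup>2) * (1 - r * R)\<^sup>2" "r * R < 1" "R > 1"
    using eventually_happens trivial_limit_at_right_real by fastforce
  have den: "r * cmod z < 1" "1 - r * R \<le> 1 - r * cmod z" if "cmod z < R" for z
    using that R r mult_left_mono[of "cmod z" R r] by linarith+
  have "cmod (u * mob r z) < 1" if z: "cmod z < R" for z
  proof -
    let ?d = "cmod (1 + of_real r * z)"
    have d: "1 - r * R \<le> ?d" using mob_den[OF r(1) den(1)[OF z]] den(2)[OF z] by linarith
    have d0: "?d > 0" using d R by linarith
    have r2: "r\<^sup>2 \<le> 1" using r by (simp add: power_le_one)
    have "(?u * cmod (z + of_real r))\<^sup>2 = ?u\<^sup>2 * ?d\<^sup>2 + ?u\<^sup>2 * ((1 - r\<^sup>2) * ((cmod z)\<^sup>2 - 1))"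
      unfolding power_mult_distrib mob_norm_identity by (simp add: algebra_simps)
    also have "?u\<^sup>2 * ((1 - r\<^sup>2) * ((cmod z)\<^sup>2 - 1)) \<le> ?u\<^sup>2 * ((1 - r\<^sup>2) * (R\<^sup>2 - 1))"
      using z r2 by (intro mult_left_mono diff_right_mono power_mono) auto
    also note R(1)
    also have "(1 - ?u\<^sup>2) * (1 - r * R)\<^sup>2 \<le> (1 - ?u\<^sup>2) * ?d\<^sup>2"
      using u2 d R by (intro mult_left_mono power_mono) auto
    finally have "(?u * cmod (z + of_real r))\<^sup>2 < ?d\<^sup>2" by (simp add: algebra_simps)
    then have "?u * cmod (z + of_real r) < ?d" by (rule power2_less_imp_less) simp
    then show ?thesis using d0 by (simp add: mob_def norm_mult norm_divide)
  qed
  then have "(\<lambda>z. g (u * mob r z)) holomorphic_on ball 0 R"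
    using mob_den_nonzero[OF r(1) den(1)]
    by (intro holomorphic_on_compose_gen[OF _ g, unfolded o_def])
       (auto simp: mob_def intro!: holomorphic_intros)
  with R(3) show ?thesis by (rule that)
qed

lemma continuous_on_ball_comp:
  assumes "g holomorphic_on ball 0 1" "continuous_on UNIV \<tau>" "\<And>x. cmod (\<tau> x) < 1"
  shows "continuous_on UNIV (\<lambda>x. g (\<tau> x))"
  by (rule continuous_on_compose2[OF holomorphic_on_imp_continuous_on[OF assms(1)] assms(2)]) (use assms(3) in auto)

lemma continuous_on_mob: "0 \<le> r \<Longrightarrow> r < 1 \<Longrightarrow> continuous_on UNIV \<tau> \<Longrightarrow> continuous_on UNIV (\<lambda>x. mob r (cis (\<tau> x)))"
  unfolding mob_def using mob_den_nonzero[of r "cis _"] by (intro continuous_intros) auto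

text \<open>For each \<open>\<theta>\<close>, \<open>mean_oscillation_le\<close> compares the
  boundary values \<open>L \<theta> \<alpha>\<close> with the central value
  \<open>G \<theta>\<close>. Averaging over \<open>\<theta>\<close> as well replaces the mean of
  \<open>|L|\<close> by \<open>H1_mean g R\<close>, by rotation invariance. The oscillation is thus
  controlled by the growth of the means from radius \<open>r * R\<close> to radius
  \<open>R\<close>.\<close>

lemma dilation_oscillation:
  assumes g: "g holomorphic_on ball 0 1" and R: "0 \<le> R" "R < 1" and r: "0 \<le> r" "r < 1" and \<eta>: "0 < \<eta>" "\<eta> \<le> 1"
  shows "H1_mean g (r * R) \<le> H1_mean g R"
    and "H1_mean (\<lambda>z. g z - g (of_real (r\<^sup>2) * z)) R \<le> \<eta> * H1_mean g (r * R) + 8 / \<eta> * (H1_mean g R - H1_mean g (r * R))"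
proof -
  define G where "G \<theta> = g (of_real (r * R) * cis \<theta>)" for \<theta>
  define L where "L \<theta> \<alpha> = g (of_real R * cis \<theta> * mob r (cis \<alpha>))" for \<theta> \<alpha>
  have rR: "0 \<le> r * R" "r * R < 1" using r R mult_left_le_one_le[of R r] by auto
  have nb: "cmod (mob r (cis \<alpha>)) = 1" for \<alpha> using norm_mob_circle[OF r] .
  have cb: "continuous_on UNIV (\<lambda>x::real \<times> real. mob r (cis (snd x)))" "continuous_on UNIV (\<lambda>x::real \<times> real. mob r (cis (fst x)))"
    by (intro continuous_on_mob r continuous_intros)+
  have cL: "continuous_on UNIV (\<lambda>(\<theta>, \<alpha>). L \<theta> \<alpha>)" "continuous_on UNIV (\<lambda>(\<alpha>, \<theta>). L \<theta> \<alpha>)"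
    unfolding L_def case_prod_unfold using R
    by (auto intro!: continuous_on_ball_comp[OF g] continuous_intros cb simp: norm_mult nb)
  have cG: "continuous_on UNIV G" unfolding G_def
    using rR by (intro continuous_on_circle[OF g] continuous_intros) auto
  have cG2: "continuous_on UNIV (\<lambda>x::real \<times> real. G (fst x))" "continuous_on UNIV (\<lambda>x::real \<times> real. G (snd x))"
    by (auto intro!: continuous_on_compose2[OF cG] continuous_intros)
  have cLa: "continuous_on UNIV (\<lambda>(\<theta>, \<alpha>). cmod (L \<theta> \<alpha>))"
    using cL(1) by (auto simp: case_prod_unfold intro!: continuous_intros)
  have cLd: "continuous_on UNIV (\<lambda>(\<theta>, \<alpha>). cmod (L \<theta> \<alpha> - G \<theta>))"
    using cL(1) cG2 by (auto simp: case_prod_unfold intro!: continuous_intros)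
  have osc: "cmod (G \<theta>) \<le> cmean (\<lambda>\<alpha>. cmod (L \<theta> \<alpha>))"
    "cmean (\<lambda>\<alpha>. cmod (L \<theta> \<alpha> - G \<theta>)) \<le> \<eta> * cmod (G \<theta>) + 8 / \<eta> * (cmean (\<lambda>\<alpha>. cmod (L \<theta> \<alpha>)) - cmod (G \<theta>))" for \<theta>
  proof -
    have "cmod (of_real R * cis \<theta>) < 1" using R by (simp add: norm_mult)
    then obtain \<rho> where \<rho>: "\<rho> > 1" "(\<lambda>z. g (of_real R * cis \<theta> * mob r z)) holomorphic_on ball 0 \<rho>"
      using holomorphic_mob_comp[OF g _ r] by blast
    have "g (of_real R * cis \<theta> * mob r 0) = G \<theta>" by (simp add: G_def mult_ac)
    with mean_oscillation_le[OF \<rho>(2,1) \<eta>] show "cmod (G \<theta>) \<le> cmean (\<lambda>\<alpha>. cmod (L \<theta> \<alpha>))"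
      "cmean (\<lambda>\<alpha>. cmod (L \<theta> \<alpha> - G \<theta>)) \<le> \<eta> * cmod (G \<theta>) + 8 / \<eta> * (cmean (\<lambda>\<alpha>. cmod (L \<theta> \<alpha>)) - cmod (G \<theta>))"
      by (simp_all only: L_def)
  qed
  have M_rR: "H1_mean g (r * R) = cmean (\<lambda>\<theta>. cmod (G \<theta>))" by (simp only: H1_mean_cmean G_def)
  have M_R: "cmean (\<lambda>\<theta>. cmean (\<lambda>\<alpha>. cmod (L \<theta> \<alpha>))) = H1_mean g R"
  proof -
    have "cmean (\<lambda>\<theta>. cmod (L \<theta> \<alpha>)) = H1_mean g R" for \<alpha>
    proof -
      have "continuous_on UNIV (\<lambda>t. cmod (g (of_real R * cis t)))"
        by (intro continuous_on_norm continuous_on_circle[OF g R] continuous_on_id)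
      from cmean_rotate[of "\<lambda>z. cmod (g (of_real R * z))", OF this nb] show ?thesis
        by (simp add: L_def H1_mean_cmean mult.assoc)
    qed
    then show ?thesis by (subst cmean_swap[OF cLa]) simp
  qed
  have cLm: "continuous_on UNIV (\<lambda>\<theta>. cmean (\<lambda>\<alpha>. cmod (L \<theta> \<alpha>)))" by (rule continuous_on_cmean[OF cLa])
  show "H1_mean g (r * R) \<le> H1_mean g R"
    unfolding M_rR M_R[symmetric] using osc(1) by (intro cmean_mono cLm continuous_intros cG) auto
  have "cmean (\<lambda>\<theta>. cmean (\<lambda>\<alpha>. cmod (L \<theta> \<alpha> - G \<theta>))) \<le>
     cmean (\<lambda>\<theta>. \<eta> * cmod (G \<theta>) + 8 / \<eta> * (cmean (\<lambda>\<alpha>. cmod (L \<theta> \<alpha>)) - cmod (G \<theta>)))"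
    using osc(2) by (intro cmean_mono continuous_on_cmean[OF cLd] continuous_intros cLm cG) auto
  also have "\<dots> = \<eta> * H1_mean g (r * R) + 8 / \<eta> * (H1_mean g R - H1_mean g (r * R))"
  proof -
    have c: "continuous_on UNIV (\<lambda>\<theta>. \<eta> * cmod (G \<theta>))"
      "continuous_on UNIV (\<lambda>\<theta>. 8 / \<eta> * (cmean (\<lambda>\<alpha>. cmod (L \<theta> \<alpha>)) - cmod (G \<theta>)))"
      "continuous_on UNIV (\<lambda>\<theta>. cmod (G \<theta>))"
      using \<eta> by (intro continuous_intros cLm cG; simp)+
    show ?thesis
      unfolding cmean_add[OF c(1,2)] cmean_cmul cmean_diff[OF cLm c(3)] M_R M_rR ..
  qed
  finally have le: "cmean (\<lambda>\<theta>. cmean (\<lambda>\<alpha>. cmod (L \<theta> \<alpha> - G \<theta>))) \<le> \<eta> * H1_mean g (r * R) + 8 / \<eta> * (H1_mean g R - H1_mean g (r * R))" .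
  \<comment> \<open>Rotating \<open>\<theta>\<close> by the conjugate of
    \<open>mob r (cis \<alpha>)\<close> removes the automorphism from the first term of
    \<open>L - G\<close> and puts its conjugate into the second. Averaging over
    \<open>\<alpha>\<close> inside the modulus then evaluates the second term at the centre, which
    contributes another factor \<open>r\<close>; hence the dilation by \<open>r^2\<close>.\<close>
  define E where "E \<theta> \<alpha> = g (of_real R * cis \<theta>) - g (of_real (r * R) * cis \<theta> * cnj (mob r (cis \<alpha>)))" for \<theta> \<alpha>
  have cE: "continuous_on UNIV (\<lambda>(\<theta>, \<alpha>). E \<theta> \<alpha>)" "continuous_on UNIV (\<lambda>(\<alpha>, \<theta>). E \<theta> \<alpha>)"
    unfolding E_def case_prod_unfold using R rR
    by (auto intro!: continuous_on_ball_comp[OF g] continuous_intros cb simp: norm_mult nb abs_mult)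
  have cEa: "continuous_on UNIV (\<lambda>(\<theta>, \<alpha>). cmod (E \<theta> \<alpha>))"
    using cE(1) by (auto simp: case_prod_unfold intro!: continuous_intros)
  have cE1: "continuous_on UNIV (\<lambda>\<alpha>. E \<theta> \<alpha>)" for \<theta>
  proof -
    have "continuous_on UNIV (\<lambda>\<alpha>. (\<theta>, \<alpha>))" by (intro continuous_on_Pair continuous_on_const continuous_on_id)
    from continuous_on_compose2[OF cE(1) this] show ?thesis by simp
  qed
  have rot: "cmean (\<lambda>\<theta>. cmod (L \<theta> \<alpha> - G \<theta>)) = cmean (\<lambda>\<theta>. cmod (E \<theta> \<alpha>))" for \<alpha>
  proof -
    let ?b = "mob r (cis \<alpha>)"
    let ?u = "\<lambda>z. cmod (g (of_real R * z) - g (of_real (r * R) * z * cnj ?b))"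
    have bb: "?b * cnj ?b = 1" using nb[of \<alpha>] complex_norm_square[of ?b] by simp
    have "cmean (\<lambda>t. ?u (cis t * ?b)) = cmean (\<lambda>t. ?u (cis t))"
    proof (rule cmean_rotate[OF _ nb])
      have "continuous_on UNIV (\<lambda>t. E t \<alpha>)"
      proof -
        have "continuous_on UNIV (\<lambda>t. (t, \<alpha>))" by (intro continuous_on_Pair continuous_on_const continuous_on_id)
        from continuous_on_compose2[OF cE(1) this] show ?thesis by simp
      qed
      then show "continuous_on UNIV (\<lambda>t. ?u (cis t))" unfolding E_def by (rule continuous_on_norm)
    qed
    moreover have "?u (cis t * ?b) = cmod (L t \<alpha> - G t)" for t
    proof -
      have "of_real (r * R) * (cis t * ?b) * cnj ?b = of_real (r * R) * cis t * (?b * cnj ?b)" by (simp only: mult_ac)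
      then show ?thesis unfolding L_def G_def bb by (simp only: mult.assoc mult_1_right)
    qed
    ultimately show ?thesis by (simp add: E_def)
  qed
  have "H1_mean (\<lambda>z. g z - g (of_real (r\<^sup>2) * z)) R = cmean (\<lambda>\<theta>. cmod (cmean (E \<theta>)))"
  proof -
    have "cmean (E \<theta>) = g (of_real R * cis \<theta>) - g (of_real (r\<^sup>2) * (of_real R * cis \<theta>))" for \<theta>
    proof -
      have n: "cmod (of_real (r * R) * cis \<theta>) < 1" using rR by (simp add: norm_mult abs_mult)
      then obtain \<rho> where \<rho>: "\<rho> > 1" "(\<lambda>z. g (of_real (r * R) * cis \<theta> * mob r z)) holomorphic_on ball 0 \<rho>"
        using holomorphic_mob_comp[OF g _ r] by blast
      have "cmean (\<lambda>\<alpha>. g (of_real (r * R) * cis \<theta> * cnj (mob r (cis \<alpha>)))) = g (of_real (r * R) * cis \<theta> * of_real r)"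
        using mean_value_circle(2)[OF \<rho>(2,1)] by (simp add: cnj_mob)
      moreover have "continuous_on UNIV (\<lambda>\<alpha>. g (of_real (r * R) * cis \<theta> * cnj (mob r (cis \<alpha>))))"
        using n by (intro continuous_on_ball_comp[OF g] continuous_intros continuous_on_mob r) (simp add: norm_mult nb)
      ultimately show ?thesis
        unfolding E_def by (subst cmean_diff) (auto simp: power2_eq_square mult_ac)
    qed
    then show ?thesis by (simp add: H1_mean_cmean)
  qed
  also have "\<dots> \<le> cmean (\<lambda>\<theta>. cmean (\<lambda>\<alpha>. cmod (E \<theta> \<alpha>)))"
    using norm_cmean_le[OF cE1] by (intro cmean_mono continuous_on_cmean[OF cEa] continuous_on_norm continuous_on_cmean[OF cE(1)]) auto
  also have "\<dots> = cmean (\<lambda>\<alpha>. cmean (\<lambda>\<theta>. cmod (E \<theta> \<alpha>)))" by (rule cmean_swap[OF cEa])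
  also have "\<dots> = cmean (\<lambda>\<alpha>. cmean (\<lambda>\<theta>. cmod (L \<theta> \<alpha> - G \<theta>)))" by (simp add: rot)
  also have "\<dots> = cmean (\<lambda>\<theta>. cmean (\<lambda>\<alpha>. cmod (L \<theta> \<alpha> - G \<theta>)))" by (rule cmean_swap[OF cLd, symmetric])
  also note le
  finally show "H1_mean (\<lambda>z. g z - g (of_real (r\<^sup>2) * z)) R \<le> \<eta> * H1_mean g (r * R) + 8 / \<eta> * (H1_mean g R - H1_mean g (r * R))" .
qed

lemma H1_mean_mono:
  assumes g: "g holomorphic_on ball 0 1" and s: "0 \<le> s" "s \<le> R" "R < 1"
  shows "H1_mean g s \<le> H1_mean g R"
proof (cases "s = R")
  case False
  have "H1_mean g (s / R * R) \<le> H1_mean g R"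
    using s False by (intro dilation_oscillation(1)[OF g, of _ _ 1]) auto
  then show ?thesis using s False by simp
qed simp

lemma H1_mean_nonneg: "g holomorphic_on ball 0 1 \<Longrightarrow> 0 \<le> r \<Longrightarrow> r < 1 \<Longrightarrow> 0 \<le> H1_mean g r"
  unfolding H1_mean_cmean by (intro cmean_nonneg continuous_intros continuous_on_circle) auto

section \<open>The norm of \<open>H1\<close>, coefficient bounds and approximation by
  dilations\<close>

lemma H1D: "g \<in> H1 \<Longrightarrow> g holomorphic_on ball 0 1" "g \<in> H1 \<Longrightarrow> bdd_above (H1_mean g ` {0..<1})"
  by (auto simp: H1_def)

lemma H1_mean_le_norm: "g \<in> H1 \<Longrightarrow> 0 \<le> r \<Longrightarrow> r < 1 \<Longrightarrow> H1_mean g r \<le> H1_norm g"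
  unfolding H1_norm_def by (intro cSUP_upper) (auto simp: H1_def)

lemma H1_norm_nonneg: "g \<in> H1 \<Longrightarrow> 0 \<le> H1_norm g"
  using H1_mean_le_norm[of g 0] H1_mean_nonneg[of g 0] H1D(1)[of g] by force

lemma H1I:
  assumes "g holomorphic_on ball 0 1" "\<And>r. 0 \<le> r \<Longrightarrow> r < 1 \<Longrightarrow> H1_mean g r \<le> B"
  shows "g \<in> H1" "H1_norm g \<le> B"
  using assms unfolding H1_def H1_norm_def
  by (auto intro!: bdd_aboveI2[of _ _ B] cSUP_least)

lemma H1_linear:
  assumes f: "f \<in> H1" and g: "g \<in> H1"
  shows "(\<lambda>z. a * f z + b * g z) \<in> H1" "H1_norm (\<lambda>z. a * f z + b * g z) \<le> cmod a * H1_norm f + cmod b * H1_norm g"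
proof -
  have h: "(\<lambda>z. a * f z + b * g z) holomorphic_on ball 0 1"
    using f g by (intro holomorphic_intros H1D)
  have m: "H1_mean (\<lambda>z. a * f z + b * g z) r \<le> cmod a * H1_norm f + cmod b * H1_norm g" if r: "0 \<le> r" "r < 1" for r
  proof -
    have c: "continuous_on UNIV (\<lambda>t. f (of_real r * cis t))" "continuous_on UNIV (\<lambda>t. g (of_real r * cis t))"
      by (intro continuous_on_circle H1D f g r continuous_intros)+
    have c': "continuous_on UNIV (\<lambda>t. cmod a * cmod (f (of_real r * cis t)))" "continuous_on UNIV (\<lambda>t. cmod b * cmod (g (of_real r * cis t)))"
      by (intro continuous_intros c)+
    have "H1_mean (\<lambda>z. a * f z + b * g z) r \<le> cmean (\<lambda>t. cmod a * cmod (f (of_real r * cis t)) + cmod b * cmod (g (of_real r * cis t)))"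
      unfolding H1_mean_cmean
      by (intro cmean_mono continuous_intros c) (metis norm_mult norm_triangle_ineq)
    also have "\<dots> = cmod a * H1_mean f r + cmod b * H1_mean g r"
      unfolding cmean_add[OF c'] cmean_cmul H1_mean_cmean ..
    also have "\<dots> \<le> cmod a * H1_norm f + cmod b * H1_norm g"
      by (intro add_mono mult_left_mono H1_mean_le_norm f g r) auto
    finally show ?thesis .
  qed
  from H1I[OF h m] show "(\<lambda>z. a * f z + b * g z) \<in> H1" "H1_norm (\<lambda>z. a * f z + b * g z) \<le> cmod a * H1_norm f + cmod b * H1_norm g"
    by auto
qed

lemma H1_diff:
  assumes "f \<in> H1" "g \<in> H1"
  shows "(\<lambda>z. f z - g z) \<in> H1" "H1_norm (\<lambda>z. f z - g z) \<le> H1_norm f + H1_norm g"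
  using H1_linear[OF assms, of 1 "-1"] by auto

lemma norm_taylor_coeff_le_mean:
  assumes g: "g holomorphic_on ball 0 1" and r: "0 \<le> r" "r < 1"
  shows "cmod (taylor_coeff g k) * r ^ k \<le> H1_mean g r"
proof -
  have eq: "g (of_real r * cis t) = pser (\<lambda>k. taylor_coeff g k * of_real r ^ k) (cis t)" for t
    by (rule holomorphic_dilated_eq_pser[OF g r]) simp
  have "cmod (taylor_coeff g k * of_real r ^ k) = cmod (cmean (\<lambda>t. g (of_real r * cis t) * cis (- (real k * t))))"
    unfolding eq cmean_pser_cis[OF summable_dilated_taylor[OF g r]] ..
  also have "\<dots> \<le> cmean (\<lambda>t. norm (g (of_real r * cis t) * cis (- (real k * t))))"
    by (intro norm_cmean_le continuous_intros continuous_on_circle g r)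
  also have "\<dots> = H1_mean g r" by (simp add: norm_mult H1_mean_cmean)
  finally show ?thesis using r by (simp add: norm_mult norm_power)
qed

lemma norm_taylor_coeff_le:
  assumes "g \<in> H1" shows "cmod (taylor_coeff g k) \<le> H1_norm g"
proof (rule tendsto_le[OF trivial_limit_at_left_real tendsto_const])
  show "((\<lambda>r::real. cmod (taylor_coeff g k) * r ^ k) \<longlongrightarrow> cmod (taylor_coeff g k)) (at_left 1)"
    using tendsto_mult[OF tendsto_const[of "cmod (taylor_coeff g k)"] tendsto_power[OF tendsto_ident_at[of "1::real" "{..<1}"], of k]] by simp
  have "eventually (\<lambda>r::real. r \<in> {0<..<1}) (at_left 1)" by (rule eventually_at_left_real) auto
  then show "eventually (\<lambda>r::real. cmod (taylor_coeff g k) * r ^ k \<le> H1_norm g) (at_left 1)"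
  proof eventually_elim
    case (elim r)
    then have r: "0 \<le> r" "r < 1" by auto
    show ?case
      using norm_taylor_coeff_le_mean[OF H1D(1)[OF assms] r] H1_mean_le_norm[OF assms r] by (rule order_trans)
  qed
qed

lemma holomorphic_dilate:
  assumes "g holomorphic_on ball 0 1" "0 \<le> s" "s \<le> 1"
  shows "(\<lambda>z. g (of_real s * z)) holomorphic_on ball 0 1"
proof (rule holomorphic_on_compose_gen[OF _ assms(1), unfolded o_def])
  show "(\<lambda>z. complex_of_real s * z) ` ball 0 1 \<subseteq> ball 0 1"
  proof (rule image_subsetI)
    fix z :: complex assume "z \<in> ball 0 1"
    then show "of_real s * z \<in> ball 0 1"
      using assms mult_left_le_one_le[of "cmod z" s] by (simp add: norm_mult)
  qed
qed (intro holomorphic_intros)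

lemma taylor_coeff_dilate:
  assumes g: "g holomorphic_on ball 0 1" and s: "0 \<le> s" "s \<le> 1"
  shows "taylor_coeff (\<lambda>z. g (of_real s * z)) = (\<lambda>k. taylor_coeff g k * of_real s ^ k)"
proof (rule taylor_coeff_eqI)
  fix z :: complex assume "z \<in> ball 0 1"
  then have "cmod (of_real s * z) < 1" using s mult_left_le_one_le[of "cmod z" s] by (simp add: norm_mult)
  from taylor_sums[OF g this] show "(\<lambda>k. taylor_coeff g k * of_real s ^ k * z ^ k) sums g (of_real s * z)"
    by (simp add: power_mult_distrib mult.assoc)
qed

text \<open>The means increase to \<open>H1_norm g\<close>, so beyond some radius \<open>r0\<close>
  their growth is negligible and \<open>dilation_oscillation\<close> makes the difference from the
  dilation by \<open>r^2\<close> small, uniformly in the radius.\<close>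

lemma H1_dilate_dense:
  assumes g: "g \<in> H1" and e: "e > 0"
  obtains s where "0 \<le> s" "s < 1" "(\<lambda>z. g (of_real s * z)) \<in> H1" "H1_norm (\<lambda>z. g z - g (of_real s * z)) \<le> e"
proof -
  note h = H1D(1)[OF g]
  define N where "N = H1_norm g"
  have N: "N \<ge> 0" unfolding N_def by (rule H1_norm_nonneg[OF g])
  \<comment> \<open>The error \<open>e\<close> is shared equally:
    \<open>\<eta> * N \<le> e / 2\<close>, and a growth of at most \<open>e * \<eta> / 16\<close>,
    multiplied by \<open>8 / \<eta>\<close>, gives the other half.\<close>
  define \<eta> where "\<eta> = min 1 (e / (2 * (N + 1)))"
  have \<eta>: "0 < \<eta>" "\<eta> \<le> 1" using e N by (auto simp: \<eta>_def)
  have \<eta>N: "\<eta> * N \<le> e / 2"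
  proof -
    have "\<eta> * N \<le> e / (2 * (N + 1)) * (N + 1)" using N e by (intro mult_mono) (auto simp: \<eta>_def)
    also have "\<dots> = e / 2" using N by (simp add: field_simps)
    finally show ?thesis .
  qed
  have "N - e * \<eta> / 16 < N" using e \<eta> by simp
  then obtain r0 where r0: "0 \<le> r0" "r0 < 1" "N - e * \<eta> / 16 < H1_mean g r0"
    using less_cSUP_iff[of "{0..<1::real}" "H1_mean g" "N - e * \<eta> / 16"] H1D(2)[OF g] unfolding N_def H1_norm_def by auto
  obtain r where r: "r0 < r" "r < 1" using r0(2) dense by blast
  have r': "0 \<le> r" using r r0 by simp
  have s: "0 \<le> r\<^sup>2" "r\<^sup>2 < 1" using r r' by (auto simp: power_less_one_iff)
  have hd: "(\<lambda>z. g (of_real (r\<^sup>2) * z)) holomorphic_on ball 0 1"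
    using s by (intro holomorphic_dilate h) auto
  have hs: "(\<lambda>z. g z - g (of_real (r\<^sup>2) * z)) holomorphic_on ball 0 1"
    by (intro holomorphic_on_diff h hd)
  have m: "H1_mean (\<lambda>z. g z - g (of_real (r\<^sup>2) * z)) R \<le> e" if R: "0 \<le> R" "R < 1" for R
  proof -
    have "r0 / r < 1" using r r0 by simp
    \<comment> \<open>The growth estimate needs \<open>r * Q \<ge> r0\<close>. Smaller radii are
      moved out to \<open>Q\<close> by monotonicity of the means of the difference.\<close>
    define Q where "Q = max R (r0 / r)"
    have Q: "0 \<le> Q" "Q < 1" "R \<le> Q" "r0 \<le> r * Q"
      using R r r0 by (auto simp: Q_def max_def field_simps)
    have "r * Q \<le> Q" using Q r r' by (intro mult_left_le_one_le) auto
    then have rQ: "r * Q < 1" "0 \<le> r * Q" using Q r' by auto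
    have "H1_mean (\<lambda>z. g z - g (of_real (r\<^sup>2) * z)) R \<le> H1_mean (\<lambda>z. g z - g (of_real (r\<^sup>2) * z)) Q"
      by (rule H1_mean_mono[OF hs R(1) Q(3,2)])
    also have "\<dots> \<le> \<eta> * H1_mean g (r * Q) + 8 / \<eta> * (H1_mean g Q - H1_mean g (r * Q))"
      by (rule dilation_oscillation(2)[OF h Q(1,2) r' r(2) \<eta>])
    also have "\<dots> \<le> \<eta> * N + 8 / \<eta> * (e * \<eta> / 16)"
    proof (intro add_mono mult_left_mono)
      show "H1_mean g (r * Q) \<le> N" unfolding N_def using rQ by (intro H1_mean_le_norm g) auto
      have "H1_mean g Q \<le> N" unfolding N_def using Q by (intro H1_mean_le_norm g) auto
      moreover have "H1_mean g r0 \<le> H1_mean g (r * Q)" by (rule H1_mean_mono[OF h r0(1) Q(4) rQ(1)])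
      ultimately show "H1_mean g Q - H1_mean g (r * Q) \<le> e * \<eta> / 16" using r0(3) by linarith
    qed (use \<eta> in auto)
    also have "\<dots> \<le> e" using \<eta>N \<eta> by simp
    finally show ?thesis .
  qed
  note d = H1I[OF hs m]
  have "(\<lambda>z. g z - (g z - g (of_real (r\<^sup>2) * z))) \<in> H1" by (rule H1_diff(1)[OF g d(1)])
  then have "(\<lambda>z. g (of_real (r\<^sup>2) * z)) \<in> H1" by simp
  with d(2) s that show ?thesis by blast
qed

section \<open>A weak-type estimate for radial maximal functions\<close>

lemma integral_period_symmetric:
  fixes u :: "real \<Rightarrow> real"
  assumes c: "continuous_on UNIV u" and per: "\<And>t. u (t + 2*pi) = u t"
  shows "integral {0..2*pi} u = integral {0..pi} (\<lambda>s. u s + u (- s))"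
proof -
  have cr: "continuous_on UNIV (\<lambda>s. u (- s))"
    by (rule continuous_on_compose2[OF c]) (auto intro!: continuous_intros)
  have "integral {0..2*pi} u = integral {0..pi} u + integral {pi..2*pi} u"
    by (intro Henstock_Kurzweil_Integration.integral_combine[symmetric] continuous_integrable c) auto
  also have "integral {pi..2*pi} u = integral {-pi..0} u"
    using integral_shift_Icc_real[of "-pi" 0 u "2*pi"] per by (simp add: o_def add.commute)
  also have "\<dots> = integral {0..pi} (\<lambda>s. u (- s))"
    using Henstock_Kurzweil_Integration.integral_reflect_real[of pi 0 "\<lambda>s. u (- s)"] by simp
  finally show ?thesis
    by (simp add: integral_add continuous_integrable c cr)
qed

lemma pk_real:
  assumes "0 \<le> r" "r < 1"
  shows "pk (of_real r) s = (1 - r\<^sup>2) / (1 - 2 * r * cos s + r\<^sup>2)" "1 - 2 * r * cos s + r\<^sup>2 > 0"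
proof -
  have "(cmod (cis s - of_real r))\<^sup>2 = (cos s - r)\<^sup>2 + (sin s)\<^sup>2" by (simp add: cmod_power2)
  also have "\<dots> = ((sin s)\<^sup>2 + (cos s)\<^sup>2) - 2 * r * cos s + r\<^sup>2" by (simp only: power2_eq_square) (simp add: algebra_simps)
  finally have eq: "(cmod (cis s - of_real r))\<^sup>2 = 1 - 2 * r * cos s + r\<^sup>2" by simp
  then show "pk (of_real r) s = (1 - r\<^sup>2) / (1 - 2 * r * cos s + r\<^sup>2)" by (simp add: pk_def)
  show "1 - 2 * r * cos s + r\<^sup>2 > 0"
    unfolding eq[symmetric] using cis_diff_nonzero[of "of_real r" s] assms by simp
qed

text \<open>The Poisson kernel is even and decreasing on \<open>[0, \<pi>]\<close>, so integrating by parts against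
  \<open>2 \<mu> \<delta> - \<integral>\<^sub>0\<^sup>\<delta> \<psi> \<ge> 0\<close> bounds a Poisson average by averages over centred intervals.\<close>

lemma Poisson_le_interval_averages:
  fixes \<phi> :: "real \<Rightarrow> real"
  assumes c: "continuous_on UNIV \<phi>" and per: "\<And>t. \<phi> (t + 2*pi) = \<phi> t" and r: "0 \<le> r" "r < 1"
    and av: "\<And>\<delta>. 0 < \<delta> \<Longrightarrow> \<delta> \<le> pi \<Longrightarrow> integral {t - \<delta>..t + \<delta>} \<phi> \<le> 2 * \<delta> * \<mu>"
  shows "cmean (\<lambda>s. pk (of_real r) s * \<phi> (t + s)) \<le> \<mu>"
proof -
  define P where "P = pk (of_real r)"
  have r': "cmod (of_real r) < 1" using r by simp
  have cP: "continuous_on UNIV P" unfolding P_def by (rule continuous_on_pk[OF r'])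
  have P0: "0 \<le> P s" for s unfolding P_def by (rule pk_nonneg[OF r'])
  have Pev: "P (- s) = P s" and Pper: "P (s + 2*pi) = P s" for s
    unfolding P_def pk_real(1)[OF r] by (simp_all add: cos_periodic)
  define \<psi> where "\<psi> s = \<phi> (t + s) + \<phi> (t - s)" for s
  have c1: "continuous_on UNIV (\<lambda>s. \<phi> (t + s))" "continuous_on UNIV (\<lambda>s. \<phi> (t - s))"
    by (auto intro!: continuous_on_compose2[OF c] continuous_intros)
  have c\<psi>: "continuous_on UNIV \<psi>" unfolding \<psi>_def by (intro continuous_intros c1)
  have per1: "\<phi> (t + (s + 2*pi)) = \<phi> (t + s)" for s using per[of "t + s"] by (simp add: add.assoc)
  have IPs: "integral {0..2*pi} (\<lambda>s. P s * \<phi> (t + s)) = integral {0..pi} (\<lambda>s. P s * \<psi> s)"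
  proof -
    have "continuous_on UNIV (\<lambda>s. P s * \<phi> (t + s))" by (intro continuous_intros cP c1)
    moreover have "P (s + 2*pi) * \<phi> (t + (s + 2*pi)) = P s * \<phi> (t + s)" for s by (simp only: Pper per1)
    ultimately have "integral {0..2*pi} (\<lambda>s. P s * \<phi> (t + s)) = integral {0..pi} (\<lambda>s. P s * \<phi> (t + s) + P (- s) * \<phi> (t + - s))"
      by (rule integral_period_symmetric)
    then show ?thesis by (simp add: Pev \<psi>_def distrib_left)
  qed
  have IP: "integral {0..pi} P = pi"
  proof -
    have "integral {0..2*pi} P = 2 * pi"
      using cmean_pk[OF r'] by (simp add: cmean_def P_def field_simps)
    moreover have "integral {0..2*pi} P = integral {0..pi} (\<lambda>s. P s + P (- s))"
      by (rule integral_period_symmetric[OF cP Pper])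
    moreover have "integral {0..pi} (\<lambda>s. P s + P (- s)) = 2 * integral {0..pi} P"
      by (simp add: Pev flip: mult_2)
    ultimately show ?thesis by simp
  qed
  define \<Xi> where "\<Xi> \<delta> = 2 * \<delta> * \<mu> - integral {0..\<delta>} \<psi>" for \<delta>
  have \<Xi>0: "0 \<le> \<Xi> \<delta>" if \<delta>: "0 \<le> \<delta>" "\<delta> \<le> pi" for \<delta>
  proof (cases "\<delta> = 0")
    case False
    have "integral {0..\<delta>} \<psi> = integral {0..\<delta>} (\<lambda>s. \<phi> (t + s)) + integral {0..\<delta>} (\<lambda>s. \<phi> (t - s))"
      unfolding \<psi>_def by (intro integral_add continuous_integrable c1)
    also have "integral {0..\<delta>} (\<lambda>s. \<phi> (t + s)) = integral {t..t + \<delta>} \<phi>"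
      using integral_shift_Icc_real[of 0 \<delta> \<phi> t] by (simp add: o_def add.commute)
    also have "integral {0..\<delta>} (\<lambda>s. \<phi> (t - s)) = integral {-\<delta>..0} (\<lambda>s. \<phi> (t + s))"
      using Henstock_Kurzweil_Integration.integral_reflect_real[of \<delta> 0 "\<lambda>s. \<phi> (t - s)"] by simp
    also have "\<dots> = integral {t - \<delta>..t} \<phi>"
      using integral_shift_Icc_real[of "-\<delta>" 0 \<phi> t] by (simp add: o_def add.commute)
    also have "integral {t..t + \<delta>} \<phi> + integral {t - \<delta>..t} \<phi> = integral {t - \<delta>..t + \<delta>} \<phi>"
      using Henstock_Kurzweil_Integration.integral_combine[of "t - \<delta>" t "t + \<delta>" \<phi>] \<delta> continuous_integrable[OF c] by simp
    finally show ?thesis using av[of \<delta>] \<delta> False by (simp add: \<Xi>_def)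
  qed (simp add: \<Xi>_def)
  define P' where "P' s = - ((1 - r\<^sup>2) * (2 * r * sin s) / (1 - 2 * r * cos s + r\<^sup>2)\<^sup>2)" for s
  have dP: "(P has_real_derivative P' s) (at s within S)" for s S
    using pk_real(2)[OF r, of s] unfolding P_def pk_real(1)[OF r, abs_def] P'_def
    by (auto intro!: derivative_eq_intros simp: power2_eq_square mult_ac)
  have d\<Xi>: "(\<Xi> has_real_derivative (2 * \<mu> - \<psi> s)) (at s within {0..pi})" if "s \<in> {0..pi}" for s
    using integral_has_real_derivative[of 0 pi \<psi> s] continuous_on_subset[OF c\<psi>] that
    unfolding \<Xi>_def by (auto intro!: derivative_eq_intros)
  have "((\<lambda>s. P' s * \<Xi> s + P s * (2 * \<mu> - \<psi> s)) has_integral (P pi * \<Xi> pi - P 0 * \<Xi> 0)) {0..pi}"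
    by (rule fundamental_theorem_of_calculus)
       (auto intro!: derivative_eq_intros dP d\<Xi> simp flip: has_real_derivative_iff_has_vector_derivative)
  then have FT: "integral {0..pi} (\<lambda>s. P' s * \<Xi> s + P s * (2 * \<mu> - \<psi> s)) = P pi * \<Xi> pi"
    by (auto dest!: integral_unique simp: \<Xi>_def)
  have c\<Xi>: "continuous_on {0..pi} \<Xi>" by (rule DERIV_continuous_on) (rule d\<Xi>)
  have cP': "continuous_on {0..pi} P'" unfolding P'_def
    using pk_real(2)[OF r] by (intro continuous_intros) (metis less_irrefl zero_eq_power2)
  have i1: "(\<lambda>s. P' s * \<Xi> s) integrable_on {0..pi}"
    by (intro integrable_continuous_interval continuous_intros c\<Xi> cP')
  have i2: "(\<lambda>s. P s * (2 * \<mu> - \<psi> s)) integrable_on {0..pi}"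
    by (intro continuous_integrable continuous_intros cP c\<psi>)
  have "integral {0..pi} (\<lambda>s. P' s * \<Xi> s) \<le> integral {0..pi} (\<lambda>s. 0)"
  proof (rule integral_le[OF i1])
    fix s assume s: "s \<in> {0..pi}"
    have "P' s \<le> 0"
    proof -
      have "0 \<le> (1 - r\<^sup>2) * (2 * r * sin s)" using s r by (intro mult_nonneg_nonneg sin_ge_zero) (auto simp: power_le_one)
      then have "0 \<le> ((1 - r\<^sup>2) * (2 * r * sin s)) / (1 - 2 * r * cos s + r\<^sup>2)\<^sup>2" by (rule divide_nonneg_nonneg) simp
      then show ?thesis unfolding P'_def by (simp only: neg_le_0_iff_le)
    qed
    then show "P' s * \<Xi> s \<le> 0" using \<Xi>0 s by (auto intro: mult_nonpos_nonneg)
  qed (rule integrable_const_ivl)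
  moreover have "0 \<le> P pi * \<Xi> pi" by (intro mult_nonneg_nonneg P0 \<Xi>0) auto
  ultimately have "0 \<le> integral {0..pi} (\<lambda>s. P s * (2 * \<mu> - \<psi> s))"
    using FT integral_add[OF i1 i2] by simp
  also have "integral {0..pi} (\<lambda>s. P s * (2 * \<mu> - \<psi> s)) = integral {0..pi} (\<lambda>s. 2 * \<mu> * P s - P s * \<psi> s)"
    by (simp add: algebra_simps)
  also have "\<dots> = 2 * \<mu> * pi - integral {0..pi} (\<lambda>s. P s * \<psi> s)"
    by (subst integral_diff) (auto intro!: continuous_integrable continuous_intros cP c\<psi> simp: IP)
  finally have "integral {0..pi} (\<lambda>s. P s * \<psi> s) \<le> 2 * pi * \<mu>" by (simp add: mult_ac)
  then show ?thesis unfolding cmean_def P_def[symmetric] IPs by (simp add: divide_le_eq mult_ac)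
qed

text \<open>If all centred averages of \<open>|f|^2\<close> were at most \<open>lam\<close>, so
  would be its Poisson mean at the given point, which dominates \<open>|f|^2\<close> there by
  \<open>Poisson_square\<close>. Twisting the coefficients by \<open>cis t ^ k\<close> moves the
  point to the real axis.\<close>

lemma radial_maximal_interval:
  assumes c: "summable (\<lambda>k. cmod (c k))" and r: "0 \<le> r" "r < 1"
    and big: "lam < (cmod (pser c (of_real r * cis t)))\<^sup>2"
  obtains \<delta> where "0 < \<delta>" "\<delta> \<le> pi" "2 * \<delta> * lam < integral {t - \<delta>..t + \<delta>} (\<lambda>s. (cmod (pser c (cis s)))\<^sup>2)"
proof -
  let ?\<phi> = "\<lambda>s. (cmod (pser c (cis s)))\<^sup>2"
  have "\<exists>\<delta>. 0 < \<delta> \<and> \<delta> \<le> pi \<and> 2 * \<delta> * lam < integral {t - \<delta>..t + \<delta>} ?\<phi>"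
  proof (rule ccontr)
    assume "\<not> (\<exists>\<delta>. 0 < \<delta> \<and> \<delta> \<le> pi \<and> 2 * \<delta> * lam < integral {t - \<delta>..t + \<delta>} ?\<phi>)"
    then have av: "integral {t - \<delta>..t + \<delta>} ?\<phi> \<le> 2 * \<delta> * lam" if "0 < \<delta>" "\<delta> \<le> pi" for \<delta>
      using that by force
    define c' where "c' k = c k * cis t ^ k" for k
    have c': "summable (\<lambda>k. cmod (c' k))" using c by (simp add: c'_def norm_mult norm_power)
    have eq: "pser c' z = pser c (z * cis t)" for z unfolding c'_def by (simp add: pser_dilate mult.commute)
    have cont: "continuous_on UNIV ?\<phi>" by (intro continuous_intros continuous_on_pser_cis c)
    have "(cmod (pser c (of_real r * cis t)))\<^sup>2 = (cmod (pser c' (of_real r)))\<^sup>2" by (simp add: eq)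
    also have "\<dots> \<le> cmean (\<lambda>s. pk (of_real r) s * (cmod (pser c' (cis s)))\<^sup>2)"
      using Poisson_square[OF c', of "of_real r"] r by simp
    also have "\<dots> = cmean (\<lambda>s. pk (of_real r) s * ?\<phi> (t + s))"
      by (simp add: eq cis_mult add.commute)
    also have "\<dots> \<le> lam"
      by (rule Poisson_le_interval_averages[OF cont _ r av]) (simp_all flip: cis_mult)
    finally show False using big by simp
  qed
  with that show ?thesis by blast
qed

lemma integral_sq_pser:
  assumes "summable (\<lambda>k. cmod (c k))"
  shows "integral {0..2*pi} (\<lambda>s. (cmod (pser c (cis s)))\<^sup>2) = 2 * pi * (n2 c)\<^sup>2"
  using Parseval_pser_norm[OF assms] n2_sq[OF summable_imp_l2[OF assms]]
  by (simp add: sums_iff cmean_def field_simps)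

text \<open>Vitali's lemma selects disjoint intervals whose fivefold enlargements cover the
  exceptional set. Each enlargement has length \<open>10 * \<delta>\<close>, at most
  \<open>5 / lam\<close> times the integral of \<open>|f|^2\<close> over the original interval. The
  covering set \<open>T\<close> is measurable by construction.\<close>

lemma weak_type_pser:
  assumes c: "summable (\<lambda>k. cmod (c k))" and lam: "lam > 0"
  obtains T where "{t \<in> {0..2*pi}. \<exists>r\<in>{0..<1}. lam < (cmod (pser c (of_real r * cis t)))\<^sup>2} \<subseteq> T"
    "T \<in> lmeasurable" "measure lebesgue T \<le> 20 * pi * (n2 c)\<^sup>2 / lam"
proof -
  define E where "E = {t \<in> {0..2*pi}. \<exists>r\<in>{0..<1}. lam < (cmod (pser c (of_real r * cis t)))\<^sup>2}"
  define \<phi> where "\<phi> s = (cmod (pser c (cis s)))\<^sup>2" for s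
  have cont: "continuous_on UNIV \<phi>" unfolding \<phi>_def by (intro continuous_intros continuous_on_pser_cis c)
  have \<phi>0: "0 \<le> \<phi> s" for s by (simp add: \<phi>_def)
  have "\<forall>t\<in>E. \<exists>\<delta>. 0 < \<delta> \<and> \<delta> \<le> pi \<and> 2 * \<delta> * lam < integral {t - \<delta>..t + \<delta>} \<phi>"
  proof
    fix t assume "t \<in> E"
    then obtain r where "0 \<le> r" "r < 1" "lam < (cmod (pser c (of_real r * cis t)))\<^sup>2" unfolding E_def by auto
    from radial_maximal_interval[OF c this] show "\<exists>\<delta>. 0 < \<delta> \<and> \<delta> \<le> pi \<and> 2 * \<delta> * lam < integral {t - \<delta>..t + \<delta>} \<phi>"
      unfolding \<phi>_def by blast
  qed
  then obtain \<delta> where \<delta>: "\<And>t. t \<in> E \<Longrightarrow> 0 < \<delta> t \<and> \<delta> t \<le> pi \<and> 2 * \<delta> t * lam < integral {t - \<delta> t..t + \<delta> t} \<phi>"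
    by metis
  have cov: "E \<subseteq> (\<Union>i\<in>E. cball i (\<delta> i))"
  proof
    fix t assume t: "t \<in> E"
    show "t \<in> (\<Union>i\<in>E. cball i (\<delta> i))" by (rule UN_I[OF t]) (use \<delta>[OF t] in simp)
  qed
  have \<delta>': "0 < \<delta> t \<and> \<delta> t \<le> pi" if "t \<in> E" for t using \<delta>[OF that] by blast
  obtain C where C: "countable C" "C \<subseteq> E" "pairwise (\<lambda>i j. disjnt (cball i (\<delta> i)) (cball j (\<delta> j))) C"
    "E \<subseteq> (\<Union>i\<in>C. cball i (5 * \<delta> i))"
    by (rule Vitali_covering_lemma_cballs[OF cov \<delta>'])
  let ?B = "20 * pi * (n2 c)\<^sup>2 / lam"
  have bound: "measure lebesgue (\<Union>i\<in>D. cball i (5 * \<delta> i)) \<le> ?B" if D: "D \<subseteq> C" "finite D" for D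
  proof -
    have DE: "D \<subseteq> E" using D(1) C(2) by (rule subset_trans)
    have "measure lebesgue (\<Union>i\<in>D. cball i (5 * \<delta> i)) \<le> (\<Sum>i\<in>D. measure lebesgue (cball i (5 * \<delta> i)))"
      by (rule measure_UNION_le[OF D(2)]) simp
    also have "\<dots> = (\<Sum>i\<in>D. 10 * \<delta> i)"
    proof (rule sum.cong[OF refl])
      fix i assume "i \<in> D"
      then have "0 < \<delta> i" using \<delta> DE by blast
      then show "measure lebesgue (cball i (5 * \<delta> i)) = 10 * \<delta> i" by (simp add: cball_eq_atLeastAtMost)
    qed
    also have "\<dots> \<le> (\<Sum>i\<in>D. 5 / lam * integral (cball i (\<delta> i)) \<phi>)"
    proof (rule sum_mono)
      fix i assume "i \<in> D"
      then have "2 * \<delta> i * lam < integral {i - \<delta> i..i + \<delta> i} \<phi>" using \<delta> DE by blast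
      then show "10 * \<delta> i \<le> 5 / lam * integral (cball i (\<delta> i)) \<phi>"
        using lam by (simp add: cball_eq_atLeastAtMost field_simps)
    qed
    also have "\<dots> = 5 / lam * (\<Sum>i\<in>D. integral (cball i (\<delta> i)) \<phi>)" by (simp add: sum_distrib_left)
    also have "(\<Sum>i\<in>D. integral (cball i (\<delta> i)) \<phi>) \<le> 4 * pi * (n2 c)\<^sup>2"
    proof -
      have hi: "(\<phi> has_integral (\<Sum>i\<in>D. integral (cball i (\<delta> i)) \<phi>)) (\<Union>i\<in>D. cball i (\<delta> i))"
      proof (rule has_integral_UN[OF D(2)])
        show "(\<phi> has_integral integral (cball i (\<delta> i)) \<phi>) (cball i (\<delta> i))" for i
          unfolding cball_eq_atLeastAtMost by (intro integrable_integral continuous_integrable cont)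
        show "pairwise (\<lambda>i i'. negligible (cball i (\<delta> i) \<inter> cball i' (\<delta> i'))) D"
          using C(3) D(1) unfolding pairwise_def disjnt_def by (metis negligible_empty subsetD)
      qed
      \<comment> \<open>Centres lie in one period and radii are at most \<open>pi\<close>, so the
        disjoint intervals fit into two periods. The integral there is
        \<open>4 * pi * (n2 c)^2\<close>, which explains the constant 20.\<close>
      have sub: "(\<Union>i\<in>D. cball i (\<delta> i)) \<subseteq> {-pi..3*pi}"
      proof
        fix x assume "x \<in> (\<Union>i\<in>D. cball i (\<delta> i))"
        then obtain i where i: "i \<in> D" "x \<in> cball i (\<delta> i)" by blast
        then have iE: "i \<in> E" using DE by blast
        then have "0 \<le> i" "i \<le> 2*pi" by (auto simp: E_def)
        moreover have "\<delta> i \<le> pi" using \<delta>'[OF iE] by simp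
        moreover have "i - \<delta> i \<le> x" "x \<le> i + \<delta> i" using i(2) by (auto simp: cball_eq_atLeastAtMost)
        ultimately show "x \<in> {-pi..3*pi}" by simp
      qed
      have "(\<Sum>i\<in>D. integral (cball i (\<delta> i)) \<phi>) = integral (\<Union>i\<in>D. cball i (\<delta> i)) \<phi>"
        using hi by (simp add: integral_unique)
      also have "\<dots> \<le> integral {-pi..3*pi} \<phi>"
        using hi \<phi>0 by (intro integral_subset_le[OF sub] continuous_integrable[OF cont]) auto
      also have "\<dots> = integral {-pi..pi} \<phi> + integral {pi..3*pi} \<phi>"
        by (intro Henstock_Kurzweil_Integration.integral_combine[symmetric] continuous_integrable cont) auto
      also have "\<dots> = 2 * integral {0..2*pi} \<phi>"
      proof -
        have per: "\<phi> (s + 2*pi) = \<phi> s" for s by (simp add: \<phi>_def flip: cis_mult)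
        have "integral {0..2*pi} (\<lambda>s. \<phi> (s + pi)) = integral {0..2*pi} \<phi>"
          using cmean_shift_nonneg[OF cont per, of pi] by (simp add: cmean_def)
        moreover have "integral {0..2*pi} (\<lambda>s. \<phi> (s + pi)) = integral {pi..3*pi} \<phi>"
          using integral_shift_Icc_real[of 0 "2*pi" \<phi> pi] by (simp add: o_def add.commute)
        moreover have "integral {-pi..pi} (\<lambda>s. \<phi> (s + 2*pi)) = integral {pi..3*pi} \<phi>"
          using integral_shift_Icc_real[of "-pi" pi \<phi> "2*pi"] by (simp add: o_def add.commute)
        ultimately show ?thesis by (simp add: per)
      qed
      also have "integral {0..2*pi} \<phi> = 2 * pi * (n2 c)\<^sup>2"
        unfolding \<phi>_def by (rule integral_sq_pser[OF c])
      finally show ?thesis by simp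
    qed
    finally show ?thesis using lam by (simp add: field_simps)
  qed
  show ?thesis
  proof (rule that[OF C(4)[unfolded E_def]])
    show "(\<Union>i\<in>C. cball i (5 * \<delta> i)) \<in> lmeasurable"
      by (rule fmeasurable_UN_bound[OF C(1) _ bound]) auto
    show "measure lebesgue (\<Union>i\<in>C. cball i (5 * \<delta> i)) \<le> ?B"
      by (rule measure_UN_bound[OF C(1) _ bound]) auto
  qed
qed

section \<open>\<open>H2\<close> as the space of square-summable coefficients\<close>

lemma H2_mean_eq:
  assumes f: "f holomorphic_on ball 0 1" and r: "0 \<le> r" "r < 1"
  shows "H2_mean f r = (n2 (\<lambda>k. taylor_coeff f k * of_real r ^ k))\<^sup>2"
proof -
  note s = summable_dilated_taylor[OF f r]
  have "H2_mean f r = cmean (\<lambda>t. (cmod (pser (\<lambda>k. taylor_coeff f k * of_real r ^ k) (cis t)))\<^sup>2)"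
    unfolding H2_mean_cmean using holomorphic_dilated_eq_pser[OF f r] by simp
  also have "\<dots> = (n2 (\<lambda>k. taylor_coeff f k * of_real r ^ k))\<^sup>2"
    using Parseval_pser_norm[OF s] n2_sq[OF summable_imp_l2[OF s]] by (simp add: sums_iff)
  finally show ?thesis .
qed

lemma l2_dilate:
  assumes "l2 c" "0 \<le> r" "r \<le> 1"
  shows "l2 (\<lambda>k. c k * of_real r ^ k)" "n2 (\<lambda>k. c k * of_real r ^ k) \<le> n2 c"
proof -
  have *: "cmod (c k * of_real r ^ k) \<le> cmod (c k)" for k
    using assms by (simp add: norm_mult norm_power mult_left_le power_le_one)
  show "l2 (\<lambda>k. c k * of_real r ^ k)" "n2 (\<lambda>k. c k * of_real r ^ k) \<le> n2 c"
    using n2_mono[OF assms(1) *] by auto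
qed

text \<open>Parseval expresses each mean through the dilated coefficients. Finite sections pass to
  the limit as \<open>r\<close> tends to 1, and conversely dilation does not increase
  \<open>n2\<close>.\<close>

lemma H2_iff: "f \<in> H2 \<longleftrightarrow> f holomorphic_on ball 0 1 \<and> l2 (taylor_coeff f)"
proof (intro iffI conjI)
  assume f: "f \<in> H2"
  then show h: "f holomorphic_on ball 0 1" by (simp add: H2_def)
  obtain B where B: "\<And>r. 0 \<le> r \<Longrightarrow> r < 1 \<Longrightarrow> H2_mean f r \<le> B"
    using f by (force simp: H2_def bdd_above_def)
  have "L2_set (\<lambda>k. cmod (taylor_coeff f k)) {..<K} \<le> sqrt B" for K
  proof (rule tendsto_le[OF trivial_limit_at_left_real tendsto_const])
    show "((\<lambda>r::real. L2_set (\<lambda>k. cmod (taylor_coeff f k * of_real r ^ k)) {..<K}) \<longlongrightarrow> L2_set (\<lambda>k. cmod (taylor_coeff f k)) {..<K}) (at_left 1)"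
    proof -
      have "((\<lambda>r::real. L2_set (\<lambda>k. cmod (taylor_coeff f k * of_real r ^ k)) {..<K}) \<longlongrightarrow> L2_set (\<lambda>k. cmod (taylor_coeff f k * of_real 1 ^ k)) {..<K}) (at_left 1)"
        unfolding L2_set_def by (intro tendsto_intros)
      then show ?thesis by simp
    qed
    have "eventually (\<lambda>r::real. r \<in> {0<..<1}) (at_left 1)" by (rule eventually_at_left_real) auto
    then show "eventually (\<lambda>r::real. L2_set (\<lambda>k. cmod (taylor_coeff f k * of_real r ^ k)) {..<K} \<le> sqrt B) (at_left 1)"
    proof eventually_elim
      case (elim r)
      then have r: "0 \<le> r" "r < 1" by auto
      have "L2_set (\<lambda>k. cmod (taylor_coeff f k * of_real r ^ k)) {..<K} \<le> n2 (\<lambda>k. taylor_coeff f k * of_real r ^ k)"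
        by (rule L2_set_le_n2[OF summable_imp_l2[OF summable_dilated_taylor[OF h r]]]) simp
      also have "\<dots> \<le> sqrt B" using B[OF r] H2_mean_eq[OF h r] by (simp add: real_le_rsqrt)
      finally show ?case .
    qed
  qed
  from n2_leI(1)[OF this] show "l2 (taylor_coeff f)" .
next
  assume f: "f holomorphic_on ball 0 1 \<and> l2 (taylor_coeff f)"
  have "H2_mean f r \<le> (n2 (taylor_coeff f))\<^sup>2" if "0 \<le> r" "r < 1" for r
    using H2_mean_eq[of f r] f that l2_dilate[of "taylor_coeff f" r]
    by (auto intro!: power_mono n2_nonneg')
  then show "f \<in> H2" using f unfolding H2_def by (auto intro!: bdd_aboveI2)
qed

text \<open>After dilation by \<open>R j\<close> the coefficients are absolutely summable and
  \<open>weak_type_pser\<close> applies with a bound independent of \<open>j\<close>. The sets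
  \<open>A j\<close> increase to the exceptional set; they are measurable because each is an
  interval intersected with a union of open sets.\<close>

lemma weak_type_H2:
  assumes f: "f holomorphic_on ball 0 1" and c: "l2 (taylor_coeff f)" and lam: "lam > 0"
  obtains T where "{t \<in> {0..2*pi}. \<exists>r\<in>{0..<1}. lam < (cmod (f (of_real r * cis t)))\<^sup>2} \<subseteq> T"
    "T \<in> lmeasurable" "measure lebesgue T \<le> 20 * pi * (n2 (taylor_coeff f))\<^sup>2 / lam"
proof -
  let ?c = "taylor_coeff f"
  let ?B = "20 * pi * (n2 ?c)\<^sup>2 / lam"
  define R where "R j = 1 - 1 / real (Suc j)" for j
  have R: "0 \<le> R j" "R j < 1" for j by (auto simp: R_def)
  have Rm: "R i \<le> R j" if "i \<le> j" for i j using that by (auto simp: R_def frac_le)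
  define A where "A j = {t \<in> {0..2*pi}. \<exists>r\<in>{0..<R j}. lam < (cmod (f (of_real r * cis t)))\<^sup>2}" for j
  have Aeq: "A j = {0..2*pi} \<inter> (\<Union>r\<in>{0..<R j}. {t. lam < (cmod (f (of_real r * cis t)))\<^sup>2})" for j
    by (auto simp: A_def)
  have Am: "A j \<in> lmeasurable" for j
  proof -
    have "open (\<Union>r\<in>{0..<R j}. {t. lam < (cmod (f (of_real r * cis t)))\<^sup>2})"
    proof (intro open_UN ballI open_Collect_less)
      fix r assume r: "r \<in> {0..<R j}"
      show "continuous_on UNIV (\<lambda>t. (cmod (f (of_real r * cis t)))\<^sup>2)"
        using r R(2)[of j] by (intro continuous_intros continuous_on_circle[OF f]) auto
    qed auto
    then have "(\<Union>r\<in>{0..<R j}. {t. lam < (cmod (f (of_real r * cis t)))\<^sup>2}) \<in> sets lebesgue"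
      by (auto intro: borel_open)
    then show ?thesis unfolding Aeq
      by (intro fmeasurable_Int_fmeasurable) (auto simp: lmeasurable_iff_integrable_on)
  qed
  have Ab: "measure lebesgue (A j) \<le> ?B" for j
  proof -
    note s = summable_dilated_taylor[OF f R(1,2)[of j]]
    obtain T where T: "{t \<in> {0..2*pi}. \<exists>r\<in>{0..<1}. lam < (cmod (pser (\<lambda>k. ?c k * of_real (R j) ^ k) (of_real r * cis t)))\<^sup>2} \<subseteq> T"
      "T \<in> lmeasurable" "measure lebesgue T \<le> 20 * pi * (n2 (\<lambda>k. ?c k * of_real (R j) ^ k))\<^sup>2 / lam"
      using weak_type_pser[OF s lam] by blast
    have "A j \<subseteq> T"
    proof
      fix t assume "t \<in> A j"
      then obtain r where t: "t \<in> {0..2*pi}" and r: "0 \<le> r" "r < R j" "lam < (cmod (f (of_real r * cis t)))\<^sup>2"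
        by (auto simp: A_def)
      have Rp: "R j > 0" using r by linarith
      have q: "0 \<le> r / R j" "r / R j < 1" using r Rp by auto
      have "f (of_real r * cis t) = f (of_real (R j) * (of_real (r / R j) * cis t))" using Rp by simp
      also have "\<dots> = pser (\<lambda>k. ?c k * of_real (R j) ^ k) (of_real (r / R j) * cis t)"
        using q by (intro holomorphic_dilated_eq_pser[OF f R]) (simp add: norm_mult del: of_real_divide)
      finally have "lam < (cmod (pser (\<lambda>k. ?c k * of_real (R j) ^ k) (of_real (r / R j) * cis t)))\<^sup>2"
        using r(3) by simp
      then show "t \<in> T" using T(1) t q by force
    qed
    then have "measure lebesgue (A j) \<le> measure lebesgue T"
      using T(2) Am by (intro measure_mono_fmeasurable) auto
    also have "\<dots> \<le> ?B"
    proof -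
      have "(n2 (\<lambda>k. ?c k * of_real (R j) ^ k))\<^sup>2 \<le> (n2 ?c)\<^sup>2"
        using l2_dilate[OF c R(1)[of j]] R(2)[of j] by (intro power_mono n2_nonneg') auto
      then have "20 * pi * (n2 (\<lambda>k. ?c k * of_real (R j) ^ k))\<^sup>2 / lam \<le> ?B"
        using lam by (intro divide_right_mono mult_left_mono) auto
      then show ?thesis using T(3) by linarith
    qed
    finally show ?thesis .
  qed
  have bound: "measure lebesgue (\<Union>j\<in>D. A j) \<le> ?B" if D: "D \<subseteq> UNIV" "finite D" for D
  proof (cases "D = {}")
    case False
    have "(\<Union>j\<in>D. A j) = A (Max D)"
    proof
      show "(\<Union>j\<in>D. A j) \<subseteq> A (Max D)"
        using Max_ge[OF D(2)] Rm by (fastforce simp: A_def)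
      show "A (Max D) \<subseteq> (\<Union>j\<in>D. A j)" using Max_in[OF D(2) False] by blast
    qed
    then show ?thesis using Ab by simp
  qed (use lam in simp)
  show ?thesis
  proof (rule that)
    show "{t \<in> {0..2*pi}. \<exists>r\<in>{0..<1}. lam < (cmod (f (of_real r * cis t)))\<^sup>2} \<subseteq> (\<Union>j. A j)"
    proof clarify
      fix t r :: real assume tr: "t \<in> {0..2*pi}" "r \<in> {0..<1}" "lam < (cmod (f (of_real r * cis t)))\<^sup>2"
      have "1 - r > 0" using tr by simp
      then obtain j where "inverse (real (Suc j)) < 1 - r" using reals_Archimedean by blast
      then have "r \<in> {0..<R j}" using tr by (auto simp: R_def inverse_eq_divide)
      then have "t \<in> A j" using tr unfolding A_def by blast
      then show "t \<in> (\<Union>j. A j)" by blast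
    qed
    show "(\<Union>j. A j) \<in> lmeasurable" by (rule fmeasurable_UN_bound[OF _ Am bound]) auto
    show "measure lebesgue (\<Union>j. A j) \<le> ?B" by (rule measure_UN_bound[OF _ Am bound]) auto
  qed
qed

section \<open>Radial limits\<close>

text \<open>Split \<open>f\<close> into a dilation, which is continuous up to the circle, and a
  remainder \<open>k\<close> with small coefficient norm. Near the circle the dilation oscillates by
  less than \<open>e/2\<close>, so oscillation above \<open>e\<close> forces
  \<open>|k| > e/4\<close> at some radius, and the weak-type bound makes that set as small as
  desired. The Cauchy criterion then needs only countably many \<open>e\<close>.\<close>

lemma Fatou_radial_limits:
  assumes f: "f holomorphic_on ball 0 1" and c: "l2 (taylor_coeff f)"
  shows "negligible {t \<in> {0..2*pi}. \<not> (\<exists>l. ((\<lambda>r. f (of_real r * cis t)) \<longlongrightarrow> l) (at_left (1::real)))}"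
proof -
  define \<Omega> where "\<Omega> e = {t \<in> {0..2*pi}. \<forall>s<1. \<exists>r\<in>{0..<1}. \<exists>r'\<in>{0..<1}. s < r \<and> s < r' \<and>
      e < cmod (f (of_real r * cis t) - f (of_real r' * cis t))}" for e :: real
  have neg: "negligible (\<Omega> e)" if e: "e > 0" for e
    unfolding negligible_outer_le
  proof (intro allI impI)
    fix d :: real assume d: "d > 0"
    let ?c = "taylor_coeff f"
    have "((\<lambda>\<rho>. 20 * pi * (n2 (\<lambda>k. ?c k - ?c k * of_real \<rho> ^ k))\<^sup>2 / (e/4)\<^sup>2) \<longlongrightarrow> 20 * pi * 0\<^sup>2 / (e/4)\<^sup>2) (at_left 1)"
      using e by (intro tendsto_intros n2_diff_dilate_tendsto c) auto
    then have "eventually (\<lambda>\<rho>. 20 * pi * (n2 (\<lambda>k. ?c k - ?c k * of_real \<rho> ^ k))\<^sup>2 / (e/4)\<^sup>2 < d) (at_left 1)"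
      using d by (intro order_tendstoD(2)) auto
    moreover have "eventually (\<lambda>r::real. r \<in> {0<..<1}) (at_left 1)" by (rule eventually_at_left_real) auto
    ultimately have "eventually (\<lambda>\<rho>. 20 * pi * (n2 (\<lambda>k. ?c k - ?c k * of_real \<rho> ^ k))\<^sup>2 / (e/4)\<^sup>2 < d \<and> \<rho> \<in> {0<..<1}) (at_left 1)"
      by (rule eventually_conj)
    then obtain \<rho> where \<rho>: "20 * pi * (n2 (\<lambda>k. ?c k - ?c k * of_real \<rho> ^ k))\<^sup>2 / (e/4)\<^sup>2 < d" "0 < \<rho>" "\<rho> < 1"
      using eventually_happens'[OF trivial_limit_at_left_real] by fastforce
    define f\<rho> where "f\<rho> z = f (of_real \<rho> * z)" for z
    have f\<rho>: "f\<rho> holomorphic_on ball 0 1" unfolding f\<rho>_def using \<rho> by (intro holomorphic_dilate f) auto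
    have tf\<rho>: "taylor_coeff f\<rho> = (\<lambda>k. ?c k * of_real \<rho> ^ k)"
      unfolding f\<rho>_def using \<rho> by (intro taylor_coeff_dilate f) auto
    define k where "k z = f z - f\<rho> z" for z
    have k: "k holomorphic_on ball 0 1" unfolding k_def by (intro holomorphic_on_diff f f\<rho>)
    have tk: "taylor_coeff k = (\<lambda>k. ?c k - ?c k * of_real \<rho> ^ k)"
      unfolding k_def by (subst taylor_coeff_diff[OF f f\<rho>]) (simp add: tf\<rho>)
    have l2k: "l2 (taylor_coeff k)" unfolding tk using \<rho> by (intro n2_diff(1) c l2_dilate(1)) auto
    obtain T where T: "{t \<in> {0..2*pi}. \<exists>r\<in>{0..<1}. (e/4)\<^sup>2 < (cmod (k (of_real r * cis t)))\<^sup>2} \<subseteq> T"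
      "T \<in> lmeasurable" "measure lebesgue T \<le> 20 * pi * (n2 (taylor_coeff k))\<^sup>2 / (e/4)\<^sup>2"
      using weak_type_H2[OF k l2k, of "(e/4)\<^sup>2"] e by auto
    have "\<Omega> e \<subseteq> T"
    proof
      fix t assume t: "t \<in> \<Omega> e"
      have "((\<lambda>r::real. f (of_real \<rho> * (of_real r * cis t))) \<longlongrightarrow> f (of_real \<rho> * (of_real 1 * cis t))) (at_left 1)"
      proof (rule isCont_tendsto_compose[of _ f])
        show "isCont f (of_real \<rho> * (of_real 1 * cis t))"
          using \<rho> by (intro continuous_on_interior[OF holomorphic_on_imp_continuous_on[OF f]]) (auto simp: norm_mult)
      qed (intro tendsto_intros)
      then have "eventually (\<lambda>r. dist (f\<rho> (of_real r * cis t)) (f\<rho> (cis t)) < e / 4) (at_left 1)"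
        using e by (intro tendstoD) (auto simp: f\<rho>_def)
      then obtain s where s: "s < 1" "\<And>r. s < r \<Longrightarrow> r < 1 \<Longrightarrow> dist (f\<rho> (of_real r * cis t)) (f\<rho> (cis t)) < e / 4"
        unfolding eventually_at_left_field by blast
      obtain r r' where r: "r \<in> {0..<1}" "r' \<in> {0..<1}" "s < r" "s < r'"
        "e < cmod (f (of_real r * cis t) - f (of_real r' * cis t))"
        using t s(1) unfolding \<Omega>_def by blast
      have 1: "cmod (f\<rho> (of_real r * cis t) - f\<rho> (of_real r' * cis t)) < e / 2"
        using s(2)[of r] s(2)[of r'] r dist_triangle_half_l[of "f\<rho> (of_real r * cis t)" "f\<rho> (cis t)" "e/2" "f\<rho> (of_real r' * cis t)"]
        by (auto simp: dist_norm norm_minus_commute)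
      have eq: "f (of_real r * cis t) - f (of_real r' * cis t) =
        (k (of_real r * cis t) - k (of_real r' * cis t)) + (f\<rho> (of_real r * cis t) - f\<rho> (of_real r' * cis t))"
        by (simp add: k_def)
      have "e < cmod (k (of_real r * cis t)) + cmod (k (of_real r' * cis t)) + e / 2"
        using r(5) 1 norm_triangle_ineq[of "k (of_real r * cis t) - k (of_real r' * cis t)" "f\<rho> (of_real r * cis t) - f\<rho> (of_real r' * cis t)"]
          norm_triangle_ineq4[of "k (of_real r * cis t)" "k (of_real r' * cis t)"] unfolding eq by linarith
      then have "e / 4 < cmod (k (of_real r * cis t)) \<or> e / 4 < cmod (k (of_real r' * cis t))" by linarith
      then have "\<exists>r\<in>{0..<1}. e / 4 < cmod (k (of_real r * cis t))" using r by blast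
      then have "\<exists>r\<in>{0..<1}. (e/4)\<^sup>2 < (cmod (k (of_real r * cis t)))\<^sup>2"
        using e by (meson power_strict_mono less_imp_le divide_pos_pos zero_less_numeral pos2)
      then show "t \<in> T" using T(1) t by (auto simp: \<Omega>_def)
    qed
    then show "\<exists>T. \<Omega> e \<subseteq> T \<and> T \<in> lmeasurable \<and> measure lebesgue T \<le> d"
      using T(2,3) \<rho>(1) unfolding tk by (intro exI[of _ T]) auto
  qed
  have "{t \<in> {0..2*pi}. \<not> (\<exists>l. ((\<lambda>r. f (of_real r * cis t)) \<longlongrightarrow> l) (at_left (1::real)))} \<subseteq> (\<Union>n. \<Omega> (1 / real (Suc n)))"
  proof (rule subsetI, rule ccontr)
    fix t assume t: "t \<in> {t \<in> {0..2*pi}. \<not> (\<exists>l. ((\<lambda>r. f (of_real r * cis t)) \<longlongrightarrow> l) (at_left (1::real)))}"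
      and nt: "t \<notin> (\<Union>n. \<Omega> (1 / real (Suc n)))"
    have "cauchy_filter (filtermap (\<lambda>r. f (of_real r * cis t)) (at_left (1::real)))"
      unfolding cauchy_filter_metric_filtermap
    proof (intro allI impI)
      fix e :: real assume e: "e > 0"
      then obtain n where n: "inverse (real (Suc n)) < e" using reals_Archimedean by blast
      from nt have "t \<notin> \<Omega> (1 / real (Suc n))" by blast
      then have "\<not> (\<forall>s<1. \<exists>r\<in>{0..<1}. \<exists>r'\<in>{0..<1}. s < r \<and> s < r' \<and>
          1 / real (Suc n) < cmod (f (of_real r * cis t) - f (of_real r' * cis t)))"
        using t unfolding \<Omega>_def by blast
      then obtain s where s: "s < 1" "\<And>r r'. r \<in> {0..<1} \<Longrightarrow> r' \<in> {0..<1} \<Longrightarrow> s < r \<Longrightarrow> s < r' \<Longrightarrow>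
          cmod (f (of_real r * cis t) - f (of_real r' * cis t)) \<le> 1 / real (Suc n)"
        unfolding not_less[symmetric] by blast
      show "\<exists>P. eventually P (at_left (1::real)) \<and> (\<forall>x y. P x \<and> P y \<longrightarrow> dist (f (of_real x * cis t)) (f (of_real y * cis t)) < e)"
      proof (intro exI[of _ "\<lambda>x. x \<in> {max 0 s<..<1}"] conjI allI impI)
        show "eventually (\<lambda>x. x \<in> {max 0 s<..<1}) (at_left 1)" by (rule eventually_at_left_real) (use s in auto)
        show "dist (f (of_real x * cis t)) (f (of_real y * cis t)) < e" if "x \<in> {max 0 s<..<1} \<and> y \<in> {max 0 s<..<1}" for x y
          using s(2)[of x y] that n by (auto simp: dist_norm inverse_eq_divide)
      qed
    qed
    moreover have "filtermap (\<lambda>r. f (of_real r * cis t)) (at_left (1::real)) \<noteq> bot"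
      by (simp add: filtermap_bot_iff)
    ultimately obtain l where "filtermap (\<lambda>r. f (of_real r * cis t)) (at_left (1::real)) \<le> nhds l"
      using complete_UNIV[where 'a=complex] unfolding complete_uniform by auto
    then have "((\<lambda>r. f (of_real r * cis t)) \<longlongrightarrow> l) (at_left (1::real))" by (simp add: filterlim_def)
    with t show False by blast
  qed
  moreover have "negligible (\<Union>n. \<Omega> (1 / real (Suc n)))"
    by (rule negligible_Union_nat) (auto intro!: neg)
  ultimately show ?thesis by (rule negligible_subset[rotated])
qed


section \<open>Boundary values and the coefficient form of the Garsia functional\<close>

lemma norm_sq_diff_le:
  fixes x y :: complex
  assumes "\<eta> > 0"
  shows "\<bar>(cmod x)\<^sup>2 - (cmod y)\<^sup>2\<bar> \<le> (1 + 1/\<eta>) * (cmod (x - y))\<^sup>2 + \<eta> * (cmod y)\<^sup>2"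
proof -
  define d where "d = cmod (x - y)"
  define b where "b = cmod y"
  define a where "a = cmod x"
  have ab: "\<bar>a - b\<bar> \<le> d" unfolding a_def b_def d_def by (rule norm_triangle_ineq3)
  have nn: "0 \<le> d" "0 \<le> b" "0 \<le> a" by (auto simp: d_def b_def a_def)
  have "a\<^sup>2 - b\<^sup>2 = (a - b) * (a + b)" by (simp add: power2_eq_square algebra_simps)
  then have "\<bar>a\<^sup>2 - b\<^sup>2\<bar> = \<bar>a - b\<bar> * (a + b)" using nn by (simp add: abs_mult)
  also have "\<dots> \<le> d * (d + 2 * b)" using ab nn by (intro mult_mono) auto
  also have "\<dots> \<le> (1 + 1/\<eta>) * d\<^sup>2 + \<eta> * b\<^sup>2"
  proof -
    have "0 \<le> (d - \<eta> * b)\<^sup>2 / \<eta>" using assms by simp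
    also have "(d - \<eta> * b)\<^sup>2 / \<eta> = d\<^sup>2 / \<eta> - 2 * d * b + \<eta> * b\<^sup>2"
      using assms by (simp add: power2_eq_square field_simps)
    finally show ?thesis by (simp add: algebra_simps power2_eq_square)
  qed
  finally show ?thesis by (simp add: a_def b_def d_def)
qed

text \<open>The dilations converge to the boundary function in \<open>L\<^sup>2\<close> (Fatou's lemma), and
  \<open>Poisson_square\<close> passes to the limit.\<close>

lemma poisson_sq_eq:
  assumes f: "f holomorphic_on ball 0 1" and c: "l2 (taylor_coeff f)" and z: "cmod z < 1"
  shows "poisson_sq f z = (cmod (f z))\<^sup>2 + (gars (taylor_coeff f) z)\<^sup>2"
proof -
  define c where "c = taylor_coeff f"
  have lc: "l2 c" using assms(2) by (simp add: c_def)
  define I where "I = {0..2*pi}"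
  define M where "M = lebesgue_on I"
  define R where "R j = 1 - 1 / real (Suc (Suc j))" for j
  have R: "0 \<le> R j" "R j < 1" for j by (auto simp: R_def)
  have Rm: "R i \<le> R j" if "i \<le> j" for i j using that by (auto simp: R_def frac_le)
  have R1: "filterlim R (at_left 1) sequentially"
  proof -
    have "(\<lambda>j. 1 - 1 / real (Suc (Suc j))) \<longlonglongrightarrow> 1 - 0"
      using LIMSEQ_Suc[OF LIMSEQ_inverse_real_of_nat] by (intro tendsto_diff) (auto simp: inverse_eq_divide)
    then show ?thesis unfolding filterlim_at using R(2) by (auto simp: R_def[abs_def] less_imp_neq)
  qed
  define h where "h j t = f (of_real (R j) * cis t)" for j t
  have ch: "continuous_on UNIV (h j)" for j
    unfolding h_def by (intro continuous_on_circle[OF f R] continuous_on_id)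
  \<comment> \<open>A limit along a sequence of radii is Borel measurable by construction. Off the
    null set \<open>Z\<close> it agrees with \<open>boundary_val\<close>, the limit over all
    radii.\<close>
  define b where "b t = lim (\<lambda>j. h j t)" for t
  define Z where "Z = {t \<in> {0..2*pi}. \<not> (\<exists>l. ((\<lambda>r. f (of_real r * cis t)) \<longlongrightarrow> l) (at_left (1::real)))}"
  have Z: "negligible Z" unfolding Z_def by (rule Fatou_radial_limits[OF f assms(2)])
  have lim: "(\<lambda>j. h j t) \<longlonglongrightarrow> b t" "boundary_val f t = b t" if t: "t \<in> I - Z" for t
  proof -
    obtain l where l: "((\<lambda>r. f (of_real r * cis t)) \<longlongrightarrow> l) (at_left (1::real))"
      using t by (auto simp: I_def Z_def)
    have "(\<lambda>j. h j t) \<longlonglongrightarrow> l" unfolding h_def by (rule filterlim_compose[OF l R1])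
    moreover from this have "b t = l" unfolding b_def by (rule limI)
    moreover have "boundary_val f t = l" unfolding boundary_val_def by (rule tendsto_Lim[OF trivial_limit_at_left_real l])
    ultimately show "(\<lambda>j. h j t) \<longlonglongrightarrow> b t" "boundary_val f t = b t" by auto
  qed
  have Im: "I \<in> sets lebesgue" by (simp add: I_def)
  have meas: "u \<in> borel_measurable M" if "u \<in> borel_measurable borel" for u :: "real \<Rightarrow> 'b::{topological_space}"
    unfolding M_def by (intro measurable_restrict_space1 measurable_completion) (use that in simp)
  have mh: "h j \<in> borel_measurable borel" for j by (rule borel_measurable_continuous_onI[OF ch])
  have mb: "b \<in> borel_measurable borel" unfolding b_def using mh by measurable
  have AE: "AE t in M. (\<lambda>j. h j t) \<longlonglongrightarrow> b t"
  proof -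
    have "AE t in lebesgue. t \<notin> Z" using Z by (simp add: negligible_iff_null_sets AE_not_in)
    then have "AE t in lebesgue. t \<in> I \<longrightarrow> (\<lambda>j. h j t) \<longlonglongrightarrow> b t"
      by eventually_elim (use lim in auto)
    then show ?thesis unfolding M_def using Im by (subst AE_restrict_space_iff) auto
  qed
  define cc where "cc j k = c k * of_real (R j) ^ k" for j k
  have scc: "summable (\<lambda>k. cmod (cc j k))" for j unfolding cc_def c_def by (rule summable_dilated_taylor[OF f R])
  have hcc: "h j t = pser (cc j) (cis t)" for j t
    unfolding h_def cc_def c_def by (rule holomorphic_dilated_eq_pser[OF f R]) simp
  define \<delta> where "\<delta> i = 2 * pi * (n2 (\<lambda>k. c k - cc i k))\<^sup>2" for i
  have \<delta>0: "0 \<le> \<delta> i" for i by (simp add: \<delta>_def)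
  have lcc: "l2 (cc j)" "n2 (cc j) \<le> n2 c" for j
    unfolding cc_def using l2_dilate[OF lc R(1)[of j]] R(2)[of j] by auto
  have ld: "l2 (\<lambda>k. c k - cc i k)" for i by (rule n2_diff(1)[OF lc lcc(1)])
  have n2lim: "(\<lambda>i. n2 (\<lambda>k. c k - cc i k)) \<longlonglongrightarrow> 0"
    unfolding cc_def by (rule filterlim_compose[OF n2_diff_dilate_tendsto[OF lc] R1])
  have \<delta>lim: "\<delta> \<longlonglongrightarrow> 0"
  proof -
    from n2lim have "(\<lambda>i. 2 * pi * (n2 (\<lambda>k. c k - cc i k))\<^sup>2) \<longlonglongrightarrow> 2 * pi * 0\<^sup>2" by (intro tendsto_intros)
    then show ?thesis by (simp add: \<delta>_def[abs_def])
  qed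
  have integrable_cont: "integrable M u" "integral\<^sup>L M u = integral I u" if "continuous_on UNIV u" for u :: "real \<Rightarrow> real"
  proof -
    show 1: "integrable M u" unfolding M_def I_def
      by (rule continuous_imp_integrable_real) (rule continuous_on_subset[OF that subset_UNIV])
    show "integral\<^sup>L M u = integral I u"
      using lebesgue_integral_eq_integral[OF 1[unfolded M_def] Im] by (simp add: M_def)
  qed
  have d_ji: "integral\<^sup>L M (\<lambda>t. (cmod (h j t - h i t))\<^sup>2) \<le> \<delta> i" if "i \<le> j" for i j
  proof -
    have s: "summable (\<lambda>k. cmod (cc j k - cc i k))"
      by (rule summable_comparison_test'[OF summable_add[OF scc[of j] scc[of i]], of 0]) (auto intro: norm_triangle_ineq4)
    have eq: "h j t - h i t = pser (\<lambda>k. cc j k - cc i k) (cis t)" for t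
    proof -
      have "(\<lambda>k. cc j k * cis t ^ k - cc i k * cis t ^ k) sums (h j t - h i t)"
        unfolding hcc by (intro sums_diff pser_sums scc) auto
      then show ?thesis by (simp add: pser_def sums_iff left_diff_distrib)
    qed
    have "integral\<^sup>L M (\<lambda>t. (cmod (h j t - h i t))\<^sup>2) = integral I (\<lambda>t. (cmod (h j t - h i t))\<^sup>2)"
      by (intro integrable_cont continuous_intros ch)
    also have "\<dots> = 2 * pi * (n2 (\<lambda>k. cc j k - cc i k))\<^sup>2"
      unfolding eq I_def by (rule integral_sq_pser[OF s])
    also have "\<dots> \<le> \<delta> i"
    proof -
      have "cmod (cc j k - cc i k) \<le> cmod (c k - cc i k)" for k
      proof -
        have "cc j k - cc i k = c k * of_real (R j ^ k - R i ^ k)" "c k - cc i k = c k * of_real (1 - R i ^ k)"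
          by (simp_all add: cc_def algebra_simps)
        moreover have "\<bar>R j ^ k - R i ^ k\<bar> \<le> \<bar>1 - R i ^ k\<bar>"
          using power_mono[OF Rm[OF that] R(1), of k] power_le_one[OF R(1), of j k] R(2)[of j] by auto
        ultimately show ?thesis by (simp only: norm_mult norm_of_real) (rule mult_left_mono, auto)
      qed
      from n2_mono[OF ld this] show ?thesis unfolding \<delta>_def
        by (intro mult_left_mono power_mono n2_nonneg') auto
    qed
    finally show ?thesis .
  qed
  have nn: "(\<integral>\<^sup>+t. ennreal ((cmod (b t - h i t))\<^sup>2) \<partial>M) \<le> ennreal (\<delta> i)" for i
  proof -
    have "(\<integral>\<^sup>+t. ennreal ((cmod (b t - h i t))\<^sup>2) \<partial>M) = (\<integral>\<^sup>+t. liminf (\<lambda>j. ennreal ((cmod (h j t - h i t))\<^sup>2)) \<partial>M)"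
    proof (rule nn_integral_cong_AE)
      show "AE t in M. ennreal ((cmod (b t - h i t))\<^sup>2) = liminf (\<lambda>j. ennreal ((cmod (h j t - h i t))\<^sup>2))"
        using AE
      proof eventually_elim
        case (elim t)
        then have "(\<lambda>j. ennreal ((cmod (h j t - h i t))\<^sup>2)) \<longlonglongrightarrow> ennreal ((cmod (b t - h i t))\<^sup>2)"
          by (intro tendsto_ennrealI tendsto_intros)
        then show ?case by (intro lim_imp_Liminf[symmetric]) auto
      qed
    qed
    also have "\<dots> \<le> liminf (\<lambda>j. \<integral>\<^sup>+t. ennreal ((cmod (h j t - h i t))\<^sup>2) \<partial>M)"
    proof (rule nn_integral_liminf, rule meas)
      show "(\<lambda>t. ennreal ((cmod (h j t - h i t))\<^sup>2)) \<in> borel_measurable borel" for j using mh by measurable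
    qed
    also have "\<dots> \<le> ennreal (\<delta> i)"
    proof (rule Liminf_le)
      show "\<forall>\<^sub>F j in sequentially. (\<integral>\<^sup>+t. ennreal ((cmod (h j t - h i t))\<^sup>2) \<partial>M) \<le> ennreal (\<delta> i)"
        using eventually_ge_at_top[of i]
      proof eventually_elim
        case (elim j)
        have "(\<integral>\<^sup>+t. ennreal ((cmod (h j t - h i t))\<^sup>2) \<partial>M) = ennreal (integral\<^sup>L M (\<lambda>t. (cmod (h j t - h i t))\<^sup>2))"
          by (intro nn_integral_eq_integral integrable_cont continuous_intros ch) auto
        then show ?case using d_ji[OF elim] by (simp add: ennreal_leI)
      qed
    qed simp
    finally show ?thesis .
  qed
  have mbh: "(\<lambda>t. (cmod (b t - h i t))\<^sup>2) \<in> borel_measurable M" for i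
    by (rule meas) (use mb mh in measurable)
  have ibh: "integrable M (\<lambda>t. (cmod (b t - h i t))\<^sup>2)" for i
  proof (rule integrableI_nonneg[OF mbh])
    show "(\<integral>\<^sup>+t. ennreal ((cmod (b t - h i t))\<^sup>2) \<partial>M) < \<infinity>"
      using nn[of i] by (rule le_less_trans) simp
  qed simp
  have ibh_le: "integral\<^sup>L M (\<lambda>t. (cmod (b t - h i t))\<^sup>2) \<le> \<delta> i" for i
  proof -
    have "ennreal (integral\<^sup>L M (\<lambda>t. (cmod (b t - h i t))\<^sup>2)) = (\<integral>\<^sup>+t. ennreal ((cmod (b t - h i t))\<^sup>2) \<partial>M)"
      by (rule nn_integral_eq_integral[symmetric, OF ibh]) simp
    also note nn[of i]
    finally show ?thesis using \<delta>0 by simp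
  qed
  have ih: "integrable M (\<lambda>t. (cmod (h i t))\<^sup>2)" for i
    by (intro integrable_cont continuous_intros ch)
  have ih_le: "integral\<^sup>L M (\<lambda>t. (cmod (h i t))\<^sup>2) \<le> 2 * pi * (n2 c)\<^sup>2" for i
  proof -
    have "integral\<^sup>L M (\<lambda>t. (cmod (h i t))\<^sup>2) = integral I (\<lambda>t. (cmod (h i t))\<^sup>2)"
      by (intro integrable_cont continuous_intros ch)
    also have "\<dots> = 2 * pi * (n2 (cc i))\<^sup>2" unfolding hcc I_def by (rule integral_sq_pser[OF scc])
    finally show ?thesis using lcc[of i] by (simp add: power_mono n2_nonneg')
  qed
  have mb2: "(\<lambda>t. (cmod (b t))\<^sup>2) \<in> borel_measurable M" by (rule meas) (use mb in measurable)
  have ib: "integrable M (\<lambda>t. (cmod (b t))\<^sup>2)"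
  proof (rule Bochner_Integration.integrable_bound[OF _ mb2])
    show "integrable M (\<lambda>t. 2 * (cmod (b t - h 0 t))\<^sup>2 + 2 * (cmod (h 0 t))\<^sup>2)"
      using ibh[of 0] ih[of 0] by simp
    have "(cmod (b t))\<^sup>2 \<le> 2 * (cmod (b t - h 0 t))\<^sup>2 + 2 * (cmod (h 0 t))\<^sup>2" for t
      using norm_sq_diff_le[of 1 "b t" "h 0 t"] by simp
    then show "AE t in M. norm ((cmod (b t))\<^sup>2) \<le> norm (2 * (cmod (b t - h 0 t))\<^sup>2 + 2 * (cmod (h 0 t))\<^sup>2)"
      by auto
  qed
  define w where "w = pk z"
  have cw: "continuous_on UNIV w" unfolding w_def by (rule continuous_on_pk[OF z])
  have w0: "0 \<le> w t" for t unfolding w_def by (rule pk_nonneg[OF z])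
  define W where "W = (1 - (cmod z)\<^sup>2) / (1 - cmod z)\<^sup>2"
  have wW: "w t \<le> W" for t
  proof -
    have "1 - cmod z \<le> cmod (cis t - z)" using norm_triangle_ineq2[of "cis t" z] by simp
    then have "(1 - cmod z)\<^sup>2 \<le> (cmod (cis t - z))\<^sup>2" using z by (intro power_mono) auto
    then show ?thesis unfolding w_def pk_def W_def
      using z norm_sq_less_1[OF z] by (intro divide_left_mono) (auto simp: zero_less_mult_iff cis_diff_nonzero)
  qed
  have W0: "0 \<le> W" using w0[of 0] wW[of 0] by linarith
  have mw: "w \<in> borel_measurable M" by (rule meas[OF borel_measurable_continuous_onI[OF cw]])
  have iw: "integrable M (\<lambda>t. w t * u t)" if "integrable M u" for u :: "real \<Rightarrow> real"
  proof (rule Bochner_Integration.integrable_bound[of _ "\<lambda>t. W * u t"])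
    show "(\<lambda>t. w t * u t) \<in> borel_measurable M" using mw that by measurable
    show "AE t in M. norm (w t * u t) \<le> norm (W * u t)"
      using w0 wW W0 by (auto simp: abs_mult intro!: mult_right_mono)
  qed (use that in simp)
  define J where "J = integral\<^sup>L M (\<lambda>t. w t * (cmod (b t))\<^sup>2)"
  define Jh where "Jh i = integral\<^sup>L M (\<lambda>t. w t * (cmod (h i t))\<^sup>2)" for i
  \<comment> \<open>The parameter \<open>\<eta>\<close> stays free: it is fixed first, to make the
    term with the bounded integrals of \<open>|h i|^2\<close> small, and only then does
    \<open>\<delta> i\<close> tend to 0 against the large factor
    \<open>1 + 1/\<eta>\<close>.\<close>
  have est: "\<bar>J - Jh i\<bar> \<le> W * ((1 + 1/\<eta>) * \<delta> i + \<eta> * (2 * pi * (n2 c)\<^sup>2))" if \<eta>: "\<eta> > 0" for i \<eta>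
  proof -
    have "J - Jh i = integral\<^sup>L M (\<lambda>t. w t * (cmod (b t))\<^sup>2 - w t * (cmod (h i t))\<^sup>2)"
      unfolding J_def Jh_def by (rule Bochner_Integration.integral_diff[symmetric]; intro iw ib ih)
    also have "\<bar>\<dots>\<bar> \<le> integral\<^sup>L M (\<lambda>t. \<bar>w t * (cmod (b t))\<^sup>2 - w t * (cmod (h i t))\<^sup>2\<bar>)"
      by (rule integral_abs_bound)
    also have "\<dots> \<le> integral\<^sup>L M (\<lambda>t. W * ((1 + 1/\<eta>) * (cmod (b t - h i t))\<^sup>2 + \<eta> * (cmod (h i t))\<^sup>2))"
    proof (rule Bochner_Integration.integral_mono)
      show "integrable M (\<lambda>t. \<bar>w t * (cmod (b t))\<^sup>2 - w t * (cmod (h i t))\<^sup>2\<bar>)"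
        by (intro Bochner_Integration.integrable_abs Bochner_Integration.integrable_diff iw ib ih)
      show "integrable M (\<lambda>t. W * ((1 + 1/\<eta>) * (cmod (b t - h i t))\<^sup>2 + \<eta> * (cmod (h i t))\<^sup>2))"
        by (intro Bochner_Integration.integrable_mult_right Bochner_Integration.integrable_add ibh ih)
      fix t
      have "\<bar>w t * (cmod (b t))\<^sup>2 - w t * (cmod (h i t))\<^sup>2\<bar> = w t * \<bar>(cmod (b t))\<^sup>2 - (cmod (h i t))\<^sup>2\<bar>"
        using w0[of t] by (simp add: abs_mult flip: right_diff_distrib)
      also have "\<dots> \<le> W * ((1 + 1/\<eta>) * (cmod (b t - h i t))\<^sup>2 + \<eta> * (cmod (h i t))\<^sup>2)"
        by (intro mult_mono wW W0 norm_sq_diff_le \<eta>) auto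
      finally show "\<bar>w t * (cmod (b t))\<^sup>2 - w t * (cmod (h i t))\<^sup>2\<bar> \<le> W * ((1 + 1/\<eta>) * (cmod (b t - h i t))\<^sup>2 + \<eta> * (cmod (h i t))\<^sup>2)" .
    qed
    also have "\<dots> = W * ((1 + 1/\<eta>) * integral\<^sup>L M (\<lambda>t. (cmod (b t - h i t))\<^sup>2) + \<eta> * integral\<^sup>L M (\<lambda>t. (cmod (h i t))\<^sup>2))"
      using ibh[of i] ih[of i] by (simp del: distrib_left_numeral)
    also have "\<dots> \<le> W * ((1 + 1/\<eta>) * \<delta> i + \<eta> * (2 * pi * (n2 c)\<^sup>2))"
      using \<eta> W0 by (intro mult_left_mono add_mono ibh_le ih_le) auto
    finally show ?thesis .
  qed
  have JhJ: "Jh \<longlonglongrightarrow> J"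
  proof (rule LIMSEQ_I)
    fix e :: real assume e: "e > 0"
    define C where "C = W * (2 * pi * (n2 c)\<^sup>2)"
    have C: "C \<ge> 0" using W0 by (simp add: C_def)
    define \<eta> where "\<eta> = e / (2 * (C + 1))"
    have \<eta>: "\<eta> > 0" using e C by (simp add: \<eta>_def)
    have \<eta>C: "\<eta> * C < e / 2 + 0"
    proof -
      have "\<eta> * C < \<eta> * (C + 1)" using \<eta> by simp
      also have "\<dots> = e / 2" using C by (simp add: \<eta>_def field_simps)
      finally show ?thesis by simp
    qed
    have "(\<lambda>i. W * (1 + 1/\<eta>) * \<delta> i) \<longlonglongrightarrow> W * (1 + 1/\<eta>) * 0" by (intro tendsto_intros \<delta>lim)
    then have "eventually (\<lambda>i. W * (1 + 1/\<eta>) * \<delta> i < e / 2) sequentially"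
      using e by (intro order_tendstoD(2)) auto
    then obtain N where N: "\<And>i. i \<ge> N \<Longrightarrow> W * (1 + 1/\<eta>) * \<delta> i < e / 2"
      unfolding eventually_sequentially by blast
    show "\<exists>no. \<forall>n\<ge>no. norm (Jh n - J) < e"
    proof (intro exI[of _ N] allI impI)
      fix i assume "N \<le> i"
      have "W * ((1 + 1/\<eta>) * \<delta> i + \<eta> * (2 * pi * (n2 c)\<^sup>2)) = W * (1 + 1/\<eta>) * \<delta> i + \<eta> * C"
        by (simp only: C_def distrib_left mult_ac)
      with est[OF \<eta>, of i] N[OF \<open>N \<le> i\<close>] \<eta>C show "norm (Jh i - J) < e" by (simp add: abs_minus_commute)
    qed
  qed
  have Jh_eq: "Jh i = 2 * pi * ((cmod (pser (cc i) z))\<^sup>2 + (gars (cc i) z)\<^sup>2)" for i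
  proof -
    have "Jh i = integral I (\<lambda>t. w t * (cmod (h i t))\<^sup>2)"
      unfolding Jh_def by (intro integrable_cont continuous_intros ch cw)
    also have "\<dots> = 2 * pi * cmean (\<lambda>t. w t * (cmod (h i t))\<^sup>2)" by (simp add: cmean_def I_def)
    also have "cmean (\<lambda>t. w t * (cmod (h i t))\<^sup>2) = (cmod (pser (cc i) z))\<^sup>2 + (gars (cc i) z)\<^sup>2"
      unfolding hcc w_def by (rule Poisson_square[OF scc z])
    finally show ?thesis .
  qed
  have lim_p: "(\<lambda>i. pser (cc i) z) \<longlonglongrightarrow> f z"
  proof -
    have "pser (cc i) z = f (of_real (R i) * z)" for i
      unfolding cc_def c_def using z by (intro holomorphic_dilated_eq_pser[OF f R, symmetric]) simp
    moreover have "(\<lambda>i. f (of_real (R i) * z)) \<longlonglongrightarrow> f (of_real 1 * z)"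
    proof (rule isCont_tendsto_compose[of _ f])
      show "isCont f (of_real 1 * z)"
        using z by (intro continuous_on_interior[OF holomorphic_on_imp_continuous_on[OF f]]) auto
      have "R \<longlonglongrightarrow> 1" using R1 unfolding filterlim_at by simp
      then show "(\<lambda>i. of_real (R i) * z) \<longlonglongrightarrow> of_real 1 * z" by (intro tendsto_intros)
    qed
    ultimately show ?thesis by simp
  qed
  have lim_g: "(\<lambda>i. gars (cc i) z) \<longlonglongrightarrow> gars c z"
  proof -
    have bnd: "\<bar>gars c z - gars (cc i) z\<bar> \<le> 2 * n2 (\<lambda>k. c k - cc i k) / (1 - cmod z)\<^sup>2" for i
    proof -
      have 1: "gars c z \<le> gars (cc i) z + gars (\<lambda>k. c k - cc i k) z"
        using gars_add[OF lcc(1)[of i] ld[of i] z] by simp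
      have 2: "gars (cc i) z \<le> gars c z + gars (\<lambda>k. c k - cc i k) z"
        using gars_diff[OF lc ld[of i] z] by simp
      show ?thesis using 1 2 gars_le[OF ld[of i] z] by linarith
    qed
    have z1: "(1 - cmod z)\<^sup>2 \<noteq> 0" using z by simp
    have "(\<lambda>i. 2 * n2 (\<lambda>k. c k - cc i k) / (1 - cmod z)\<^sup>2) \<longlonglongrightarrow> 2 * 0 / (1 - cmod z)\<^sup>2"
      by (intro tendsto_divide tendsto_mult tendsto_const n2lim z1)
    then have "(\<lambda>i. 2 * n2 (\<lambda>k. c k - cc i k) / (1 - cmod z)\<^sup>2) \<longlonglongrightarrow> 0" by simp
    then have "(\<lambda>i. gars c z - gars (cc i) z) \<longlonglongrightarrow> 0"
      by (rule Lim_null_comparison[rotated]) (use bnd in simp)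
    from tendsto_diff[OF tendsto_const this, of "gars c z"] show ?thesis by simp
  qed
  have "Jh \<longlonglongrightarrow> 2 * pi * ((cmod (f z))\<^sup>2 + (gars c z)\<^sup>2)"
    unfolding Jh_eq[abs_def] by (intro tendsto_intros lim_p lim_g)
  with JhJ have J: "J = 2 * pi * ((cmod (f z))\<^sup>2 + (gars c z)\<^sup>2)" by (rule LIMSEQ_unique)
  \<comment> \<open>Where the radial limit fails to exist, \<open>boundary_val\<close> has an
    unspecified value; this happens only on the negligible set \<open>Z\<close>.\<close>
  have "integral I (\<lambda>t. w t * (cmod (boundary_val f t))\<^sup>2) = integral I (\<lambda>t. w t * (cmod (b t))\<^sup>2)"
    by (rule integral_spike[OF Z]) (simp add: lim)
  also have "\<dots> = J"
    unfolding J_def M_def using lebesgue_integral_eq_integral[OF iw[OF ib, unfolded M_def] Im] by simp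
  finally have "integral {0..2*pi} (\<lambda>t. (1 - (cmod z)\<^sup>2) / (cmod (cis t - z))\<^sup>2 * (cmod (boundary_val f t))\<^sup>2) = J"
    by (simp only: I_def w_def pk_def)
  then show ?thesis unfolding poisson_sq_def c_def[symmetric] by (simp add: J)
qed

lemma garsia_eq:
  assumes "f holomorphic_on ball 0 1" "l2 (taylor_coeff f)" "cmod z < 1"
  shows "garsia f z = (gars (taylor_coeff f) z)\<^sup>2"
  by (simp add: garsia_def poisson_sq_eq[OF assms])

section \<open>\<open>BMOA\<close> and \<open>VMOA\<close> in terms of Taylor coefficients\<close>

abbreviation tc :: "(complex \<Rightarrow> complex) \<Rightarrow> nat \<Rightarrow> complex" where "tc \<equiv> taylor_coeff"

lemma sqrt_garsia:
  assumes "f \<in> H2" "cmod z < 1"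
  shows "sqrt (garsia f z) = gars (tc f) z"
  using assms garsia_eq[of f z] gars_nonneg[of "tc f" z] by (simp add: H2_iff)

lemma BMOA_iff: "f \<in> BMOA \<longleftrightarrow> f holomorphic_on ball 0 1 \<and> l2 (tc f) \<and> (\<exists>B. \<forall>z. cmod z < 1 \<longrightarrow> gars (tc f) z \<le> B)"
proof (cases "f \<in> H2")
  case True
  have "(\<lambda>z. sqrt (garsia f z)) ` ball 0 1 = (\<lambda>z. gars (tc f) z) ` ball 0 1"
    by (rule image_cong) (use sqrt_garsia[OF True] in auto)
  then have "bdd_above ((\<lambda>z. sqrt (garsia f z)) ` ball 0 1) \<longleftrightarrow> (\<exists>B. \<forall>z. cmod z < 1 \<longrightarrow> gars (tc f) z \<le> B)"
    by (simp add: bdd_above_def) (simp add: Ball_def)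
  then show ?thesis using True unfolding BMOA_def by (simp add: H2_iff)
qed (auto simp: BMOA_def H2_iff)

lemma BMOAD: "f \<in> BMOA \<Longrightarrow> f holomorphic_on ball 0 1" "f \<in> BMOA \<Longrightarrow> l2 (tc f)"
  by (auto simp: BMOA_iff)

lemma BMOA_norm_eq:
  assumes "f \<in> BMOA"
  shows "BMOA_norm f = cmod (f 0) + (SUP z\<in>ball 0 1. gars (tc f) z)"
proof -
  have "f \<in> H2" using assms by (simp add: BMOA_def)
  then show ?thesis unfolding BMOA_norm_def by (simp add: sqrt_garsia cong: SUP_cong_simp)
qed

lemma gars_le_BMOA_norm:
  assumes f: "f \<in> BMOA" and z: "cmod z < 1"
  shows "cmod (f 0) + gars (tc f) z \<le> BMOA_norm f"
proof -
  have "gars (tc f) z \<le> (SUP z\<in>ball 0 1. gars (tc f) z)"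
  proof (rule cSUP_upper)
    obtain B where "\<And>z. cmod z < 1 \<Longrightarrow> gars (tc f) z \<le> B" using f by (auto simp: BMOA_iff)
    then show "bdd_above ((\<lambda>z. gars (tc f) z) ` ball 0 1)" by (intro bdd_aboveI2[of _ _ B]) simp
  qed (use z in simp)
  then show ?thesis by (simp add: BMOA_norm_eq[OF f])
qed

lemma BMOAI:
  assumes "f holomorphic_on ball 0 1" "l2 (tc f)" "\<And>z. cmod z < 1 \<Longrightarrow> cmod (f 0) + gars (tc f) z \<le> B"
  shows "f \<in> BMOA" "BMOA_norm f \<le> B"
proof -
  have g: "gars (tc f) z \<le> B - cmod (f 0)" if "cmod z < 1" for z using assms(3)[OF that] by simp
  show 1: "f \<in> BMOA" using assms g by (auto simp: BMOA_iff)
  have "(SUP z\<in>ball 0 1. gars (tc f) z) \<le> B - cmod (f 0)"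
    using g by (intro cSUP_least) auto
  then show "BMOA_norm f \<le> B" by (simp add: BMOA_norm_eq[OF 1])
qed

lemma n2_le_BMOA_norm: "f \<in> BMOA \<Longrightarrow> n2 (tc f) \<le> BMOA_norm f"
  using n2_le_gars[of "tc f"] gars_le_BMOA_norm[of f 0] by (simp add: BMOAD taylor_coeff_0)

lemma BMOA_norm_nonneg: "f \<in> BMOA \<Longrightarrow> 0 \<le> BMOA_norm f"
  using n2_le_BMOA_norm[of f] n2_nonneg'[OF BMOAD(2), of f] by linarith

lemma BMOA_linear:
  assumes f: "f \<in> BMOA" and g: "g \<in> BMOA"
  shows "(\<lambda>z. a * f z + b * g z) \<in> BMOA" "BMOA_norm (\<lambda>z. a * f z + b * g z) \<le> cmod a * BMOA_norm f + cmod b * BMOA_norm g"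
proof -
  have h: "(\<lambda>z. a * f z + b * g z) holomorphic_on ball 0 1"
    using f g by (intro holomorphic_intros BMOAD)
  note t = taylor_coeff_linear[OF BMOAD(1)[OF f] BMOAD(1)[OF g], of a b]
  have l: "l2 (tc (\<lambda>z. a * f z + b * g z))"
    unfolding t by (intro n2_triangle(1) n2_cmul(1) BMOAD f g)
  have n: "cmod (a * f 0 + b * g 0) + gars (tc (\<lambda>z. a * f z + b * g z)) z \<le> cmod a * BMOA_norm f + cmod b * BMOA_norm g"
    if z: "cmod z < 1" for z
  proof -
    have "cmod (a * f 0 + b * g 0) \<le> cmod a * cmod (f 0) + cmod b * cmod (g 0)"
      by (metis norm_mult norm_triangle_ineq)
    moreover have "gars (tc (\<lambda>z. a * f z + b * g z)) z \<le> cmod a * gars (tc f) z + cmod b * gars (tc g) z"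
      unfolding t by (rule gars_linear[OF BMOAD(2)[OF f] BMOAD(2)[OF g] z])
    moreover have "cmod a * (cmod (f 0) + gars (tc f) z) \<le> cmod a * BMOA_norm f"
      "cmod b * (cmod (g 0) + gars (tc g) z) \<le> cmod b * BMOA_norm g"
      by (intro mult_left_mono gars_le_BMOA_norm f g z norm_ge_zero)+
    ultimately show ?thesis by (simp add: distrib_left)
  qed
  from BMOAI[OF h l n] show "(\<lambda>z. a * f z + b * g z) \<in> BMOA" "BMOA_norm (\<lambda>z. a * f z + b * g z) \<le> cmod a * BMOA_norm f + cmod b * BMOA_norm g"
    by auto
qed

lemma VMOA_iff: "f \<in> VMOA \<longleftrightarrow> f \<in> BMOA \<and> (\<forall>e>0. \<exists>r<1. \<forall>z. r < cmod z \<and> cmod z < 1 \<longrightarrow> gars (tc f) z < e)"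
proof (cases "f \<in> BMOA")
  case True
  have g: "\<bar>garsia f z\<bar> = (gars (tc f) z)\<^sup>2" "0 \<le> gars (tc f) z" if "cmod z < 1" for z
    using garsia_eq[OF BMOAD[OF True] that] gars_nonneg[OF BMOAD(2)[OF True] that] by auto
  have "(\<forall>e>0. \<exists>r<1. \<forall>z. r < cmod z \<and> cmod z < 1 \<longrightarrow> \<bar>garsia f z\<bar> < e) \<longleftrightarrow>
        (\<forall>e>0. \<exists>r<1. \<forall>z. r < cmod z \<and> cmod z < 1 \<longrightarrow> gars (tc f) z < e)" (is "?L \<longleftrightarrow> ?R")
  proof
    assume L: ?L
    show ?R
    proof (intro allI impI)
      fix e :: real assume "e > 0"
      with L obtain r where r: "r < 1" "\<And>z. r < cmod z \<Longrightarrow> cmod z < 1 \<Longrightarrow> \<bar>garsia f z\<bar> < e\<^sup>2"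
        by (metis zero_less_power)
      have "gars (tc f) z < e" if z: "r < cmod z" "cmod z < 1" for z
      proof -
        have "(gars (tc f) z)\<^sup>2 < e\<^sup>2" using r(2)[OF z] g(1)[OF z(2)] by simp
        then show ?thesis using \<open>e > 0\<close> by (simp add: power2_less_imp_less)
      qed
      with r(1) show "\<exists>r<1. \<forall>z. r < cmod z \<and> cmod z < 1 \<longrightarrow> gars (tc f) z < e" by blast
    qed
  next
    assume R: ?R
    show ?L
    proof (intro allI impI)
      fix e :: real assume e: "e > 0"
      then have "sqrt e > 0" by simp
      with R obtain r where r: "r < 1" "\<And>z. r < cmod z \<Longrightarrow> cmod z < 1 \<Longrightarrow> gars (tc f) z < sqrt e"
        by blast
      have "\<bar>garsia f z\<bar> < e" if z: "r < cmod z" "cmod z < 1" for z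
      proof -
        have "(gars (tc f) z)\<^sup>2 < (sqrt e)\<^sup>2" using r(2)[OF z] g(2)[OF z(2)] by (intro power_strict_mono) auto
        then show ?thesis using g(1)[OF z(2)] e by simp
      qed
      with r(1) show "\<exists>r<1. \<forall>z. r < cmod z \<and> cmod z < 1 \<longrightarrow> \<bar>garsia f z\<bar> < e" by blast
    qed
  qed
  then show ?thesis using True by (simp add: VMOA_def)
qed (simp add: VMOA_def)

lemma VMOA_BMOA: "f \<in> VMOA \<Longrightarrow> f \<in> BMOA"
  by (simp add: VMOA_def)

text \<open>Closedness of \<open>VMOA\<close> in the seminorm: vanishing at the circle passes to
  \<open>f\<close> because the error \<open>e/2\<close> is uniform in \<open>z\<close>. It is used
  for completeness.\<close>

lemma VMOA_approximable:
  assumes f: "f \<in> BMOA" and ap: "\<And>e. e > 0 \<Longrightarrow> \<exists>g\<in>VMOA. \<forall>z. cmod z < 1 \<longrightarrow> gars (\<lambda>k. tc f k - tc g k) z \<le> e"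
  shows "f \<in> VMOA"
  unfolding VMOA_iff
proof (intro conjI f allI impI)
  fix e :: real assume e: "e > 0"
  then obtain g where g: "g \<in> VMOA" "\<And>z. cmod z < 1 \<Longrightarrow> gars (\<lambda>k. tc f k - tc g k) z \<le> e / 2"
    using ap[of "e/2"] by auto
  obtain r where r: "r < 1" "\<And>z. r < cmod z \<Longrightarrow> cmod z < 1 \<Longrightarrow> gars (tc g) z < e / 2"
    using g(1) e unfolding VMOA_iff by (meson half_gt_zero)
  have lf: "l2 (tc f)" and lg: "l2 (tc g)" using f VMOA_BMOA[OF g(1)] by (auto intro: BMOAD)
  show "\<exists>r<1. \<forall>z. r < cmod z \<and> cmod z < 1 \<longrightarrow> gars (tc f) z < e"
  proof (intro exI[of _ r] conjI allI impI r(1))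
    fix z assume z: "r < cmod z \<and> cmod z < 1"
    have "gars (tc f) z \<le> gars (\<lambda>k. tc f k - tc g k) z + gars (tc g) z"
      using gars_add[OF n2_diff(1)[OF lf lg] lg, of z] z by simp
    then show "gars (tc f) z < e" using g(2)[of z] r(2)[of z] z by auto
  qed
qed

lemma VMOA_linear:
  assumes f: "f \<in> VMOA" and g: "g \<in> VMOA"
  shows "(\<lambda>z. a * f z + b * g z) \<in> VMOA"
  unfolding VMOA_iff
proof (intro conjI allI impI)
  note fB = VMOA_BMOA[OF f] and gB = VMOA_BMOA[OF g]
  show "(\<lambda>z. a * f z + b * g z) \<in> BMOA" by (rule BMOA_linear(1)[OF fB gB])
  fix e :: real assume e: "e > 0"
  define S where "S = cmod a + cmod b + 1"
  have S: "S > 0" by (simp add: S_def add_nonneg_pos)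
  define d where "d = e / (2 * S)"
  have d: "d > 0" using e S by (simp add: d_def)
  obtain r where r: "r < 1" "\<And>z. r < cmod z \<Longrightarrow> cmod z < 1 \<Longrightarrow> gars (tc f) z < d"
    using f d unfolding VMOA_iff by meson
  obtain s where s: "s < 1" "\<And>z. s < cmod z \<Longrightarrow> cmod z < 1 \<Longrightarrow> gars (tc g) z < d"
    using g d unfolding VMOA_iff by meson
  show "\<exists>r<1. \<forall>z. r < cmod z \<and> cmod z < 1 \<longrightarrow> gars (tc (\<lambda>z. a * f z + b * g z)) z < e"
  proof (intro exI[of _ "max r s"] conjI allI impI)
    fix z assume z: "max r s < cmod z \<and> cmod z < 1"
    then have z1: "cmod z < 1" by simp
    have "gars (tc (\<lambda>z. a * f z + b * g z)) z \<le> cmod a * gars (tc f) z + cmod b * gars (tc g) z"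
      unfolding taylor_coeff_linear[OF BMOAD(1)[OF fB] BMOAD(1)[OF gB]]
      by (rule gars_linear[OF BMOAD(2)[OF fB] BMOAD(2)[OF gB] z1])
    also have "\<dots> \<le> cmod a * d + cmod b * d"
      using r(2)[of z] s(2)[of z] z by (intro add_mono mult_left_mono) auto
    also have "\<dots> = (S - 1) * d" by (simp add: S_def algebra_simps)
    also have "\<dots> < S * (2 * d)" using d S by (simp add: algebra_simps add_pos_pos)
    also have "\<dots> = e" using S by (simp add: d_def)
    finally show "gars (tc (\<lambda>z. a * f z + b * g z)) z < e" .
  qed (use r s in auto)
qed

section \<open>Absolutely convergent series and density of dilations in \<open>VMOA\<close>\<close>

lemma suminf_norm_bound: "summable (\<lambda>k. cmod (c k)) \<Longrightarrow> cmod (c k) \<le> (\<Sum>k. cmod (c k))"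
  using sum_le_suminf[of "\<lambda>k. cmod (c k)" "{k}"] by simp

text \<open>The approximants and dilations are series of this kind, so they lie in every space at
  once, with norms bounded by the absolute sum of the coefficients. The factor 2 counts the value at
  0 and the seminorm separately.\<close>

lemma
  assumes c: "summable (\<lambda>k. cmod (c k))"
  shows pser_holomorphic: "pser c holomorphic_on ball 0 1"
    and tc_pser: "tc (pser c) = c"
    and pser_H1: "pser c \<in> H1" and pser_H1_norm: "H1_norm (pser c) \<le> (\<Sum>k. cmod (c k))"
    and pser_VMOA: "pser c \<in> VMOA" and pser_BMOA_norm: "BMOA_norm (pser c) \<le> 2 * (\<Sum>k. cmod (c k))"
proof -
  let ?S = "\<Sum>k. cmod (c k)"
  note bd = suminf_norm_bound[OF c]
  show h: "pser c holomorphic_on ball 0 1" by (rule holomorphic_pser[OF bd])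
  show t: "tc (pser c) = c" by (rule taylor_coeff_pser[OF bd])
  have "H1_mean (pser c) r \<le> ?S" if r: "0 \<le> r" "r < 1" for r
  proof -
    have "H1_mean (pser c) r \<le> cmean (\<lambda>t. ?S)"
      unfolding H1_mean_cmean using r
      by (intro cmean_mono continuous_intros continuous_on_circle[OF h] norm_pser_le c) (auto simp: norm_mult)
    then show ?thesis by simp
  qed
  from H1I[OF h this] show "pser c \<in> H1" "H1_norm (pser c) \<le> ?S" by auto
  have l: "l2 (tc (pser c))" unfolding t by (rule summable_imp_l2[OF c])
  have n: "cmod (pser c 0) + gars (tc (pser c)) z \<le> 2 * ?S" if "cmod z < 1" for z
    unfolding t using gars_le_summable[OF c that] norm_pser_le[OF c, of 0] by simp
  from BMOAI[OF h l n] show "BMOA_norm (pser c) \<le> 2 * ?S" by auto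
  from BMOAI(1)[OF h l n] show "pser c \<in> VMOA"
    unfolding VMOA_iff t using gars_summable_small[OF c] by auto
qed

text \<open>The pairing is bilinear, with \<open>h\<close> evaluated along the reversed circle,
  whereas the Uchiyama estimate is sesquilinear. Conjugating coefficients passes from one to the
  other, and the set of values of the seminorm over the disc is unchanged.\<close>

lemma gars_cnj:
  assumes "l2 c" "cmod z < 1"
  shows "gars (\<lambda>k. cnj (c k)) z = gars c (cnj z)"
proof -
  have "dq (\<lambda>k. cnj (c k)) z k = cnj (dq c (cnj z) k)" for k
  proof -
    have "(\<lambda>j. cnj (c (Suc k + j) * cnj z ^ j)) sums cnj (dq c (cnj z) k)"
      unfolding sums_cnj dq_def tser_def
      by (intro summable_sums tser_summable[of c "n2 c"] l2_bounded assms(1)) (use assms(2) in simp)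
    then show ?thesis by (simp add: dq_def tser_def sums_iff)
  qed
  then have "n2 (dq (\<lambda>k. cnj (c k)) z) = n2 (dq c (cnj z))"
    by (simp add: n2_def)
  then show ?thesis by (simp add: gars_def)
qed

text \<open>Near the circle both \<open>f\<close> and its dilation have small seminorm, the latter
  by \<open>gars_dilate\<close> since \<open>s * z\<close> is still near the circle. On the
  remaining disc \<open>|z| \<le> q\<close> the seminorm is controlled by the coefficient norm,
  which tends to 0 by \<open>n2_diff_dilate_tendsto\<close>.\<close>

lemma VMOA_dilate_dense:
  assumes f: "f \<in> VMOA" and e: "e > 0"
  obtains s where "0 < s" "s < 1" "BMOA_norm (\<lambda>z. f z - f (of_real s * z)) \<le> e"
proof -
  note fB = VMOA_BMOA[OF f]
  let ?c = "tc f"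
  have l: "l2 ?c" by (rule BMOAD(2)[OF fB])
  obtain r where r: "r < 1" "\<And>z. r < cmod z \<Longrightarrow> cmod z < 1 \<Longrightarrow> gars ?c z < e / 2"
    using f e unfolding VMOA_iff by (meson half_gt_zero)
  \<comment> \<open>Strictly between \<open>max r 0\<close> and 1, so that every \<open>s\<close>
    close to 1 satisfies \<open>s * q > r\<close>; points beyond \<open>q\<close> then remain beyond
    \<open>r\<close> after dilation.\<close>
  define q where "q = (max r 0 + 1) / 2"
  have q: "0 < q" "q < 1" "max r 0 < q" using r(1) by (auto simp: q_def)
  have "((\<lambda>s. 2 * n2 (\<lambda>k. ?c k - ?c k * of_real s ^ k) / (1 - q)\<^sup>2) \<longlongrightarrow> 2 * 0 / (1 - q)\<^sup>2) (at_left 1)"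
    using q by (intro tendsto_divide tendsto_mult tendsto_const n2_diff_dilate_tendsto l) auto
  then have "eventually (\<lambda>s. 2 * n2 (\<lambda>k. ?c k - ?c k * of_real s ^ k) / (1 - q)\<^sup>2 < e) (at_left 1)"
    using e by (intro order_tendstoD(2)) auto
  moreover have "eventually (\<lambda>s::real. s \<in> {max r 0 / q<..<1}) (at_left 1)"
    using q by (intro eventually_at_left_real) auto
  ultimately have "eventually (\<lambda>s. 2 * n2 (\<lambda>k. ?c k - ?c k * of_real s ^ k) / (1 - q)\<^sup>2 < e \<and> s \<in> {max r 0 / q<..<1}) (at_left 1)"
    by (rule eventually_conj)
  then obtain s where s: "2 * n2 (\<lambda>k. ?c k - ?c k * of_real s ^ k) / (1 - q)\<^sup>2 < e" "max r 0 / q < s" "s < 1"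
    using eventually_happens'[OF trivial_limit_at_left_real] by fastforce
  have s0: "0 < s" using s(2) q by (meson divide_nonneg_pos le_less_trans max.cobounded2)
  have hs: "(\<lambda>z. f (of_real s * z)) holomorphic_on ball 0 1"
    using s s0 by (intro holomorphic_dilate BMOAD fB) auto
  have tcs: "tc (\<lambda>z. f (of_real s * z)) = (\<lambda>k. ?c k * of_real s ^ k)"
    using s s0 by (intro taylor_coeff_dilate BMOAD fB) auto
  have ls: "l2 (\<lambda>k. ?c k * of_real s ^ k)" using s s0 by (intro l2_dilate l) auto
  have td: "tc (\<lambda>z. f z - f (of_real s * z)) = (\<lambda>k. ?c k - ?c k * of_real s ^ k)"
    by (subst taylor_coeff_diff[OF BMOAD(1)[OF fB] hs]) (simp add: tcs)
  have hd: "(\<lambda>z. f z - f (of_real s * z)) holomorphic_on ball 0 1" by (intro holomorphic_on_diff hs BMOAD fB)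
  have ld: "l2 (\<lambda>k. ?c k - ?c k * of_real s ^ k)" by (rule n2_diff(1)[OF l ls])
  have n: "cmod (f 0 - f (of_real s * 0)) + gars (tc (\<lambda>z. f z - f (of_real s * z))) z \<le> e" if z: "cmod z < 1" for z
  proof (cases "cmod z \<le> q")
    case True
    have "gars (\<lambda>k. ?c k - ?c k * of_real s ^ k) z \<le> 2 * n2 (\<lambda>k. ?c k - ?c k * of_real s ^ k) / (1 - cmod z)\<^sup>2"
      by (rule gars_le[OF ld z])
    also have "\<dots> \<le> 2 * n2 (\<lambda>k. ?c k - ?c k * of_real s ^ k) / (1 - q)\<^sup>2"
    proof (rule divide_left_mono)
      show "(1 - q)\<^sup>2 \<le> (1 - cmod z)\<^sup>2" using True q by (intro power_mono) auto
    qed (use q z n2_nonneg'[OF ld] in auto)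
    finally show ?thesis using s(1) by (simp add: td)
  next
    case False
    have "max r 0 < s * q" using s(2) q by (simp add: divide_less_eq)
    also have "s * q \<le> s * cmod z" using False s0 by simp
    finally have sz: "r < cmod (of_real s * z)" using s0 by (simp add: norm_mult)
    have sz1: "cmod (of_real s * z) < 1" using s s0 z mult_left_le_one_le[of "cmod z" s] by (simp add: norm_mult)
    have "gars (\<lambda>k. ?c k - ?c k * of_real s ^ k) z \<le> gars ?c z + gars (\<lambda>k. ?c k * of_real s ^ k) z"
      by (rule gars_diff[OF l ls z])
    also have "gars (\<lambda>k. ?c k * of_real s ^ k) z \<le> gars ?c (of_real s * z)"
      using s s0 by (intro gars_dilate l z) auto
    also have "gars ?c (of_real s * z) < e / 2" by (rule r(2)[OF sz sz1])
    also have "gars ?c z < e / 2" using r(2)[of z] False q z by auto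
    finally show ?thesis by (simp add: td)
  qed
  have "BMOA_norm (\<lambda>z. f z - f (of_real s * z)) \<le> e" by (rule BMOAI(2)[OF hd _ n]) (use ld in \<open>simp_all only: td\<close>)
  with s0 s(3) that show ?thesis by blast
qed

section \<open>The pairing between \<open>H\<^sup>1\<close> and \<open>BMOA\<close>\<close>

text \<open>\<open>Uchiyama\<close> with \<open>B = 1\<close>, for \<open>h\<close> scaled to norm
  1, gives \<open>2 * exp (1/2)\<close>; the final 1 accounts for the product of the values at
  0.\<close>

definition fefferman_const :: real where "fefferman_const = 2 * exp (1/2) + 1"

lemma fefferman_const_pos: "fefferman_const > 0" unfolding fefferman_const_def by (simp add: add_pos_pos)

definition cpair :: "(complex \<Rightarrow> complex) \<Rightarrow> (complex \<Rightarrow> complex) \<Rightarrow> real \<Rightarrow> complex" where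
  "cpair g h r = cmean (\<lambda>t. g (of_real r * cis t) * h (of_real r * cis (- t)))"

lemma pairing_eq: "pairing g h = Lim (at_left 1) (cpair g h)"
  unfolding pairing_def cpair_def cmean_def by (simp add: scaleR_conv_of_real)

lemma cpair_sums:
  assumes g: "g holomorphic_on ball 0 1" and h: "h holomorphic_on ball 0 1" and r: "0 \<le> r" "r < 1"
  shows "(\<lambda>k. tc g k * tc h k * of_real (r\<^sup>2) ^ k) sums cpair g h r"
proof -
  have "(\<lambda>k. (tc g k * of_real r ^ k) * (tc h k * of_real r ^ k)) sums cpair g h r"
    using Parseval_pser_bilinear[OF summable_dilated_taylor[OF g r] summable_dilated_taylor[OF h r]]
    by (simp add: cpair_def holomorphic_dilated_eq_pser[OF g r] holomorphic_dilated_eq_pser[OF h r])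
  moreover have "(tc g k * of_real r ^ k) * (tc h k * of_real r ^ k) = tc g k * tc h k * of_real (r\<^sup>2) ^ k" for k
    by (simp add: power2_eq_square power_mult_distrib)
  ultimately show ?thesis by simp
qed

text \<open>\<open>Uchiyama\<close> is applied to the dilations by \<open>r\<close>, holomorphic on
  the disc of radius \<open>1 / r\<close>. The function \<open>h\<close> enters with conjugated and
  normalised coefficients \<open>d\<close>, and \<open>K\<close> is its harmonic majorant
  \<open>majc d\<close>: by \<open>Re_majc\<close> the gap between \<open>Re K\<close> and the
  squared modulus is \<open>gars\<close> squared, hence between 0 and 1.\<close>

lemma cpair_bound:
  assumes g: "g \<in> H1" and h: "h \<in> BMOA" and r: "0 < r" "r < 1"
  shows "cmod (cpair g h r) \<le> fefferman_const * (H1_norm g * BMOA_norm h)"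
proof (cases "BMOA_norm h = 0")
  case True
  have l: "l2 (tc h)" by (rule BMOAD(2)[OF h])
  have "n2 (tc h) = 0" using n2_le_BMOA_norm[OF h] n2_nonneg'[OF l] True by simp
  then have "tc h k = 0" for k using l2_bounded[OF l, of k] by simp
  then have "(\<lambda>k. 0) sums cpair g h r" using cpair_sums[OF H1D(1)[OF g] BMOAD(1)[OF h], of r] r by simp
  then show ?thesis using True by (simp add: sums_iff)
next
  case False
  define \<beta> where "\<beta> = BMOA_norm h"
  have \<beta>: "\<beta> > 0" using False BMOA_norm_nonneg[OF h] by (simp add: \<beta>_def)
  have l: "l2 (tc h)" by (rule BMOAD(2)[OF h])
  define d where "d k = (1 / of_real \<beta>) * cnj (tc h k)" for k
  have lc: "l2 (\<lambda>k. cnj (tc h k))" using l by (simp add: l2_cnj)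
  have ld: "l2 d" unfolding d_def by (rule n2_cmul(1)[OF lc])
  have gd: "0 \<le> gars d z" "gars d z \<le> 1" if z: "cmod z < 1" for z
  proof -
    show "0 \<le> gars d z" by (rule gars_nonneg[OF ld z])
    have "gars d z = (1/\<beta>) * gars (tc h) (cnj z)"
      unfolding d_def gars_cmul[OF lc z] gars_cnj[OF l z] using \<beta> by (simp add: norm_divide)
    also have "gars (tc h) (cnj z) \<le> \<beta>"
    proof -
      have "cmod (cnj z) < 1" using z by simp
      from gars_le_BMOA_norm[OF h this] show ?thesis unfolding \<beta>_def using norm_ge_zero[of "h 0"] by linarith
    qed
    finally show "gars d z \<le> 1" using \<beta> by (simp add: divide_right_mono)
  qed
  have R: "1 / r > 1" "1 / r > 0" using r by auto
  have dil: "(\<lambda>z. u (of_real r * z)) holomorphic_on ball 0 (1 / r)" if "u holomorphic_on ball 0 1" for u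
    by (rule holomorphic_on_compose_gen[OF _ that, unfolded o_def])
       (use r in \<open>auto intro!: holomorphic_intros simp: norm_mult field_simps\<close>)
  have hol: "pser d holomorphic_on ball 0 1" "pser (majc d) holomorphic_on ball 0 1"
    by (rule holomorphic_pser[OF l2_bounded[OF ld]], rule holomorphic_pser[OF majc_bounded[OF ld]])
  have U: "cmod (cmean (\<lambda>t. g (of_real r * cis t) * cnj (pser d (of_real r * cis t))))
     \<le> 2 * exp (1/2) * cmean (\<lambda>t. cmod (g (of_real r * cis t))) + cmod (g (of_real r * 0) * pser d (of_real r * 0))"
  proof (rule Uchiyama[OF dil[OF H1D(1)[OF g]] dil[OF hol(1)] dil[OF hol(2)] R(1)])
    fix z assume "cmod z < 1 / r"
    then have z: "cmod (of_real r * z) < 1" using r by (simp add: norm_mult field_simps)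
    have "(gars d (of_real r * z))\<^sup>2 \<le> 1" using gd[OF z] by (simp add: power_le_one)
    then show "(cmod (pser d (of_real r * z)))\<^sup>2 \<le> Re (pser (majc d) (of_real r * z)) \<and>
         Re (pser (majc d) (of_real r * z)) \<le> (cmod (pser d (of_real r * z)))\<^sup>2 + 1"
      unfolding Re_majc[OF ld z] by simp
  qed
  have cd: "cnj (pser d (of_real r * cis t)) = (1 / of_real \<beta>) * h (of_real r * cis (- t))" for t
  proof -
    have n: "cmod (of_real r * cis t) < 1" "cmod (of_real r * cis (- t)) < 1" using r by (auto simp: norm_mult)
    have "(\<lambda>k. cnj (d k * (of_real r * cis t) ^ k)) sums cnj (pser d (of_real r * cis t))"
      unfolding sums_cnj by (rule pser_bounded_sums[OF l2_bounded[OF ld] n(1)])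
    moreover have "(\<lambda>k. (1 / of_real \<beta>) * (tc h k * (of_real r * cis (- t)) ^ k)) sums ((1 / of_real \<beta>) * h (of_real r * cis (- t)))"
      by (intro sums_mult taylor_sums[OF BMOAD(1)[OF h] n(2)])
    moreover have "cnj (d k * (of_real r * cis t) ^ k) = (1 / of_real \<beta>) * (tc h k * (of_real r * cis (- t)) ^ k)" for k
      by (simp add: d_def cis_cnj)
    ultimately show ?thesis by (metis (no_types, lifting) sums_unique2 sums_cong)
  qed
  have "cmean (\<lambda>t. g (of_real r * cis t) * cnj (pser d (of_real r * cis t))) = (1 / of_real \<beta>) * cpair g h r"
    unfolding cd cpair_def by (subst cmean_cmul[symmetric]) (simp add: mult_ac)
  then have "cmod (cpair g h r) / \<beta> \<le> 2 * exp (1/2) * H1_mean g r + cmod (g 0 * pser d 0)"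
    using U \<beta> by (simp add: norm_mult norm_divide H1_mean_cmean)
  also have "\<dots> \<le> 2 * exp (1/2) * H1_norm g + H1_norm g * 1"
  proof (intro add_mono mult_left_mono)
    show "H1_mean g r \<le> H1_norm g" using r by (intro H1_mean_le_norm g) auto
    have "cmod (pser d 0) \<le> 1"
    proof -
      have "pser d 0 = d 0" unfolding pser_def by (rule powser_zero)
      then have "cmod (pser d 0) = cmod (h 0) / \<beta>" using \<beta> by (simp add: d_def norm_mult norm_divide taylor_coeff_0)
      also have "\<dots> \<le> 1"
        using gars_le_BMOA_norm[OF h, of 0] gars_nonneg[OF l, of 0] \<beta> by (simp add: \<beta>_def divide_le_eq)
      finally show ?thesis .
    qed
    moreover have "cmod (g 0) \<le> H1_norm g" using norm_taylor_coeff_le[OF g, of 0] by (simp add: taylor_coeff_0)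
    ultimately show "cmod (g 0 * pser d 0) \<le> H1_norm g * 1"
      unfolding norm_mult by (intro mult_mono) (auto simp: H1_norm_nonneg[OF g])
  qed auto
  finally have "cmod (cpair g h r) / \<beta> \<le> fefferman_const * H1_norm g" by (simp add: fefferman_const_def algebra_simps)
  then show ?thesis using \<beta> by (simp add: divide_le_eq \<beta>_def mult_ac)
qed

lemma cpair_tendsto_summable:
  assumes g: "g holomorphic_on ball 0 1" and h: "h holomorphic_on ball 0 1" and s: "summable (\<lambda>k. cmod (tc g k * tc h k))"
  shows "(cpair g h \<longlongrightarrow> (\<Sum>k. tc g k * tc h k)) (at_left 1)"
proof -
  have ev: "eventually (\<lambda>r::real. r \<in> {0<..<1}) (at_left 1)" by (rule eventually_at_left_real) auto
  have "((\<lambda>r. \<Sum>k. tc g k * tc h k * of_real (r\<^sup>2) ^ k) \<longlongrightarrow> (\<Sum>k. tc g k * tc h k)) (at_left (1::real))"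
  proof (rule conjunct2[OF conjunct2[OF tannerys_theorem]])
    show "((\<lambda>r. tc g k * tc h k * of_real (r\<^sup>2) ^ k) \<longlongrightarrow> tc g k * tc h k) (at_left (1::real))" for k
    proof -
      have "((\<lambda>r. tc g k * tc h k * of_real (r\<^sup>2) ^ k) \<longlongrightarrow> tc g k * tc h k * of_real (1\<^sup>2) ^ k) (at_left (1::real))"
        by (intro tendsto_intros)
      then show ?thesis by simp
    qed
    have "eventually (\<lambda>(k,r::real). r \<in> {0<..<1}) (at_top \<times>\<^sub>F at_left 1)"
      unfolding eventually_prod_filter using ev
      by (intro exI[of _ "\<lambda>_. True"] exI[of _ "\<lambda>r. r \<in> {0<..<1}"]) auto
    then show "eventually (\<lambda>(k,r). norm (tc g k * tc h k * of_real (r\<^sup>2) ^ k) \<le> cmod (tc g k * tc h k)) (at_top \<times>\<^sub>F at_left (1::real))"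
    proof eventually_elim
      case (elim x)
      obtain k r where x: "x = (k, r)" by force
      have "(r\<^sup>2) ^ k \<le> 1" using elim x by (intro power_le_one) (auto simp: power_le_one)
      then show ?case using x by (simp add: norm_mult norm_power mult_left_le)
    qed
  qed (use s in auto)
  moreover have "eventually (\<lambda>r. (\<Sum>k. tc g k * tc h k * of_real (r\<^sup>2) ^ k) = cpair g h r) (at_left 1)"
    using ev by eventually_elim (use cpair_sums[OF g h] in \<open>auto simp: sums_iff\<close>)
  ultimately show ?thesis by (rule Lim_transform_eventually)
qed

lemma pairing_summable:
  assumes "g holomorphic_on ball 0 1" "h holomorphic_on ball 0 1" "summable (\<lambda>k. cmod (tc g k * tc h k))"
  shows "pairing g h = (\<Sum>k. tc g k * tc h k)"
  unfolding pairing_eq by (rule tendsto_Lim[OF trivial_limit_at_left_real cpair_tendsto_summable[OF assms]])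

lemma cpair_linear_left:
  assumes g: "g holomorphic_on ball 0 1" "g' holomorphic_on ball 0 1" and h: "h holomorphic_on ball 0 1" and r: "0 \<le> r" "r < 1"
  shows "cpair (\<lambda>z. a * g z + b * g' z) h r = a * cpair g h r + b * cpair g' h r"
proof -
  have c: "continuous_on UNIV (\<lambda>t. a * (g (of_real r * cis t) * h (of_real r * cis (- t))))"
    "continuous_on UNIV (\<lambda>t. b * (g' (of_real r * cis t) * h (of_real r * cis (- t))))"
    by (intro continuous_intros continuous_on_circle g h r)+
  show ?thesis unfolding cpair_def cmean_cmul[symmetric] cmean_add[OF c, symmetric]
    by (simp add: algebra_simps)
qed

lemma cpair_linear_right:
  assumes g: "g holomorphic_on ball 0 1" and h: "h holomorphic_on ball 0 1" "h' holomorphic_on ball 0 1" and r: "0 \<le> r" "r < 1"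
  shows "cpair g (\<lambda>z. a * h z + b * h' z) r = a * cpair g h r + b * cpair g h' r"
proof -
  have c: "continuous_on UNIV (\<lambda>t. a * (g (of_real r * cis t) * h (of_real r * cis (- t))))"
    "continuous_on UNIV (\<lambda>t. b * (g (of_real r * cis t) * h' (of_real r * cis (- t))))"
    by (intro continuous_intros continuous_on_circle g h r)+
  show ?thesis unfolding cpair_def cmean_cmul[symmetric] cmean_add[OF c, symmetric]
    by (simp add: algebra_simps)
qed

lemma l2_norm_bounded_mult_dilate_summable:
  assumes g: "g holomorphic_on ball 0 1" and h: "h \<in> BMOA" and s: "0 \<le> s" "s < 1"
  shows "summable (\<lambda>k. cmod (tc g k * of_real s ^ k * tc h k))"
proof (rule summable_comparison_test'[OF summable_mult2[OF summable_dilated_taylor[OF g s], of "n2 (tc h)"], of 0])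
  show "norm (cmod (tc g k * of_real s ^ k * tc h k)) \<le> cmod (tc g k * of_real s ^ k) * n2 (tc h)" for k
    using l2_bounded[OF BMOAD(2)[OF h], of k] by (simp add: norm_mult mult_left_mono)
qed

text \<open>A \<open>Lim\<close> has meaning only once convergence is known. Replace
  \<open>g\<close> by a nearby dilation, for which the coefficient series converges absolutely and
  the limit exists; \<open>cpair_bound\<close> makes the error small uniformly in the radius, and
  the Cauchy criterion follows.\<close>

lemma cpair_convergent:
  assumes g: "g \<in> H1" and h: "h \<in> BMOA"
  shows "(cpair g h \<longlongrightarrow> pairing g h) (at_left 1)" "cmod (pairing g h) \<le> fefferman_const * (H1_norm g * BMOA_norm h)"
proof -
  note gh = H1D(1)[OF g] and hh = BMOAD(1)[OF h]
  have ev: "eventually (\<lambda>r::real. r \<in> {0<..<1}) (at_left 1)" by (rule eventually_at_left_real) auto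
  have "cauchy_filter (filtermap (cpair g h) (at_left 1))"
    unfolding cauchy_filter_metric_filtermap
  proof (intro allI impI)
    fix e :: real assume e: "e > 0"
    define \<beta> where "\<beta> = fefferman_const * BMOA_norm h + 1"
    have \<beta>: "\<beta> > 0" using fefferman_const_pos BMOA_norm_nonneg[OF h] by (simp add: \<beta>_def add_nonneg_pos)
    obtain s where s: "0 \<le> s" "s < 1" "(\<lambda>z. g (of_real s * z)) \<in> H1" "H1_norm (\<lambda>z. g z - g (of_real s * z)) \<le> e / (4 * \<beta>)"
    proof -
      have "e / (4 * \<beta>) > 0" using e \<beta> by simp
      from H1_dilate_dense[OF g this] that show ?thesis by blast
    qed
    define gs where "gs z = g (of_real s * z)" for z
    have gs: "gs \<in> H1" "gs holomorphic_on ball 0 1" using s(3) H1D(1)[OF s(3)] by (simp_all add: gs_def[abs_def])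
    have tgs: "tc gs = (\<lambda>k. tc g k * of_real s ^ k)" unfolding gs_def[abs_def] using s by (intro taylor_coeff_dilate gh) auto
    have sgs: "summable (\<lambda>k. cmod (tc gs k * tc h k))"
      unfolding tgs by (rule l2_norm_bounded_mult_dilate_summable[OF gh h s(1,2)])
    define L where "L = (\<Sum>k. tc gs k * tc h k)"
    have "eventually (\<lambda>r. dist (cpair gs h r) L < e / 4) (at_left 1)"
      unfolding L_def using e by (intro tendstoD[OF cpair_tendsto_summable[OF gs(2) hh sgs]]) auto
    then have P: "eventually (\<lambda>r. dist (cpair gs h r) L < e / 4 \<and> r \<in> {0<..<1}) (at_left 1)"
      using ev by (rule eventually_conj)
    have close: "dist (cpair g h r) L < e / 2" if r: "dist (cpair gs h r) L < e / 4 \<and> r \<in> {0<..<1}" for r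
    proof -
      have r': "0 < r" "r < 1" using r by auto
      have d: "(\<lambda>z. g z - gs z) \<in> H1" by (rule H1_diff(1)[OF g gs(1)])
      have "cpair g h r - cpair gs h r = cpair (\<lambda>z. g z - gs z) h r"
        using cpair_linear_left[OF gh gs(2) hh, of r 1 "-1"] r' by simp
      then have "cmod (cpair g h r - cpair gs h r) \<le> fefferman_const * (H1_norm (\<lambda>z. g z - gs z) * BMOA_norm h)"
        using cpair_bound[OF d h r'] by simp
      also have "\<dots> \<le> fefferman_const * (e / (4 * \<beta>) * BMOA_norm h)"
        using s(4) fefferman_const_pos BMOA_norm_nonneg[OF h] by (intro mult_left_mono mult_right_mono) (auto simp: gs_def)
      also have "\<dots> = e / (4 * \<beta>) * (fefferman_const * BMOA_norm h)" by simp
      also have "\<dots> \<le> e / (4 * \<beta>) * \<beta>" using e \<beta> by (intro mult_left_mono) (auto simp: \<beta>_def)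
      also have "\<dots> = e / 4" using \<beta> by simp
      finally show ?thesis using r dist_triangle[of "cpair g h r" L "cpair gs h r"] by (simp add: dist_norm)
    qed
    show "\<exists>P. eventually P (at_left 1) \<and> (\<forall>x y. P x \<and> P y \<longrightarrow> dist (cpair g h x) (cpair g h y) < e)"
    proof (rule exI, rule conjI, rule P, intro allI impI)
      fix x y
      assume xy: "(dist (cpair gs h x) L < e / 4 \<and> x \<in> {0<..<1}) \<and> dist (cpair gs h y) L < e / 4 \<and> y \<in> {0<..<1}"
      have "dist (cpair g h x) (cpair g h y) \<le> dist (cpair g h x) L + dist (cpair g h y) L" by (rule dist_triangle2)
      also have "\<dots> < e / 2 + e / 2" using xy by (intro add_strict_mono close) auto
      finally show "dist (cpair g h x) (cpair g h y) < e" by simp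
    qed
  qed
  moreover have "filtermap (cpair g h) (at_left (1::real)) \<noteq> bot" by (simp add: filtermap_bot_iff)
  ultimately obtain l where "filtermap (cpair g h) (at_left (1::real)) \<le> nhds l"
    using complete_UNIV[where 'a=complex] unfolding complete_uniform by auto
  then have l: "(cpair g h \<longlongrightarrow> l) (at_left (1::real))" by (simp add: filterlim_def)
  have pl: "pairing g h = l" unfolding pairing_eq by (rule tendsto_Lim[OF trivial_limit_at_left_real l])
  then show "(cpair g h \<longlongrightarrow> pairing g h) (at_left 1)" using l by simp
  have "eventually (\<lambda>r. cmod (cpair g h r) \<le> fefferman_const * (H1_norm g * BMOA_norm h)) (at_left 1)"
    using ev by eventually_elim (rule cpair_bound[OF g h], auto)
  from tendsto_upperbound[OF tendsto_norm[OF l] this] show "cmod (pairing g h) \<le> fefferman_const * (H1_norm g * BMOA_norm h)"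
    by (simp add: pl)
qed

lemma pairing_linear_left:
  assumes g: "g \<in> H1" "g' \<in> H1" and h: "h \<in> BMOA"
  shows "pairing (\<lambda>z. a * g z + b * g' z) h = a * pairing g h + b * pairing g' h"
proof (rule tendsto_unique[OF trivial_limit_at_left_real cpair_convergent(1)[OF H1_linear(1)[OF g] h]])
  have ev: "eventually (\<lambda>r::real. r \<in> {0<..<1}) (at_left 1)" by (rule eventually_at_left_real) auto
  have "((\<lambda>r. a * cpair g h r + b * cpair g' h r) \<longlongrightarrow> a * pairing g h + b * pairing g' h) (at_left 1)"
    by (intro tendsto_intros cpair_convergent g h)
  moreover have "eventually (\<lambda>r. a * cpair g h r + b * cpair g' h r = cpair (\<lambda>z. a * g z + b * g' z) h r) (at_left 1)"
    using ev by eventually_elim (subst cpair_linear_left, use g h in \<open>auto intro: H1D BMOAD\<close>)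
  ultimately show "(cpair (\<lambda>z. a * g z + b * g' z) h \<longlongrightarrow> a * pairing g h + b * pairing g' h) (at_left 1)"
    by (rule Lim_transform_eventually)
qed

lemma pairing_linear_right:
  assumes g: "g \<in> H1" and h: "h \<in> BMOA" "h' \<in> BMOA"
  shows "pairing g (\<lambda>z. a * h z + b * h' z) = a * pairing g h + b * pairing g h'"
proof (rule tendsto_unique[OF trivial_limit_at_left_real cpair_convergent(1)[OF g BMOA_linear(1)[OF h]]])
  have ev: "eventually (\<lambda>r::real. r \<in> {0<..<1}) (at_left 1)" by (rule eventually_at_left_real) auto
  have "((\<lambda>r. a * cpair g h r + b * cpair g h' r) \<longlongrightarrow> a * pairing g h + b * pairing g h') (at_left 1)"
    by (intro tendsto_intros cpair_convergent g h)
  moreover have "eventually (\<lambda>r. a * cpair g h r + b * cpair g h' r = cpair g (\<lambda>z. a * h z + b * h' z) r) (at_left 1)"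
    using ev by eventually_elim (subst cpair_linear_right, use g h in \<open>auto intro: H1D BMOAD\<close>)
  ultimately show "(cpair g (\<lambda>z. a * h z + b * h' z) \<longlongrightarrow> a * pairing g h + b * pairing g h') (at_left 1)"
    by (rule Lim_transform_eventually)
qed

section \<open>The easy half of the duality\<close>

lemma pser_mult:
  assumes b: "summable (\<lambda>k. cmod (b k))" and d: "summable (\<lambda>k. cmod (d k))"
  defines "q \<equiv> \<lambda>k. \<Sum>i\<le>k. b i * d (k - i)"
  shows "summable (\<lambda>k. cmod (q k))" "cmod w \<le> 1 \<Longrightarrow> pser q w = pser b w * pser d w"
proof -
  have "(\<lambda>k. \<Sum>i\<le>k. cmod (b i) * cmod (d (k - i))) sums ((\<Sum>k. cmod (b k)) * (\<Sum>k. cmod (d k)))"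
    by (rule Cauchy_product_sums) (use b d in auto)
  then have s: "summable (\<lambda>k. \<Sum>i\<le>k. cmod (b i) * cmod (d (k - i)))" by (rule sums_summable)
  show "summable (\<lambda>k. cmod (q k))"
  proof (rule summable_comparison_test'[OF s, of 0])
    show "norm (cmod (q k)) \<le> (\<Sum>i\<le>k. cmod (b i) * cmod (d (k - i)))" for k
      unfolding q_def using norm_sum[of "\<lambda>i. b i * d (k - i)" "{..k}"] by (simp add: norm_mult)
  qed
  assume w: "cmod w \<le> 1"
  have sn: "summable (\<lambda>k. norm (c k * w ^ k))" if "summable (\<lambda>k. cmod (c k))" for c
    by (rule summable_comparison_test'[OF that, of 0]) (use norm_pser_term_le[OF w] in simp)
  have "(\<lambda>k. \<Sum>i\<le>k. (b i * w ^ i) * (d (k - i) * w ^ (k - i))) sums (pser b w * pser d w)"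
    unfolding pser_def by (rule Cauchy_product_sums[OF sn[OF b] sn[OF d]])
  moreover have "(\<Sum>i\<le>k. (b i * w ^ i) * (d (k - i) * w ^ (k - i))) = q k * w ^ k" for k
    unfolding q_def sum_distrib_right
  proof (rule sum.cong[OF refl])
    fix i assume "i \<in> {..k}"
    then have "w ^ k = w ^ i * w ^ (k - i)" by (simp flip: power_add)
    then show "(b i * w ^ i) * (d (k - i) * w ^ (k - i)) = b i * d (k - i) * w ^ k" by simp
  qed
  ultimately show "pser q w = pser b w * pser d w" by (simp add: pser_def sums_iff)
qed

text \<open>The extremal function is \<open>q(\<zeta>) = (1 - |z|\<^sup>2) \<zeta> / (1 - cnj z \<zeta>) \<cdot> (f \<zeta> - f z) / (\<zeta> - z)\<close>: on the circle
  \<open>|q| = |f - f z| P\<^sub>z\<close>, and pairing it with \<open>f\<close> gives \<open>\<integral> |f - f z|\<^sup>2 P\<^sub>z\<close>.\<close>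

lemma gars_le_dual:
  assumes c: "summable (\<lambda>k. cmod (c k))" and z: "cmod z < 1" and N: "0 \<le> N"
    and dual: "\<And>q. q \<in> H1 \<Longrightarrow> cmod (\<Sum>k. tc q k * cnj (c k)) \<le> N * H1_norm q"
  shows "gars c z \<le> N"
proof -
  let ?e = "conj_kernel z" and ?d = "dq c z" and ?w = "1 - (cmod z)\<^sup>2"
  have w: "?w > 0" using norm_sq_less_1[OF z] by simp
  note se = summable_conj_kernel[OF z] and sd = dq_summable_norm[OF c z]
  define q0 where "q0 k = (\<Sum>i\<le>k. ?e i * ?d (k - i))" for k
  define qc where "qc k = of_real ?w * q0 k" for k
  note q0 = pser_mult[OF se sd, folded q0_def]
  have sq: "summable (\<lambda>k. cmod (qc k))" using q0(1) by (simp add: qc_def norm_mult summable_mult)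
  have qeq: "pser qc v = of_real ?w * (pser ?e v * pser ?d v)" if "cmod v \<le> 1" for v
  proof -
    have "(\<lambda>k. of_real ?w * (q0 k * v ^ k)) sums (of_real ?w * pser q0 v)"
      by (intro sums_mult pser_sums q0(1) that)
    then have "pser qc v = of_real ?w * pser q0 v" unfolding pser_def[of qc] qc_def by (simp add: sums_iff mult.assoc)
    then show ?thesis using q0(2)[OF that] by simp
  qed
  \<comment> \<open>The extremal function vanishes at 0, so the constant \<open>pser c z\<close>
    pairs to zero with it and only the difference from that constant contributes.\<close>
  have qc0: "qc 0 = 0" by (simp add: qc_def q0_def)
  note cD = continuous_on_pser_cis[OF sd continuous_on_id] and cQ = continuous_on_pser_cis[OF sq continuous_on_id]
  have "(\<lambda>k. qc k * cnj (c k)) sums cmean (\<lambda>t. pser qc (cis t) * cnj (pser c (cis t)))"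
    by (rule Parseval_pser[OF sq c])
  also have "cmean (\<lambda>t. pser qc (cis t) * cnj (pser c (cis t))) =
     cmean (\<lambda>t. cnj (pser c z) * pser qc (cis t) + of_real ?w * of_real ((cmod (pser ?d (cis t)))\<^sup>2))"
  proof (rule arg_cong[where f=cmean], rule ext)
    fix t
    have nz: "cis t - z \<noteq> 0" by (rule cis_diff_nonzero[OF z])
    have E: "cnj (pser ?e (cis t)) = 1 / (cis t - z)" by (rule cnj_pser_conj_kernel[OF z])
    have "pser ?e (cis t) * cnj (cis t - z) = cnj (cnj (pser ?e (cis t)) * (cis t - z))" by simp
    also have "\<dots> = 1" unfolding E using nz by simp
    finally have E1: "pser ?e (cis t) * cnj (cis t - z) = 1" .
    have C: "pser c (cis t) = pser c z + (cis t - z) * pser ?d (cis t)"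
      using pser_diff_eq[OF c z, of "cis t"] by (simp add: algebra_simps)
    have "pser qc (cis t) * cnj ((cis t - z) * pser ?d (cis t)) =
       of_real ?w * ((pser ?e (cis t) * cnj (cis t - z)) * (pser ?d (cis t) * cnj (pser ?d (cis t))))"
      by (simp add: qeq mult_ac)
    also have "\<dots> = of_real ?w * of_real ((cmod (pser ?d (cis t)))\<^sup>2)"
      unfolding E1 by (simp only: complex_norm_square mult_1_left)
    finally show "pser qc (cis t) * cnj (pser c (cis t)) =
        cnj (pser c z) * pser qc (cis t) + of_real ?w * of_real ((cmod (pser ?d (cis t)))\<^sup>2)"
      unfolding C by (simp only: complex_cnj_add distrib_left mult.commute)
  qed
  also have "\<dots> = of_real ((gars c z)\<^sup>2)"
  proof -
    have c1: "continuous_on UNIV (\<lambda>t. cnj (pser c z) * pser qc (cis t))"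
      "continuous_on UNIV (\<lambda>t. complex_of_real ?w * of_real ((cmod (pser ?d (cis t)))\<^sup>2))"
      "continuous_on UNIV (\<lambda>t. (cmod (pser ?d (cis t)))\<^sup>2)"
      by (intro continuous_intros cD cQ)+
    have "cmean (\<lambda>t. (cmod (pser ?d (cis t)))\<^sup>2) = (n2 ?d)\<^sup>2"
      using Parseval_pser_norm[OF sd] n2_sq[OF summable_imp_l2[OF sd]] by (simp add: sums_iff)
    moreover have "(gars c z)\<^sup>2 = ?w * (n2 ?d)\<^sup>2" using w by (simp add: gars_def power_mult_distrib)
    ultimately show ?thesis
      unfolding cmean_add[OF c1(1,2)] cmean_cmul cmean_pser[OF sq] qc0 cmean_of_real[OF c1(3)] by simp
  qed
  finally have sum: "(\<Sum>k. qc k * cnj (c k)) = of_real ((gars c z)\<^sup>2)" by (simp add: sums_iff)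
  \<comment> \<open>Cauchy-Schwarz separates the kernel, of squared norm
    \<open>1 / (1 - |z|^2)\<close>, from the difference quotient. The outcome is again
    \<open>gars c z\<close>, so duality yields \<open>gars^2 \<le> N * gars\<close> and one factor
    cancels.\<close>
  have norm: "H1_norm (pser qc) \<le> gars c z"
  proof (rule H1I(2)[OF pser_holomorphic[OF sq]])
    fix r :: real assume r: "0 \<le> r" "r < 1"
    have rc: "cmod (of_real r * cis t) \<le> 1" for t using r by (simp add: norm_mult)
    have par: "cmean (\<lambda>t. (cmod (pser b (of_real r * cis t)))\<^sup>2) \<le> (n2 b)\<^sup>2" "continuous_on UNIV (\<lambda>t. cmod (pser b (of_real r * cis t)))"
      if b: "summable (\<lambda>k. cmod (b k))" for b
    proof -
      have s: "summable (\<lambda>k. cmod (b k * of_real r ^ k))"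
        by (rule summable_comparison_test'[OF b, of 0]) (use r in \<open>simp add: norm_mult norm_power mult_left_le power_le_one\<close>)
      show "cmean (\<lambda>t. (cmod (pser b (of_real r * cis t)))\<^sup>2) \<le> (n2 b)\<^sup>2"
      proof -
        have "cmean (\<lambda>t. (cmod (pser b (of_real r * cis t)))\<^sup>2) = (n2 (\<lambda>k. b k * of_real r ^ k))\<^sup>2"
          using Parseval_pser_norm[OF s] n2_sq[OF summable_imp_l2[OF s]] by (simp add: pser_dilate sums_iff)
        also have "\<dots> \<le> (n2 b)\<^sup>2"
          using l2_dilate[OF summable_imp_l2[OF b], of r] r by (intro power_mono n2_nonneg') auto
        finally show ?thesis .
      qed
      show "continuous_on UNIV (\<lambda>t. cmod (pser b (of_real r * cis t)))"
        using continuous_on_pser_cis[OF s continuous_on_id] by (simp add: pser_dilate continuous_on_norm)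
    qed
    have ne: "(n2 ?e)\<^sup>2 = 1 / ?w"
      using Parseval_pser_norm[OF se] n2_sq[OF summable_imp_l2[OF se]] cmean_conj_kernel_sq[OF z] by (simp add: sums_iff)
    have "H1_mean (pser qc) r = cmean (\<lambda>t. ?w * (cmod (pser ?e (of_real r * cis t)) * cmod (pser ?d (of_real r * cis t))))"
      unfolding H1_mean_cmean qeq[OF rc] using w by (simp add: norm_mult del: of_real_diff)
    also have "\<dots> = ?w * cmean (\<lambda>t. cmod (pser ?e (of_real r * cis t)) * cmod (pser ?d (of_real r * cis t)))"
      by (rule cmean_cmul)
    also have "\<dots> \<le> ?w * (sqrt (1 / ?w) * sqrt ((n2 ?d)\<^sup>2))"
      using w par[OF se] par[OF sd] ne by (intro mult_left_mono cmean_Cauchy_Schwarz) auto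
    also have "\<dots> = (?w / sqrt ?w) * n2 ?d"
      using n2_nonneg'[OF summable_imp_l2[OF sd]] by (simp add: real_sqrt_divide)
    also have "\<dots> = gars c z"
      using w real_div_sqrt[of ?w] by (simp only: gars_def less_imp_le)
    finally show "H1_mean (pser qc) r \<le> gars c z" .
  qed
  have "(gars c z)\<^sup>2 = cmod (\<Sum>k. tc (pser qc) k * cnj (c k))"
    unfolding tc_pser[OF sq] sum by (simp del: of_real_power)
  also have "\<dots> \<le> N * H1_norm (pser qc)" by (rule dual[OF pser_H1[OF sq]])
  also have "\<dots> \<le> N * gars c z" using norm N by (rule mult_left_mono)
  finally have "gars c z * gars c z \<le> N * gars c z" by (simp add: power2_eq_square)
  moreover have "0 \<le> gars c z" by (rule gars_nonneg[OF summable_imp_l2[OF c] z])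
  ultimately show ?thesis using N by (cases "gars c z = 0") (auto simp: mult_le_cancel_right)
qed

lemma gars_le_dual':
  assumes c: "summable (\<lambda>k. cmod (c k))" and z: "cmod z < 1" and N: "0 \<le> N"
    and dual: "\<And>q. q \<in> H1 \<Longrightarrow> cmod (\<Sum>k. tc q k * c k) \<le> N * H1_norm q"
  shows "gars c z \<le> N"
proof -
  have "gars (\<lambda>k. cnj (c k)) (cnj z) \<le> N"
    by (rule gars_le_dual) (use assms in auto)
  then show ?thesis using gars_cnj[OF summable_imp_l2[OF c], of "cnj z"] z by simp
qed

text \<open>Test functions for the norm of \<open>H\<^sup>1\<close>: Riesz projections of continuous functions \<open>\<phi>\<close> with
  \<open>|\<phi>| \<le> 1\<close> close to \<open>cnj F / |F|\<close>.\<close>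

lemma H1_norm_le_dual:
  assumes c: "summable (\<lambda>k. cmod (c k))" and N: "0 \<le> N"
    and dual: "\<And>h. h \<in> VMOA \<Longrightarrow> summable (\<lambda>k. cmod (tc h k)) \<Longrightarrow> cmod (\<Sum>k. c k * tc h k) \<le> N * BMOA_norm h"
  shows "H1_norm (pser c) \<le> 2 * N"
proof (rule H1I(2)[OF pser_holomorphic[OF c]])
  fix r :: real assume r: "0 \<le> r" "r < 1"
  have sr: "summable (\<lambda>k. cmod (c k * of_real r ^ k))"
    by (rule summable_comparison_test'[OF c, of 0]) (use r in \<open>simp add: norm_mult norm_power mult_left_le power_le_one\<close>)
  define F where "F t = pser c (of_real r * cis t)" for t
  have Fe: "F t = pser (\<lambda>k. c k * of_real r ^ k) (cis t)" for t by (simp add: F_def pser_dilate)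
  have cF: "continuous_on UNIV F" unfolding Fe by (rule continuous_on_pser_cis[OF sr continuous_on_id])
  show "H1_mean (pser c) r \<le> 2 * N"
  proof (rule field_le_epsilon)
    fix e :: real assume e: "e > 0"
    \<comment> \<open>A positive substitute for \<open>|F|\<close>: it keeps \<open>\<phi>\<close>
      continuous at zeros of \<open>F\<close>, and \<open>|F|^2 / m \<ge> |F| - e\<close> limits the
      loss to \<open>e\<close>.\<close>
    define m where "m t = sqrt ((cmod (F t))\<^sup>2 + e\<^sup>2)" for t
    have m0: "m t > 0" for t unfolding m_def using e by (simp add: add_nonneg_pos)
    have mF: "cmod (F t) \<le> m t" for t unfolding m_def by (rule real_le_rsqrt) simp
    have cm: "continuous_on UNIV m" unfolding m_def by (intro continuous_intros cF)
    define \<phi> where "\<phi> t = cnj (F t) / of_real (m t)" for t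
    have c\<phi>: "continuous_on UNIV \<phi>" unfolding \<phi>_def using m0 by (intro continuous_intros cF cm) (auto simp: less_imp_neq[THEN not_sym])
    have \<phi>1: "cmod (\<phi> t) \<le> 1" for t unfolding \<phi>_def using mF[of t] m0[of t] by (simp add: norm_divide)
    define h0 where "h0 k = cmean (\<lambda>t. \<phi> t * cis (real k * t))" for k
    have h01: "cmod (h0 k) \<le> 1" for k
    proof -
      have "cmod (h0 k) \<le> cmean (\<lambda>t. norm (\<phi> t * cis (real k * t)))"
        unfolding h0_def by (intro norm_cmean_le continuous_intros c\<phi>)
      also have "\<dots> \<le> cmean (\<lambda>t. 1)"
        using \<phi>1 by (intro cmean_mono continuous_intros c\<phi>) (auto simp: norm_mult)
      finally show ?thesis by simp
    qed
    define hc where "hc k = h0 k * of_real r ^ k" for k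
    have sh: "summable (\<lambda>k. cmod (hc k))" unfolding hc_def
      by (rule summable_power_bounded[OF h01]) (use r in simp)
    have rep: "(\<lambda>k. (b k * of_real r ^ k) * h0 k) sums cmean (\<lambda>t. \<phi> t * pser (\<lambda>k. b k * of_real r ^ k) (cis t))"
      if "summable (\<lambda>k. cmod (b k * of_real r ^ k))" for b
      unfolding h0_def by (rule cmean_mult_pser[OF that c\<phi> \<phi>1])
    \<comment> \<open>The seminorm of the projected test function is itself found by duality:
      pairing with \<open>q\<close> is the mean of \<open>\<phi> * q\<close> on the circle of radius
      \<open>r\<close>, at most the norm of \<open>q\<close>. With the value at 0, also bounded by
      1, the norm is at most 2, the factor in the conclusion.\<close>
    have g1: "gars hc z \<le> 1" if z: "cmod z < 1" for z
    proof (rule gars_le_dual'[OF sh z])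
      fix q assume q: "q \<in> H1"
      note qh = H1D(1)[OF q]
      have "(\<Sum>k. tc q k * hc k) = cmean (\<lambda>t. \<phi> t * pser (\<lambda>k. tc q k * of_real r ^ k) (cis t))"
        using rep[OF summable_dilated_taylor[OF qh r]] by (simp add: sums_iff hc_def mult_ac)
      also have "\<dots> = cmean (\<lambda>t. \<phi> t * q (of_real r * cis t))"
        by (simp add: holomorphic_dilated_eq_pser[OF qh r])
      also have "cmod \<dots> \<le> cmean (\<lambda>t. norm (\<phi> t * q (of_real r * cis t)))"
        by (intro norm_cmean_le continuous_intros c\<phi> continuous_on_circle[OF qh r])
      also have "\<dots> \<le> cmean (\<lambda>t. cmod (q (of_real r * cis t)))"
        using \<phi>1 by (intro cmean_mono continuous_intros c\<phi> continuous_on_circle[OF qh r])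
          (simp add: norm_mult mult_left_le_one_le)
      also have "\<dots> \<le> 1 * H1_norm q" using H1_mean_le_norm[OF q r] by (simp add: H1_mean_cmean)
      finally show "cmod (\<Sum>k. tc q k * hc k) \<le> 1 * H1_norm q" .
    qed simp
    note hV = pser_VMOA[OF sh]
    have "BMOA_norm (pser hc) \<le> 2"
    proof (rule BMOAI(2)[OF pser_holomorphic[OF sh]])
      show "l2 (tc (pser hc))" unfolding tc_pser[OF sh] by (rule summable_imp_l2[OF sh])
      have "pser hc 0 = hc 0" unfolding pser_def by (rule powser_zero)
      then have "cmod (pser hc 0) \<le> 1" using h01[of 0] by (simp add: hc_def)
      then show "cmod (pser hc 0) + gars (tc (pser hc)) z \<le> 2" if "cmod z < 1" for z
        unfolding tc_pser[OF sh] using g1[OF that] by simp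
    qed
    then have "N * BMOA_norm (pser hc) \<le> N * 2" using N by (rule mult_left_mono)
    moreover have "cmod (\<Sum>k. c k * hc k) \<le> N * BMOA_norm (pser hc)"
      using dual[OF hV] sh by (simp add: tc_pser[OF sh])
    moreover have "(\<Sum>k. c k * hc k) = cmean (\<lambda>t. \<phi> t * F t)"
      using rep[OF sr] unfolding Fe by (simp add: sums_iff hc_def mult_ac)
    ultimately have up: "cmod (cmean (\<lambda>t. \<phi> t * F t)) \<le> 2 * N" by simp
    have c2: "continuous_on UNIV (\<lambda>t. (cmod (F t))\<^sup>2 / m t)" 
      using m0 by (intro continuous_intros cF cm) (auto simp: less_imp_neq[THEN not_sym])
    have "cmean (\<lambda>t. \<phi> t * F t) = of_real (cmean (\<lambda>t. (cmod (F t))\<^sup>2 / m t))"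
    proof -
      have "\<phi> t * F t = of_real ((cmod (F t))\<^sup>2 / m t)" for t
        unfolding \<phi>_def of_real_divide complex_norm_square by (simp add: mult.commute)
      then show ?thesis by (simp only: cmean_of_real[OF c2])
    qed
    moreover have "cmean (\<lambda>t. cmod (F t) - e) \<le> cmean (\<lambda>t. (cmod (F t))\<^sup>2 / m t)"
    proof (rule cmean_mono[OF _ c2])
      show "continuous_on UNIV (\<lambda>t. cmod (F t) - e)" by (intro continuous_intros cF)
      fix t
      have "m t \<le> cmod (F t) + e" unfolding m_def
        using sqrt_add_le_add_sqrt[of "(cmod (F t))\<^sup>2" "e\<^sup>2"] e by simp
      have "(cmod (F t) - e) * m t \<le> (cmod (F t))\<^sup>2"
      proof (cases "cmod (F t) \<le> e")
        case True
        have "(cmod (F t) - e) * m t \<le> 0" using True m0[of t] by (simp add: mult_nonpos_nonneg)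
        also have "0 \<le> (cmod (F t))\<^sup>2" by simp
        finally show ?thesis .
      next
        case False
        have "(cmod (F t) - e) * m t \<le> (cmod (F t) - e) * (cmod (F t) + e)"
          using False \<open>m t \<le> cmod (F t) + e\<close> by (intro mult_left_mono) auto
        also have "\<dots> = (cmod (F t))\<^sup>2 - e\<^sup>2" by (simp add: power2_eq_square algebra_simps)
        finally show ?thesis using zero_le_power2[of e] by linarith
      qed
      then show "cmod (F t) - e \<le> (cmod (F t))\<^sup>2 / m t" using m0[of t] by (simp add: pos_le_divide_eq)
    qed
    moreover have "cmean (\<lambda>t. cmod (F t) - e) = H1_mean (pser c) r - e"
    proof -
      have "cmean (\<lambda>t. cmod (F t) - e) = cmean (\<lambda>t. cmod (F t)) - cmean (\<lambda>t. e)"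
        by (intro cmean_diff continuous_intros cF)
      then show ?thesis by (simp add: H1_mean_cmean F_def)
    qed
    ultimately show "H1_mean (pser c) r \<le> 2 * N + e"
      using up by (simp add: norm_of_real) 
  qed
qed

section \<open>Uniform boundedness\<close>

text \<open>Sokal's gliding-hump argument: of \<open>y + \<eta>\<close> and \<open>y - \<eta>\<close> at least one has a large image.\<close>

lemma uniform_boundedness:
  fixes X :: "('a \<Rightarrow> complex) set" and N :: "('a \<Rightarrow> complex) \<Rightarrow> real" and l :: "'i \<Rightarrow> ('a \<Rightarrow> complex) \<Rightarrow> complex"
  assumes X0: "x0 \<in> X" and Xlin: "\<And>f g a b. f \<in> X \<Longrightarrow> g \<in> X \<Longrightarrow> (\<lambda>z. a * f z + b * g z) \<in> X"
    and N0: "\<And>f. f \<in> X \<Longrightarrow> 0 \<le> N f"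
    and Nlin: "\<And>f g a b. f \<in> X \<Longrightarrow> g \<in> X \<Longrightarrow> N (\<lambda>z. a * f z + b * g z) \<le> cmod a * N f + cmod b * N g"
    and llin: "\<And>i f g a b. i \<in> I \<Longrightarrow> f \<in> X \<Longrightarrow> g \<in> X \<Longrightarrow> l i (\<lambda>z. a * f z + b * g z) = a * l i f + b * l i g"
    and lbd: "\<And>i. i \<in> I \<Longrightarrow> \<exists>C. \<forall>f\<in>X. cmod (l i f) \<le> C * N f"
    and pw: "\<And>f. f \<in> X \<Longrightarrow> \<exists>C. \<forall>i\<in>I. cmod (l i f) \<le> C"
    and compl: "\<And>y. (\<And>m. y m \<in> X) \<Longrightarrow> (\<And>m. N (\<lambda>z. y (Suc m) z - y m z) \<le> (1/3) ^ Suc m) \<Longrightarrow>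
        \<exists>f\<in>X. \<forall>m. N (\<lambda>z. f z - y m z) \<le> (1/3) ^ m / 2"
  shows "\<exists>C\<ge>0. \<forall>i\<in>I. \<forall>f\<in>X. cmod (l i f) \<le> C * N f"
proof (rule ccontr)
  assume neg: "\<not> ?thesis"
  define L where "L i = (SUP f\<in>{f\<in>X. N f \<le> 1}. cmod (l i f))" for i
  have scale: "(\<lambda>z. a * f z) \<in> X" "N (\<lambda>z. a * f z) \<le> cmod a * N f" "i \<in> I \<Longrightarrow> l i (\<lambda>z. a * f z) = a * l i f"
    if "f \<in> X" for a f i
    using Xlin[OF that that, of a 0] Nlin[OF that that, of a 0] llin[of i f f a 0] that by auto
  have zero: "(\<lambda>z. 0) \<in> X" "N (\<lambda>z. 0) = 0"
    using scale(1,2)[OF X0, of 0] N0[of "\<lambda>z. 0"] by auto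
  have bdd: "bdd_above ((\<lambda>f. cmod (l i f)) ` {f\<in>X. N f \<le> 1})" if i: "i \<in> I" for i
  proof -
    obtain C where C: "\<forall>f\<in>X. cmod (l i f) \<le> C * N f" using lbd[OF i] by blast
    show ?thesis
    proof (rule bdd_aboveI2[of _ _ "\<bar>C\<bar>"])
      fix f assume f: "f \<in> {f\<in>X. N f \<le> 1}"
      then have "cmod (l i f) \<le> C * N f" using C by blast
      also have "\<dots> \<le> \<bar>C\<bar> * N f" using f N0 by (intro mult_right_mono) auto
      also have "\<dots> \<le> \<bar>C\<bar> * 1" using f by (intro mult_left_mono) auto
      finally show "cmod (l i f) \<le> \<bar>C\<bar>" by simp
    qed
  qed
  have L0: "0 \<le> L i" if "i \<in> I" for i
  proof -
    have "cmod (l i (\<lambda>z. 0)) \<le> L i"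
      unfolding L_def using zero by (intro cSUP_upper bdd that) auto
    then show ?thesis using norm_ge_zero[of "l i (\<lambda>z. 0)"] by linarith
  qed
  \<comment> \<open>In the applications \<open>N\<close> sees only values on the disc, so
    \<open>N f = 0\<close> does not force \<open>f\<close> to vanish as a total function. That case
    follows from boundedness of the individual functional.\<close>
  have LN: "cmod (l i f) \<le> L i * N f" if i: "i \<in> I" and f: "f \<in> X" for i f
  proof (cases "N f = 0")
    case True
    obtain C where "\<forall>f\<in>X. cmod (l i f) \<le> C * N f" using lbd[OF i] by blast
    then have "cmod (l i f) \<le> C * N f" using f by blast
    then show ?thesis using True by simp
  next
    case False
    then have Nf: "N f > 0" using N0[OF f] by simp
    define g where "g = (\<lambda>z. of_real (1 / N f) * f z)"
    have g: "g \<in> X" "N g \<le> 1"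
      using scale(1,2)[OF f, of "of_real (1 / N f)"] Nf by (auto simp: g_def norm_divide)
    have "cmod (l i g) \<le> L i" unfolding L_def using g by (intro cSUP_upper bdd i) auto
    moreover have "l i g = of_real (1 / N f) * l i f" unfolding g_def by (rule scale(3)[OF f i])
    ultimately show ?thesis using Nf by (simp add: norm_mult norm_divide divide_le_eq)
  qed
  have big: "\<exists>i\<in>I. M < L i" if "M \<ge> 0" for M
  proof (rule ccontr)
    assume "\<not> ?thesis"
    then have "L i \<le> M" if "i \<in> I" for i using that by force
    then have "cmod (l i f) \<le> M * N f" if "i \<in> I" "f \<in> X" for i f
      using LN[OF that] N0[OF that(2)] that by (meson mult_right_mono order_trans)
    with neg \<open>M \<ge> 0\<close> show False by blast
  qed
  \<comment> \<open>Steps shrink like \<open>3^-m\<close> while the chosen functionals grow like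
    \<open>4^m\<close>, so their products are unbounded. The factor \<open>2/3\<close> allows for a
    supremum that is not attained.\<close>
  have step: "\<exists>y'. y' \<in> X \<and> (N (\<lambda>z. y' z - y z) \<le> (1/3) ^ Suc m \<and>
      (\<exists>i\<in>I. 4 ^ m < L i \<and> 2/3 * (1/3) ^ Suc m * L i \<le> cmod (l i y')))" if y: "y \<in> X" for y m
  proof -
    obtain i where i: "i \<in> I" "4 ^ m < L i" using big[of "4 ^ m"] by auto
    have Lp: "L i > 0" using i(2) by (meson less_trans zero_less_numeral zero_less_power)
    have "2/3 * L i < L i" using Lp by simp
    then obtain \<xi> where \<xi>: "\<xi> \<in> X" "N \<xi> \<le> 1" "2/3 * L i < cmod (l i \<xi>)"
    proof -
      have "{f\<in>X. N f \<le> 1} \<noteq> {}" using zero by force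
      from less_cSUP_iff[OF this bdd[OF i(1)], of "2/3 * L i", folded L_def] \<open>2/3 * L i < L i\<close>
      have "\<exists>\<xi>\<in>{f\<in>X. N f \<le> 1}. 2/3 * L i < cmod (l i \<xi>)" by (rule iffD1)
      with that show ?thesis by blast
    qed
    define \<epsilon> :: real where "\<epsilon> = (1/3) ^ Suc m"
    have \<epsilon>: "\<epsilon> > 0" by (simp add: \<epsilon>_def)
    define \<eta> where "\<eta> = (\<lambda>z. of_real \<epsilon> * \<xi> z)"
    have \<eta>: "\<eta> \<in> X" "l i \<eta> = of_real \<epsilon> * l i \<xi>" unfolding \<eta>_def by (rule scale[OF \<xi>(1)] i(1))+
    have N\<eta>: "N \<eta> \<le> \<epsilon>"
    proof -
      have "N \<eta> \<le> cmod (of_real \<epsilon>) * N \<xi>" unfolding \<eta>_def by (rule scale(2)[OF \<xi>(1)])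
      also have "\<dots> \<le> \<epsilon> * 1" using \<epsilon> \<xi>(2) by simp
      finally show ?thesis by simp
    qed
    have "2/3 * \<epsilon> * L i \<le> cmod (l i \<eta>)"
      using \<xi>(3) \<epsilon> by (simp add: \<eta>(2) norm_mult mult.left_commute mult_left_mono less_imp_le)
    have pm: "l i (\<lambda>z. 1 * y z + 1 * \<eta> z) = 1 * l i y + 1 * l i \<eta>" "l i (\<lambda>z. 1 * y z + (-1) * \<eta> z) = 1 * l i y + (-1) * l i \<eta>"
      by (rule llin[OF i(1) y \<eta>(1)])+
    have "cmod (l i \<eta> + l i \<eta>) \<le> cmod (l i y + l i \<eta>) + cmod (l i y - l i \<eta>)"
      using norm_triangle_ineq4[of "l i y + l i \<eta>" "l i y - l i \<eta>"] by (simp add: algebra_simps)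
    then have "2 * cmod (l i \<eta>) \<le> cmod (l i y + l i \<eta>) + cmod (l i y - l i \<eta>)"
      by (metis mult_2 norm_mult norm_numeral)
    then consider "cmod (l i \<eta>) \<le> cmod (l i y + l i \<eta>)" | "cmod (l i \<eta>) \<le> cmod (l i y - l i \<eta>)" by linarith
    then show ?thesis
    proof cases
      case 1
      show ?thesis
      proof (intro exI[of _ "\<lambda>z. 1 * y z + 1 * \<eta> z"] conjI bexI[OF _ i(1)])
        show "(\<lambda>z. 1 * y z + 1 * \<eta> z) \<in> X" by (rule Xlin[OF y \<eta>(1)])
        show "N (\<lambda>z. 1 * y z + 1 * \<eta> z - y z) \<le> (1/3) ^ Suc m" using N\<eta> by (simp add: \<epsilon>_def)
        show "2/3 * (1/3) ^ Suc m * L i \<le> cmod (l i (\<lambda>z. 1 * y z + 1 * \<eta> z))"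
          unfolding pm using 1 \<open>2/3 * \<epsilon> * L i \<le> cmod (l i \<eta>)\<close> by (simp add: \<epsilon>_def)
      qed (rule i(2))
    next
      case 2
      show ?thesis
      proof (intro exI[of _ "\<lambda>z. 1 * y z + (-1) * \<eta> z"] conjI bexI[OF _ i(1)])
        show "(\<lambda>z. 1 * y z + (-1) * \<eta> z) \<in> X" by (rule Xlin[OF y \<eta>(1)])
        have "N (\<lambda>z. (-1) * \<eta> z) \<le> N \<eta>" using scale(2)[OF \<eta>(1), of "-1"] by simp
        then show "N (\<lambda>z. 1 * y z + (-1) * \<eta> z - y z) \<le> (1/3) ^ Suc m" using N\<eta> by (simp add: \<epsilon>_def)
        show "2/3 * (1/3) ^ Suc m * L i \<le> cmod (l i (\<lambda>z. 1 * y z + (-1) * \<eta> z))"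
          unfolding pm using 2 \<open>2/3 * \<epsilon> * L i \<le> cmod (l i \<eta>)\<close> by (simp add: \<epsilon>_def)
      qed (rule i(2))
    qed
  qed
  define Q where "Q m y y' \<longleftrightarrow> N (\<lambda>z. y' z - y z) \<le> (1/3) ^ Suc m \<and>
      (\<exists>i\<in>I. 4 ^ m < L i \<and> 2/3 * (1/3) ^ Suc m * L i \<le> cmod (l i y'))" for m :: nat and y y'
  have "\<exists>y. \<forall>m. y m \<in> X \<and> Q m (y m) (y (Suc m))"
  proof (rule dependent_nat_choice)
    show "\<exists>y. y \<in> X" using X0 by blast
    show "\<exists>y'. y' \<in> X \<and> Q m y y'" if "y \<in> X" for y m unfolding Q_def by (rule step[OF that])
  qed
  then obtain y where y0: "\<And>m. y m \<in> X" "\<And>m. Q m (y m) (y (Suc m))" by blast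
  then have y: "\<And>m. y m \<in> X" "\<And>m. N (\<lambda>z. y (Suc m) z - y m z) \<le> (1/3) ^ Suc m"
    "\<And>m. \<exists>i\<in>I. 4 ^ m < L i \<and> 2/3 * (1/3) ^ Suc m * L i \<le> cmod (l i (y (Suc m)))"
    unfolding Q_def by blast+
  obtain f where f: "f \<in> X" "\<And>m. N (\<lambda>z. f z - y m z) \<le> (1/3) ^ m / 2" using compl[OF y(1,2)] by blast
  obtain C where C: "\<And>i. i \<in> I \<Longrightarrow> cmod (l i f) \<le> C" using pw[OF f(1)] by blast
  \<comment> \<open>All moves after stage \<open>m + 1\<close> amount to at most half of
    \<open>3^-(m+1)\<close>. Of the fraction \<open>2/3\<close> at least
    \<open>2/3 - 1/2 = 1/6\<close> survives in the limit, and
    \<open>3^-(m+1) * 4^m / 6 = (4/3)^m / 18\<close>.\<close>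
  have bnd: "(4/3) ^ m / 18 \<le> C" for m :: nat
  proof -
    obtain i where i: "i \<in> I" "4 ^ m < L i" "2/3 * (1/3) ^ Suc m * L i \<le> cmod (l i (y (Suc m)))"
      using y(3) by blast
    let ?e = "(1/3) ^ Suc m :: real"
    have d: "(\<lambda>z. 1 * f z + (-1) * y (Suc m) z) \<in> X" by (rule Xlin[OF f(1) y(1)])
    have "cmod (l i f - l i (y (Suc m))) = cmod (l i (\<lambda>z. 1 * f z + (-1) * y (Suc m) z))"
      unfolding llin[OF i(1) f(1) y(1)] by simp
    also have "\<dots> \<le> L i * N (\<lambda>z. 1 * f z + (-1) * y (Suc m) z)" by (rule LN[OF i(1) d])
    also have "\<dots> \<le> L i * (?e / 2)" using f(2)[of "Suc m"] L0[OF i(1)] by (intro mult_left_mono) auto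
    finally have "cmod (l i (y (Suc m))) - L i * (?e / 2) \<le> cmod (l i f)"
      using norm_triangle_ineq2[of "l i (y (Suc m))" "l i f"] by (simp add: norm_minus_commute)
    moreover have "L i * (?e / 2) = 1/2 * (?e * L i)" "2/3 * ?e * L i = 2/3 * (?e * L i)" "?e * L i / 6 = 1/6 * (?e * L i)"
      by simp_all
    ultimately have "?e * L i / 6 \<le> C" using i(3) C[OF i(1)] by linarith
    moreover have "?e * 4 ^ m / 6 \<le> ?e * L i / 6"
      using i(2) by (intro divide_right_mono mult_left_mono) auto
    moreover have "?e * 4 ^ m / 6 = (4/3) ^ m / 18" by (simp add: power_divide)
    ultimately show ?thesis by linarith
  qed
  obtain m where "18 * C < (4/3 :: real) ^ m" using real_arch_pow[of "4/3" "18 * C"] by auto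
  with bnd[of m] show False by linarith
qed

section \<open>Completeness\<close>

text \<open>The bound is the exact geometric sum of the steps from \<open>m\<close> to
  \<open>j\<close>; in this form it carries the induction, and dropping the \<open>j\<close> term
  yields the bound demanded by \<open>uniform_boundedness\<close>.\<close>

lemma geometric_Cauchy:
  fixes X :: "('a \<Rightarrow> complex) set" and N :: "('a \<Rightarrow> complex) \<Rightarrow> real"
  assumes N: "\<And>f g. f \<in> X \<Longrightarrow> g \<in> X \<Longrightarrow> N (\<lambda>z. f z + g z) \<le> N f + N g"
    and d: "\<And>f g. f \<in> X \<Longrightarrow> g \<in> X \<Longrightarrow> (\<lambda>z. f z - g z) \<in> X"
    and y: "\<And>m. y m \<in> X" and s: "\<And>m. N (\<lambda>z. y (Suc m) z - y m z) \<le> (1/3) ^ Suc m"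
    and z: "N (\<lambda>z. 0) = 0" and mj: "m \<le> j"
  shows "N (\<lambda>z. y j z - y m z) \<le> ((1/3) ^ m - (1/3) ^ j) / 2"
  using mj
proof (induction j rule: dec_induct)
  case base
  then show ?case by (simp add: z)
next
  case (step j)
  have "N (\<lambda>z. y (Suc j) z - y m z) = N (\<lambda>z. (y (Suc j) z - y j z) + (y j z - y m z))" by simp
  also have "\<dots> \<le> N (\<lambda>z. y (Suc j) z - y j z) + N (\<lambda>z. y j z - y m z)" by (intro N d y)
  also have "\<dots> \<le> (1/3) ^ Suc j + ((1/3) ^ m - (1/3) ^ j) / 2" by (intro add_mono s step)
  also have "\<dots> = ((1/3) ^ m - (1/3) ^ Suc j) / 2" by (simp add: field_simps)
  finally show ?case .
qed

lemma uniform_coefficient_limit: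
  fixes y :: "nat \<Rightarrow> nat \<Rightarrow> complex"
  assumes "\<And>m j k. m \<le> j \<Longrightarrow> cmod (y j k - y m k) \<le> (1/3) ^ m / 2"
  obtains c where "\<And>k. (\<lambda>j. y j k) \<longlonglongrightarrow> c k" "\<And>m k. cmod (c k - y m k) \<le> (1/3) ^ m / 2"
proof -
  have "\<exists>c. (\<lambda>j. y j k) \<longlonglongrightarrow> c" for k
  proof -
    have "Cauchy (\<lambda>j. y j k)"
    proof (rule metric_CauchyI)
      fix e :: real assume "e > 0"
      then obtain M where M: "(1/3 :: real) ^ M < e" using real_arch_pow_inv[of e "1/3"] by auto
      show "\<exists>M. \<forall>m\<ge>M. \<forall>n\<ge>M. dist (y m k) (y n k) < e"
      proof (intro exI[of _ M] allI impI)
        fix m n assume "M \<le> m" "M \<le> n"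
        then have "dist (y m k) (y M k) \<le> (1/3) ^ M / 2" "dist (y n k) (y M k) \<le> (1/3) ^ M / 2"
          using assms[of M m k] assms[of M n k] by (auto simp: dist_norm)
        then show "dist (y m k) (y n k) < e"
          using M dist_triangle2[of "y m k" "y n k" "y M k"] by linarith
      qed
    qed
    then show ?thesis by (simp add: Cauchy_convergent_iff convergent_def)
  qed
  then obtain c where c: "\<And>k. (\<lambda>j. y j k) \<longlonglongrightarrow> c k" by metis
  moreover have "cmod (c k - y m k) \<le> (1/3) ^ m / 2" for m k
  proof (rule LIMSEQ_le_const2)
    show "(\<lambda>j. cmod (y j k - y m k)) \<longlonglongrightarrow> cmod (c k - y m k)" by (intro tendsto_intros c)
    show "\<exists>N. \<forall>j\<ge>N. cmod (y j k - y m k) \<le> (1/3) ^ m / 2" using assms by blast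
  qed
  ultimately show ?thesis by (rule that)
qed

lemma third_power_tendsto: "(\<lambda>j. (1/3 :: real) ^ j / 2) \<longlonglongrightarrow> 0"
proof -
  have "(\<lambda>j. (1/3 :: real) ^ j / 2) \<longlonglongrightarrow> 0 / 2"
    by (intro tendsto_divide tendsto_const LIMSEQ_realpow_zero) auto
  then show ?thesis by simp
qed

lemma H1_zero: "(\<lambda>z. 0) \<in> H1" "H1_norm (\<lambda>z. 0) = 0"
proof -
  have "H1_mean (\<lambda>z. 0) r = 0" for r by (simp add: H1_mean_def)
  then show "(\<lambda>z. 0) \<in> H1" "H1_norm (\<lambda>z. 0) = 0"
    using H1I[of "\<lambda>z. 0" 0] H1_norm_nonneg[of "\<lambda>z. 0"] by auto
qed

text \<open>The limit is built from coefficients, whose convergence is uniform in the index and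
  hence locally uniform on the disc. On a fixed circle the means pass to the limit, and the
  resulting bound is independent of the radius.\<close>

lemma H1_complete:
  assumes y: "\<And>m. y m \<in> H1" and s: "\<And>m. H1_norm (\<lambda>z. y (Suc m) z - y m z) \<le> (1/3) ^ Suc m"
  shows "\<exists>f\<in>H1. \<forall>m. H1_norm (\<lambda>z. f z - y m z) \<le> (1/3) ^ m / 2"
proof -
  note hy = H1D(1)[OF y]
  have add: "H1_norm (\<lambda>z. f z + g z) \<le> H1_norm f + H1_norm g" if "f \<in> H1" "g \<in> H1" for f g
    using H1_linear(2)[OF that, of 1 1] by simp
  have Ny: "H1_norm (\<lambda>z. y j z - y m z) \<le> (1/3) ^ m / 2" if mj: "m \<le> j" for m j
  proof -
    have "H1_norm (\<lambda>z. y j z - y m z) \<le> ((1/3) ^ m - (1/3) ^ j) / 2"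
      by (rule geometric_Cauchy[of H1 H1_norm y m j, OF add H1_diff(1) y s H1_zero(2) mj])
    also have "\<dots> \<le> (1/3) ^ m / 2" by simp
    finally show ?thesis .
  qed
  have "cmod (tc (y j) k - tc (y m) k) \<le> (1/3) ^ m / 2" if "m \<le> j" for m j k
    using norm_taylor_coeff_le[OF H1_diff(1)[OF y[of j] y[of m]], of k] Ny[OF that]
    by (simp add: taylor_coeff_diff[OF hy hy])
  then obtain c where c: "\<And>m k. cmod (c k - tc (y m) k) \<le> (1/3) ^ m / 2"
    by (rule uniform_coefficient_limit[of "\<lambda>m. tc (y m)"]) auto
  have cb: "cmod (c k) \<le> H1_norm (y 0) + 1" for k
  proof -
    have "cmod (c k) \<le> cmod (c k - tc (y 0) k) + cmod (tc (y 0) k)" by (metis diff_add_cancel norm_triangle_ineq)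
    then show ?thesis using c[of k 0] norm_taylor_coeff_le[OF y[of 0], of k] by simp
  qed
  define f where "f = pser c"
  have hf: "f holomorphic_on ball 0 1" unfolding f_def by (rule holomorphic_pser[OF cb])
  have close: "cmod (f z - y j z) \<le> (1/3) ^ j / 2 / (1 - cmod z)" if z: "cmod z < 1" for z j
  proof -
    have "(\<lambda>k. c k * z ^ k - tc (y j) k * z ^ k) sums (f z - y j z)"
      unfolding f_def by (intro sums_diff pser_bounded_sums[OF cb z] taylor_sums[OF hy z])
    then have "f z - y j z = pser (\<lambda>k. c k - tc (y j) k) z" by (simp add: pser_def sums_iff left_diff_distrib)
    then show ?thesis using norm_tser_le[of "\<lambda>k. c k - tc (y j) k" "(1/3) ^ j / 2" z 0, OF c z] by (simp add: tser_0)
  qed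
  have m: "H1_mean (\<lambda>z. f z - y m z) r \<le> (1/3) ^ m / 2" if r: "0 \<le> r" "r < 1" for m r
  proof -
    have cf: "continuous_on UNIV (\<lambda>t. f (of_real r * cis t))" and cy: "\<And>j. continuous_on UNIV (\<lambda>t. y j (of_real r * cis t))"
      by (intro continuous_on_circle hf hy r continuous_on_id)+
    have le: "H1_mean (\<lambda>z. f z - y m z) r \<le> (1/3) ^ j / 2 / (1 - r) + (1/3) ^ m / 2" if mj: "m \<le> j" for j
    proof -
      have "H1_mean (\<lambda>z. f z - y m z) r \<le> cmean (\<lambda>t. (1/3) ^ j / 2 / (1 - r) + cmod (y j (of_real r * cis t) - y m (of_real r * cis t)))"
        unfolding H1_mean_cmean
      proof (rule cmean_mono)
        fix t
        have "cmod (f (of_real r * cis t) - y j (of_real r * cis t)) \<le> (1/3) ^ j / 2 / (1 - r)"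
          using close[of "of_real r * cis t" j] r by (simp add: norm_mult)
        then show "cmod (f (of_real r * cis t) - y m (of_real r * cis t)) \<le>
          (1/3) ^ j / 2 / (1 - r) + cmod (y j (of_real r * cis t) - y m (of_real r * cis t))"
          using norm_triangle_ineq[of "f (of_real r * cis t) - y j (of_real r * cis t)" "y j (of_real r * cis t) - y m (of_real r * cis t)"] by simp
      qed (intro continuous_intros cf cy)+
      also have "\<dots> = (1/3) ^ j / 2 / (1 - r) + H1_mean (\<lambda>z. y j z - y m z) r"
        by (subst cmean_add) (auto intro!: continuous_intros cy simp: H1_mean_cmean)
      also have "H1_mean (\<lambda>z. y j z - y m z) r \<le> (1/3) ^ m / 2"
        using H1_mean_le_norm[OF H1_diff(1)[OF y y] r] Ny[OF mj] by (rule order_trans)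
      finally show ?thesis by simp
    qed
    have "(\<lambda>j. (1/3) ^ j / 2 / (1 - r) + (1/3) ^ m / 2) \<longlonglongrightarrow> 0 / (1 - r) + (1/3) ^ m / 2"
      using r by (intro tendsto_add tendsto_divide tendsto_const third_power_tendsto) auto
    then show ?thesis using le by (intro LIMSEQ_le_const[of _ "(1/3) ^ m / 2"]) auto
  qed
  have d: "(\<lambda>z. f z - y m z) \<in> H1" "H1_norm (\<lambda>z. f z - y m z) \<le> (1/3) ^ m / 2" for m
  proof -
    have "H1_mean (\<lambda>z. f z - y m z) r \<le> (1/3) ^ m / 2" if "0 \<le> r" "r < 1" for r using that by (rule m)
    from H1I[OF holomorphic_on_diff[OF hf hy[of m]] this]
    show "(\<lambda>z. f z - y m z) \<in> H1" "H1_norm (\<lambda>z. f z - y m z) \<le> (1/3) ^ m / 2" by auto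
  qed
  have "(\<lambda>z. 1 * (f z - y 0 z) + 1 * y 0 z) \<in> H1" by (rule H1_linear(1)[OF d(1) y])
  then have "f \<in> H1" by simp
  with d(2) show ?thesis by blast
qed

lemma VMOA_diff: "f \<in> VMOA \<Longrightarrow> g \<in> VMOA \<Longrightarrow> (\<lambda>z. f z - g z) \<in> VMOA"
  using VMOA_linear[of f g 1 "-1"] by simp

lemma VMOA_zero: "(\<lambda>z. 0) \<in> VMOA" "BMOA_norm (\<lambda>z. 0) = 0"
proof -
  have "pser (\<lambda>k. 0) = (\<lambda>z. 0)" by (simp add: pser_def fun_eq_iff)
  then show 1: "(\<lambda>z. 0) \<in> VMOA" and "BMOA_norm (\<lambda>z. 0) = 0"
    using pser_VMOA[of "\<lambda>k. 0"] pser_BMOA_norm[of "\<lambda>k. 0"] BMOA_norm_nonneg[OF VMOA_BMOA, of "\<lambda>z. 0"] by auto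
qed

text \<open>As for \<open>H1\<close>, with a point \<open>z\<close> in place of a circle: at fixed
  \<open>z\<close> the seminorm is continuous for the coefficient norm by \<open>gars_le\<close>.
  The limiting bound is uniform in \<open>z\<close>, so \<open>VMOA_approximable\<close> keeps the
  limit in \<open>VMOA\<close>.\<close>

lemma VMOA_complete:
  assumes y: "\<And>m. y m \<in> VMOA" and s: "\<And>m. BMOA_norm (\<lambda>z. y (Suc m) z - y m z) \<le> (1/3) ^ Suc m"
  shows "\<exists>f\<in>VMOA. \<forall>m. BMOA_norm (\<lambda>z. f z - y m z) \<le> (1/3) ^ m / 2"
proof -
  note yB = VMOA_BMOA[OF y]
  note hy = BMOAD(1)[OF yB] and ly = BMOAD(2)[OF yB]
  have add: "BMOA_norm (\<lambda>z. f z + g z) \<le> BMOA_norm f + BMOA_norm g" if "f \<in> VMOA" "g \<in> VMOA" for f g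
    using BMOA_linear(2)[OF that[THEN VMOA_BMOA], of 1 1] by simp
  have Ny: "BMOA_norm (\<lambda>z. y j z - y m z) \<le> (1/3) ^ m / 2" if mj: "m \<le> j" for m j
  proof -
    have "BMOA_norm (\<lambda>z. y j z - y m z) \<le> ((1/3) ^ m - (1/3) ^ j) / 2"
      by (rule geometric_Cauchy[of VMOA BMOA_norm y m j, OF add VMOA_diff y s VMOA_zero(2) mj])
    also have "\<dots> \<le> (1/3) ^ m / 2" by simp
    finally show ?thesis .
  qed
  have td: "tc (\<lambda>z. y j z - y m z) = (\<lambda>k. tc (y j) k - tc (y m) k)" for j m by (rule taylor_coeff_diff[OF hy hy])
  have dB: "(\<lambda>z. y j z - y m z) \<in> BMOA" for j m by (rule VMOA_BMOA[OF VMOA_diff[OF y y]])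
  have n2y: "n2 (\<lambda>k. tc (y j) k - tc (y m) k) \<le> (1/3) ^ m / 2" if "m \<le> j" for m j
    using n2_le_BMOA_norm[OF dB, of j m] Ny[OF that] by (simp add: td)
  have ldy: "l2 (\<lambda>k. tc (y j) k - tc (y m) k)" for j m by (rule n2_diff(1)[OF ly ly])
  have "cmod (tc (y j) k - tc (y m) k) \<le> (1/3) ^ m / 2" if "m \<le> j" for m j k
    using l2_bounded[OF ldy[of j m], of k] n2y[OF that] by linarith
  then obtain c where lim: "\<And>k. (\<lambda>j. tc (y j) k) \<longlonglongrightarrow> c k" and c: "\<And>m k. cmod (c k - tc (y m) k) \<le> (1/3) ^ m / 2"
    by (rule uniform_coefficient_limit[of "\<lambda>m. tc (y m)"]) auto
  have L: "L2_set (\<lambda>k. cmod (c k - tc (y m) k)) {..<K} \<le> (1/3) ^ m / 2" for m K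
  proof (rule LIMSEQ_le_const2)
    show "(\<lambda>j. L2_set (\<lambda>k. cmod (tc (y j) k - tc (y m) k)) {..<K}) \<longlonglongrightarrow> L2_set (\<lambda>k. cmod (c k - tc (y m) k)) {..<K}"
      unfolding L2_set_def by (intro tendsto_intros lim)
    show "\<exists>N. \<forall>j\<ge>N. L2_set (\<lambda>k. cmod (tc (y j) k - tc (y m) k)) {..<K} \<le> (1/3) ^ m / 2"
      using order_trans[OF L2_set_le_n2[OF ldy] n2y] by blast
  qed
  note lcd = n2_leI[OF L]
  have lc: "l2 c" using n2_triangle(1)[OF lcd(1)[of 0] ly[of 0]] by simp
  define f where "f = pser c"
  have hf: "f holomorphic_on ball 0 1" unfolding f_def by (rule holomorphic_pser[OF l2_bounded[OF lc]])
  have tf: "tc f = c" unfolding f_def by (rule taylor_coeff_pser[OF l2_bounded[OF lc]])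
  have tfd: "tc (\<lambda>z. f z - y m z) = (\<lambda>k. c k - tc (y m) k)" for m
    using taylor_coeff_diff[OF hf hy] by (simp add: tf)
  have n: "cmod (f 0 - y m 0) + gars (tc (\<lambda>z. f z - y m z)) z \<le> (1/3) ^ m / 2" if z: "cmod z < 1" for m z
  proof -
    have z1: "1 - cmod z \<noteq> 0" "(1 - cmod z)\<^sup>2 > 0" using z by auto
    have le: "cmod (f 0 - y m 0) + gars (\<lambda>k. c k - tc (y m) k) z \<le> (1/3) ^ j / 2 + 2 * ((1/3) ^ j / 2) / (1 - cmod z)\<^sup>2 + (1/3) ^ m / 2"
      if mj: "m \<le> j" for j
    proof -
      have "cmod (f 0 - y m 0) \<le> cmod (f 0 - y j 0) + cmod (y j 0 - y m 0)"
        using norm_triangle_ineq[of "f 0 - y j 0" "y j 0 - y m 0"] by simp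
      moreover have "cmod (f 0 - y j 0) \<le> (1/3) ^ j / 2"
        using c[of 0 j] by (simp add: taylor_coeff_0 flip: tf)
      moreover have "gars (\<lambda>k. c k - tc (y m) k) z \<le> gars (\<lambda>k. c k - tc (y j) k) z + gars (\<lambda>k. tc (y j) k - tc (y m) k) z"
        using gars_add[OF lcd(1)[of j] ldy[of j m] z] by simp
      moreover have "gars (\<lambda>k. c k - tc (y j) k) z \<le> 2 * ((1/3) ^ j / 2) / (1 - cmod z)\<^sup>2"
      proof -
        have "gars (\<lambda>k. c k - tc (y j) k) z \<le> 2 * n2 (\<lambda>k. c k - tc (y j) k) / (1 - cmod z)\<^sup>2" by (rule gars_le[OF lcd(1) z])
        also have "\<dots> \<le> 2 * ((1/3) ^ j / 2) / (1 - cmod z)\<^sup>2"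
          using lcd(2)[of j] z1 by (intro divide_right_mono mult_left_mono) auto
        finally show ?thesis .
      qed
      moreover have "cmod (y j 0 - y m 0) + gars (\<lambda>k. tc (y j) k - tc (y m) k) z \<le> (1/3) ^ m / 2"
        using gars_le_BMOA_norm[OF dB z, of j m] Ny[OF mj] by (simp add: td)
      ultimately show ?thesis by linarith
    qed
    have "(\<lambda>j. (1/3) ^ j / 2 + 2 * ((1/3) ^ j / 2) / (1 - cmod z)\<^sup>2 + (1/3) ^ m / 2) \<longlonglongrightarrow> 0 + 2 * 0 / (1 - cmod z)\<^sup>2 + (1/3) ^ m / 2"
      using z1 by (intro tendsto_add tendsto_divide tendsto_mult tendsto_const third_power_tendsto) auto
    then show ?thesis unfolding tfd using le by (intro LIMSEQ_le_const[of _ "(1/3) ^ m / 2"]) auto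
  qed
  have hd: "(\<lambda>z. f z - y m z) holomorphic_on ball 0 1" for m by (rule holomorphic_on_diff[OF hf hy])
  have ld: "l2 (tc (\<lambda>z. f z - y m z))" for m unfolding tfd by (rule lcd(1))
  note B = BMOAI[OF hd ld n]
  have "(\<lambda>z. 1 * (f z - y 0 z) + 1 * y 0 z) \<in> BMOA" by (rule BMOA_linear(1)[OF B(1) yB])
  then have fB: "f \<in> BMOA" by simp
  have "f \<in> VMOA"
  proof (rule VMOA_approximable[OF fB])
    fix e :: real assume "e > 0"
    then obtain m where m: "(1/3 :: real) ^ m < e" using real_arch_pow_inv[of e "1/3"] by auto
    show "\<exists>g\<in>VMOA. \<forall>z. cmod z < 1 \<longrightarrow> gars (\<lambda>k. tc f k - tc g k) z \<le> e"
    proof (intro bexI[of _ "y m"] allI impI y)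
      fix z :: complex assume "cmod z < 1"
      from n[OF this, of m] have "gars (\<lambda>k. c k - tc (y m) k) z \<le> (1/3) ^ m / 2"
        using norm_ge_zero[of "f 0 - y m 0"] unfolding tfd by linarith
      moreover have "(1/3 :: real) ^ m > 0" by simp
      ultimately show "gars (\<lambda>k. tc f k - tc (y m) k) z \<le> e" using m unfolding tf by linarith
    qed
  qed
  with B(2) show ?thesis by blast
qed

section \<open>Coefficient multipliers\<close>

lemma summable_mult_bounded:
  assumes "summable (\<lambda>k. cmod (a k))" "\<And>k. cmod (b k) \<le> M"
  shows "summable (\<lambda>k. cmod (a k * b k))"
  by (rule summable_comparison_test'[OF summable_mult2[OF assms(1), of M], of 0])
     (use assms(2) in \<open>auto simp: norm_mult intro!: mult_left_mono\<close>)

lemma approx_eq: "approx a n g = pser (\<lambda>k. a n k * tc g k)"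
  by (simp add: approx_def pser_def fun_eq_iff)

definition mform :: "(nat \<Rightarrow> complex) \<Rightarrow> (complex \<Rightarrow> complex) \<Rightarrow> (complex \<Rightarrow> complex) \<Rightarrow> complex" where
  "mform b g h = (\<Sum>k. b k * tc g k * tc h k)"

lemma norm_tc_le_BMOA: "h \<in> BMOA \<Longrightarrow> cmod (tc h k) \<le> BMOA_norm h"
  using l2_bounded[OF BMOAD(2), of h k] n2_le_BMOA_norm[of h] by linarith

lemma mform_summable:
  assumes b: "summable (\<lambda>k. cmod (b k))" and g: "g \<in> H1" and h: "h \<in> BMOA"
  shows "summable (\<lambda>k. cmod (b k * tc g k * tc h k))"
  by (intro summable_mult_bounded[OF summable_mult_bounded[OF b norm_taylor_coeff_le[OF g]] norm_tc_le_BMOA[OF h]])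

lemma mform_sums:
  assumes "summable (\<lambda>k. cmod (b k))" "g \<in> H1" "h \<in> BMOA"
  shows "(\<lambda>k. b k * tc g k * tc h k) sums mform b g h"
  unfolding mform_def by (rule summable_sums[OF summable_norm_cancel[OF mform_summable[OF assms]]])

lemma mform_bound:
  assumes b: "summable (\<lambda>k. cmod (b k))" and g: "g \<in> H1" and h: "h \<in> BMOA"
  shows "cmod (mform b g h) \<le> (\<Sum>k. cmod (b k)) * (H1_norm g * BMOA_norm h)"
proof -
  have "cmod (mform b g h) \<le> (\<Sum>k. cmod (b k) * (H1_norm g * BMOA_norm h))"
    unfolding mform_def
  proof (rule norm_suminf_le)
    show "norm (b k * tc g k * tc h k) \<le> cmod (b k) * (H1_norm g * BMOA_norm h)" for k
      unfolding norm_mult mult.assoc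
      by (intro mult_left_mono mult_mono norm_taylor_coeff_le[OF g] norm_tc_le_BMOA[OF h] H1_norm_nonneg[OF g]) auto
    show "summable (\<lambda>k. cmod (b k) * (H1_norm g * BMOA_norm h))" using b by (rule summable_mult2)
  qed
  also have "\<dots> = (\<Sum>k. cmod (b k)) * (H1_norm g * BMOA_norm h)" by (rule suminf_mult2[OF b, symmetric])
  finally show ?thesis .
qed

lemma mform_linear_left:
  assumes b: "summable (\<lambda>k. cmod (b k))" and g: "g \<in> H1" "g' \<in> H1" and h: "h \<in> BMOA"
  shows "mform b (\<lambda>z. x * g z + y * g' z) h = x * mform b g h + y * mform b g' h"
proof -
  have "(\<lambda>k. x * (b k * tc g k * tc h k) + y * (b k * tc g' k * tc h k)) sums (x * mform b g h + y * mform b g' h)"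
    by (intro sums_add sums_mult mform_sums b g h)
  then show ?thesis unfolding mform_def[of b "\<lambda>z. x * g z + y * g' z"]
    by (simp add: taylor_coeff_linear H1D(1) g sums_iff algebra_simps)
qed

lemma mform_linear_right:
  assumes b: "summable (\<lambda>k. cmod (b k))" and g: "g \<in> H1" and h: "h \<in> BMOA" "h' \<in> BMOA"
  shows "mform b g (\<lambda>z. x * h z + y * h' z) = x * mform b g h + y * mform b g h'"
proof -
  have "(\<lambda>k. x * (b k * tc g k * tc h k) + y * (b k * tc g k * tc h' k)) sums (x * mform b g h + y * mform b g h')"
    by (intro sums_add sums_mult mform_sums b g h)
  then show ?thesis unfolding mform_def[of b g "\<lambda>z. x * h z + y * h' z"]
    by (simp add: taylor_coeff_linear BMOAD(1) h sums_iff algebra_simps)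
qed

text \<open>Moving the multiplier across the pairing leaves the numbers unchanged, so convergence
  tested on the \<open>H1\<close> side and on the \<open>BMOA\<close> side is convergence of one and
  the same form.\<close>

lemma
  assumes b: "summable (\<lambda>k. cmod (a n k))" and g: "g \<in> H1" and h: "h \<in> BMOA"
  shows pairing_approx_left: "pairing (approx a n g) h = mform (a n) g h"
    and pairing_approx_right: "pairing g (approx a n h) = mform (a n) g h"
proof -
  have sg: "summable (\<lambda>k. cmod (a n k * tc g k))" by (rule summable_mult_bounded[OF b norm_taylor_coeff_le[OF g]])
  have sh: "summable (\<lambda>k. cmod (a n k * tc h k))" by (rule summable_mult_bounded[OF b norm_tc_le_BMOA[OF h]])
  note s = mform_summable[OF b g h]
  have "summable (\<lambda>k. cmod (tc (approx a n g) k * tc h k))"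
    using s by (simp add: approx_eq tc_pser[OF sg])
  from pairing_summable[OF _ BMOAD(1)[OF h] this] show "pairing (approx a n g) h = mform (a n) g h"
    by (simp add: approx_eq tc_pser[OF sg] pser_holomorphic[OF sg] mform_def)
  have t: "tc (approx a n h) = (\<lambda>k. a n k * tc h k)" "approx a n h holomorphic_on ball 0 1"
    unfolding approx_eq by (rule tc_pser[OF sh], rule pser_holomorphic[OF sh])
  have "summable (\<lambda>k. cmod (tc g k * tc (approx a n h) k))"
    using s by (simp add: t mult_ac)
  from pairing_summable[OF H1D(1)[OF g] t(2) this] show "pairing g (approx a n h) = mform (a n) g h"
    by (simp add: t mform_def mult_ac)
qed

section \<open>Monomials and the uniform multiplier bound\<close>

definition unitc :: "nat \<Rightarrow> nat \<Rightarrow> complex" where "unitc k = (\<lambda>j. if j = k then 1 else 0)"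

lemma unitc_sums: "(\<lambda>j. cmod (unitc k j)) sums 1"
  using sums_single[of k "\<lambda>_. 1 :: real"] by (simp add: unitc_def if_distrib cong: if_cong)

lemma summable_unitc: "summable (\<lambda>j. cmod (unitc k j))"
  using unitc_sums by (rule sums_summable)

lemma unit_H1: "pser (unitc k) \<in> H1" "H1_norm (pser (unitc k)) \<le> 1"
  using pser_H1[OF summable_unitc] pser_H1_norm[OF summable_unitc[of k]] unitc_sums[of k] by (auto simp: sums_iff)

lemma unit_VMOA: "pser (unitc k) \<in> VMOA" "BMOA_norm (pser (unitc k)) \<le> 2"
  using pser_VMOA[OF summable_unitc] pser_BMOA_norm[OF summable_unitc[of k]] unitc_sums[of k] by (auto simp: sums_iff)

lemma mform_unit: "mform b (pser (unitc k)) h = b k * tc h k"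
proof -
  have "(\<lambda>j. b j * unitc k j * tc h j) sums (b k * tc h k)"
    using sums_single[of k "\<lambda>j. b j * tc h j"] by (simp add: unitc_def if_distrib if_distribR cong: if_cong)
  then show ?thesis by (simp add: mform_def tc_pser[OF summable_unitc] sums_iff)
qed

lemma pairing_unit: "pairing (pser (unitc k)) (pser (unitc k)) = 1"
proof -
  have "(\<lambda>j. unitc k j * unitc k j) sums 1"
    using sums_single[of k "\<lambda>_. 1 :: complex"] by (simp add: unitc_def if_distrib if_distribR cong: if_cong)
  moreover have "summable (\<lambda>j. cmod (unitc k j * unitc k j))"
    by (rule summable_mult_bounded[OF summable_unitc, of _ 1]) (simp add: unitc_def)
  ultimately show ?thesis
    using pairing_summable[OF pser_holomorphic pser_holomorphic, OF summable_unitc summable_unitc, of k k]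
    by (simp add: tc_pser[OF summable_unitc] sums_iff)
qed

definition multiplier_bounded :: "(nat \<Rightarrow> nat \<Rightarrow> complex) \<Rightarrow> real \<Rightarrow> bool" where
  "multiplier_bounded a C \<longleftrightarrow> 0 \<le> C \<and> (\<forall>k. (\<lambda>n. a n k) \<longlonglongrightarrow> 1) \<and>
     (\<forall>n. \<forall>g\<in>H1. \<forall>h\<in>VMOA. cmod (mform (a n) g h) \<le> C * (H1_norm g * BMOA_norm h))"

text \<open>Monomials isolate single coefficients, which gives \<open>a n k\<close> tending to 1.
  For the bound, uniform boundedness is applied twice: on \<open>H1\<close> for fixed
  \<open>h\<close>, with a constant depending on \<open>h\<close>, and then on
  \<open>VMOA\<close>.\<close>

lemma multiplier_bounded_if_pairings_converge:
  assumes s: "\<And>n. summable (\<lambda>k. cmod (a n k))"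
    and conv: "\<And>g h. g \<in> H1 \<Longrightarrow> h \<in> VMOA \<Longrightarrow> (\<lambda>n. mform (a n) g h) \<longlonglongrightarrow> pairing g h"
  shows "\<exists>C. multiplier_bounded a C"
proof -
  have one: "(\<lambda>n. a n k) \<longlonglongrightarrow> 1" for k
  proof -
    have "mform (a n) (pser (unitc k)) (pser (unitc k)) = a n k" for n
      by (simp add: mform_unit tc_pser[OF summable_unitc]) (simp add: unitc_def)
    then show ?thesis using conv[OF unit_H1(1) unit_VMOA(1), of k k] by (simp add: pairing_unit)
  qed
  have ptw: "\<exists>C. \<forall>n\<in>UNIV. cmod (mform (a n) g h) \<le> C" if "g \<in> H1" "h \<in> VMOA" for g h
    using convergent_imp_bounded[OF conv[OF that]] by (auto simp: bounded_iff)
  have step1: "\<exists>C\<ge>0. \<forall>n\<in>UNIV. \<forall>g\<in>H1. cmod (mform (a n) g h) \<le> C * H1_norm g" if h: "h \<in> VMOA" for h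
  proof (rule uniform_boundedness[OF H1_zero(1)])
    note hB = VMOA_BMOA[OF h]
    show "\<exists>C. \<forall>g\<in>H1. cmod (mform (a n) g h) \<le> C * H1_norm g" for n
    proof (intro exI[of _ "(\<Sum>k. cmod (a n k)) * BMOA_norm h"] ballI)
      fix g assume "g \<in> H1"
      from mform_bound[OF s[of n] this hB] show "cmod (mform (a n) g h) \<le> (\<Sum>k. cmod (a n k)) * BMOA_norm h * H1_norm g"
        by (simp only: mult_ac)
    qed
    show "\<exists>f\<in>H1. \<forall>m. H1_norm (\<lambda>z. f z - y m z) \<le> (1/3) ^ m / 2"
      if "\<And>m. y m \<in> H1" "\<And>m. H1_norm (\<lambda>z. y (Suc m) z - y m z) \<le> (1/3) ^ Suc m" for y
      by (rule H1_complete[OF that])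
  qed (auto intro!: H1_linear H1_norm_nonneg mform_linear_left s VMOA_BMOA h ptw[OF _ h, simplified])
  \<comment> \<open>In the second application the functionals are indexed by \<open>n\<close>
    together with \<open>g\<close> in the unit ball of \<open>H1\<close>; the first application
    supplies the pointwise bound.\<close>
  let ?I = "{(n::nat, g). g \<in> H1 \<and> H1_norm g \<le> 1}"
  have "\<exists>C\<ge>0. \<forall>i\<in>?I. \<forall>h\<in>VMOA. cmod ((\<lambda>(n, g) h. mform (a n) g h) i h) \<le> C * BMOA_norm h"
  proof (rule uniform_boundedness[OF VMOA_zero(1)])
    show "\<exists>C. \<forall>h\<in>VMOA. cmod ((\<lambda>(n, g) h. mform (a n) g h) i h) \<le> C * BMOA_norm h" if i: "i \<in> ?I" for i
    proof -
      obtain n g where ng: "i = (n, g)" "g \<in> H1" using i by auto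
      show ?thesis
      proof (intro exI[of _ "(\<Sum>k. cmod (a n k)) * H1_norm g"] ballI)
        fix h assume "h \<in> VMOA"
        from mform_bound[OF s[of n] ng(2) VMOA_BMOA[OF this]]
        show "cmod ((\<lambda>(n, g) h. mform (a n) g h) i h) \<le> (\<Sum>k. cmod (a n k)) * H1_norm g * BMOA_norm h"
          by (simp add: ng(1) mult.assoc)
      qed
    qed
    show "\<exists>C. \<forall>i\<in>?I. cmod ((\<lambda>(n, g) h. mform (a n) g h) i h) \<le> C" if h: "h \<in> VMOA" for h
    proof -
      obtain C where C: "C \<ge> 0" "\<And>n g. g \<in> H1 \<Longrightarrow> cmod (mform (a n) g h) \<le> C * H1_norm g"
        using step1[OF h] by blast
      show ?thesis
      proof (intro exI[of _ C] ballI)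
        fix i assume "i \<in> ?I"
        then obtain n g where ng: "i = (n, g)" "g \<in> H1" "H1_norm g \<le> 1" by auto
        have "cmod (mform (a n) g h) \<le> C * H1_norm g" by (rule C(2)[OF ng(2)])
        also have "\<dots> \<le> C * 1" using C(1) ng(3) by (rule mult_left_mono[rotated])
        finally show "cmod ((\<lambda>(n, g) h. mform (a n) g h) i h) \<le> C" by (simp add: ng(1))
      qed
    qed
    show "\<exists>f\<in>VMOA. \<forall>m. BMOA_norm (\<lambda>z. f z - y m z) \<le> (1/3) ^ m / 2"
      if "\<And>m. y m \<in> VMOA" "\<And>m. BMOA_norm (\<lambda>z. y (Suc m) z - y m z) \<le> (1/3) ^ Suc m" for y
      by (rule VMOA_complete[OF that])
  qed (auto intro!: VMOA_linear BMOA_linear(2) BMOA_norm_nonneg mform_linear_right s VMOA_BMOA)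
  then obtain C where C: "C \<ge> 0" "\<And>n g h. g \<in> H1 \<Longrightarrow> H1_norm g \<le> 1 \<Longrightarrow> h \<in> VMOA \<Longrightarrow> cmod (mform (a n) g h) \<le> C * BMOA_norm h"
    by fastforce
  have "cmod (mform (a n) g h) \<le> C * (H1_norm g * BMOA_norm h)" if g: "g \<in> H1" and h: "h \<in> VMOA" for n g h
  proof (cases "H1_norm g = 0")
    case True
    then have "tc g k = 0" for k using norm_taylor_coeff_le[OF g, of k] by simp
    then show ?thesis using True by (simp add: mform_def)
  next
    case False
    then have N: "H1_norm g > 0" using H1_norm_nonneg[OF g] by simp
    define g' where "g' = (\<lambda>z. of_real (1 / H1_norm g) * g z + 0 * g z)"
    have g': "g' \<in> H1" "H1_norm g' \<le> 1"
      using H1_linear[OF g g, of "of_real (1 / H1_norm g)" 0] N by (auto simp: g'_def norm_divide)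
    have "mform (a n) g' h = of_real (1 / H1_norm g) * mform (a n) g h + 0 * mform (a n) g h"
      unfolding g'_def by (rule mform_linear_left[OF s g g VMOA_BMOA[OF h]])
    with C(2)[OF g' h, of n] have "cmod (mform (a n) g h) / H1_norm g \<le> C * BMOA_norm h"
      using N by (simp add: norm_mult norm_divide)
    then show ?thesis using N by (simp add: divide_le_eq mult_ac)
  qed
  with C(1) one show ?thesis unfolding multiplier_bounded_def by blast
qed

lemma multiplier_bounded_coefficients:
  assumes "multiplier_bounded a C" shows "cmod (a n k) \<le> 2 * C"
proof -
  have "cmod (mform (a n) (pser (unitc k)) (pser (unitc k))) \<le> C * (H1_norm (pser (unitc k)) * BMOA_norm (pser (unitc k)))"
    using assms unit_H1(1) unit_VMOA(1) unfolding multiplier_bounded_def by blast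
  also have "\<dots> \<le> C * (1 * 2)"
    using assms unit_H1[of k] unit_VMOA[of k] unfolding multiplier_bounded_def
    by (intro mult_left_mono mult_mono) (auto intro: BMOA_norm_nonneg VMOA_BMOA)
  finally show ?thesis by (simp add: mform_unit tc_pser[OF summable_unitc]) (simp add: unitc_def mult.commute)
qed

text \<open>Dominated convergence: the coefficients tend to 1 individually, and testing the uniform
  bound on monomials bounds them all by \<open>2 * C\<close>.\<close>

lemma multiplier_tendsto_summable:
  assumes C: "multiplier_bounded a C" and c: "summable (\<lambda>k. cmod (c k))"
  shows "(\<lambda>n. \<Sum>k. cmod (a n k * c k - c k)) \<longlonglongrightarrow> 0" "summable (\<lambda>k. cmod (a n k * c k - c k))"
proof -
  have bd: "cmod (a n k * c k - c k) \<le> (2 * C + 1) * cmod (c k)" for n k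
  proof -
    have "cmod (a n k * c k - c k) \<le> cmod (a n k) * cmod (c k) + cmod (c k)"
      by (metis norm_mult norm_triangle_ineq4)
    also have "\<dots> \<le> 2 * C * cmod (c k) + cmod (c k)"
      by (intro add_mono mult_right_mono multiplier_bounded_coefficients[OF C]) auto
    finally show ?thesis by (simp add: algebra_simps)
  qed
  show "summable (\<lambda>k. cmod (a n k * c k - c k))"
    by (rule summable_comparison_test'[OF summable_mult[OF c], of 0]) (use bd in auto)
  have "(\<lambda>n. \<Sum>k. cmod (a n k * c k - c k)) \<longlonglongrightarrow> (\<Sum>k. 0)"
  proof (rule conjunct2[OF conjunct2[OF tannerys_theorem]])
    show "(\<lambda>n. cmod (a n k * c k - c k)) \<longlonglongrightarrow> 0" for k
    proof -
      have "(\<lambda>n. a n k) \<longlonglongrightarrow> 1" using C by (simp add: multiplier_bounded_def)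
      then have "(\<lambda>n. cmod (a n k * c k - c k)) \<longlonglongrightarrow> cmod (1 * c k - c k)" by (intro tendsto_intros)
      then show ?thesis by simp
    qed
    show "\<forall>\<^sub>F (k, n) in at_top \<times>\<^sub>F sequentially. norm (cmod (a n k * c k - c k)) \<le> (2 * C + 1) * cmod (c k)"
      using bd by (intro always_eventually) auto
  qed (use c in \<open>auto intro: summable_mult\<close>)
  then show "(\<lambda>n. \<Sum>k. cmod (a n k * c k - c k)) \<longlonglongrightarrow> 0" by simp
qed

text \<open>The \<open>H1\<close> norm is recovered from pairings with \<open>VMOA\<close> test
  functions, which is exactly what the uniform bound controls; the factor 2 is that of
  \<open>H1_norm_le_dual\<close>.\<close>

lemma multiplier_bounded_H1:
  assumes s: "\<And>n. summable (\<lambda>k. cmod (a n k))" and C: "multiplier_bounded a C" and g: "g \<in> H1"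
  shows "approx a n g \<in> H1" "H1_norm (approx a n g) \<le> 2 * C * H1_norm g"
proof -
  have sg: "summable (\<lambda>k. cmod (a n k * tc g k))" by (rule summable_mult_bounded[OF s norm_taylor_coeff_le[OF g]])
  show "approx a n g \<in> H1" unfolding approx_eq by (rule pser_H1[OF sg])
  have "H1_norm (pser (\<lambda>k. a n k * tc g k)) \<le> 2 * (C * H1_norm g)"
  proof (rule H1_norm_le_dual[OF sg])
    show "0 \<le> C * H1_norm g" using C H1_norm_nonneg[OF g] by (simp add: multiplier_bounded_def)
    fix h assume "h \<in> VMOA"
    then show "cmod (\<Sum>k. a n k * tc g k * tc h k) \<le> C * H1_norm g * BMOA_norm h"
      using C g unfolding multiplier_bounded_def mform_def by (simp add: mult.assoc)
  qed
  then show "H1_norm (approx a n g) \<le> 2 * C * H1_norm g" by (simp add: approx_eq)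
qed

text \<open>The same form read from the other side: testing against all of \<open>H1\<close>
  controls the seminorm by \<open>gars_le_dual'\<close>.\<close>

lemma multiplier_bounded_VMOA:
  assumes s: "\<And>n. summable (\<lambda>k. cmod (a n k))" and C: "multiplier_bounded a C" and h: "h \<in> VMOA"
  shows "approx a n h \<in> VMOA" "BMOA_norm (approx a n h) \<le> 2 * C * BMOA_norm h"
proof -
  note hB = VMOA_BMOA[OF h]
  have sh: "summable (\<lambda>k. cmod (a n k * tc h k))" by (rule summable_mult_bounded[OF s norm_tc_le_BMOA[OF hB]])
  show "approx a n h \<in> VMOA" unfolding approx_eq by (rule pser_VMOA[OF sh])
  have C0: "0 \<le> C" using C by (simp add: multiplier_bounded_def)
  have bnd: "cmod (mform (a n) g h) \<le> C * (H1_norm g * BMOA_norm h)" if "g \<in> H1" for g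
    using C that h by (simp add: multiplier_bounded_def)
  have "BMOA_norm (pser (\<lambda>k. a n k * tc h k)) \<le> 2 * C * BMOA_norm h"
  proof (rule BMOAI(2)[OF pser_holomorphic[OF sh]])
    show "l2 (tc (pser (\<lambda>k. a n k * tc h k)))" unfolding tc_pser[OF sh] by (rule summable_imp_l2[OF sh])
    fix z :: complex assume z: "cmod z < 1"
    have "gars (\<lambda>k. a n k * tc h k) z \<le> C * BMOA_norm h"
    proof (rule gars_le_dual'[OF sh z])
      show "0 \<le> C * BMOA_norm h" using C0 BMOA_norm_nonneg[OF hB] by simp
      fix q assume q: "q \<in> H1"
      have "(\<Sum>k. tc q k * (a n k * tc h k)) = mform (a n) q h" by (simp add: mform_def mult_ac)
      then show "cmod (\<Sum>k. tc q k * (a n k * tc h k)) \<le> C * BMOA_norm h * H1_norm q"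
        using bnd[OF q] by (simp add: mult_ac)
    qed
    \<comment> \<open>The value at 0 is the form tested on the constant function, of
      \<open>H1\<close> norm at most 1; added to the seminorm it produces the factor 2.\<close>
    moreover have "cmod (pser (\<lambda>k. a n k * tc h k) 0) \<le> C * BMOA_norm h"
    proof -
      have "pser (\<lambda>k. a n k * tc h k) 0 = mform (a n) (pser (unitc 0)) h"
        unfolding mform_unit pser_def by (rule powser_zero)
      then have "cmod (pser (\<lambda>k. a n k * tc h k) 0) \<le> C * (H1_norm (pser (unitc 0)) * BMOA_norm h)"
        using bnd[OF unit_H1(1)] by simp
      also have "\<dots> \<le> C * (1 * BMOA_norm h)"
        by (intro mult_left_mono mult_right_mono unit_H1 C0 BMOA_norm_nonneg[OF hB])
      finally show ?thesis by simp
    qed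
    ultimately show "cmod (pser (\<lambda>k. a n k * tc h k) 0) + gars (tc (pser (\<lambda>k. a n k * tc h k))) z \<le> 2 * C * BMOA_norm h"
      unfolding tc_pser[OF sh] by simp
  qed
  then show "BMOA_norm (approx a n h) \<le> 2 * C * BMOA_norm h" by (simp add: approx_eq)
qed

section \<open>Norm convergence of the multipliers on \<open>H1\<close> and
  \<open>VMOA\<close>\<close>

lemma H1_norm_cong:
  assumes "\<And>z. cmod z < 1 \<Longrightarrow> f z = g z"
  shows "H1_norm f = H1_norm g"
proof -
  have "H1_mean f r = H1_mean g r" if "r \<in> {0..<1}" for r
    unfolding H1_mean_def using assms that by (simp add: norm_mult)
  then show ?thesis unfolding H1_norm_def by (simp cong: SUP_cong_simp)
qed

text \<open>Functions are total, while series identities such as \<open>approx_error_split\<close>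
  hold on the disc only; membership and norm depend on the disc alone.\<close>

lemma BMOA_cong:
  assumes f: "f \<in> BMOA" and eq: "\<And>z. cmod z < 1 \<Longrightarrow> f z = g z"
  shows "g \<in> BMOA" "BMOA_norm g = BMOA_norm f"
proof -
  have h: "g holomorphic_on ball 0 1"
    using holomorphic_transform[OF BMOAD(1)[OF f], of g] eq by simp
  have t: "tc g = tc f" by (rule taylor_coeff_cong_ball[OF BMOAD(1)[OF f] eq])
  show 1: "g \<in> BMOA" using f h by (simp add: BMOA_iff t)
  show "BMOA_norm g = BMOA_norm f"
    unfolding BMOA_norm_eq[OF 1] BMOA_norm_eq[OF f] t using eq[of 0] by simp
qed

text \<open>With \<open>f_s\<close> the dilation of \<open>f\<close> by \<open>s\<close>, the error
  is the multiplier applied to \<open>f - f_s\<close>, plus its error on \<open>f_s\<close>, minus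
  \<open>f - f_s\<close>. The explicit factors 1 and -1 match the shape of the linearity
  lemmas.\<close>

lemma approx_error_split:
  assumes b: "summable (\<lambda>k. cmod (a n k))" and f: "f holomorphic_on ball 0 1" and M: "\<And>k. cmod (tc f k) \<le> M"
    and s: "0 \<le> s" "s < 1" and z: "cmod z < 1"
  defines "c \<equiv> \<lambda>k. tc f k * of_real s ^ k"
  defines "d \<equiv> \<lambda>z. f z - f (of_real s * z)"
  shows "approx a n f z - f z = 1 * (1 * approx a n d z + 1 * pser (\<lambda>k. a n k * c k - c k) z) + (-1) * d z"
proof -
  have sc: "summable (\<lambda>k. cmod (c k))" unfolding c_def by (rule summable_dilated_taylor[OF f s])
  have fs: "(\<lambda>z. f (of_real s * z)) holomorphic_on ball 0 1" using s by (intro holomorphic_dilate f) auto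
  have tfs: "tc (\<lambda>z. f (of_real s * z)) = c" unfolding c_def using s by (intro taylor_coeff_dilate f) auto
  have td: "tc d = (\<lambda>k. tc f k - c k)" unfolding d_def by (subst taylor_coeff_diff[OF f fs]) (simp add: tfs)
  have z1: "cmod z \<le> 1" using z by simp
  have sf: "summable (\<lambda>k. cmod (a n k * tc f k))" by (rule summable_mult_bounded[OF b M])
  have sac: "summable (\<lambda>k. cmod (a n k * c k))" by (rule summable_mult_bounded[OF b suminf_norm_bound[OF sc]])
  have A: "(\<lambda>k. a n k * tc f k * z ^ k) sums approx a n f z"
    unfolding approx_eq by (rule pser_sums[OF sf z1])
  have B: "(\<lambda>k. a n k * c k * z ^ k) sums pser (\<lambda>k. a n k * c k) z" by (rule pser_sums[OF sac z1])
  have C: "(\<lambda>k. c k * z ^ k) sums f (of_real s * z)" using taylor_sums[OF fs z] by (simp add: tfs)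
  have "approx a n d z = approx a n f z - pser (\<lambda>k. a n k * c k) z"
    unfolding approx_eq[of a n d] td pser_def[of "\<lambda>k. a n k * (tc f k - c k)"]
    using sums_diff[OF A B] by (simp add: sums_iff algebra_simps)
  moreover have "pser (\<lambda>k. a n k * c k - c k) z = pser (\<lambda>k. a n k * c k) z - f (of_real s * z)"
    unfolding pser_def[of "\<lambda>k. a n k * c k - c k"]
    using sums_diff[OF B C] by (simp add: sums_iff algebra_simps)
  ultimately show ?thesis by (simp add: d_def)
qed

text \<open>Approximate \<open>g\<close> by a dilation up to \<open>\<delta>\<close>. The
  multiplier, of norm at most \<open>2 * C\<close>, and the identity together amplify this to
  \<open>(2 * C + 1) * \<delta> = e / 2\<close>; on the dilation itself the error tends to 0 in
  absolute coefficient sum.\<close>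

lemma multiplier_converges_H1:
  assumes s: "\<And>n. summable (\<lambda>k. cmod (a n k))" and C: "multiplier_bounded a C" and g: "g \<in> H1"
  shows "(\<lambda>n. H1_norm (\<lambda>z. approx a n g z - g z)) \<longlonglongrightarrow> 0"
proof (rule LIMSEQ_I)
  fix e :: real assume e: "e > 0"
  have C0: "0 \<le> C" using C by (simp add: multiplier_bounded_def)
  define \<delta> where "\<delta> = e / (2 * (2 * C + 1))"
  have \<delta>: "\<delta> > 0" using e C0 by (simp add: \<delta>_def)
  obtain r where r: "0 \<le> r" "r < 1" "(\<lambda>z. g (of_real r * z)) \<in> H1" "H1_norm (\<lambda>z. g z - g (of_real r * z)) \<le> \<delta>"
    by (rule H1_dilate_dense[OF g \<delta>])
  define d where "d = (\<lambda>z. g z - g (of_real r * z))"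
  define c where "c = (\<lambda>k. tc g k * of_real r ^ k)"
  have sc: "summable (\<lambda>k. cmod (c k))" unfolding c_def by (rule summable_dilated_taylor[OF H1D(1)[OF g] r(1,2)])
  have dH: "d \<in> H1" unfolding d_def using H1_diff(1)[OF g r(3)] by simp
  have dN: "H1_norm d \<le> \<delta>" using r(4) by (simp add: d_def[abs_def])
  note m = multiplier_tendsto_summable[OF C sc]
  have bound: "H1_norm (\<lambda>z. approx a n g z - g z) \<le> e / 2 + (\<Sum>k. cmod (a n k * c k - c k))"
    "0 \<le> H1_norm (\<lambda>z. approx a n g z - g z)" for n
  proof -
    let ?p = "pser (\<lambda>k. a n k * c k - c k)"
    note A = multiplier_bounded_H1[OF s C dH, of n] and P = pser_H1[OF m(2)[of n]] pser_H1_norm[OF m(2)[of n]]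
    have "H1_norm (\<lambda>z. approx a n g z - g z) = H1_norm (\<lambda>z. 1 * (1 * approx a n d z + 1 * ?p z) + (-1) * d z)"
    proof (rule H1_norm_cong)
      show "approx a n g z - g z = 1 * (1 * approx a n d z + 1 * ?p z) + (-1) * d z" if "cmod z < 1" for z
        unfolding c_def d_def by (rule approx_error_split[OF s H1D(1)[OF g] norm_taylor_coeff_le[OF g] r(1,2) that])
    qed
    also have "\<dots> \<le> cmod 1 * H1_norm (\<lambda>z. 1 * approx a n d z + 1 * ?p z) + cmod (-1) * H1_norm d"
      by (intro H1_linear(2) H1_linear(1) A P dH)
    also have "H1_norm (\<lambda>z. 1 * approx a n d z + 1 * ?p z) \<le> cmod 1 * H1_norm (approx a n d) + cmod 1 * H1_norm ?p"
      by (intro H1_linear(2) A P)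
    finally have "H1_norm (\<lambda>z. approx a n g z - g z) \<le> H1_norm (approx a n d) + H1_norm ?p + H1_norm d" by simp
    also have "\<dots> \<le> 2 * C * \<delta> + (\<Sum>k. cmod (a n k * c k - c k)) + \<delta>"
    proof (intro add_mono P dN)
      have "2 * C * H1_norm d \<le> 2 * C * \<delta>" using dN C0 by (intro mult_left_mono) auto
      then show "H1_norm (approx a n d) \<le> 2 * C * \<delta>" using A(2) by linarith
    qed
    also have "\<dots> = (2 * C + 1) * \<delta> + (\<Sum>k. cmod (a n k * c k - c k))" by (simp add: algebra_simps)
    also have "(2 * C + 1) * \<delta> = e / 2"
    proof -
      have "x * (e / (2 * x)) = e / 2" if "x > 0" for x using that by simp
      from this[of "2 * C + 1"] show ?thesis unfolding \<delta>_def using C0 by linarith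
    qed
    finally show "H1_norm (\<lambda>z. approx a n g z - g z) \<le> e / 2 + (\<Sum>k. cmod (a n k * c k - c k))" .
    show "0 \<le> H1_norm (\<lambda>z. approx a n g z - g z)"
      by (intro H1_norm_nonneg H1_diff multiplier_bounded_H1[OF s C] g)
  qed
  obtain no where no: "\<And>n. n \<ge> no \<Longrightarrow> norm ((\<Sum>k. cmod (a n k * c k - c k)) - 0) < e / 2"
    using LIMSEQ_D[OF m(1), of "e/2"] e by auto
  show "\<exists>no. \<forall>n\<ge>no. norm (H1_norm (\<lambda>z. approx a n g z - g z) - 0) < e"
  proof (intro exI[of _ no] allI impI)
    fix n assume "no \<le> n"
    from no[OF this] have "(\<Sum>k. cmod (a n k * c k - c k)) < e / 2" by simp
    then show "norm (H1_norm (\<lambda>z. approx a n g z - g z) - 0) < e" using bound[of n] by simp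
  qed
qed

lemma multiplier_converges_VMOA:
  assumes s: "\<And>n. summable (\<lambda>k. cmod (a n k))" and C: "multiplier_bounded a C" and h: "h \<in> VMOA"
  shows "(\<lambda>n. BMOA_norm (\<lambda>z. approx a n h z - h z)) \<longlonglongrightarrow> 0"
proof (rule LIMSEQ_I)
  fix e :: real assume e: "e > 0"
  note hB = VMOA_BMOA[OF h]
  have C0: "0 \<le> C" using C by (simp add: multiplier_bounded_def)
  define \<delta> where "\<delta> = e / (2 * (2 * C + 1))"
  have \<delta>: "\<delta> > 0" using e C0 by (simp add: \<delta>_def)
  obtain r where r0: "0 < r" and r: "r < 1" "BMOA_norm (\<lambda>z. h z - h (of_real r * z)) \<le> \<delta>"
    by (rule VMOA_dilate_dense[OF h \<delta>])
  have r': "0 \<le> r" using r0 by simp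
  define d where "d = (\<lambda>z. h z - h (of_real r * z))"
  define c where "c = (\<lambda>k. tc h k * of_real r ^ k)"
  have sc: "summable (\<lambda>k. cmod (c k))" unfolding c_def by (rule summable_dilated_taylor[OF BMOAD(1)[OF hB] r' r(1)])
  \<comment> \<open>The dilation equals the series \<open>pser c\<close> only on the disc, so
    membership is shown for \<open>h - pser c\<close> and transferred to \<open>d\<close>.\<close>
  have dV: "d \<in> VMOA"
  proof -
    have "(\<lambda>z. h z - pser c z) \<in> VMOA" by (rule VMOA_diff[OF h pser_VMOA[OF sc]])
    moreover have "h z - pser c z = d z" if "cmod z < 1" for z
      unfolding d_def c_def using that by (simp add: holomorphic_dilated_eq_pser[OF BMOAD(1)[OF hB] r' r(1)])
    ultimately show ?thesis
      using BMOA_cong(1)[OF VMOA_BMOA] taylor_coeff_cong_ball[OF BMOAD(1)[OF VMOA_BMOA]] unfolding VMOA_iff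
      by (metis (no_types, lifting))
  qed
  have dN: "BMOA_norm d \<le> \<delta>" using r(2) by (simp add: d_def[abs_def])
  note m = multiplier_tendsto_summable[OF C sc]
  have bound: "BMOA_norm (\<lambda>z. approx a n h z - h z) \<le> e / 2 + 2 * (\<Sum>k. cmod (a n k * c k - c k))"
    "0 \<le> BMOA_norm (\<lambda>z. approx a n h z - h z)" for n
  proof -
    let ?p = "pser (\<lambda>k. a n k * c k - c k)"
    note A = multiplier_bounded_VMOA[OF s C dV, of n] and P = pser_VMOA[OF m(2)[of n]] pser_BMOA_norm[OF m(2)[of n]]
    note AB = VMOA_BMOA[OF A(1)] and PB = VMOA_BMOA[OF P(1)] and dB = VMOA_BMOA[OF dV]
    have diff: "(\<lambda>z. approx a n h z - h z) \<in> BMOA"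
      by (intro VMOA_BMOA VMOA_diff multiplier_bounded_VMOA[OF s C] h)
    have "BMOA_norm (\<lambda>z. approx a n h z - h z) = BMOA_norm (\<lambda>z. 1 * (1 * approx a n d z + 1 * ?p z) + (-1) * d z)"
    proof (rule BMOA_cong(2)[OF diff, symmetric])
      show "approx a n h z - h z = 1 * (1 * approx a n d z + 1 * ?p z) + (-1) * d z" if "cmod z < 1" for z
        unfolding c_def d_def by (rule approx_error_split[OF s BMOAD(1)[OF hB] norm_tc_le_BMOA[OF hB] r' r(1) that])
    qed
    also have "\<dots> \<le> cmod 1 * BMOA_norm (\<lambda>z. 1 * approx a n d z + 1 * ?p z) + cmod (-1) * BMOA_norm d"
      by (intro BMOA_linear(2) BMOA_linear(1) AB PB dB)
    also have "BMOA_norm (\<lambda>z. 1 * approx a n d z + 1 * ?p z) \<le> cmod 1 * BMOA_norm (approx a n d) + cmod 1 * BMOA_norm ?p"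
      by (intro BMOA_linear(2) AB PB)
    finally have "BMOA_norm (\<lambda>z. approx a n h z - h z) \<le> BMOA_norm (approx a n d) + BMOA_norm ?p + BMOA_norm d" by simp
    also have "\<dots> \<le> 2 * C * \<delta> + 2 * (\<Sum>k. cmod (a n k * c k - c k)) + \<delta>"
    proof (intro add_mono P dN)
      have "2 * C * BMOA_norm d \<le> 2 * C * \<delta>" using dN C0 by (intro mult_left_mono) auto
      then show "BMOA_norm (approx a n d) \<le> 2 * C * \<delta>" using A(2) by linarith
    qed
    also have "\<dots> = (2 * C + 1) * \<delta> + 2 * (\<Sum>k. cmod (a n k * c k - c k))" by (simp add: algebra_simps)
    also have "(2 * C + 1) * \<delta> = e / 2"
    proof -
      have "x * (e / (2 * x)) = e / 2" if "x > 0" for x using that by simp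
      from this[of "2 * C + 1"] show ?thesis unfolding \<delta>_def using C0 by linarith
    qed
    finally show "BMOA_norm (\<lambda>z. approx a n h z - h z) \<le> e / 2 + 2 * (\<Sum>k. cmod (a n k * c k - c k))" .
    show "0 \<le> BMOA_norm (\<lambda>z. approx a n h z - h z)" by (rule BMOA_norm_nonneg[OF diff])
  qed
  obtain no where no: "\<And>n. n \<ge> no \<Longrightarrow> norm ((\<Sum>k. cmod (a n k * c k - c k)) - 0) < e / 4"
    using LIMSEQ_D[OF m(1), of "e/4"] e by auto
  show "\<exists>no. \<forall>n\<ge>no. norm (BMOA_norm (\<lambda>z. approx a n h z - h z) - 0) < e"
  proof (intro exI[of _ no] allI impI)
    fix n assume "no \<le> n"
    from no[OF this] have "(\<Sum>k. cmod (a n k * c k - c k)) < e / 4" by simp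
    then show "norm (BMOA_norm (\<lambda>z. approx a n h z - h z) - 0) < e" using bound[of n] by simp
  qed
qed

section \<open>From norm to weak convergence, and the equivalence\<close>

lemma weak_conv_if_norm_conv:
  assumes x: "x \<in> X" "\<And>n. xs n \<in> X" "\<And>n. (\<lambda>z. xs n z - x z) \<in> X"
    and lim: "(\<lambda>n. N (\<lambda>z. xs n z - x z)) \<longlonglongrightarrow> 0"
  shows "weak_conv X N xs x"
  unfolding weak_conv_def
proof (intro allI impI)
  fix \<phi> assume \<phi>: "bounded_lin_functional X N \<phi>"
  then obtain C where C: "\<And>f. f \<in> X \<Longrightarrow> cmod (\<phi> f) \<le> C * N f"
    unfolding bounded_lin_functional_def by blast
  have "\<phi> (\<lambda>z. 1 * xs n z + (-1) * x z) = 1 * \<phi> (xs n) + (-1) * \<phi> x" for n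
    using \<phi> x(1) x(2)[of n] unfolding bounded_lin_functional_def by blast
  then have eq: "\<phi> (\<lambda>z. xs n z - x z) = \<phi> (xs n) - \<phi> x" for n by simp
  have "(\<lambda>n. \<phi> (xs n) - \<phi> x) \<longlonglongrightarrow> 0"
  proof (rule Lim_null_comparison)
    show "\<forall>\<^sub>F n in sequentially. norm (\<phi> (xs n) - \<phi> x) \<le> C * N (\<lambda>z. xs n z - x z)"
      using C[OF x(3)] by (intro always_eventually) (simp add: eq)
    show "(\<lambda>n. C * N (\<lambda>z. xs n z - x z)) \<longlonglongrightarrow> 0"
      using tendsto_mult[OF tendsto_const lim, of C] by simp
  qed
  then show "(\<lambda>n. \<phi> (xs n)) \<longlonglongrightarrow> \<phi> x" by (simp add: Lim_null[symmetric])
qed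

theorem theorem5p1:
  fixes a :: "nat \<Rightarrow> nat \<Rightarrow> complex"
  assumes "\<And>n. summable (\<lambda>k. cmod (a n k))"
  defines "P1 \<equiv> (\<forall>g\<in>H1. weak_conv H1 H1_norm (\<lambda>n. approx a n g) g)"
      and "P2 \<equiv> (\<forall>g\<in>H1. (\<lambda>n. H1_norm (\<lambda>z. approx a n g z - g z)) \<longlonglongrightarrow> 0)"
      and "P3 \<equiv> (\<forall>h\<in>BMOA. weak_star_BMOA (\<lambda>n. approx a n h) h)"
      and "P4 \<equiv> (\<forall>f\<in>VMOA. weak_conv VMOA BMOA_norm (\<lambda>n. approx a n f) f)"
      and "P5 \<equiv> (\<forall>f\<in>VMOA. (\<lambda>n. BMOA_norm (\<lambda>z. approx a n f z - f z)) \<longlonglongrightarrow> 0)"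
  shows "(P1 \<longleftrightarrow> P2) \<and> (P2 \<longleftrightarrow> P3) \<and> (P3 \<longleftrightarrow> P4) \<and> (P4 \<longleftrightarrow> P5)"
proof -
  note s = assms(1)
  have aH: "approx a n g \<in> H1" if "g \<in> H1" for n g
    unfolding approx_eq by (rule pser_H1[OF summable_mult_bounded[OF s norm_taylor_coeff_le[OF that]]])
  have aV: "approx a n h \<in> VMOA" if "h \<in> VMOA" for n h
    unfolding approx_eq by (rule pser_VMOA[OF summable_mult_bounded[OF s norm_tc_le_BMOA[OF VMOA_BMOA[OF that]]]])
  have 21: P1 if P2
    unfolding P1_def using that[unfolded P2_def]
    by (blast intro: weak_conv_if_norm_conv aH H1_diff(1))
  have 54: P4 if P5
    unfolding P4_def using that[unfolded P5_def]
    by (blast intro: weak_conv_if_norm_conv aV VMOA_diff)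
  \<comment> \<open>Pairing with a fixed \<open>h\<close> is a bounded functional on
    \<open>H1\<close>, so weak convergence applies to it; the multiplier is then moved over to
    \<open>h\<close>.\<close>
  have 13: P3 if P1
    unfolding P3_def weak_star_BMOA_def
  proof (intro ballI)
    fix h g assume h: "h \<in> BMOA" and g: "g \<in> H1"
    have "bounded_lin_functional H1 H1_norm (\<lambda>g. pairing g h)"
      unfolding bounded_lin_functional_def
    proof (intro conjI ballI allI exI[of _ "fefferman_const * BMOA_norm h"])
      show "cmod (pairing f h) \<le> fefferman_const * BMOA_norm h * H1_norm f" if "f \<in> H1" for f
        using cpair_convergent(2)[OF that h] by (simp only: mult_ac)
    qed (rule pairing_linear_left[OF _ _ h])
    with that g have "(\<lambda>n. pairing (approx a n g) h) \<longlonglongrightarrow> pairing g h"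
      unfolding P1_def weak_conv_def by blast
    then show "(\<lambda>n. pairing g (approx a n h)) \<longlonglongrightarrow> pairing g h"
      by (simp only: pairing_approx_left[OF s g h] pairing_approx_right[OF s g h])
  qed
  have 3: "\<exists>C. multiplier_bounded a C" if P3
  proof (rule multiplier_bounded_if_pairings_converge[OF s])
    fix g h assume g: "g \<in> H1" and h: "h \<in> VMOA"
    have "(\<lambda>n. pairing g (approx a n h)) \<longlonglongrightarrow> pairing g h"
      using that VMOA_BMOA[OF h] g unfolding P3_def weak_star_BMOA_def by blast
    then show "(\<lambda>n. mform (a n) g h) \<longlonglongrightarrow> pairing g h"
      by (simp only: pairing_approx_right[OF s g VMOA_BMOA[OF h]])
  qed
  \<comment> \<open>Here weak convergence is tested on the functionals that pair with a fixed
    \<open>g\<close> in \<open>H1\<close>; they suffice for the uniform bound.\<close>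
  have 4: "\<exists>C. multiplier_bounded a C" if P4
  proof (rule multiplier_bounded_if_pairings_converge[OF s])
    fix g h assume g: "g \<in> H1" and h: "h \<in> VMOA"
    have "bounded_lin_functional VMOA BMOA_norm (pairing g)"
      unfolding bounded_lin_functional_def
    proof (intro conjI ballI allI exI[of _ "fefferman_const * H1_norm g"])
      show "cmod (pairing g f) \<le> fefferman_const * H1_norm g * BMOA_norm f" if "f \<in> VMOA" for f
        using cpair_convergent(2)[OF g VMOA_BMOA[OF that]] by (simp only: mult_ac)
    qed (intro pairing_linear_right g VMOA_BMOA)
    with that h have "(\<lambda>n. pairing g (approx a n h)) \<longlonglongrightarrow> pairing g h"
      unfolding P4_def weak_conv_def by blast
    then show "(\<lambda>n. mform (a n) g h) \<longlonglongrightarrow> pairing g h"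
      by (simp only: pairing_approx_right[OF s g VMOA_BMOA[OF h]])
  qed
  \<comment> \<open>This closes both cycles: each statement leads to the uniform bound, and the
    bound returns the two norm statements together.\<close>
  have 25: "P2 \<and> P5" if "\<exists>C. multiplier_bounded a C"
    using that multiplier_converges_H1[where a = a, OF s] multiplier_converges_VMOA[where a = a, OF s] unfolding P2_def P5_def by blast
  from 21 54 13 3 4 25 show ?thesis by blast
qed

end
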